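(* Let $T,\delta,\lambda\in(0,\infty)$. For every $d\in\mathbb N$ let $u_d=(u_d(t,x))_{(t,x)\in[0,T]\times\mathbb R^d}\in C^{1,2}([0,T]\times\mathbb R^d,\mathbb R)$ be an at most polynomially growing function, let $f_d\in C(\mathbb R\times\mathbb R^d,\mathbb R)$, $g_d\in C(\mathbb R^d,\mathbb R)$, and let $L_{d,i}\in\mathbb R$, $i\in\mathbb N$. Assume for all $d\in\mathbb N$, $t\in[0,T)$, $x=(x_1,\ldots,x_d),\mathfrak x=(\mathfrak x_1,\ldots,\mathfrak x_d),z=(z_1,\ldots,z_d),\mathfrak z=(\mathfrak z_1,\ldots,\mathfrak z_d)\in\mathbb R^d$, $y,\mathfrak y\in\mathbb R$ that $$\max\{|f_d(y,z)-f_d(\mathfrak y,\mathfrak z)|,|g_d(x)-g_d(\mathfrak x)|\}\le\sum_{j=1}^d L_{d,j}\big(d^\lambda|x_j-\mathfrak x_j|+|y-\mathfrak y|+|z_j-\mathfrak z_j|\big),$$ $$\big(\tfrac{\partial}{\partial t}u_d\big)(t,x)=(\Delta_xu_d)(t,x)+f_d\big(u_d(t,x),(\nabla_xu_d)(t,x)\big),\qquad u_d(0,x)=g_d(x),$$ and $d^{-\lambda}(|g_d(0)|+|f_d(0,0)|)+\sum_{i=1}^dL_{d,i}\le\lambda$. Let $(\Omega,\mathcal F,\mathbb P)$ be a probability space, let $\Theta=\bigcup_{n\in\mathbb N}\mathbb Z^n$, let $Z^{d,\theta}\colon\Omega\to\mathbb R^d$, $d\in\mathbb N$, $\theta\in\Theta$,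 be independent standard normal random variables, let $\mathfrak r^\theta\colon\Omega\to(0,1)$, $\theta\in\Theta$, be i.i.d. random variables with $\mathbb P(\mathfrak r^0\le b)=\sqrt b$ for all $b\in(0,1)$, and assume that $(Z^{d,\theta})_{(d,\theta)\in\mathbb N\times\Theta}$ and $(\mathfrak r^\theta)_{\theta\in\Theta}$ are independent. Let $\mathbf U^{d,\theta}_{n,M}=(\mathbf U^{d,\theta,0}_{n,M},\mathbf U^{d,\theta,1}_{n,M},\ldots,\mathbf U^{d,\theta,d}_{n,M})\colon(0,T]\times\mathbb R^d\times\Omega\to\mathbb R^{1+d}$, $n\in\{-1,0,1,\ldots\}$, $M,d\in\mathbb N$, $\theta\in\Theta$, satisfy for all $n,M,d\in\mathbb N$, $\theta\in\Theta$, $t\in(0,T]$, $x\in\mathbb R^d$ that $\mathbf U^{d,\theta}_{-1,M}(t,x)=\mathbf U^{d,\theta}_{0,M}(t,x)=0$ and $$\begin{aligned}\mathbf U^{d,\theta}_{n,M}(t,x)&=(g_d(x),0)+\sum_{i=1}^{M^n}\tfrac1{M^n}\big(g_d(x+[2t]^{1/2}Z^{d,(\theta,0,-i)})-g_d(x)\big)\big(1,[2t]^{-1/2}Z^{d,(\theta,0,-i)}\big)\\&\quad+\sum_{l=0}^{n-1}\sum_{i=1}^{M^{n-l}}\tfrac{2t[\mathfrak r^{(\theta,l,i)}]^{1/2}}{M^{n-l}}\Big[f_d\big(\mathbf U^{d,(\theta,l,i)}_{l,M}(t(1-\mathfrak r^{(\theta,l,i)}),x+[2t\mathfrak r^{(\theta,l,i)}]^{1/2}Z^{d,(\theta,l,i)})\big)\\&\qquad-\mathbf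 1_{\mathbb N}(l)f_d\big(\mathbf U^{d,(\theta,-l,i)}_{l-1,M}(t(1-\mathfrak r^{(\theta,l,i)}),x+[2t\mathfrak r^{(\theta,l,i)}]^{1/2}Z^{d,(\theta,l,i)})\big)\Big]\big(1,[2t\mathfrak r^{(\theta,l,i)}]^{-1/2}Z^{d,(\theta,l,i)}\big).\end{aligned}$$ For $d,n,M\in\mathbb N$ let $\mathrm{RV}_{d,n,M}$ be the number of realizations of scalar random variables used to compute one realization of $\mathbf U^{d,0}_{n,M}(T,0)$; precisely, let $\mathrm{RV}_{d,n,M}\in\mathbb Z$, $d,n,M\in\mathbb Z$, satisfy for all $d,n,M\in\mathbb N$ that $\mathrm{RV}_{d,0,M}=0$ and $$\mathrm{RV}_{d,n,M}\le dM^n+\sum_{l=0}^{n-1}\Big[M^{n-l}\big(d+1+\mathrm{RV}_{d,l,M}+\mathbf 1_{\mathbb N}(l)\,\mathrm{RV}_{d,l-1,M}\big)\Big].$$ Then there exist $c\in\mathbb R$ and $N=(N_{d,\varepsilon})_{(d,\varepsilon)\in\mathbb N\times(0,1]}\colon\mathbb N\times(0,1]\to\mathbb N$ such that for all $d\in\mathbb N$, $\varepsilon\in(0,1]$ it holds that $\sum_{n=1}^{N_{d,\varepsilon}}\mathrm{RV}_{d,n,\lfloor n^{1/4}\rfloor}\le c\,d^c\,\varepsilon^{-(2+\delta)}$ and $$\sup_{n\in\mathbb N\cap[N_{d,\varepsilon},\infty)}\Big[\mathbb E\big[|\mathbf U^{d,0,0}_{n,\lfloor n^{1/4}\rfloor}(T,0)-u_d(T,0)|^2\big]+\max_{i\in\{1,\ldots,d\}}\mathbb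 E\big[|\mathbf U^{d,0,i}_{n,\lfloor n^{1/4}\rfloor}(T,0)-(\tfrac{\partial}{\partial x_i}u_d)(T,0)|^2\big]\Big]^{1/2}\le\varepsilon.$$
   Context: $\mathbb N=\{1,2,3,\ldots\}$. For $\theta=(\theta_1,\ldots,\theta_k)\in\Theta$ and $l,i\in\mathbb Z$, $(\theta,l,i)=(\theta_1,\ldots,\theta_k,l,i)\in\Theta$; the index $0$ means the element $0\in\mathbb Z^1\subseteq\Theta$. In $\mathbf U^{d,0,i}_{n,M}$ the last superscript is the component index ($0$ for the solution approximation, $1,\ldots,d$ for the gradient approximation). $\mathbf 1_{\mathbb N}(l)$ is $1$ if $l\in\mathbb N$ and $0$ otherwise. For $a\in\mathbb R$, $v\in\mathbb R^d$ the pair $(a,v)$ is regarded as an element of $\mathbb R^{1+d}$, and $f_d$ is evaluated on $\mathbb R^{1+d}\cong\mathbb R\times\mathbb R^d$. $\lfloor\cdot\rfloor$ is the floor function. A function $u$ on $[0,T]\times\mathbb R^d$ is at most polynomially growing if $|u(t,x)|\le\eta(1+\sum_i|x_i|)^\eta$ for some $\eta\in(0,\infty)$ and all $(t,x)$. *)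

theory Defs
  imports "HOL-Probability.Probability"
begin

text \<open>
  Since the dimension \<open>d\<close> is quantified inside the statement, a vector of \<open>\<real>\<^sup>d\<close> is a function
  \<open>nat \<Rightarrow> real\<close> that is extensional on \<open>{1..d}\<close>. On this set the product topology of
  \<open>nat \<Rightarrow> real\<close> is the usual topology of \<open>\<real>\<^sup>d\<close>, because all other coordinates are constant.
\<close>

definition Rd :: "nat \<Rightarrow> (nat \<Rightarrow> real) set" where
  "Rd d = {1..d} \<rightarrow>\<^sub>E UNIV"

definition zero_vec :: "nat \<Rightarrow> nat \<Rightarrow> real" where
  "zero_vec d = (\<lambda>j\<in>{1..d}. 0)"

definition add_scaled :: "nat \<Rightarrow> (nat \<Rightarrow> real) \<Rightarrow> real \<Rightarrow> (nat \<Rightarrow> real) \<Rightarrow> nat \<Rightarrow> real" where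
  "add_scaled d x s z = (\<lambda>j\<in>{1..d}. x j + s * z j)"

text \<open>
  Elements of \<open>\<real>\<^sup>1\<^sup>+\<^sup>d\<close> are indexed by \<open>{0..d}\<close>: component \<open>0\<close> is the real part, components
  \<open>1, \<dots>, d\<close> are the \<open>\<real>\<^sup>d\<close> part. Values at indices beyond \<open>d\<close> are irrelevant.
\<close>

definition join_vec :: "real \<Rightarrow> (nat \<Rightarrow> real) \<Rightarrow> nat \<Rightarrow> real" where
  "join_vec a v k = (if k = 0 then a else v k)"

definition eval_joined :: "nat \<Rightarrow> (real \<Rightarrow> (nat \<Rightarrow> real) \<Rightarrow> real) \<Rightarrow> (nat \<Rightarrow> real) \<Rightarrow> real" where
  "eval_joined d f v = f (v 0) (restrict v {1..d})"

definition time_deriv :: "real \<Rightarrow> (real \<Rightarrow> (nat \<Rightarrow> real) \<Rightarrow> real) \<Rightarrow> real \<Rightarrow> (nat \<Rightarrow> real) \<Rightarrow> real" where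
  "time_deriv T u t x = vector_derivative (\<lambda>s. u s x) (at t within {0..T})"

definition space_deriv :: "nat \<Rightarrow> ((nat \<Rightarrow> real) \<Rightarrow> real) \<Rightarrow> (nat \<Rightarrow> real) \<Rightarrow> real" where
  "space_deriv i v x = deriv (\<lambda>h. v (x(i := h))) (x i)"

definition space_grad :: "nat \<Rightarrow> ((nat \<Rightarrow> real) \<Rightarrow> real) \<Rightarrow> (nat \<Rightarrow> real) \<Rightarrow> nat \<Rightarrow> real" where
  "space_grad d v x = (\<lambda>i\<in>{1..d}. space_deriv i v x)"

definition laplacian :: "nat \<Rightarrow> ((nat \<Rightarrow> real) \<Rightarrow> real) \<Rightarrow> (nat \<Rightarrow> real) \<Rightarrow> real" where
  "laplacian d v x = (\<Sum>i=1..d. space_deriv i (space_deriv i v) x)"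

text \<open>
  The class \<open>C\<^sup>1\<^sup>,\<^sup>2([0,T] \<times> \<real>\<^sup>d, \<real>)\<close>; time derivatives at \<open>0\<close> and \<open>T\<close> are one-sided.
\<close>

definition C12 :: "real \<Rightarrow> nat \<Rightarrow> (real \<Rightarrow> (nat \<Rightarrow> real) \<Rightarrow> real) \<Rightarrow> bool" where
  "C12 T d u \<longleftrightarrow>
     continuous_on ({0..T} \<times> Rd d) (\<lambda>(t, x). u t x) \<and>
     (\<forall>t\<in>{0..T}. \<forall>x\<in>Rd d. (\<lambda>s. u s x) differentiable (at t within {0..T})) \<and>
     continuous_on ({0..T} \<times> Rd d) (\<lambda>(t, x). time_deriv T u t x) \<and>
     (\<forall>i\<in>{1..d}.
        (\<forall>t\<in>{0..T}. \<forall>x\<in>Rd d. (\<lambda>h. u t (x(i := h))) field_differentiable (at (x i))) \<and>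
        continuous_on ({0..T} \<times> Rd d) (\<lambda>(t, x). space_deriv i (u t) x)) \<and>
     (\<forall>i\<in>{1..d}. \<forall>j\<in>{1..d}.
        (\<forall>t\<in>{0..T}. \<forall>x\<in>Rd d.
           (\<lambda>h. space_deriv j (u t) (x(i := h))) field_differentiable (at (x i))) \<and>
        continuous_on ({0..T} \<times> Rd d) (\<lambda>(t, x). space_deriv i (space_deriv j (u t)) x))"

definition at_most_poly_growing :: "real \<Rightarrow> nat \<Rightarrow> (real \<Rightarrow> (nat \<Rightarrow> real) \<Rightarrow> real) \<Rightarrow> bool" where
  "at_most_poly_growing T d u \<longleftrightarrow>
     (\<exists>\<eta>>0. \<forall>t\<in>{0..T}. \<forall>x\<in>Rd d. \<bar>u t x\<bar> \<le> \<eta> * (1 + (\<Sum>i=1..d. \<bar>x i\<bar>)) powr \<eta>)"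

text \<open>
  \<open>\<Theta>\<close> is the set of nonempty integer tuples; \<open>(\<theta>, l, i)\<close> is \<open>\<theta> @ [l, i]\<close>, and the index \<open>0\<close> is \<open>[0]\<close>.
\<close>

definition Theta :: "int list set" where
  "Theta = {\<theta>. \<theta> \<noteq> []}"

definition borel_Rd :: "nat \<Rightarrow> (nat \<Rightarrow> real) measure" where
  "borel_Rd d = Pi\<^sub>M {1..d} (\<lambda>_. borel)"

definition std_normal_Rd :: "nat \<Rightarrow> (nat \<Rightarrow> real) measure" where
  "std_normal_Rd d = Pi\<^sub>M {1..d} (\<lambda>_. density lborel (\<lambda>y. ennreal (std_normal_density y)))"

text \<open>
  The sigma-algebra on \<open>space P\<close> generated by a whole family of random variables.
  (The library's \<open>indep_var\<close> needs both variables to have the same value type, so independence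
  of the two families is expressed by these sigma-algebras.)
\<close>

definition generated_sets ::
    "'w measure \<Rightarrow> 'i set \<Rightarrow> ('i \<Rightarrow> 'b measure) \<Rightarrow> ('i \<Rightarrow> 'w \<Rightarrow> 'b) \<Rightarrow> 'w set set" where
  "generated_sets P I N X =
     sets (vimage_algebra (space P) (\<lambda>\<omega>. \<lambda>i\<in>I. X i \<omega>) (Pi\<^sub>M I N))"

text \<open>
  The multilevel Picard scheme. The arguments of \<open>U\<close> are \<open>d\<close>, \<open>\<theta>\<close>, \<open>n\<close>, \<open>M\<close>, \<open>t\<close>, \<open>x\<close>, \<open>\<omega>\<close>
  and the component index in \<open>{0..d}\<close>.
\<close>

definition mlp_scheme ::
    "'w measure \<Rightarrow> real \<Rightarrow> (nat \<Rightarrow> real \<Rightarrow> (nat \<Rightarrow> real) \<Rightarrow> real) \<Rightarrow> (nat \<Rightarrow> (nat \<Rightarrow> real) \<Rightarrow> real)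
     \<Rightarrow> (nat \<Rightarrow> int list \<Rightarrow> 'w \<Rightarrow> nat \<Rightarrow> real) \<Rightarrow> (int list \<Rightarrow> 'w \<Rightarrow> real)
     \<Rightarrow> (nat \<Rightarrow> int list \<Rightarrow> int \<Rightarrow> nat \<Rightarrow> real \<Rightarrow> (nat \<Rightarrow> real) \<Rightarrow> 'w \<Rightarrow> nat \<Rightarrow> real) \<Rightarrow> bool" where
  "mlp_scheme P T f g Z r U \<longleftrightarrow>
     (\<forall>n\<ge>1. \<forall>M\<ge>1. \<forall>d\<ge>1. \<forall>\<theta>\<in>Theta. \<forall>t\<in>{0<..T}. \<forall>x\<in>Rd d. \<forall>\<omega>\<in>space P. \<forall>k\<in>{0..d}.
        U d \<theta> (-1) M t x \<omega> k = 0 \<and>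
        U d \<theta> 0 M t x \<omega> k = 0 \<and>
        U d \<theta> (int n) M t x \<omega> k =
          join_vec (g d x) (\<lambda>_. 0) k
          + (\<Sum>i=1..M ^ n.
               let z = Z d (\<theta> @ [0, - int i]) \<omega> in
                 1 / real (M ^ n) * (g d (add_scaled d x (sqrt (2 * t)) z) - g d x)
                 * join_vec 1 (\<lambda>j. 1 / sqrt (2 * t) * z j) k)
          + (\<Sum>l<n. \<Sum>i=1..M ^ (n - l).
               let z = Z d (\<theta> @ [int l, int i]) \<omega>;
                   \<rho> = r (\<theta> @ [int l, int i]) \<omega>;
                   s = t * (1 - \<rho>);
                   y = add_scaled d x (sqrt (2 * t * \<rho>)) z
               in
                 2 * t * sqrt \<rho> / real (M ^ (n - l))
                 * (eval_joined d (f d) (U d (\<theta> @ [int l, int i]) (int l) M s y \<omega>)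
                    - indicator {1..} l
                      * eval_joined d (f d) (U d (\<theta> @ [- int l, int i]) (int l - 1) M s y \<omega>))
                 * join_vec 1 (\<lambda>j. 1 / sqrt (2 * t * \<rho>) * z j) k))"

end

theory Submission
  imports Defs "HOL-Real_Asymp.Real_Asymp"
begin

text \<open>
  Fix the dimension. A maximum principle for the spatial differences of \<open>u\<close> (penalised by
  \<open>\<epsilon> * cosh\<close>-sums) bounds \<open>u\<close> and its gradient by \<open>d powr lam\<close> times a dimension-free constant, so the
  source \<open>f (u, grad u)\<close> grows linearly. A second maximum principle identifies \<open>u\<close> with the Duhamel
  integral; differentiating the Gaussian kernel turns this into a fixed-point equation for
  \<open>(u, grad u)\<close> in which each term is an expectation of exactly the random variables that the scheme
  samples.

  The scheme is a deterministic functional of a field of independent pairs (Gaussian vector, time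
  variable). Its mean square error splits into variances of independent summands and a squared bias that
  involves the previous level only. In the norm weighted by \<open>exp (\<mu> * t) * (1 + sum L\<^sub>j x\<^sub>j\<^sup>2)\<close> the
  fixed-point map contracts by a factor of order \<open>1 / sqrt \<mu>\<close>, because the time variable has the density
  \<open>1 / (2 * sqrt q)\<close>. With \<open>\<mu> = M\<^sup>2\<close> the squared error is at most \<open>C\<^sup>n / M\<^sup>n * exp (M\<^sup>2 T)\<close>, and the cost is
  at most \<open>d (8 M)\<^sup>n\<close>. For \<open>M\<close> close to \<open>n powr (1/4)\<close>, the cost at level \<open>n + 1\<close> times the power \<open>1 + \<delta>/2\<close>
  of the squared error at level \<open>n\<close> stays bounded, and \<open>N\<close> is the first level after which the error
  stays below \<open>\<epsilon>\<close>.
\<close>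

section \<open>The standard normal distribution on \<open>Rd\<close>\<close>

text \<open>What keeps the constants free of the dimension is that every quantitative estimate is
  weighted by the \<open>L j\<close>, whose sum is at most \<open>lam\<close>: the mean of
  \<open>L j * (z j)^2\<close> summed over \<open>j\<close> stays bounded, while the mean square
  norm of \<open>z\<close> grows with \<open>d\<close>. The factor \<open>d powr lam\<close> enters
  through the initial value and \<open>f\<close> at zero only. It scales solution and error, and is
  absent from the contraction constant.

  Regularity is the main obstacle. The source is merely continuous, so it is never differentiated: a
  shift of the base point is moved into the Gaussian density. The second derivatives of
  \<open>u\<close> have no known growth, so they are used only on compact sets.

  With \<open>\<mu> = M^2\<close> the contraction factor \<open>1 / sqrt \<mu>\<close> equals
  \<open>1 / M\<close>, the gain of one averaging step, so the recursion closes geometrically. The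
  price \<open>exp (M^2 * T)\<close> is harmless because \<open>M^2 \<le> n\<close> when
  \<open>M\<close> is at most the fourth root of \<open>n\<close>; it only enlarges \<open>C\<close>
  in \<open>C^n\<close>. The surplus \<open>\<delta>\<close> in the exponent leaves a factor
  \<open>M^(- n * \<delta> / 2)\<close>, which beats every exponential in \<open>n\<close>.\<close>

declare One_nat_def [simp del]  \<comment> \<open>keeps index sets in the form \<open>{1..d}\<close>\<close>

type_synonym rvec = "nat \<Rightarrow> real"

abbreviation std_normal :: "real measure" where
  "std_normal \<equiv> density lborel (\<lambda>y. ennreal (std_normal_density y))"

lemma prob_space_std_normal: "prob_space std_normal"
  by (rule prob_space_normal_density) simp

section \<open>Measurability in extensional coordinates\<close>

lemma space_borel_Rd [simp]: "space (borel_Rd d) = Rd d"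
  by (simp add: borel_Rd_def Rd_def space_PiM)

lemma sets_std_normal_Rd [measurable_cong, simp]: "sets (std_normal_Rd d) = sets (borel_Rd d)"
  unfolding std_normal_Rd_def borel_Rd_def by (rule sets_PiM_cong) auto

lemma space_std_normal_Rd [simp]: "space (std_normal_Rd d) = Rd d"
  by (simp add: std_normal_Rd_def Rd_def space_PiM)

lemma prob_space_std_normal_Rd: "prob_space (std_normal_Rd d)"
  unfolding std_normal_Rd_def by (rule prob_space_PiM) (rule prob_space_std_normal)

interpretation gauss: prob_space "std_normal_Rd d" for d
  by (rule prob_space_std_normal_Rd)

lemma product_sigma_finite_std_normal: "product_sigma_finite (\<lambda>_::nat. std_normal)"
  unfolding product_sigma_finite_def
  using prob_space_std_normal by (simp add: prob_space_imp_sigma_finite)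

text \<open>No side condition on \<open>j\<close> is imposed: outside \<open>{1..d}\<close> the
  coordinate is constantly \<open>undefined\<close>, because points of \<open>Rd d\<close> are
  extensional.\<close>

lemma measurable_coord_Rd [measurable (raw)]:
  assumes "X \<in> N \<rightarrow>\<^sub>M borel_Rd d"
  shows "(\<lambda>\<omega>. X \<omega> j) \<in> borel_measurable N"
proof (cases "j \<in> {1..d}")
  case True
  then have "(\<lambda>x. x j) \<in> borel_Rd d \<rightarrow>\<^sub>M borel"
    unfolding borel_Rd_def by (rule measurable_component_singleton)
  then show ?thesis using assms by (rule measurable_compose[rotated])
next
  case False
  have "(\<lambda>\<omega>. undefined :: real) \<in> borel_measurable N" by simp
  also have "?this \<longleftrightarrow> ?thesis"
    using measurable_space[OF assms] False
    by (intro measurable_cong) (force simp: Rd_def PiE_def extensional_def)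
  finally show ?thesis .
qed

lemma measurable_into_Rd:
  assumes "\<And>j. j \<in> {1..d} \<Longrightarrow> (\<lambda>\<omega>. X \<omega> j) \<in> borel_measurable N"
    and "\<And>\<omega>. \<omega> \<in> space N \<Longrightarrow> X \<omega> \<in> Rd d"
  shows "X \<in> N \<rightarrow>\<^sub>M borel_Rd d"
  unfolding borel_Rd_def using assms
  by (intro measurable_PiM_single') (auto simp: Rd_def PiE_def extensional_def)

lemma add_scaled_in_Rd [simp]: "add_scaled d x s z \<in> Rd d"
  by (simp add: add_scaled_def Rd_def)

lemma zero_vec_in_Rd [simp]: "zero_vec d \<in> Rd d"
  by (simp add: zero_vec_def Rd_def)

lemma add_scaled_apply [simp]: "j \<in> {1..d} \<Longrightarrow> add_scaled d x s z j = x j + s * z j"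
  by (simp add: add_scaled_def)

lemma zero_vec_apply [simp]: "j \<in> {1..d} \<Longrightarrow> zero_vec d j = 0"
  by (simp add: zero_vec_def)

lemma Rd_eqI: "x \<in> Rd d \<Longrightarrow> y \<in> Rd d \<Longrightarrow> (\<And>j. j \<in> {1..d} \<Longrightarrow> x j = y j) \<Longrightarrow> x = y"
  unfolding Rd_def by (rule PiE_ext)

lemma Rd_fun_upd [simp]: "x \<in> Rd d \<Longrightarrow> i \<in> {1..d} \<Longrightarrow> x(i := a) \<in> Rd d"
  by (auto simp: Rd_def PiE_def extensional_def)

lemma restrict_in_Rd [simp]: "restrict x {1..d} \<in> Rd d"
  by (simp add: Rd_def)

lemma measurable_add_scaled [measurable (raw)]:
  assumes [measurable]: "X \<in> N \<rightarrow>\<^sub>M borel_Rd d" "s \<in> borel_measurable N" "z \<in> N \<rightarrow>\<^sub>M borel_Rd d"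
  shows "(\<lambda>\<omega>. add_scaled d (X \<omega>) (s \<omega>) (z \<omega>)) \<in> N \<rightarrow>\<^sub>M borel_Rd d"
  by (rule measurable_into_Rd) (simp_all, measurable)

text \<open>Continuity refers to the topology of the whole function space, measurability to the
  product sigma-algebra of finitely many coordinates. The bridge: a map with measurable coordinates
  is Borel measurable into the function space, and can then be composed with the restriction of
  \<open>F\<close> to \<open>S \<times> Rd d\<close>.\<close>

lemma borel_measurable_continuous_Rd:
  fixes F :: "'a :: {second_countable_topology, t2_space} \<Rightarrow> rvec \<Rightarrow> real"
  assumes F: "continuous_on (S \<times> Rd d) (\<lambda>(t, x). F t x)" and S: "closed S"
    and a: "a \<in> borel_measurable N" "\<And>\<omega>. \<omega> \<in> space N \<Longrightarrow> a \<omega> \<in> S"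
    and X: "X \<in> N \<rightarrow>\<^sub>M borel_Rd d"
  shows "(\<lambda>\<omega>. F (a \<omega>) (X \<omega>)) \<in> borel_measurable N"
proof -
  have "X \<in> borel_measurable N"
    by (rule measurable_coordinatewise_then_product) (use X in measurable)
  with a have "(\<lambda>\<omega>. (a \<omega>, X \<omega>)) \<in> borel_measurable N"
    by (simp add: borel_measurable_Pair)
  then have 1: "(\<lambda>\<omega>. (a \<omega>, X \<omega>)) \<in> N \<rightarrow>\<^sub>M restrict_space borel (S \<times> Rd d)"
    using a measurable_space[OF X] by (intro measurable_restrict_space2) auto
  have "(\<lambda>(t, x). F t x) \<in> borel_measurable (restrict_space borel (S \<times> Rd d))"
    by (rule borel_measurable_continuous_on_restrict[OF F])
  from measurable_compose[OF 1 this] show ?thesis by simp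
qed

section \<open>Exponential integrability and Gaussian moments\<close>

lemma integrable_std_normal_exp: "integrable std_normal (\<lambda>y. exp (c * y))"
  and integral_std_normal_exp: "(\<integral>y. exp (c * y) \<partial>std_normal) = exp (c\<^sup>2 / 2)"
proof -
  \<comment> \<open>Completing the square: the tilt by \<open>exp (c * y)\<close> moves the mean to
    \<open>c\<close> and leaves the factor \<open>exp (c\<^sup>2 / 2)\<close>.\<close>
  have eq: "std_normal_density y * exp (c * y) = exp (c\<^sup>2 / 2) * normal_density c 1 y" for y
    by (simp add: normal_density_def mult_exp_exp[symmetric] power2_eq_square field_simps flip: exp_add)
  show "integrable std_normal (\<lambda>y. exp (c * y))"
    by (subst integrable_density) (auto simp: eq)
  show "(\<integral>y. exp (c * y) \<partial>std_normal) = exp (c\<^sup>2 / 2)"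
    by (subst integral_density) (auto simp: eq)
qed

lemma integrable_std_normal_exp_abs: "integrable std_normal (\<lambda>y. exp (c * \<bar>y\<bar>))"
proof (rule Bochner_Integration.integrable_bound)
  show "integrable std_normal (\<lambda>y. exp (c * y) + exp (- c * y))"
    by (intro Bochner_Integration.integrable_add integrable_std_normal_exp)
  show "AE y in std_normal. norm (exp (c * \<bar>y\<bar>)) \<le> norm (exp (c * y) + exp (- c * y))"
  proof (rule AE_I2)
    fix y :: real
    have "0 < exp (c * y)" "0 < exp (- (c * y))" by simp_all
    then show "norm (exp (c * \<bar>y\<bar>)) \<le> norm (exp (c * y) + exp (- c * y))"
      by (cases "y \<ge> 0") (simp_all add: abs_of_pos del: exp_gt_zero)
  qed
qed simp

lemma integrable_std_normal_Rd_exp: "integrable (std_normal_Rd d) (\<lambda>z. exp (c * (\<Sum>j=1..d. \<bar>z j\<bar>)))"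
proof -
  interpret product_sigma_finite "\<lambda>_::nat. std_normal" by (rule product_sigma_finite_std_normal)
  have "integrable (std_normal_Rd d) (\<lambda>z. \<Prod>j=1..d. exp (c * \<bar>z j\<bar>))"
    unfolding std_normal_Rd_def
    by (rule product_integrable_prod) (auto intro: integrable_std_normal_exp_abs)
  also have "(\<lambda>z::nat\<Rightarrow>real. \<Prod>j=1..d. exp (c * \<bar>z j\<bar>)) = (\<lambda>z. exp (c * (\<Sum>j=1..d. \<bar>z j\<bar>)))"
    by (auto simp: exp_sum sum_distrib_left)
  finally show ?thesis .
qed

text \<open>The domination criterion used for most Gaussian integrals below: growth at most
  exponential in the sum of the absolute coordinates.\<close>

lemma integrable_std_normal_Rd:
  assumes "F \<in> borel_measurable (borel_Rd d)"
    and "\<And>z. z \<in> Rd d \<Longrightarrow> \<bar>F z\<bar> \<le> C * exp (c * (\<Sum>j=1..d. \<bar>z j\<bar>))"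
  shows "integrable (std_normal_Rd d) F"
proof (rule Bochner_Integration.integrable_bound)
  show "integrable (std_normal_Rd d) (\<lambda>z. C * exp (c * (\<Sum>j=1..d. \<bar>z j\<bar>)))"
    by (intro integrable_mult_right integrable_std_normal_Rd_exp)
  show "F \<in> borel_measurable (std_normal_Rd d)"
    using assms(1) by (simp cong: measurable_cong_sets)
  show "AE z in std_normal_Rd d. norm (F z) \<le> norm (C * exp (c * (\<Sum>j=1..d. \<bar>z j\<bar>)))"
    using assms(2) by (intro AE_I2) (force simp: abs_le_iff)
qed

lemma distr_std_normal_Rd_coord:
  assumes "i \<in> {1..d}"
  shows "distr (std_normal_Rd d) borel (\<lambda>z. z i) = std_normal"
proof -
  have "distr (std_normal_Rd d) borel (\<lambda>z. z i) = distr (std_normal_Rd d) std_normal (\<lambda>z. z i)"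
    by (rule distr_cong) auto
  also have "\<dots> = std_normal"
    unfolding std_normal_Rd_def using assms prob_space_std_normal by (intro distr_PiM_component)
  finally show ?thesis .
qed

lemma
  fixes \<phi> :: "real \<Rightarrow> real"
  assumes i: "i \<in> {1..d}" and [measurable]: "\<phi> \<in> borel_measurable borel"
  shows integral_std_normal_Rd_coord: "(\<integral>z. \<phi> (z i) \<partial>std_normal_Rd d) = (\<integral>y. \<phi> y \<partial>std_normal)"
    and integrable_std_normal_Rd_coord: "integrable (std_normal_Rd d) (\<lambda>z. \<phi> (z i)) \<longleftrightarrow> integrable std_normal \<phi>"
proof -
  have [measurable]: "(\<lambda>z. z i) \<in> borel_measurable (std_normal_Rd d)" by measurable
  show "(\<integral>z. \<phi> (z i) \<partial>std_normal_Rd d) = (\<integral>y. \<phi> y \<partial>std_normal)"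
    unfolding distr_std_normal_Rd_coord[OF i, symmetric] by (subst integral_distr) auto
  show "integrable (std_normal_Rd d) (\<lambda>z. \<phi> (z i)) \<longleftrightarrow> integrable std_normal \<phi>"
    unfolding distr_std_normal_Rd_coord[OF i, symmetric] by (subst integrable_distr_eq) auto
qed

lemma integrable_std_normal_Rd_power:
  assumes "i \<in> {1..d}" shows "integrable (std_normal_Rd d) (\<lambda>z. (z i) ^ k)"
  using assms by (subst integrable_std_normal_Rd_coord[of i d "\<lambda>y. y ^ k"])
    (auto simp: integrable_density integrable_std_normal_moment)

lemma
  assumes "i \<in> {1..d}"
  shows std_normal_Rd_moment1: "(\<integral>z. z i \<partial>std_normal_Rd d) = 0"
    and std_normal_Rd_moment2: "(\<integral>z. (z i)\<^sup>2 \<partial>std_normal_Rd d) = 1"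
    and std_normal_Rd_moment4: "(\<integral>z. (z i) ^ 4 \<partial>std_normal_Rd d) = 3"
    and std_normal_Rd_exp: "(\<integral>z. exp (c * z i) \<partial>std_normal_Rd d) = exp (c\<^sup>2 / 2)"
    and std_normal_Rd_exp_integrable: "integrable (std_normal_Rd d) (\<lambda>z. exp (c * z i))"
proof -
  have P: "(\<integral>z. (z i) ^ k \<partial>std_normal_Rd d) = (\<integral>y. std_normal_density y * y ^ k \<partial>lborel)" for k
    using integral_std_normal_Rd_coord[OF assms, of "\<lambda>y. y ^ k"] by (simp add: integral_density)
  show "(\<integral>z. z i \<partial>std_normal_Rd d) = 0"
    using P[of 1] integral_std_normal_moment_odd[of 0] by simp
  show "(\<integral>z. (z i)\<^sup>2 \<partial>std_normal_Rd d) = 1"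
    using P[of 2] integral_std_normal_moment_even[of 1] by simp
  show "(\<integral>z. (z i) ^ 4 \<partial>std_normal_Rd d) = 3"
    using P[of 4] integral_std_normal_moment_even[of 2] by (simp add: fact_numeral)
  show "(\<integral>z. exp (c * z i) \<partial>std_normal_Rd d) = exp (c\<^sup>2 / 2)"
    using integral_std_normal_Rd_coord[OF assms, of "\<lambda>y. exp (c * y)"] integral_std_normal_exp by simp
  show "integrable (std_normal_Rd d) (\<lambda>z. exp (c * z i))"
    using integrable_std_normal_Rd_coord[OF assms, of "\<lambda>y. exp (c * y)"] integrable_std_normal_exp by simp
qed

section \<open>Convolution, reflection and shift of the Gaussian law\<close>

lemma std_normal_Rd_PiM_eqI:
  assumes P: "sets P = sets (borel_Rd d)"
    and eq: "\<And>A. (\<And>i. i \<in> {1..d} \<Longrightarrow> A i \<in> sets borel) \<Longrightarrow> emeasure P (Pi\<^sub>E {1..d} A) = (\<Prod>i\<in>{1..d}. emeasure std_normal (A i))"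
  shows "P = std_normal_Rd d"
proof -
  interpret product_sigma_finite "\<lambda>_::nat. std_normal" by (rule product_sigma_finite_std_normal)
  show ?thesis unfolding std_normal_Rd_def
  proof (rule PiM_eqI)
    show "sets P = sets (Pi\<^sub>M {1..d} (\<lambda>_. std_normal))"
      using P sets_std_normal_Rd[of d] unfolding std_normal_Rd_def by simp
  qed (use eq in auto)
qed

lemma std_normal_Rd_box:
  assumes "\<And>i. i \<in> {1..d} \<Longrightarrow> A i \<in> sets borel"
  shows "emeasure (std_normal_Rd d) (Pi\<^sub>E {1..d} A) = (\<Prod>i\<in>{1..d}. emeasure std_normal (A i))"
proof -
  interpret product_sigma_finite "\<lambda>_::nat. std_normal" by (rule product_sigma_finite_std_normal)
  show ?thesis unfolding std_normal_Rd_def using assms by (intro emeasure_PiM) auto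
qed

lemma box_in_sets_Rd: "(\<And>i. i \<in> {1..d} \<Longrightarrow> A i \<in> sets borel) \<Longrightarrow> Pi\<^sub>E {1..d} A \<in> sets (borel_Rd d)"
  unfolding borel_Rd_def by (intro sets_PiM_I_finite) auto

lemma distributed_std_normal_id: "distributed std_normal lborel (\<lambda>x. x) std_normal_density"
proof -
  have "distr std_normal lborel (\<lambda>x. x) = std_normal" by (rule distr_id2) simp
  then show ?thesis by (auto simp: distributed_def)
qed

text \<open>The nested integral is the law of \<open>\<alpha> * fst p + \<beta> * snd p\<close> on
  the product of two standard normal laws. There the coordinates are independent, so the rule for
  sums of independent normal variables applies, with variance
  \<open>\<alpha>\<^sup>2 + \<beta>\<^sup>2 = 1\<close>.\<close>

lemma std_normal_convolution:
  assumes ab: "\<alpha>\<^sup>2 + \<beta>\<^sup>2 = 1" "\<alpha> > 0" "\<beta> > 0" and [measurable]: "A \<in> sets borel"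
  shows "(\<integral>\<^sup>+w. \<integral>\<^sup>+y. indicator A (\<alpha> * w + \<beta> * y) \<partial>std_normal \<partial>std_normal) = emeasure std_normal A"
proof -
  interpret N: prob_space std_normal by (rule prob_space_std_normal)
  interpret NN: pair_prob_space std_normal std_normal ..
  let ?P = "std_normal \<Otimes>\<^sub>M std_normal"
  have fst: "distr ?P lborel fst = std_normal" and snd: "distr ?P lborel snd = std_normal"
  proof -
    show "distr ?P lborel fst = std_normal"
    proof (rule measure_eqI)
      fix B assume "B \<in> sets (distr ?P lborel fst)"
      then have [measurable]: "B \<in> sets borel" by simp
      have "fst -` B \<inter> space ?P = B \<times> UNIV" by (auto simp: space_pair_measure)
      then show "emeasure (distr ?P lborel fst) B = emeasure std_normal B"
        using N.emeasure_space_1 by (simp add: emeasure_distr N.emeasure_pair_measure_Times)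
    qed simp
    show "distr ?P lborel snd = std_normal"
    proof (rule measure_eqI)
      fix B assume "B \<in> sets (distr ?P lborel snd)"
      then have [measurable]: "B \<in> sets borel" by simp
      have "snd -` B \<inter> space ?P = UNIV \<times> B" by (auto simp: space_pair_measure)
      then show "emeasure (distr ?P lborel snd) B = emeasure std_normal B"
        using N.emeasure_space_1 by (simp add: emeasure_distr N.emeasure_pair_measure_Times)
    qed simp
  qed
  have b: "distr ?P borel X = distr ?P lborel X" for X :: "real \<times> real \<Rightarrow> real"
    by (rule distr_cong) auto
  have ind: "NN.indep_var borel fst borel snd"
    unfolding NN.indep_var_distribution_eq b fst snd
  proof (intro conjI)
    have "distr ?P (borel \<Otimes>\<^sub>M borel) (\<lambda>x. (fst x, snd x)) = distr ?P ?P (\<lambda>x. x)"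
      by (rule distr_cong) (auto intro!: sets_pair_measure_cong)
    then show "?P = distr ?P (borel \<Otimes>\<^sub>M borel) (\<lambda>x. (fst x, snd x))"
      by simp
  qed auto
  have 1: "distributed ?P lborel (\<lambda>p. 0 + \<alpha> * fst p) (normal_density (0 + \<alpha> * 0) (\<bar>\<alpha>\<bar> * 1))"
    by (rule NN.normal_density_affine) (use fst ab in \<open>auto simp: distributed_def\<close>)
  have 2: "distributed ?P lborel (\<lambda>p. 0 + \<beta> * snd p) (normal_density (0 + \<beta> * 0) (\<bar>\<beta>\<bar> * 1))"
    by (rule NN.normal_density_affine) (use snd ab in \<open>auto simp: distributed_def\<close>)
  have "NN.indep_var borel ((\<lambda>x. \<alpha> * x) \<circ> fst) borel ((\<lambda>x. \<beta> * x) \<circ> snd)"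
    by (rule NN.indep_var_compose[OF ind]) auto
  then have "distributed ?P lborel (\<lambda>p. \<alpha> * fst p + \<beta> * snd p) (normal_density (0 + 0) (sqrt (\<alpha>\<^sup>2 + \<beta>\<^sup>2)))"
    using 1 2 ab by (intro NN.add_indep_normal) (auto simp: comp_def)
  then have "distr ?P lborel (\<lambda>p. \<alpha> * fst p + \<beta> * snd p) = std_normal"
    using ab by (simp add: distributed_def)
  then have "emeasure std_normal A = emeasure (distr ?P lborel (\<lambda>p. \<alpha> * fst p + \<beta> * snd p)) A" by simp
  also have "\<dots> = (\<integral>\<^sup>+x. indicator A x \<partial>distr ?P lborel (\<lambda>p. \<alpha> * fst p + \<beta> * snd p))"
    by simp
  also have "\<dots> = (\<integral>\<^sup>+p. indicator A (\<alpha> * fst p + \<beta> * snd p) \<partial>?P)"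
    by (subst nn_integral_distr) auto
  also have "\<dots> = (\<integral>\<^sup>+w. \<integral>\<^sup>+y. indicator A (\<alpha> * w + \<beta> * y) \<partial>std_normal \<partial>std_normal)"
    by (subst N.nn_integral_fst[symmetric]) auto
  finally show ?thesis by simp
qed

lemma indicator_PiE_prod:
  assumes "x \<in> Rd d"
  shows "indicator (Pi\<^sub>E {1..d} A) x = (\<Prod>j\<in>{1..d}. indicator (A j) (x j) :: ennreal)"
proof (cases "x \<in> Pi\<^sub>E {1..d} A")
  case True
  then show ?thesis by (auto simp: PiE_def Pi_def)
next
  case False
  then obtain j where "j \<in> {1..d}" "x j \<notin> A j" using assms by (auto simp: Rd_def PiE_def Pi_def)
  then have "(\<Prod>j\<in>{1..d}. indicator (A j) (x j) :: ennreal) = 0" by (intro prod_zero) (auto intro!: bexI[of _ j])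
  with False show ?thesis by simp
qed

lemma std_normal_Rd_nn_integral_prod:
  assumes "\<And>i. i \<in> {1..d} \<Longrightarrow> f i \<in> borel_measurable borel"
  shows "(\<integral>\<^sup>+z. (\<Prod>i\<in>{1..d}. f i (z i)) \<partial>std_normal_Rd d) = (\<Prod>i\<in>{1..d}. \<integral>\<^sup>+y. f i y \<partial>std_normal)"
proof -
  interpret product_sigma_finite "\<lambda>_::nat. std_normal" by (rule product_sigma_finite_std_normal)
  show ?thesis unfolding std_normal_Rd_def using assms by (intro product_nn_integral_prod) auto
qed

text \<open>A law on \<open>Rd d\<close> is determined by boxes, and on a box the claim factorises
  into its one-dimensional version in each coordinate. Reflection and shift below follow the same
  pattern.\<close>

lemma std_normal_Rd_convolution:
  assumes ab: "\<alpha>\<^sup>2 + \<beta>\<^sup>2 = 1" "\<alpha> > 0" "\<beta> > 0"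
  shows "distr (std_normal_Rd d \<Otimes>\<^sub>M std_normal_Rd d) (borel_Rd d)
      (\<lambda>(z, z'). add_scaled d (add_scaled d (zero_vec d) \<alpha> z) \<beta> z') = std_normal_Rd d" (is "distr ?P _ ?f = _")
proof (rule std_normal_Rd_PiM_eqI)
  interpret N: prob_space std_normal by (rule prob_space_std_normal)
  fix A :: "nat \<Rightarrow> real set" assume A: "\<And>i. i \<in> {1..d} \<Longrightarrow> A i \<in> sets borel"
  then have [measurable]: "Pi\<^sub>E {1..d} A \<in> sets (borel_Rd d)" by (rule box_in_sets_Rd)
  have [measurable]: "?f \<in> ?P \<rightarrow>\<^sub>M borel_Rd d" by measurable
  have "emeasure (distr ?P (borel_Rd d) ?f) (Pi\<^sub>E {1..d} A) = (\<integral>\<^sup>+x. indicator (Pi\<^sub>E {1..d} A) x \<partial>distr ?P (borel_Rd d) ?f)"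
    by (subst nn_integral_indicator) auto
  also have "\<dots> = (\<integral>\<^sup>+p. indicator (Pi\<^sub>E {1..d} A) (?f p) \<partial>?P)"
    by (subst nn_integral_distr) auto
  also have "\<dots> = (\<integral>\<^sup>+z. \<integral>\<^sup>+z'. indicator (Pi\<^sub>E {1..d} A) (?f (z, z')) \<partial>std_normal_Rd d \<partial>std_normal_Rd d)"
    by (subst gauss.nn_integral_fst[symmetric]) auto
  also have "\<dots> = (\<integral>\<^sup>+z. \<integral>\<^sup>+z'. (\<Prod>j\<in>{1..d}. indicator (A j) (\<alpha> * z j + \<beta> * z' j)) \<partial>std_normal_Rd d \<partial>std_normal_Rd d)"
    by (intro nn_integral_cong) (auto simp: indicator_PiE_prod intro!: prod.cong)
  also have "\<dots> = (\<integral>\<^sup>+z. (\<Prod>j\<in>{1..d}. \<integral>\<^sup>+y. indicator (A j) (\<alpha> * z j + \<beta> * y) \<partial>std_normal) \<partial>std_normal_Rd d)"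
  proof (intro nn_integral_cong)
    fix z
    show "(\<integral>\<^sup>+z'. (\<Prod>j\<in>{1..d}. indicator (A j) (\<alpha> * z j + \<beta> * z' j)) \<partial>std_normal_Rd d)
      = (\<Prod>j\<in>{1..d}. \<integral>\<^sup>+y. indicator (A j) (\<alpha> * z j + \<beta> * y) \<partial>std_normal)"
      using A by (intro std_normal_Rd_nn_integral_prod[of d "\<lambda>j y. indicator (A j) (\<alpha> * z j + \<beta> * y)"]) auto
  qed
  also have "\<dots> = (\<Prod>j\<in>{1..d}. \<integral>\<^sup>+w. \<integral>\<^sup>+y. indicator (A j) (\<alpha> * w + \<beta> * y) \<partial>std_normal \<partial>std_normal)"
  proof (rule std_normal_Rd_nn_integral_prod[of d "\<lambda>j w. \<integral>\<^sup>+y. indicator (A j) (\<alpha> * w + \<beta> * y) \<partial>std_normal"])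
    fix i assume "i \<in> {1..d}"
    then have [measurable]: "A i \<in> sets borel" by (rule A)
    show "(\<lambda>w. \<integral>\<^sup>+y. indicator (A i) (\<alpha> * w + \<beta> * y) \<partial>std_normal) \<in> borel_measurable borel"
      by measurable
  qed
  also have "\<dots> = (\<Prod>j\<in>{1..d}. emeasure std_normal (A j))"
    using A ab by (intro prod.cong refl std_normal_convolution) auto
  finally show "emeasure (distr ?P (borel_Rd d) ?f) (Pi\<^sub>E {1..d} A) = (\<Prod>j\<in>{1..d}. emeasure std_normal (A j))" .
qed simp

lemma add_scaled_sum_abs_le:
  "(\<Sum>j=1..d. \<bar>add_scaled d x s z j\<bar>) \<le> (\<Sum>j=1..d. \<bar>x j\<bar>) + \<bar>s\<bar> * (\<Sum>j=1..d. \<bar>z j\<bar>)"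
  unfolding sum_distrib_left sum.distrib[symmetric]
  by (intro sum_mono) (auto simp: abs_mult[symmetric] intro: abs_triangle_ineq order_trans)

text \<open>Two consecutive Gaussian steps of widths \<open>a\<close> and \<open>b\<close> are one
  step of width \<open>sqrt (a\<^sup>2 + b\<^sup>2)\<close>: division by \<open>s\<close> turns
  \<open>(a, b)\<close> into a unit vector, and the exponential bound gives the integrability that
  Fubini requires.\<close>

lemma integral_std_normal_Rd_convolution:
  assumes F [measurable]: "F \<in> borel_measurable (borel_Rd d)"
    and bd: "\<And>z. z \<in> Rd d \<Longrightarrow> \<bar>F z\<bar> \<le> C * exp (c * (\<Sum>j=1..d. \<bar>z j\<bar>))"
    and s: "a > 0" "b > 0" "s = sqrt (a\<^sup>2 + b\<^sup>2)" and c: "c \<ge> 0" and x: "x \<in> Rd d"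
  shows "(\<integral>z. \<integral>z'. F (add_scaled d (add_scaled d x a z) b z') \<partial>std_normal_Rd d \<partial>std_normal_Rd d)
      = (\<integral>z. F (add_scaled d x s z) \<partial>std_normal_Rd d)"
proof -
  interpret GG: pair_prob_space "std_normal_Rd d" "std_normal_Rd d" ..
  let ?P = "std_normal_Rd d \<Otimes>\<^sub>M std_normal_Rd d"
  let ?f = "\<lambda>(z, z'). add_scaled d (add_scaled d (zero_vec d) (a / s) z) (b / s) z'"
  have [simp]: "s > 0" using s by (simp add: add_pos_pos)
  then have [simp]: "s \<noteq> 0" by linarith
  have "(a / s)\<^sup>2 + (b / s)\<^sup>2 = (a\<^sup>2 + b\<^sup>2) / s\<^sup>2" by (simp add: power_divide add_divide_distrib)
  also have "\<dots> = 1" using s by (simp add: add_pos_pos sum_power2_eq_zero_iff)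
  finally have d: "distr ?P (borel_Rd d) ?f = std_normal_Rd d"
    using s \<open>s > 0\<close> by (intro std_normal_Rd_convolution) (metis | metis divide_pos_pos)+
  have [measurable]: "?f \<in> ?P \<rightarrow>\<^sub>M borel_Rd d" by measurable
  have [measurable]: "x \<in> space (borel_Rd d)" using x by simp
  let ?G = "\<lambda>z. F (add_scaled d x s z)"
  have [measurable]: "?G \<in> borel_measurable (borel_Rd d)" by measurable
  have e: "?G (?f (z, z')) = F (add_scaled d (add_scaled d x a z) b z')" for z z'
    using \<open>s > 0\<close> by (intro arg_cong[where f=F] Rd_eqI[of _ d]) (auto simp: field_simps)
  have "\<bar>?G z\<bar> \<le> C * exp (c * (\<Sum>j=1..d. \<bar>x j\<bar>)) * exp (c * s * (\<Sum>j=1..d. \<bar>z j\<bar>))" if "z \<in> Rd d" for z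
  proof -
    have "C \<ge> 0" using bd[of "zero_vec d"] by (auto simp: zero_le_mult_iff not_less dest!: order_trans[OF abs_ge_zero] split: if_splits)
    have "\<bar>?G z\<bar> \<le> C * exp (c * (\<Sum>j=1..d. \<bar>add_scaled d x s z j\<bar>))" by (rule bd) simp
    also have "\<dots> \<le> C * exp (c * ((\<Sum>j=1..d. \<bar>x j\<bar>) + \<bar>s\<bar> * (\<Sum>j=1..d. \<bar>z j\<bar>)))"
      using add_scaled_sum_abs_le[of d x s z] c \<open>C \<ge> 0\<close> by (intro mult_left_mono) (auto intro: mult_left_mono)
    finally show ?thesis using abs_of_pos[OF \<open>s > 0\<close>] by (simp add: exp_add[symmetric] algebra_simps)
  qed
  then have i: "integrable (std_normal_Rd d) ?G"
    by (intro integrable_std_normal_Rd) auto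
  then have "integrable (distr ?P (borel_Rd d) ?f) ?G" by (simp only: d)
  then have i2: "integrable ?P (\<lambda>p. ?G (?f p))" by (subst (asm) integrable_distr_eq) auto
  have "(\<integral>z. ?G z \<partial>std_normal_Rd d) = (\<integral>z. ?G z \<partial>distr ?P (borel_Rd d) ?f)" by (simp only: d)
  also have "\<dots> = (\<integral>p. ?G (?f p) \<partial>?P)" by (subst integral_distr) auto
  also have "\<dots> = (\<integral>z. \<integral>z'. ?G (?f (z, z')) \<partial>std_normal_Rd d \<partial>std_normal_Rd d)"
    using GG.integral_fst'[OF i2] by simp
  finally show ?thesis by (simp only: e)
qed

lemma std_normal_reflect: "distr std_normal borel uminus = std_normal"
proof -
  interpret N: prob_space std_normal by (rule prob_space_std_normal)
  have "distributed std_normal lborel (\<lambda>x. 0 + -1 * x) (normal_density (0 + -1 * 0) (\<bar>-1\<bar> * 1))"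
    by (rule N.normal_density_affine) (auto intro: distributed_std_normal_id)
  then have "distr std_normal lborel uminus = std_normal" by (simp add: distributed_def)
  moreover have "distr std_normal borel uminus = distr std_normal lborel uminus" by (rule distr_cong) auto
  ultimately show ?thesis by simp
qed

lemma std_normal_Rd_reflect:
  assumes i: "i \<in> {1..d}"
  shows "distr (std_normal_Rd d) (borel_Rd d) (\<lambda>z. z(i := - z i)) = std_normal_Rd d"
proof (rule std_normal_Rd_PiM_eqI)
  have [measurable]: "(\<lambda>z. z(i := - z i)) \<in> borel_Rd d \<rightarrow>\<^sub>M borel_Rd d"
    by (rule measurable_into_Rd) (use i in auto)
  fix A :: "nat \<Rightarrow> real set" assume A: "\<And>i. i \<in> {1..d} \<Longrightarrow> A i \<in> sets borel"
  then have [measurable]: "Pi\<^sub>E {1..d} A \<in> sets (borel_Rd d)" by (rule box_in_sets_Rd)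
  let ?B = "A(i := uminus -` A i)"
  have "(\<lambda>z. z(i := - z i)) -` Pi\<^sub>E {1..d} A \<inter> Rd d = Pi\<^sub>E {1..d} ?B"
    using i by (auto simp: Rd_def PiE_def Pi_def extensional_def split: if_splits)
  then have "emeasure (distr (std_normal_Rd d) (borel_Rd d) (\<lambda>z. z(i := - z i))) (Pi\<^sub>E {1..d} A)
     = emeasure (std_normal_Rd d) (Pi\<^sub>E {1..d} ?B)"
    by (subst emeasure_distr) auto
  also have "\<dots> = (\<Prod>j\<in>{1..d}. emeasure std_normal (?B j))"
    using A i by (intro std_normal_Rd_box) (auto intro!: measurable_sets[of uminus borel borel, simplified])
  also have "\<dots> = (\<Prod>j\<in>{1..d}. emeasure std_normal (A j))"
  proof (intro prod.cong refl)
    fix j assume "j \<in> {1..d}"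
    then have "emeasure (distr std_normal borel uminus) (A i) = emeasure std_normal (uminus -` A i)"
      using A[OF i] by (subst emeasure_distr) auto
    then show "emeasure std_normal (?B j) = emeasure std_normal (A j)" using std_normal_reflect by auto
  qed
  finally show "emeasure (distr (std_normal_Rd d) (borel_Rd d) (\<lambda>z. z(i := - z i))) (Pi\<^sub>E {1..d} A)
     = (\<Prod>j\<in>{1..d}. emeasure std_normal (A j))" .
qed simp

text \<open>Reflection of one coordinate preserves the law, so the integral equals its own negative.
  This removes the first-order terms in the expansion of \<open>u\<close>.\<close>

lemma integral_std_normal_Rd_odd:
  fixes G :: "rvec \<Rightarrow> real"
  assumes i: "i \<in> {1..d}" and [measurable]: "G \<in> borel_measurable (borel_Rd d)"
    and odd: "\<And>z. z \<in> Rd d \<Longrightarrow> G (z(i := - z i)) = - G z"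
  shows "(\<integral>z. G z \<partial>std_normal_Rd d) = 0"
proof -
  have [measurable]: "(\<lambda>z. z(i := - z i)) \<in> borel_Rd d \<rightarrow>\<^sub>M borel_Rd d"
    by (rule measurable_into_Rd) (use i in auto)
  have "(\<integral>z. G z \<partial>std_normal_Rd d) = (\<integral>z. G z \<partial>distr (std_normal_Rd d) (borel_Rd d) (\<lambda>z. z(i := - z i)))"
    by (simp only: std_normal_Rd_reflect[OF i])
  also have "\<dots> = (\<integral>z. G (z(i := - z i)) \<partial>std_normal_Rd d)" by (subst integral_distr) auto
  also have "\<dots> = (\<integral>z. - G z \<partial>std_normal_Rd d)" by (intro Bochner_Integration.integral_cong) (auto simp: odd)
  finally show ?thesis by simp
qed

text \<open>The Cameron-Martin formula in one dimension: the density
  \<open>exp (c * y - c\<^sup>2 / 2)\<close> moves the mean to \<open>c\<close>, and subtracting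
  \<open>c\<close> restores the standard normal law.\<close>

lemma std_normal_shift:
  assumes [measurable]: "A \<in> sets borel"
  shows "(\<integral>\<^sup>+y. ennreal (exp (c * y - c\<^sup>2 / 2)) * indicator A (y - c) \<partial>std_normal) = emeasure std_normal A"
proof -
  have e: "std_normal_density (y + c) * exp (c * (y + c) - c\<^sup>2 / 2) = std_normal_density y" for y
    by (simp add: std_normal_density_def flip: exp_add) (simp add: power2_eq_square field_simps)
  have "(\<integral>\<^sup>+y. ennreal (exp (c * y - c\<^sup>2 / 2)) * indicator A (y - c) \<partial>std_normal)
     = (\<integral>\<^sup>+y. ennreal (std_normal_density y * exp (c * y - c\<^sup>2 / 2)) * indicator A (y - c) \<partial>lborel)"
    by (subst nn_integral_density) (auto simp: ennreal_mult' mult.assoc)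
  also have "\<dots> = (\<integral>\<^sup>+y. ennreal (std_normal_density (c + 1 * y) * exp (c * (c + 1 * y) - c\<^sup>2 / 2)) * indicator A (c + 1 * y - c) \<partial>lborel)"
    by (subst nn_integral_real_affine[of _ 1 c]) auto
  also have "\<dots> = (\<integral>\<^sup>+y. ennreal (std_normal_density y) * indicator A y \<partial>lborel)"
    using e by (simp add: add.commute)
  finally show ?thesis by (simp add: emeasure_density)
qed

lemma std_normal_Rd_shift:
  assumes i: "i \<in> {1..d}"
  shows "distr (density (std_normal_Rd d) (\<lambda>z. ennreal (exp (c * z i - c\<^sup>2 / 2)))) (borel_Rd d) (\<lambda>z. z(i := z i - c)) = std_normal_Rd d"
   (is "distr ?D _ ?f = _")
proof (rule std_normal_Rd_PiM_eqI)
  have [measurable]: "?f \<in> borel_Rd d \<rightarrow>\<^sub>M borel_Rd d"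
    by (rule measurable_into_Rd) (use i in auto)
  fix A :: "nat \<Rightarrow> real set" assume A: "\<And>i. i \<in> {1..d} \<Longrightarrow> A i \<in> sets borel"
  then have [measurable]: "Pi\<^sub>E {1..d} A \<in> sets (borel_Rd d)" by (rule box_in_sets_Rd)
  \<comment> \<open>Coordinate \<open>i\<close> alone carries the density and the shift, which makes
    the integrand a product over the coordinates.\<close>
  let ?h = "\<lambda>j y. if j = i then ennreal (exp (c * y - c\<^sup>2 / 2)) * indicator (A j) (y - c) else indicator (A j) y"
  have "emeasure (distr ?D (borel_Rd d) ?f) (Pi\<^sub>E {1..d} A) = (\<integral>\<^sup>+x. indicator (Pi\<^sub>E {1..d} A) x \<partial>distr ?D (borel_Rd d) ?f)"
    by (subst nn_integral_indicator) auto
  also have "\<dots> = (\<integral>\<^sup>+z. ennreal (exp (c * z i - c\<^sup>2 / 2)) * indicator (Pi\<^sub>E {1..d} A) (?f z) \<partial>std_normal_Rd d)"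
    by (subst nn_integral_distr, simp, simp, subst nn_integral_density) auto
  also have "\<dots> = (\<integral>\<^sup>+z. (\<Prod>j\<in>{1..d}. ?h j (z j)) \<partial>std_normal_Rd d)"
  proof (intro nn_integral_cong)
    fix z assume "z \<in> space (std_normal_Rd d)"
    then have "indicator (Pi\<^sub>E {1..d} A) (?f z) = (\<Prod>j\<in>{1..d}. indicator (A j) (?f z j) :: ennreal)"
      using i by (intro indicator_PiE_prod) auto
    also have "\<dots> = indicator (A i) (z i - c) * (\<Prod>j\<in>{1..d}-{i}. indicator (A j) (z j))"
      using i by (subst prod.remove[of _ i]) (auto intro!: arg_cong2[where f="(*)"] prod.cong)
    moreover have "(\<Prod>j\<in>{1..d}. ?h j (z j)) = ?h i (z i) * (\<Prod>j\<in>{1..d}-{i}. indicator (A j) (z j))"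
      using i by (subst prod.remove[of _ i]) (auto intro!: arg_cong2[where f="(*)"] prod.cong)
    ultimately show "ennreal (exp (c * z i - c\<^sup>2 / 2)) * indicator (Pi\<^sub>E {1..d} A) (?f z) = (\<Prod>j\<in>{1..d}. ?h j (z j))"
      by (simp add: mult.assoc)
  qed
  also have "\<dots> = (\<Prod>j\<in>{1..d}. \<integral>\<^sup>+y. ?h j y \<partial>std_normal)"
    using A by (intro std_normal_Rd_nn_integral_prod) auto
  also have "\<dots> = (\<Prod>j\<in>{1..d}. emeasure std_normal (A j))"
  proof (intro prod.cong refl)
    fix j assume "j \<in> {1..d}"
    with A have "A j \<in> sets borel" by blast
    then show "(\<integral>\<^sup>+y. ?h j y \<partial>std_normal) = emeasure std_normal (A j)"
      using std_normal_shift[of "A j" c] by (cases "j = i") auto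
  qed
  finally show "emeasure (distr ?D (borel_Rd d) ?f) (Pi\<^sub>E {1..d} A) = (\<Prod>j\<in>{1..d}. emeasure std_normal (A j))" .
qed simp

text \<open>Trades a shift of the argument for a smooth weight. Differentiating in \<open>c\<close>
  then never touches \<open>G\<close>, which in the applications is only continuous.\<close>

lemma integral_std_normal_Rd_shift:
  fixes G :: "rvec \<Rightarrow> real"
  assumes i: "i \<in> {1..d}" and [measurable]: "G \<in> borel_measurable (borel_Rd d)"
  shows "(\<integral>z. G (z(i := z i + c)) \<partial>std_normal_Rd d) = (\<integral>z. exp (c * z i - c\<^sup>2 / 2) * G z \<partial>std_normal_Rd d)"
proof -
  let ?D = "density (std_normal_Rd d) (\<lambda>z. ennreal (exp (c * z i - c\<^sup>2 / 2)))"
  have [measurable]: "(\<lambda>z. z(i := z i - c)) \<in> borel_Rd d \<rightarrow>\<^sub>M borel_Rd d"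
     "(\<lambda>z. z(i := z i + c)) \<in> borel_Rd d \<rightarrow>\<^sub>M borel_Rd d"
    by (rule measurable_into_Rd; use i in auto)+
  have "(\<integral>z. G (z(i := z i + c)) \<partial>std_normal_Rd d) = (\<integral>z. G (z(i := z i + c)) \<partial>distr ?D (borel_Rd d) (\<lambda>z. z(i := z i - c)))"
    by (simp only: std_normal_Rd_shift[OF i])
  also have "\<dots> = (\<integral>z. G z \<partial>?D)" by (subst integral_distr) auto
  also have "\<dots> = (\<integral>z. exp (c * z i - c\<^sup>2 / 2) * G z \<partial>std_normal_Rd d)" by (subst integral_density) auto
  finally show ?thesis .
qed

section \<open>Maximum principle and Lipschitz bounds\<close>

text \<open>The penalty of both maximum principles. It outgrows every polynomial, bounds its own
  first derivatives, is its own Laplacian, and is therefore multiplied by \<open>exp s\<close> under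
  a heat step of length \<open>s\<close>.\<close>

definition cosh_sum :: "nat \<Rightarrow> rvec \<Rightarrow> real" where
  "cosh_sum d x = (\<Sum>j=1..d. cosh (x j))"

lemma cosh_le_cosh_sum: "j \<in> {1..d} \<Longrightarrow> cosh (x j) \<le> cosh_sum d x"
  unfolding cosh_sum_def by (rule member_le_sum) (auto simp: cosh_real_nonneg)

lemma cosh_sum_pos: "d \<ge> 1 \<Longrightarrow> cosh_sum d x > 0"
  using cosh_le_cosh_sum[of 1 d x] cosh_real_pos[of "x 1"] by (simp del: cosh_real_pos)

lemma abs_sinh_le_cosh: "\<bar>sinh (y::real)\<bar> \<le> cosh y"
proof -
  have "0 < exp y" "0 < exp (- y)" by simp_all
  then show ?thesis unfolding sinh_field_def cosh_field_def by (auto simp: abs_le_iff field_simps)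
qed

lemma cosh_sum_dominates_poly:
  fixes A C \<eta> \<epsilon> :: real
  assumes d: "d \<ge> 1" and pos: "A > 0" "C > 0" "\<eta> > 0" "\<epsilon> > 0"
  shows "\<exists>R. \<forall>x. \<forall>j\<in>{1..d}. \<bar>x j\<bar> \<ge> R \<longrightarrow> C * (A + (\<Sum>j=1..d. \<bar>x j\<bar>)) powr \<eta> \<le> \<epsilon> * cosh_sum d x"
proof -
  \<comment> \<open>Some coordinate is at least the average \<open>S / d\<close> in absolute value,
    so the \<open>cosh\<close>-sum is at least \<open>cosh (c * S)\<close>, which beats any power of
    \<open>S\<close>.\<close>
  define c where "c = 1 / real d"
  have c: "c > 0" using d by (simp add: c_def)
  have "((\<lambda>S. (A + S) powr \<eta> / exp (c * S)) \<longlongrightarrow> 0) at_top"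
    using c pos by real_asymp
  then have "eventually (\<lambda>S. (A + S) powr \<eta> / exp (c * S) < \<epsilon> / (2 * C)) at_top"
    using pos by (intro order_tendstoD) auto
  then obtain R where R: "\<And>S. S \<ge> R \<Longrightarrow> (A + S) powr \<eta> / exp (c * S) < \<epsilon> / (2 * C)"
    by (auto simp: eventually_at_top_linorder)
  show ?thesis
  proof (intro exI[of _ R] allI ballI impI)
    fix x :: "nat \<Rightarrow> real" and j assume j: "j \<in> {1..d}" "\<bar>x j\<bar> \<ge> R"
    let ?S = "\<Sum>j=1..d. \<bar>x j\<bar>"
    have "R \<le> ?S" using j member_le_sum[of j "{1..d}" "\<lambda>j. \<bar>x j\<bar>"] by auto
    have "\<exists>k\<in>{1..d}. ?S / real d \<le> \<bar>x k\<bar>"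
    proof (rule ccontr)
      assume "\<not> ?thesis"
      then have "(\<Sum>k=1..d. \<bar>x k\<bar>) < (\<Sum>k=1..d. ?S / real d)"
        using d by (intro sum_strict_mono) (auto simp: not_le)
      then show False using d by simp
    qed
    then obtain k where k: "k \<in> {1..d}" "c * ?S \<le> \<bar>x k\<bar>" by (auto simp: c_def)
    have "C * (A + ?S) powr \<eta> \<le> \<epsilon> * (exp (c * ?S) / 2)"
      using R[OF \<open>R \<le> ?S\<close>] pos by (simp add: field_simps)
    also have "exp (c * ?S) / 2 \<le> cosh (c * ?S)"
      by (simp add: cosh_field_def)
    also have "\<dots> \<le> cosh \<bar>x k\<bar>"
      using k c by (subst cosh_real_nonneg_le_iff) (auto intro!: mult_nonneg_nonneg sum_nonneg)
    also have "\<dots> = cosh (x k)" by (simp add: cosh_real_abs)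
    also have "\<dots> \<le> cosh_sum d x" by (rule cosh_le_cosh_sum[OF k(1)])
    finally show "C * (A + ?S) powr \<eta> \<le> \<epsilon> * cosh_sum d x" using pos by simp
  qed
qed

text \<open>Tychonoff's theorem in the function space: each coordinate outside \<open>{1..d}\<close>
  ranges over the singleton \<open>{undefined}\<close>.\<close>

lemma compact_Rd_box: "compact {x \<in> Rd d. \<forall>j\<in>{1..d}. \<bar>x j\<bar> \<le> R}"
proof -
  have eq: "{x \<in> Rd d. \<forall>j\<in>{1..d}. \<bar>x j\<bar> \<le> R} = (\<Pi>\<^sub>E j\<in>UNIV. if j \<in> {1..d} then {-R..R} else {undefined})"
    by (auto simp: Rd_def PiE_def extensional_def Pi_def abs_le_iff split: if_splits; force)
  have "compactin (product_topology (\<lambda>_. euclidean) UNIV) (\<Pi>\<^sub>E j\<in>UNIV. if j \<in> {1..d} then {-R..R} else {undefined::real})"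
    by (subst compactin_PiE) auto
  then show ?thesis
    by (simp add: eq euclidean_product_topology)
qed

text \<open>A positive value can occur only inside the box of radius \<open>R\<close>, so a maximum
  over this compact box is a global one.\<close>

lemma attains_positive_max:
  fixes \<Phi> :: "real \<Rightarrow> rvec \<Rightarrow> real"
  assumes cont: "continuous_on ({0..T'} \<times> Rd d) (\<lambda>(t, x). \<Phi> t x)"
    and far: "\<And>t x j. t \<in> {0..T'} \<Longrightarrow> x \<in> Rd d \<Longrightarrow> j \<in> {1..d} \<Longrightarrow> \<bar>x j\<bar> \<ge> R \<Longrightarrow> \<Phi> t x \<le> 0"
    and pos: "t1 \<in> {0..T'}" "x1 \<in> Rd d" "\<Phi> t1 x1 > 0"
  obtains t0 x0 where "t0 \<in> {0..T'}" "x0 \<in> Rd d" "\<Phi> t0 x0 > 0" "\<And>t x. t \<in> {0..T'} \<Longrightarrow> x \<in> Rd d \<Longrightarrow> \<Phi> t x \<le> \<Phi> t0 x0"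
proof -
  let ?B = "{x \<in> Rd d. \<forall>j\<in>{1..d}. \<bar>x j\<bar> \<le> R}"
  have far': "\<Phi> t x \<le> 0" if "t \<in> {0..T'}" "x \<in> Rd d" "x \<notin> ?B" for t x
    using that far[of t x] by force
  have "(t1, x1) \<in> {0..T'} \<times> ?B" using pos far'[of t1 x1] by force
  moreover have "compact ({0..T'} \<times> ?B)" by (intro compact_Times compact_Rd_box) auto
  moreover have "continuous_on ({0..T'} \<times> ?B) (\<lambda>(t, x). \<Phi> t x)"
    by (rule continuous_on_subset[OF cont]) auto
  ultimately obtain p where p: "p \<in> {0..T'} \<times> ?B" "\<And>q. q \<in> {0..T'} \<times> ?B \<Longrightarrow> (\<lambda>(t, x). \<Phi> t x) q \<le> (\<lambda>(t, x). \<Phi> t x) p"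
    using continuous_attains_sup[of "{0..T'} \<times> ?B" "\<lambda>(t, x). \<Phi> t x"] by blast
  obtain t0 x0 where tx: "p = (t0, x0)" by (cases p)
  have m: "\<Phi> t x \<le> \<Phi> t0 x0" if "t \<in> {0..T'}" "x \<in> ?B" for t x
    using p(2)[of "(t, x)"] that by (auto simp: tx)
  have "\<Phi> t0 x0 > 0" using m[of t1 x1] pos \<open>(t1, x1) \<in> _\<close> by auto
  moreover from this have "\<Phi> t x \<le> \<Phi> t0 x0" if "t \<in> {0..T'}" "x \<in> Rd d" for t x
    using m[of t x] far'[of t x] that by (cases "x \<in> ?B") auto
  ultimately show ?thesis using p(1) by (intro that[of t0 x0]) (auto simp: tx)
qed

text \<open>The maximum may sit at the right end \<open>T'\<close>, so only earlier times are
  available for comparison. They suffice for the sign.\<close>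

lemma time_derivative_at_max:
  fixes \<phi> :: "real \<Rightarrow> real"
  assumes D: "(\<phi> has_real_derivative D) (at t0 within {0..T})"
    and t0: "0 < t0" "t0 \<le> T'" "T' \<le> T" and max: "\<And>t. t \<in> {0..T'} \<Longrightarrow> \<phi> t \<le> \<phi> t0"
  shows "D \<ge> 0"
proof (rule ccontr)
  assume "\<not> D \<ge> 0"
  then obtain e where e: "e > 0" "\<And>h. h > 0 \<Longrightarrow> t0 - h \<in> {0..T} \<Longrightarrow> h < e \<Longrightarrow> \<phi> t0 < \<phi> (t0 - h)"
    using has_real_derivative_neg_dec_left[OF D] by auto
  have "\<phi> t0 < \<phi> (t0 - min (e / 2) t0)" using e(1) t0 by (intro e(2)) auto
  moreover have "t0 - min (e / 2) t0 \<in> {0..T'}" using t0 e(1) by (simp add: min_def)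
  ultimately show False using max[of "t0 - min (e / 2) t0"] by linarith
qed

lemma second_derivative_at_max:
  fixes \<phi> \<phi>' :: "real \<Rightarrow> real"
  assumes d1: "\<And>h. (\<phi> has_real_derivative \<phi>' h) (at h)" and d2: "(\<phi>' has_real_derivative D) (at a)"
    and max: "\<And>h. \<phi> h \<le> \<phi> a"
  shows "\<phi>' a = 0" "D \<le> 0"
proof -
  show z: "\<phi>' a = 0" using DERIV_local_max[OF d1[of a], of 1] max by auto
  show "D \<le> 0"
  proof (rule ccontr)
    assume "\<not> D \<le> 0"
    then obtain e where e: "e > 0" "\<And>h. h > 0 \<Longrightarrow> h < e \<Longrightarrow> \<phi>' a < \<phi>' (a + h)"
      using has_real_derivative_pos_inc_right[OF d2] by auto
    have "\<phi> a < \<phi> (a + e / 2)"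
    proof (rule DERIV_pos_imp_increasing_open[where f=\<phi> and a=a])
      show "a < a + e / 2" using e by simp
      fix x assume "a < x" "x < a + e / 2"
      then have "\<phi>' x > 0" using e(2)[of "x - a"] e(1) z by simp
      then show "\<exists>y. (\<phi> has_real_derivative y) (at x) \<and> 0 < y" using d1 by blast
    next
      show "continuous_on {a..a + e / 2} \<phi>" using d1 DERIV_isCont continuous_at_imp_continuous_on by blast
    qed
    with max[of "a + e / 2"] show False by auto
  qed
qed

lemma continuous_on_snd_coord: "continuous_on S (\<lambda>p. snd p j)" for S :: "('a::topological_space \<times> ('b \<Rightarrow> real)) set"
  by (rule continuous_on_product_then_coordinatewise[OF continuous_on_snd[OF continuous_on_id]])

text \<open>\<open>Dl\<close> stands for \<open>real d powr lam\<close>. As a separate parameter it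
  shows how a bound depends on the dimension: the quantitative bounds contain \<open>d\<close>
  through \<open>Dl\<close> alone, everything else in them depends on \<open>T\<close> and
  \<open>lam\<close>.\<close>

locale pde_solution =
  fixes d :: nat and T :: real and u :: "real \<Rightarrow> rvec \<Rightarrow> real"
    and f :: "real \<Rightarrow> rvec \<Rightarrow> real" and g :: "rvec \<Rightarrow> real"
    and L :: "nat \<Rightarrow> real" and Dl lam :: real
  assumes d: "d \<ge> 1" and T: "T > 0" and lam: "lam > 0" and Dl: "Dl \<ge> 1"
    and u_C12: "C12 T d u" and u_growth: "at_most_poly_growing T d u"
    and f_cont: "continuous_on (UNIV \<times> Rd d) (\<lambda>(y, z). f y z)" and g_cont: "continuous_on (Rd d) g"
    and lipschitz: "\<And>x x' z z' y y'. \<lbrakk>x \<in> Rd d; x' \<in> Rd d; z \<in> Rd d; z' \<in> Rd d\<rbrakk> \<Longrightarrow>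
        max \<bar>f y z - f y' z'\<bar> \<bar>g x - g x'\<bar> \<le> (\<Sum>j=1..d. L j * (Dl * \<bar>x j - x' j\<bar> + \<bar>y - y'\<bar> + \<bar>z j - z' j\<bar>))"
    and pde: "\<And>t x. \<lbrakk>t \<in> {0..<T}; x \<in> Rd d\<rbrakk> \<Longrightarrow>
        time_deriv T u t x = laplacian d (u t) x + f (u t x) (space_grad d (u t) x)"
    and initial: "\<And>x. x \<in> Rd d \<Longrightarrow> u 0 x = g x"
    and L_sum: "(\<Sum>j=1..d. L j) \<le> lam" and base: "\<bar>g (zero_vec d)\<bar> + \<bar>f 0 (zero_vec d)\<bar> \<le> Dl * lam"
begin

text \<open>At two points that differ by one unit in gradient slot \<open>j\<close> and agree
  otherwise, the right-hand side of the Lipschitz condition is exactly \<open>L j\<close>, and it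
  bounds a nonnegative number.\<close>

lemma L_nonneg: assumes "j \<in> {1..d}" shows "L j \<ge> 0"
proof -
  have "0 \<le> (\<Sum>k=1..d. L k * (Dl * \<bar>zero_vec d k - zero_vec d k\<bar> + \<bar>0 - 0\<bar> + \<bar>((zero_vec d)(j := 1)) k - zero_vec d k\<bar>))"
    using order_trans[OF max.coboundedI1[OF abs_ge_zero] lipschitz[of "zero_vec d" "zero_vec d" "(zero_vec d)(j := 1)" "zero_vec d" 0 0]] assms
    by (simp only: Rd_fun_upd zero_vec_in_Rd)
  also have "\<dots> = (\<Sum>k=1..d. if k = j then L j else 0)" using assms by (intro sum.cong) auto
  also have "\<dots> = L j" using assms by simp
  finally show ?thesis .
qed

lemma f_lip: assumes "z \<in> Rd d" "z' \<in> Rd d"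
  shows "\<bar>f y z - f y' z'\<bar> \<le> (\<Sum>j=1..d. L j * (\<bar>y - y'\<bar> + \<bar>z j - z' j\<bar>))"
proof -
  have "\<bar>f y z - f y' z'\<bar> \<le> (\<Sum>j=1..d. L j * (Dl * \<bar>zero_vec d j - zero_vec d j\<bar> + \<bar>y - y'\<bar> + \<bar>z j - z' j\<bar>))"
    by (rule order_trans[OF max.cobounded1 lipschitz]) (simp_all add: assms)
  then show ?thesis by (simp only: diff_self abs_zero mult_zero_right add_0)
qed

lemma g_lip: assumes "x \<in> Rd d" "x' \<in> Rd d"
  shows "\<bar>g x - g x'\<bar> \<le> Dl * (\<Sum>j=1..d. L j * \<bar>x j - x' j\<bar>)"
proof -
  have "\<bar>g x - g x'\<bar> \<le> (\<Sum>j=1..d. L j * (Dl * \<bar>x j - x' j\<bar> + \<bar>0 - 0\<bar> + \<bar>zero_vec d j - zero_vec d j\<bar>))"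
    by (rule order_trans[OF max.cobounded2 lipschitz]) (simp_all add: assms)
  also have "\<dots> = Dl * (\<Sum>j=1..d. L j * \<bar>x j - x' j\<bar>)"
    unfolding sum_distrib_left by (intro sum.cong refl) simp
  finally show ?thesis .
qed

lemma u_cont: "continuous_on ({0..T} \<times> Rd d) (\<lambda>(t, x). u t x)"
  and ut_cont: "continuous_on ({0..T} \<times> Rd d) (\<lambda>(t, x). time_deriv T u t x)"
  and du_cont: "i \<in> {1..d} \<Longrightarrow> continuous_on ({0..T} \<times> Rd d) (\<lambda>(t, x). space_deriv i (u t) x)"
  and ddu_cont: "i \<in> {1..d} \<Longrightarrow> continuous_on ({0..T} \<times> Rd d) (\<lambda>(t, x). space_deriv i (space_deriv i (u t)) x)"
  using u_C12 unfolding C12_def by blast+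

lemma u_time: assumes "t \<in> {0..T}" "x \<in> Rd d"
  shows "((\<lambda>s. u s x) has_real_derivative time_deriv T u t x) (at t within {0..T})"
proof -
  have "(\<lambda>s. u s x) differentiable (at t within {0..T})"
    using u_C12 assms unfolding C12_def by blast
  then show ?thesis
    by (simp add: time_deriv_def has_real_derivative_iff_has_vector_derivative vector_derivative_works[symmetric])
qed

lemma u_space: assumes "t \<in> {0..T}" "x \<in> Rd d" "i \<in> {1..d}"
  shows "((\<lambda>h. u t (x(i := h))) has_real_derivative space_deriv i (u t) x) (at (x i))"
proof -
  have "(\<lambda>h. u t (x(i := h))) field_differentiable (at (x i))"
    using u_C12 assms unfolding C12_def by blast
  then show ?thesis by (simp add: space_deriv_def DERIV_deriv_iff_field_differentiable)
qed

lemma u_space2: assumes "t \<in> {0..T}" "x \<in> Rd d" "i \<in> {1..d}"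
  shows "((\<lambda>h. space_deriv i (u t) (x(i := h))) has_real_derivative space_deriv i (space_deriv i (u t)) x) (at (x i))"
proof -
  have "(\<lambda>h. space_deriv i (u t) (x(i := h))) field_differentiable (at (x i))"
    using u_C12 assms unfolding C12_def by blast
  then show ?thesis unfolding space_deriv_def[of i "space_deriv i (u t)"] by (simp add: DERIV_deriv_iff_field_differentiable)
qed

lemma u_space_at: assumes "t \<in> {0..T}" "x \<in> Rd d" "i \<in> {1..d}"
  shows "((\<lambda>h. u t (x(i := h))) has_real_derivative space_deriv i (u t) (x(i := a))) (at a)"
    "((\<lambda>h. space_deriv i (u t) (x(i := h))) has_real_derivative space_deriv i (space_deriv i (u t)) (x(i := a))) (at a)"
  using u_space[of t "x(i := a)" i] u_space2[of t "x(i := a)" i] assms by simp_all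

end

text \<open>For \<open>j = i\<close> the shift translates the differentiation variable itself, for
  \<open>j \<noteq> i\<close> it only moves the base point; hence the case split.\<close>

lemma shifted_space_derivative:
  assumes F: "\<And>x j. x \<in> Rd d \<Longrightarrow> j \<in> {1..d} \<Longrightarrow> ((\<lambda>h. F (x(j := h))) has_real_derivative D j x) (at (x j))"
    and x: "x \<in> Rd d" and ij: "i \<in> {1..d}" "j \<in> {1..d}"
  shows "((\<lambda>h. F ((x(j := h))(i := (x(j := h)) i + a))) has_real_derivative D j (x(i := x i + a))) (at (x j))"
proof (cases "i = j")
  case True
  have "((\<lambda>h. F (x(j := h))) has_real_derivative D j (x(j := x j + a))) (at (x j + a))"
    using F[of "x(j := x j + a)" j] x ij by simp
  then have "((\<lambda>h. F (x(j := h + a))) has_real_derivative D j (x(j := x j + a))) (at (x j))"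
    using DERIV_shift[of "\<lambda>h. F (x(j := h))"] by simp
  with True show ?thesis by simp
next
  case False
  have "((\<lambda>h. F ((x(i := x i + a))(j := h))) has_real_derivative D j (x(i := x i + a))) (at ((x(i := x i + a)) j))"
    by (rule F) (use x ij in auto)
  moreover have "(x(i := x i + a))(j := h) = (x(j := h))(i := (x(j := h)) i + a)" for h
    using False by auto
  ultimately show ?thesis using False by simp
qed

context pde_solution
begin

lemma shift_cont:
  assumes F: "continuous_on ({0..T} \<times> Rd d) (\<lambda>(t, x). F t x)" and i: "i \<in> {1..d}"
  shows "continuous_on ({0..T} \<times> Rd d) (\<lambda>(t, x). F t (x(i := x i + a)))"
proof -
  have "continuous_on UNIV (\<lambda>p::real \<times> rvec. ((snd p)(i := snd p i + a)) j)" for j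
    by (cases "j = i") (simp_all add: continuous_on_snd_coord continuous_on_add)
  then have "continuous_on UNIV (\<lambda>p::real \<times> rvec. (snd p)(i := snd p i + a))"
    by (intro continuous_on_coordinatewise_then_product) auto
  then have 1: "continuous_on ({0..T} \<times> Rd d) (\<lambda>p. (fst p, (snd p)(i := snd p i + a)))"
    by (intro continuous_on_Pair continuous_on_fst continuous_on_id) (auto elim: continuous_on_subset)
  have "continuous_on ({0..T} \<times> Rd d) ((\<lambda>(t, x). F t x) \<circ> (\<lambda>p. (fst p, (snd p)(i := snd p i + a))))"
    by (rule continuous_on_compose[OF 1]) (rule continuous_on_subset[OF F], use i in auto)
  then show ?thesis by (simp add: comp_def case_prod_unfold)
qed

lemma cosh_sum_cont: "continuous_on S (\<lambda>p. cosh_sum d (snd p))" for S :: "(real \<times> rvec) set"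
  unfolding cosh_sum_def by (intro continuous_on_sum continuous_on_cosh continuous_on_snd_coord)

text \<open>
  At a positive maximum of the penalised difference the derivative conditions and the equation give
  \<open>lam + 2 \<le> lam + 1\<close>; the \<open>cosh\<close>-sum dominates the polynomial growth and controls its own derivatives.
\<close>

lemma shift_difference_le:
  assumes i: "i \<in> {1..d}" and t1: "t1 \<in> {0..<T}" and x1: "x1 \<in> Rd d" and eps: "\<epsilon> > 0"
  shows "exp (- lam * t1) * (u t1 (x1(i := x1 i + a)) - u t1 x1) \<le> Dl * L i * \<bar>a\<bar> + \<epsilon> * exp ((lam + 2) * t1) * cosh_sum d x1"
proof (rule ccontr)
  define S :: "rvec \<Rightarrow> nat \<Rightarrow> real" where "S = (\<lambda>x. x(i := x i + a))"
  have S: "S x \<in> Rd d" if "x \<in> Rd d" for x using i that by (auto simp: S_def)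
  define w where "w = (\<lambda>t x. u t (S x) - u t x)"
  define \<kappa> where "\<kappa> = Dl * L i * \<bar>a\<bar>"
  \<comment> \<open>The rate exceeds by one what the equation can return: \<open>1\<close> from the
    Laplacian of the \<open>cosh\<close>-sum and \<open>lam\<close> from the gradient slots of
    \<open>f\<close>. The dependence of \<open>f\<close> on the value of \<open>u\<close> is
    absorbed by the factor \<open>exp (- lam * t)\<close> in the next line.\<close>
  define K where "K = lam + 2"
  define \<Phi> where "\<Phi> = (\<lambda>t x. exp (- lam * t) * w t x - \<kappa> - \<epsilon> * exp (K * t) * cosh_sum d x)"
  assume "\<not> ?thesis"
  then have pos1: "\<Phi> t1 x1 > 0" by (simp add: \<Phi>_def w_def S_def \<kappa>_def K_def)
  have \<kappa>0: "\<kappa> \<ge> 0" using Dl L_nonneg[OF i] by (simp add: \<kappa>_def)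
  from u_growth obtain \<eta> where \<eta>: "\<eta> > 0" "\<And>t x. t \<in> {0..T} \<Longrightarrow> x \<in> Rd d \<Longrightarrow> \<bar>u t x\<bar> \<le> \<eta> * (1 + (\<Sum>i=1..d. \<bar>x i\<bar>)) powr \<eta>"
    unfolding at_most_poly_growing_def by auto
  have wg: "w t x \<le> 2 * \<eta> * (1 + \<bar>a\<bar> + (\<Sum>i=1..d. \<bar>x i\<bar>)) powr \<eta>" if "t \<in> {0..T}" "x \<in> Rd d" for t x
  proof -
    have "(\<Sum>k=1..d. \<bar>S x k\<bar>) \<le> (\<Sum>k=1..d. \<bar>x k\<bar> + (if k = i then \<bar>a\<bar> else 0))"
      by (intro sum_mono) (auto simp: S_def)
    also have "\<dots> = \<bar>a\<bar> + (\<Sum>k=1..d. \<bar>x k\<bar>)" using i by (simp add: sum.distrib)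
    finally have le: "(\<Sum>k=1..d. \<bar>S x k\<bar>) \<le> \<bar>a\<bar> + (\<Sum>k=1..d. \<bar>x k\<bar>)" .
    have nn: "0 \<le> (\<Sum>k=1..d. \<bar>S x k\<bar>)" "0 \<le> (\<Sum>k=1..d. \<bar>x k\<bar>)" by (simp_all add: sum_nonneg)
    have "\<eta> * (1 + (\<Sum>k=1..d. \<bar>S x k\<bar>)) powr \<eta> \<le> \<eta> * (1 + \<bar>a\<bar> + (\<Sum>i=1..d. \<bar>x i\<bar>)) powr \<eta>"
      by (intro mult_left_mono powr_mono2) (use \<eta>(1) nn le in linarith)+
    moreover have "\<eta> * (1 + (\<Sum>k=1..d. \<bar>x k\<bar>)) powr \<eta> \<le> \<eta> * (1 + \<bar>a\<bar> + (\<Sum>i=1..d. \<bar>x i\<bar>)) powr \<eta>"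
      by (intro mult_left_mono powr_mono2) (use \<eta>(1) nn le in linarith)+
    ultimately show ?thesis using \<eta>(2)[OF that] \<eta>(2)[OF that(1) S[OF that(2)]] unfolding w_def by linarith
  qed
  obtain R where R: "\<And>x j. j \<in> {1..d} \<Longrightarrow> \<bar>x j\<bar> \<ge> R \<Longrightarrow> 2 * \<eta> * (1 + \<bar>a\<bar> + (\<Sum>j=1..d. \<bar>x j\<bar>)) powr \<eta> \<le> \<epsilon> * cosh_sum d x"
  proof -
    have "0 < 1 + \<bar>a\<bar>" "0 < 2 * \<eta>" using \<eta>(1) by linarith+
    from cosh_sum_dominates_poly[OF d this \<eta>(1) eps] show ?thesis using that by blast
  qed
  have K0: "K > 0" using lam by (simp add: K_def)
  obtain t0 x0 where tx: "t0 \<in> {0..t1}" "x0 \<in> Rd d" and Pos: "\<Phi> t0 x0 > 0" and Max: "\<And>t x. t \<in> {0..t1} \<Longrightarrow> x \<in> Rd d \<Longrightarrow> \<Phi> t x \<le> \<Phi> t0 x0"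
  proof (rule attains_positive_max[of t1 d \<Phi> R t1 x1])
    have "continuous_on ({0..T} \<times> Rd d) (\<lambda>p. w (fst p) (snd p))"
      unfolding w_def S_def using shift_cont[OF u_cont i, of a] u_cont
      by (auto intro!: continuous_intros simp: case_prod_unfold)
    then have "continuous_on ({0..T} \<times> Rd d) (\<lambda>p. \<Phi> (fst p) (snd p))"
      unfolding \<Phi>_def by (intro continuous_intros cosh_sum_cont)
    then show "continuous_on ({0..t1} \<times> Rd d) (\<lambda>(t, x). \<Phi> t x)"
      unfolding case_prod_unfold by (rule continuous_on_subset) (use t1 in auto)
    fix t x j assume h: "t \<in> {0..t1}" "x \<in> Rd d" "j \<in> {1..d}" "R \<le> \<bar>x j\<bar>"
    have c0: "0 \<le> \<epsilon> * cosh_sum d x" using eps cosh_sum_pos[OF d, of x] by simp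
    have "w t x \<le> \<epsilon> * cosh_sum d x" using wg[of t x] R[of j x] h t1 by auto
    then have "exp (- lam * t) * w t x \<le> exp (- lam * t) * (\<epsilon> * cosh_sum d x)" by (intro mult_left_mono) auto
    also have "\<dots> \<le> exp (K * t) * (\<epsilon> * cosh_sum d x)"
      using c0 lam K0 h by (intro mult_right_mono) (auto intro: order_trans[of _ 0])
    finally show "\<Phi> t x \<le> 0" using \<kappa>0 by (simp add: \<Phi>_def mult_ac)
  qed (use pos1 t1 x1 in auto)
  have c0: "cosh_sum d x0 > 0" by (rule cosh_sum_pos[OF d])
  \<comment> \<open>At time \<open>0\<close> the Lipschitz bound for \<open>g\<close> gives
    \<open>w \<le> \<kappa>\<close>, and the penalty is strictly positive.\<close>
  have "t0 \<noteq> 0"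
  proof
    assume "t0 = 0"
    have "w 0 x0 \<le> Dl * (\<Sum>j=1..d. L j * \<bar>S x0 j - x0 j\<bar>)"
      using g_lip[of "S x0" x0] S tx by (simp add: w_def initial)
    also have "(\<Sum>j=1..d. L j * \<bar>S x0 j - x0 j\<bar>) = (\<Sum>j=1..d. if j = i then L i * \<bar>a\<bar> else 0)"
      by (intro sum.cong) (auto simp: S_def)
    also have "\<dots> = L i * \<bar>a\<bar>" using i by simp
    finally have "w 0 x0 \<le> \<kappa>" by (simp add: \<kappa>_def)
    moreover have "\<epsilon> * cosh_sum d x0 > 0" using c0 eps by simp
    ultimately show False using Pos \<open>t0 = 0\<close> by (simp add: \<Phi>_def)
  qed
  then have t0: "0 < t0" "t0 \<in> {0..T}" "t0 \<in> {0..<T}" "t0 \<le> t1" using tx t1 by auto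
  let ?e = "exp (- lam * t0)" and ?k = "\<epsilon> * exp (K * t0)"
  have k0: "?k > 0" using eps by simp
  define wt where "wt = time_deriv T u t0 (S x0) - time_deriv T u t0 x0"
  have "((\<lambda>t. \<Phi> t x0) has_real_derivative (?e * wt - lam * ?e * w t0 x0 - ?k * K * cosh_sum d x0)) (at t0 within {0..T})"
    unfolding \<Phi>_def w_def wt_def
    by (rule derivative_eq_intros u_time[OF t0(2) S[OF tx(2)]] u_time[OF t0(2) tx(2)] refl)+ (simp add: algebra_simps)
  from time_derivative_at_max[OF this, of t1] t0 t1 tx Max
  have time: "?e * wt - lam * ?e * w t0 x0 \<ge> ?k * K * cosh_sum d x0" by auto
  \<comment> \<open>Stationarity in direction \<open>j\<close> identifies the scaled gradient
    difference with \<open>?k * sinh (x0 j)\<close>, which the penalty dominates. The second-order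
    condition bounds the difference of the second derivatives by the second derivative of the
    penalty.\<close>
  have space: "\<bar>?e * (space_deriv j (u t0) (S x0) - space_deriv j (u t0) x0)\<bar> \<le> ?k * cosh_sum d x0 \<and>
     ?e * (space_deriv j (space_deriv j (u t0)) (S x0) - space_deriv j (space_deriv j (u t0)) x0) \<le> ?k * cosh (x0 j)"
    if j: "j \<in> {1..d}" for j
  proof -
    define \<phi>' where "\<phi>' = (\<lambda>h. ?e * (space_deriv j (u t0) (S (x0(j := h))) - space_deriv j (u t0) (x0(j := h))) - ?k * sinh h)"
    define D where "D = ?e * (space_deriv j (space_deriv j (u t0)) (S x0) - space_deriv j (space_deriv j (u t0)) x0) - ?k * cosh (x0 j)"
    have cs: "cosh_sum d (x0(j := h)) = cosh h + (\<Sum>k\<in>{1..d}-{j}. cosh (x0 k))" for h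
      unfolding cosh_sum_def using j by (subst sum.remove[of _ j]) (auto intro!: sum.cong)
    have d1: "((\<lambda>h. \<Phi> t0 (x0(j := h))) has_real_derivative \<phi>' h) (at h)" for h
    proof -
      have "((\<lambda>h. u t0 (S (x0(j := h)))) has_real_derivative space_deriv j (u t0) (S (x0(j := h)))) (at h)"
        using shifted_space_derivative[of d "u t0" "\<lambda>j. space_deriv j (u t0)" "x0(j := h)" i j a] u_space[OF t0(2)] tx i j
        by (simp add: S_def)
      note this [derivative_intros] and u_space_at(1)[OF t0(2) tx(2) j, derivative_intros]
      show ?thesis unfolding \<Phi>_def w_def cs \<phi>'_def
        by (rule derivative_eq_intros refl)+ (simp add: algebra_simps)
    qed
    have "((\<lambda>h. space_deriv j (u t0) (S (x0(j := h)))) has_real_derivative space_deriv j (space_deriv j (u t0)) (S x0)) (at (x0 j))"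
    proof -
      show ?thesis
      proof (cases "i = j")
        case True
        have "((\<lambda>h. space_deriv j (u t0) (x0(j := h))) has_real_derivative space_deriv j (space_deriv j (u t0)) (S x0)) (at (x0 j + a))"
          using u_space2[OF t0(2) S[OF tx(2)] j] by (simp add: S_def True)
        then show ?thesis using DERIV_shift[of "\<lambda>h. space_deriv j (u t0) (x0(j := h))"] by (simp add: S_def True)
      next
        case False
        then have "S (x0(j := h)) = (S x0)(j := h)" for h by (auto simp: S_def)
        moreover have "S x0 j = x0 j" using False by (simp add: S_def)
        ultimately show ?thesis using u_space2[OF t0(2) S[OF tx(2)] j] by simp
      qed
    qed
    note this [derivative_intros] and u_space2[OF t0(2) tx(2) j, derivative_intros]
    have d2: "(\<phi>' has_real_derivative D) (at (x0 j))"
      unfolding \<phi>'_def D_def by (rule derivative_eq_intros refl)+ (simp add: algebra_simps)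
    have mx: "\<Phi> t0 (x0(j := h)) \<le> \<Phi> t0 (x0(j := x0 j))" for h
      using Max[of t0 "x0(j := h)"] tx j by auto
    note 2 = second_derivative_at_max[of "\<lambda>h. \<Phi> t0 (x0(j := h))" \<phi>' D "x0 j", OF d1 d2 mx]
    have "\<bar>?e * (space_deriv j (u t0) (S x0) - space_deriv j (u t0) x0)\<bar> = ?k * \<bar>sinh (x0 j)\<bar>"
      using 2(1) eps by (simp add: \<phi>'_def abs_mult)
    also have "\<dots> \<le> ?k * cosh_sum d x0"
      using k0 abs_sinh_le_cosh[of "x0 j"] cosh_le_cosh_sum[OF j, of x0] by (intro mult_left_mono) auto
    finally show ?thesis using 2(2) by (simp add: D_def)
  qed
  have lap: "?e * (laplacian d (u t0) (S x0) - laplacian d (u t0) x0) \<le> ?k * cosh_sum d x0"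
    unfolding laplacian_def cosh_sum_def sum_subtractf[symmetric] sum_distrib_left
    by (intro sum_mono) (use space in blast)
  \<comment> \<open>Positivity gives \<open>\<bar>w\<bar> = w\<close>, so the Lipschitz term in the
    value of \<open>u\<close> is the same \<open>lam * ?e * w\<close> that the time derivative of
    the exponential factor produces, and the two cancel.\<close>
  have wpos: "w t0 x0 > 0"
  proof -
    have "0 < ?k * cosh_sum d x0" using k0 c0 by simp
    then have "?e * w t0 x0 > 0" using Pos \<kappa>0 by (simp add: \<Phi>_def)
    then show ?thesis by (simp add: zero_less_mult_iff)
  qed
  have "?e * (f (u t0 (S x0)) (space_grad d (u t0) (S x0)) - f (u t0 x0) (space_grad d (u t0) x0))
      \<le> ?e * (\<Sum>j=1..d. L j * (\<bar>w t0 x0\<bar> + \<bar>space_deriv j (u t0) (S x0) - space_deriv j (u t0) x0\<bar>))"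
  proof (rule mult_left_mono)
    have "\<bar>f (u t0 (S x0)) (space_grad d (u t0) (S x0)) - f (u t0 x0) (space_grad d (u t0) x0)\<bar>
      \<le> (\<Sum>j=1..d. L j * (\<bar>u t0 (S x0) - u t0 x0\<bar> + \<bar>space_grad d (u t0) (S x0) j - space_grad d (u t0) x0 j\<bar>))"
      by (rule f_lip) (simp_all add: space_grad_def)
    then show "f (u t0 (S x0)) (space_grad d (u t0) (S x0)) - f (u t0 x0) (space_grad d (u t0) x0)
      \<le> (\<Sum>j=1..d. L j * (\<bar>w t0 x0\<bar> + \<bar>space_deriv j (u t0) (S x0) - space_deriv j (u t0) x0\<bar>))"
      by (simp add: w_def space_grad_def)
  qed simp
  also have "\<dots> = (\<Sum>j=1..d. L j * (?e * w t0 x0 + \<bar>?e * (space_deriv j (u t0) (S x0) - space_deriv j (u t0) x0)\<bar>))"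
    unfolding sum_distrib_left using wpos by (intro sum.cong refl) (simp add: abs_mult distrib_left mult_ac)
  also have "\<dots> \<le> (\<Sum>j=1..d. L j * (?e * w t0 x0 + ?k * cosh_sum d x0))"
    by (intro sum_mono mult_left_mono add_left_mono L_nonneg) (use space in blast)+
  also have "\<dots> = (\<Sum>j=1..d. L j) * (?e * w t0 x0 + ?k * cosh_sum d x0)"
    by (simp add: sum_distrib_right)
  also have "\<dots> \<le> lam * (?e * w t0 x0 + ?k * cosh_sum d x0)"
    using wpos k0 c0 eps by (intro mult_right_mono L_sum add_nonneg_nonneg mult_nonneg_nonneg) auto
  finally have "?e * wt \<le> ?k * cosh_sum d x0 + lam * (?e * w t0 x0 + ?k * cosh_sum d x0)"
    using lap pde[OF t0(3) S[OF tx(2)]] pde[OF t0(3) tx(2)] by (simp add: wt_def algebra_simps)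
  with time have "?k * cosh_sum d x0 * K \<le> ?k * cosh_sum d x0 * (1 + lam)" by (simp add: algebra_simps)
  moreover have "?k * cosh_sum d x0 > 0" using k0 c0 by simp
  ultimately have "K \<le> 1 + lam" by (simp only: mult_le_cancel_left_pos)
  then show False by (simp add: K_def)
qed

text \<open>With \<open>\<epsilon> = e / C\<close> the penalty at the given point equals
  \<open>e\<close>, so it can be made to vanish. The equation holds only before \<open>T\<close>;
  the value at \<open>T\<close> is reached by continuity.\<close>

lemma shift_difference_le':
  assumes i: "i \<in> {1..d}" and t: "t \<in> {0..T}" and x: "x \<in> Rd d"
  shows "u t (x(i := x i + a)) - u t x \<le> exp (lam * t) * Dl * L i * \<bar>a\<bar>"
proof -
  define \<phi> where "\<phi> = (\<lambda>t. u t (x(i := x i + a)) - u t x - exp (lam * t) * Dl * L i * \<bar>a\<bar>)"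
  have sx: "x(i := x i + a) \<in> Rd d" using x i by simp
  have le: "\<phi> s \<le> 0" if s: "s \<in> {0..<T}" for s
  proof -
    define C where "C = exp ((lam + 2) * s) * cosh_sum d x"
    have C: "C > 0" using cosh_sum_pos[OF d] by (simp add: C_def)
    have "exp (- lam * s) * (u s (x(i := x i + a)) - u s x) \<le> Dl * L i * \<bar>a\<bar> + e" if e: "e > 0" for e
    proof -
      have "e / C * exp ((lam + 2) * s) * cosh_sum d x = e / C * C" by (simp add: C_def mult.assoc)
      then show ?thesis using shift_difference_le[OF i s x, of "e / C" a] C e by simp
    qed
    then have "exp (- lam * s) * (u s (x(i := x i + a)) - u s x) \<le> Dl * L i * \<bar>a\<bar>"
      by (rule field_le_epsilon)
    then have "exp (lam * s) * (exp (- lam * s) * (u s (x(i := x i + a)) - u s x)) \<le> exp (lam * s) * (Dl * L i * \<bar>a\<bar>)"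
      by (intro mult_left_mono) auto
    then have "(exp (lam * s) * exp (- lam * s)) * (u s (x(i := x i + a)) - u s x) \<le> exp (lam * s) * Dl * L i * \<bar>a\<bar>"
      by (simp only: mult.assoc)
    moreover have "exp (lam * s) * exp (- lam * s) = 1" by (simp flip: exp_add)
    ultimately have "1 * (u s (x(i := x i + a)) - u s x) \<le> exp (lam * s) * Dl * L i * \<bar>a\<bar>" by (simp only:)
    then show ?thesis by (simp add: \<phi>_def)
  qed
  have c: "continuous_on {0..T} (\<lambda>s. u s y)" if "y \<in> Rd d" for y
  proof -
    have "continuous_on {0..T} ((\<lambda>(t, x). u t x) \<circ> (\<lambda>s. (s, y)))"
      by (intro continuous_on_compose continuous_intros continuous_on_subset[OF u_cont]) (use that in auto)
    then show ?thesis by (simp add: comp_def)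
  qed
  have "continuous_on {0..T} \<phi>" unfolding \<phi>_def by (intro continuous_intros c x sx)
  moreover have "closure {0..<T} = {0..T}" using T by (rule closure_atLeastLessThan)
  ultimately have "\<phi> t \<le> 0"
    using t by (intro continuous_le_on_closure[OF _ _ le]) (simp_all only:)
  then show ?thesis by (simp add: \<phi>_def)
qed

definition Lip :: real where "Lip = exp (lam * T) * Dl"

lemma Lip_pos: "Lip > 0" using Dl by (simp add: Lip_def)

lemma shift_difference_bound:
  assumes i: "i \<in> {1..d}" and t: "t \<in> {0..T}" and x: "x \<in> Rd d"
  shows "\<bar>u t (x(i := b)) - u t x\<bar> \<le> Lip * L i * \<bar>b - x i\<bar>"
proof -
  have e: "exp (lam * t) * Dl * L i * \<bar>a\<bar> \<le> Lip * L i * \<bar>a\<bar>" for a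
    using t lam Dl L_nonneg[OF i] unfolding Lip_def by (intro mult_right_mono) auto
  have "u t (x(i := b)) - u t x \<le> Lip * L i * \<bar>b - x i\<bar>"
    using shift_difference_le'[OF i t x, of "b - x i"] e[of "b - x i"] by simp
  moreover have "u t x - u t (x(i := b)) \<le> Lip * L i * \<bar>x i - b\<bar>"
    using shift_difference_le'[OF i t Rd_fun_upd[OF x i], of b "x i - b"] e[of "x i - b"] by simp
  ultimately show ?thesis by (simp add: abs_le_iff abs_minus_commute)
qed

lemma u_lip:
  assumes t: "t \<in> {0..T}" and x: "x \<in> Rd d" and y: "y \<in> Rd d"
  shows "\<bar>u t x - u t y\<bar> \<le> Lip * (\<Sum>j=1..d. L j * \<bar>x j - y j\<bar>)"
proof -
  \<comment> \<open>Points between \<open>y\<close> and \<open>x\<close> that change one coordinate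
    at a time, so that the one-coordinate bounds add up.\<close>
  define m where "m = (\<lambda>k j. if j \<le> k then x j else y j :: real)"
  have m: "m k \<in> Rd d" for k using x y by (auto simp: m_def Rd_def PiE_def extensional_def)
  have "\<bar>u t (m k) - u t (m 0)\<bar> \<le> Lip * (\<Sum>j=1..k. L j * \<bar>x j - y j\<bar>)" if "k \<le> d" for k
    using that
  proof (induction k)
    case (Suc k)
    have "m (Suc k) = (m k)(Suc k := x (Suc k))" by (auto simp: m_def)
    then have "\<bar>u t (m (Suc k)) - u t (m k)\<bar> \<le> Lip * L (Suc k) * \<bar>x (Suc k) - y (Suc k)\<bar>"
      using shift_difference_bound[of "Suc k" t "m k" "x (Suc k)"] Suc.prems t m by (simp add: m_def)
    with Suc show ?case by (simp add: algebra_simps)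
  qed simp
  from this[of d] have "\<bar>u t (m d) - u t (m 0)\<bar> \<le> Lip * (\<Sum>j=1..d. L j * \<bar>x j - y j\<bar>)" by simp
  moreover have "m d = x" by (rule Rd_eqI[OF m x]) (simp add: m_def)
  moreover have "m 0 = y" by (rule Rd_eqI[OF m y]) (simp add: m_def)
  ultimately show ?thesis by simp
qed

end

lemma derivative_bounded_by_lipschitz:
  fixes \<phi> :: "real \<Rightarrow> real"
  assumes "(\<phi> has_real_derivative D) (at a)" and "\<And>h. \<bar>\<phi> h - \<phi> a\<bar> \<le> B * \<bar>h - a\<bar>"
  shows "\<bar>D\<bar> \<le> B"
proof -
  have "((\<lambda>y. \<bar>(\<phi> y - \<phi> a) / (y - a)\<bar>) \<longlongrightarrow> \<bar>D\<bar>) (at a)"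
    using assms(1) by (intro tendsto_rabs) (simp add: has_field_derivative_iff)
  moreover have "eventually (\<lambda>y. \<bar>(\<phi> y - \<phi> a) / (y - a)\<bar> \<le> B) (at a)"
    using assms(2) by (auto simp: eventually_at_filter abs_divide divide_le_eq)
  ultimately show ?thesis by (intro tendsto_upperbound) auto
qed

definition norm1 :: "nat \<Rightarrow> rvec \<Rightarrow> real" where
  "norm1 d x = (\<Sum>j=1..d. \<bar>x j\<bar>)"

lemma norm1_nonneg [simp]: "0 \<le> norm1 d x"
  by (simp add: norm1_def sum_nonneg)

context pde_solution
begin

lemma du_bound:
  assumes i: "i \<in> {1..d}" and t: "t \<in> {0..T}" and x: "x \<in> Rd d"
  shows "\<bar>space_deriv i (u t) x\<bar> \<le> Lip * L i"
  by (rule derivative_bounded_by_lipschitz[OF u_space[OF t x i]]) (use shift_difference_bound[OF i t x] in simp)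

definition h :: "real \<Rightarrow> rvec \<Rightarrow> real" where
  "h t x = f (u t x) (space_grad d (u t) x)"

lemma space_grad_in_Rd [simp]: "space_grad d v x \<in> Rd d"
  by (simp add: space_grad_def)

lemma h_cont: "continuous_on ({0..T} \<times> Rd d) (\<lambda>(t, x). h t x)"
proof -
  have "continuous_on ({0..T} \<times> Rd d) (\<lambda>p. space_grad d (u (fst p)) (snd p) j)" for j
    using du_cont[of j] by (cases "j \<in> {1..d}") (auto simp: space_grad_def case_prod_unfold)
  then have 1: "continuous_on ({0..T} \<times> Rd d) (\<lambda>p. space_grad d (u (fst p)) (snd p))"
    by (rule continuous_on_coordinatewise_then_product)
  have "continuous_on ({0..T} \<times> Rd d) ((\<lambda>(y, z). f y z) \<circ> (\<lambda>p. (u (fst p) (snd p), space_grad d (u (fst p)) (snd p))))"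
    using u_cont 1
    by (intro continuous_on_compose continuous_on_Pair continuous_on_subset[OF f_cont]) (auto simp: case_prod_unfold)
  then show ?thesis by (simp add: h_def comp_def case_prod_unfold)
qed

text \<open>The gradient bound turns the gradient slots of \<open>f\<close> into a constant, which
  leaves linear growth in the value of \<open>u\<close>.\<close>

lemma h_bound:
  assumes t: "t \<in> {0..T}" and x: "x \<in> Rd d"
  shows "\<bar>h t x\<bar> \<le> \<bar>f 0 (zero_vec d)\<bar> + lam * \<bar>u t x\<bar> + lam * (Lip * lam)"
proof -
  have L1: "L j \<le> lam" if "j \<in> {1..d}" for j
    using member_le_sum[of j "{1..d}" L] that L_nonneg L_sum by fastforce
  have "\<bar>h t x - f 0 (zero_vec d)\<bar> \<le> (\<Sum>j=1..d. L j * (\<bar>u t x - 0\<bar> + \<bar>space_grad d (u t) x j - zero_vec d j\<bar>))"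
    unfolding h_def by (rule f_lip) auto
  also have "\<dots> \<le> (\<Sum>j=1..d. L j * (\<bar>u t x\<bar> + Lip * lam))"
  proof (intro sum_mono mult_left_mono L_nonneg add_mono)
    fix j assume j: "j \<in> {1..d}"
    have "\<bar>space_deriv j (u t) x\<bar> \<le> Lip * L j" by (rule du_bound[OF j t x])
    also have "\<dots> \<le> Lip * lam" using L1[OF j] Lip_pos by simp
    finally show "\<bar>space_grad d (u t) x j - zero_vec d j\<bar> \<le> Lip * lam" using j by (simp add: space_grad_def)
  qed auto
  also have "\<dots> = (\<Sum>j=1..d. L j) * (\<bar>u t x\<bar> + Lip * lam)" by (simp add: sum_distrib_right)
  also have "\<dots> \<le> lam * (\<bar>u t x\<bar> + Lip * lam)" using Lip_pos lam L_sum by (intro mult_right_mono) auto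
  finally have "\<bar>h t x - f 0 (zero_vec d)\<bar> \<le> lam * (\<bar>u t x\<bar> + Lip * lam)" .
  then show ?thesis by (simp add: distrib_left)
qed

lemma L_sum_abs_le:
  "(\<Sum>j=1..d. L j * \<bar>x j\<bar>) \<le> lam * norm1 d x"
  unfolding sum_distrib_left norm1_def
proof (intro sum_mono mult_right_mono)
  fix j assume "j \<in> {1..d}"
  then show "L j \<le> lam" using member_le_sum[of j "{1..d}" L] L_nonneg L_sum by fastforce
qed simp

text \<open>This constant may depend on the dimension; it serves integrability and domination. The
  dimension-free estimate at the origin is \<open>u_zero_bound\<close>.\<close>

lemma growth_constant:
  "\<exists>C>0. (\<forall>x\<in>Rd d. \<bar>g x\<bar> \<le> C * (1 + norm1 d x)) \<and>
     (\<forall>t\<in>{0..T}. \<forall>x\<in>Rd d. \<bar>u t x\<bar> \<le> C * (1 + norm1 d x) \<and> \<bar>h t x\<bar> \<le> C * (1 + norm1 d x))"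
proof -
  have "continuous_on {0..T} ((\<lambda>(t, x). u t x) \<circ> (\<lambda>s. (s, zero_vec d)))"
    by (intro continuous_on_compose continuous_intros continuous_on_subset[OF u_cont]) auto
  then have "compact ((\<lambda>s. u s (zero_vec d)) ` {0..T})"
    by (intro compact_continuous_image) (auto simp: comp_def)
  then obtain C0 where C0: "C0 > 0" "\<And>t. t \<in> {0..T} \<Longrightarrow> \<bar>u t (zero_vec d)\<bar> \<le> C0"
    using compact_imp_bounded bounded_pos[of "(\<lambda>s. u s (zero_vec d)) ` {0..T}"] by auto
  define C1 where "C1 = C0 + Lip * lam"
  have C1: "C1 > 0" using C0 Lip_pos lam by (simp add: C1_def add_pos_pos)
  have u: "\<bar>u t x\<bar> \<le> C1 * (1 + norm1 d x)" if "t \<in> {0..T}" "x \<in> Rd d" for t x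
  proof -
    have "\<bar>u t x - u t (zero_vec d)\<bar> \<le> Lip * (\<Sum>j=1..d. L j * \<bar>x j - zero_vec d j\<bar>)"
      using that by (intro u_lip) auto
    also have "\<dots> \<le> Lip * (lam * norm1 d x)"
      using L_sum_abs_le[of x] Lip_pos by (intro mult_left_mono) auto
    finally have "\<bar>u t x\<bar> \<le> C0 * 1 + Lip * lam * norm1 d x" using C0(2)[OF that(1)] by simp
    also have "\<dots> \<le> C1 * 1 + C1 * norm1 d x"
      using C0 Lip_pos lam unfolding C1_def by (intro add_mono mult_right_mono) auto
    also have "\<dots> = C1 * (1 + norm1 d x)" by (simp add: distrib_left)
    finally show ?thesis .
  qed
  have g: "\<bar>g x\<bar> \<le> C1 * (1 + norm1 d x)" if "x \<in> Rd d" for x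
    using u[of 0 x] T initial[OF that] that by simp
  define C2 where "C2 = C1 + \<bar>f 0 (zero_vec d)\<bar> + lam * C1 + lam * (Lip * lam)"
  have C12: "C2 \<ge> C1" using C1 lam Lip_pos by (simp add: C2_def)
  have hb: "\<bar>h t x\<bar> \<le> C2 * (1 + norm1 d x)" if tx: "t \<in> {0..T}" "x \<in> Rd d" for t x
  proof -
    let ?e = "(1 + norm1 d x)"
    have e1: "?e \<ge> 1" by simp
    have "\<bar>h t x\<bar> \<le> \<bar>f 0 (zero_vec d)\<bar> * 1 + lam * (C1 * ?e) + lam * (Lip * lam) * 1"
      using h_bound[OF tx] u[OF tx] lam by (smt (verit) mult_left_mono mult.right_neutral)
    also have "\<dots> \<le> \<bar>f 0 (zero_vec d)\<bar> * ?e + lam * (C1 * ?e) + lam * (Lip * lam) * ?e"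
      using e1 lam Lip_pos C1 by (intro add_mono mult_left_mono) auto
    also have "\<dots> \<le> C2 * ?e" using C1 by (simp add: C2_def algebra_simps)
    finally show ?thesis .
  qed
  have mono: "C1 * (1 + norm1 d x) \<le> C2 * (1 + norm1 d x)" for x :: "nat \<Rightarrow> real"
    using C12 by (intro mult_right_mono add_nonneg_nonneg) simp_all
  show ?thesis
    using C1 C12 g u hb mono by (intro exI[of _ C2]) (meson less_le_trans order_trans)
qed

end

section \<open>Gaussian and heat averages\<close>

lemma LIMSEQ_funI:
  fixes X :: "nat \<Rightarrow> ('a \<Rightarrow> real)"
  assumes "\<And>j. (\<lambda>n. X n j) \<longlonglongrightarrow> x j"
  shows "X \<longlonglongrightarrow> x"
proof -
  have "limitin (product_topology (\<lambda>_. euclidean) UNIV) X x sequentially"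
    unfolding limitin_componentwise using assms by simp
  then show ?thesis by (simp add: euclidean_product_topology)
qed

lemma LIMSEQ_funD:
  fixes X :: "nat \<Rightarrow> ('a \<Rightarrow> real)"
  assumes "X \<longlonglongrightarrow> x"
  shows "(\<lambda>n. X n j) \<longlonglongrightarrow> x j"
proof -
  have "limitin (product_topology (\<lambda>_. euclidean) UNIV) X x sequentially"
    using assms by (simp add: euclidean_product_topology)
  then show ?thesis unfolding limitin_componentwise by simp
qed

lemma norm1_add_scaled_le: "norm1 d (add_scaled d x s z) \<le> norm1 d x + \<bar>s\<bar> * norm1 d z"
  unfolding norm1_def by (rule add_scaled_sum_abs_le)

lemma norm1_le_exp: "norm1 d z \<le> exp (norm1 d z)"
  using exp_ge_add_one_self[of "norm1 d z"] by linarith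

lemma measurable_norm1 [measurable (raw)]:
  "X \<in> N \<rightarrow>\<^sub>M borel_Rd d \<Longrightarrow> (\<lambda>\<omega>. norm1 d' (X \<omega>)) \<in> borel_measurable N"
  unfolding norm1_def by measurable

lemma integrable_std_normal_Rd':
  assumes "F \<in> borel_measurable (borel_Rd d)"
    and "\<And>z. z \<in> Rd d \<Longrightarrow> \<bar>F z\<bar> \<le> C * exp (c * norm1 d z)"
  shows "integrable (std_normal_Rd d) F"
  using assms integrable_std_normal_Rd unfolding norm1_def by blast

lemma integrable_norm1: "integrable (std_normal_Rd d) (norm1 d)"
  by (rule integrable_std_normal_Rd'[of _ _ 1 1]) (use norm1_le_exp in simp_all)

lemma expectation_norm1_le: "(\<integral>z. norm1 d z \<partial>std_normal_Rd d) \<le> d"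
proof -
  have "(\<integral>z. norm1 d z \<partial>std_normal_Rd d) \<le> (\<integral>z. (\<Sum>j=1..d. (1 + (z j)\<^sup>2) / 2) \<partial>std_normal_Rd d)"
  proof (intro integral_mono integrable_norm1)
    show "integrable (std_normal_Rd d) (\<lambda>z. \<Sum>j=1..d. (1 + (z j)\<^sup>2) / 2)"
      using integrable_std_normal_Rd_power[of _ d 2] by (intro Bochner_Integration.integrable_sum) auto
    fix z :: "nat \<Rightarrow> real"
    have "\<bar>z j\<bar> \<le> (1 + (z j)\<^sup>2) / 2" for j
      using zero_le_power2[of "\<bar>z j\<bar> - 1"] by (simp add: power2_diff)
    then show "norm1 d z \<le> (\<Sum>j=1..d. (1 + (z j)\<^sup>2) / 2)" unfolding norm1_def by (rule sum_mono)
  qed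
  also have "\<dots> = (\<Sum>j=1..d. (\<integral>z. (1 + (z j)\<^sup>2) / 2 \<partial>std_normal_Rd d))"
    using integrable_std_normal_Rd_power[of _ d 2] by (intro Bochner_Integration.integral_sum) auto
  also have "\<dots> = (\<Sum>j=1..d. 1)"
    using integrable_std_normal_Rd_power[of _ d 2] std_normal_Rd_moment2 gauss.prob_space by (intro sum.cong refl) (simp)
  finally show ?thesis by simp
qed

text \<open>Uniform in the first argument over the whole type, so that time arguments never have to
  be tracked; time-dependent functions are extended beyond \<open>[0, T]\<close> to fit.\<close>

definition lin_growth :: "nat \<Rightarrow> real \<Rightarrow> ('a \<Rightarrow> rvec \<Rightarrow> real) \<Rightarrow> bool" where
  "lin_growth d C F \<longleftrightarrow> (\<forall>t. \<forall>x\<in>Rd d. \<bar>F t x\<bar> \<le> C * (1 + norm1 d x))"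

lemma lin_growthD: "lin_growth d C F \<Longrightarrow> x \<in> Rd d \<Longrightarrow> \<bar>F t x\<bar> \<le> C * (1 + norm1 d x)"
  by (simp add: lin_growth_def)

lemma lin_growth_nonneg: assumes "lin_growth d C F" shows "C \<ge> 0"
proof -
  have "0 \<le> C * (1 + norm1 d (zero_vec d))"
    using lin_growthD[OF assms zero_vec_in_Rd, of undefined] by linarith
  moreover have "norm1 d (zero_vec d) = 0" by (simp add: norm1_def)
  ultimately show ?thesis by simp
qed

lemma lin_growth_add_scaled:
  assumes "lin_growth d C F"
  shows "\<bar>F t (add_scaled d x s z)\<bar> \<le> C * (1 + norm1 d x + \<bar>s\<bar> * norm1 d z)"
proof -
  have "\<bar>F t (add_scaled d x s z)\<bar> \<le> C * (1 + norm1 d (add_scaled d x s z))"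
    using assms by (rule lin_growthD) simp
  also have "\<dots> \<le> C * (1 + (norm1 d x + \<bar>s\<bar> * norm1 d z))"
    using norm1_add_scaled_le[of d x s z] lin_growth_nonneg[OF assms] by (intro mult_left_mono) auto
  finally show ?thesis by (simp add: add.assoc)
qed

text \<open>For \<open>s = sqrt (2 * a)\<close> this is the heat semigroup at time \<open>a\<close>;
  the generator is the full Laplacian, without the factor one half.\<close>

definition gauss_mean :: "nat \<Rightarrow> ('a \<Rightarrow> rvec \<Rightarrow> real) \<Rightarrow> 'a \<Rightarrow> real \<Rightarrow> rvec \<Rightarrow> real" where
  "gauss_mean d F t s x = (\<integral>z. F t (add_scaled d x s z) \<partial>std_normal_Rd d)"

lemma continuous_Rd_measurable:
  fixes F :: "'a::{second_countable_topology, t2_space} \<Rightarrow> rvec \<Rightarrow> real"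
  assumes "continuous_on (UNIV \<times> Rd d) (\<lambda>(t, x). F t x)" "a \<in> borel_measurable N" "X \<in> N \<rightarrow>\<^sub>M borel_Rd d"
  shows "(\<lambda>\<omega>. F (a \<omega>) (X \<omega>)) \<in> borel_measurable N"
  by (rule borel_measurable_continuous_Rd[OF assms(1)]) (use assms in auto)

lemma integrable_gauss_mean:
  fixes F :: "real \<Rightarrow> rvec \<Rightarrow> real"
  assumes F: "continuous_on (UNIV \<times> Rd d) (\<lambda>(t, x). F t x)" and gr: "lin_growth d C F" and x: "x \<in> Rd d"
  shows "integrable (std_normal_Rd d) (\<lambda>z. F t (add_scaled d x s z))"
proof (rule Bochner_Integration.integrable_bound)
  show "integrable (std_normal_Rd d) (\<lambda>z. C * (1 + norm1 d x + \<bar>s\<bar> * norm1 d z))"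
    using integrable_norm1 by simp
  have [measurable]: "x \<in> space (borel_Rd d)" using x by simp
  show "(\<lambda>z. F t (add_scaled d x s z)) \<in> borel_measurable (std_normal_Rd d)"
    by (rule continuous_Rd_measurable[OF F]) measurable
  show "AE z in std_normal_Rd d. norm (F t (add_scaled d x s z)) \<le> norm (C * (1 + norm1 d x + \<bar>s\<bar> * norm1 d z))"
    using lin_growth_add_scaled[OF gr, of t x s] by (intro AE_I2) (auto intro: order_trans[OF _ abs_ge_self])
qed

lemma gauss_mean_bound:
  fixes F :: "real \<Rightarrow> rvec \<Rightarrow> real"
  assumes F: "continuous_on (UNIV \<times> Rd d) (\<lambda>(t, x). F t x)" and gr: "lin_growth d C F" and x: "x \<in> Rd d"
  shows "\<bar>gauss_mean d F t s x\<bar> \<le> C * (1 + norm1 d x + \<bar>s\<bar> * d)"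
proof -
  have "\<bar>gauss_mean d F t s x\<bar> \<le> (\<integral>z. \<bar>F t (add_scaled d x s z)\<bar> \<partial>std_normal_Rd d)"
    unfolding gauss_mean_def by (rule integral_abs_bound)
  also have "\<dots> \<le> (\<integral>z. C * (1 + norm1 d x + \<bar>s\<bar> * norm1 d z) \<partial>std_normal_Rd d)"
    using lin_growth_add_scaled[OF gr] integrable_norm1
    by (intro integral_mono integrable_abs integrable_gauss_mean[OF F gr x]) auto
  also have "\<dots> = C * (1 + norm1 d x + \<bar>s\<bar> * (\<integral>z. norm1 d z \<partial>std_normal_Rd d))"
    using integrable_norm1 gauss.prob_space by simp
  also have "\<dots> \<le> C * (1 + norm1 d x + \<bar>s\<bar> * d)"
    using lin_growth_nonneg[OF gr] expectation_norm1_le by (intro mult_left_mono add_left_mono) auto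
  finally show ?thesis .
qed

lemma add_scaled_tendsto:
  assumes "a \<longlonglongrightarrow> s" "X \<longlonglongrightarrow> x"
  shows "(\<lambda>n. add_scaled d (X n) (a n) z) \<longlonglongrightarrow> add_scaled d x s z"
proof (rule LIMSEQ_funI)
  fix j
  show "(\<lambda>n. add_scaled d (X n) (a n) z j) \<longlonglongrightarrow> add_scaled d x s z j"
    by (cases "j \<in> {1..d}") (auto simp: add_scaled_def intro!: tendsto_intros assms(1) LIMSEQ_funD[OF assms(2)])
qed

lemma norm1_tendsto:
  assumes "X \<longlonglongrightarrow> x" shows "(\<lambda>n. norm1 d (X n)) \<longlonglongrightarrow> norm1 d x"
  unfolding norm1_def by (intro tendsto_sum tendsto_rabs LIMSEQ_funD assms)

lemma continuous_Rd_tendsto: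
  fixes F :: "real \<Rightarrow> rvec \<Rightarrow> real"
  assumes F: "continuous_on (S \<times> Rd d) (\<lambda>(t, x). F t x)"
    and "b \<longlonglongrightarrow> t" "X \<longlonglongrightarrow> x" "\<And>n. b n \<in> S" "\<And>n. X n \<in> Rd d" "t \<in> S" "x \<in> Rd d"
  shows "(\<lambda>n. F (b n) (X n)) \<longlonglongrightarrow> F t x"
proof -
  have "((\<lambda>(t, x). F t x) \<circ> (\<lambda>n. (b n, X n))) \<longlonglongrightarrow> (\<lambda>(t, x). F t x) (t, x)"
    using F[unfolded continuous_on_sequentially, rule_format, of "(t, x)" "\<lambda>n. (b n, X n)"] assms
    by (auto intro: tendsto_Pair)
  then show ?thesis by (simp add: comp_def)
qed

text \<open>Convergent widths and base points are bounded, so a single linear function of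
  \<open>norm1\<close> dominates the whole sequence. Width zero is allowed in the limit, which gives
  continuity up to the initial time.\<close>

lemma gauss_mean_tendsto:
  fixes F :: "real \<Rightarrow> rvec \<Rightarrow> real"
  assumes F: "continuous_on (UNIV \<times> Rd d) (\<lambda>(t, x). F t x)" and gr: "lin_growth d C F"
    and b: "b \<longlonglongrightarrow> t" and a: "a \<longlonglongrightarrow> s" and X: "X \<longlonglongrightarrow> x" "\<And>n. X n \<in> Rd d" "x \<in> Rd d"
  shows "(\<lambda>n. gauss_mean d F (b n) (a n) (X n)) \<longlonglongrightarrow> gauss_mean d F t s x"
proof -
  obtain B1 where B1: "\<And>n. norm1 d (X n) \<le> B1"
    using convergent_imp_Bseq[OF convergentI[OF norm1_tendsto[OF X(1), of d]]] unfolding Bseq_def by auto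
  obtain B2 where B2: "\<And>n. \<bar>a n\<bar> \<le> B2"
    using convergent_imp_Bseq[OF convergentI[OF a]] unfolding Bseq_def by auto
  show ?thesis unfolding gauss_mean_def
  proof (rule integral_dominated_convergence[where w="\<lambda>z. C * (1 + B1 + B2 * norm1 d z)"])
    show "integrable (std_normal_Rd d) (\<lambda>z. C * (1 + B1 + B2 * norm1 d z))"
      using integrable_norm1 by simp
    show "AE z in std_normal_Rd d. (\<lambda>n. F (b n) (add_scaled d (X n) (a n) z)) \<longlonglongrightarrow> F t (add_scaled d x s z)"
      by (intro AE_I2 continuous_Rd_tendsto[OF F] b add_scaled_tendsto a X) auto
    fix n
    have "C * (1 + norm1 d (X n) + \<bar>a n\<bar> * norm1 d z) \<le> C * (1 + B1 + B2 * norm1 d z)" for z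
      using B1[of n] B2[of n] lin_growth_nonneg[OF gr] by (intro mult_left_mono add_mono mult_right_mono) auto
    then show "AE z in std_normal_Rd d. norm (F (b n) (add_scaled d (X n) (a n) z)) \<le> C * (1 + B1 + B2 * norm1 d z)"
      using lin_growth_add_scaled[OF gr, of "b n" "X n" "a n"] by (intro AE_I2) (auto intro: order_trans)
  qed (use integrable_gauss_mean[OF F gr] X in auto)
qed

text \<open>For \<open>s > 0\<close>, \<open>s * heat_mean d F t s x\<close> is the Duhamel integral
  of \<open>F\<close> over the last \<open>s\<close> units of time before \<open>t\<close>.
  Rescaling to the unit interval fixes the domain of integration, so that limits in
  \<open>s\<close>, including \<open>s = 0\<close>, are plain dominated convergence, and it produces
  the form in which the scheme samples time.\<close>

definition heat_mean :: "nat \<Rightarrow> (real \<Rightarrow> rvec \<Rightarrow> real) \<Rightarrow> real \<Rightarrow> real \<Rightarrow> rvec \<Rightarrow> real" where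
  "heat_mean d F t s x = (\<integral>q. indicator {0..1} q * gauss_mean d F (t - s * q) (sqrt (2 * s * q)) x \<partial>lborel)"

lemma gauss_mean_measurable:
  fixes F :: "real \<Rightarrow> rvec \<Rightarrow> real"
  assumes F: "continuous_on (UNIV \<times> Rd d) (\<lambda>(t, x). F t x)"
    and [measurable]: "b \<in> borel_measurable N" "a \<in> borel_measurable N" "X \<in> N \<rightarrow>\<^sub>M borel_Rd d"
  shows "(\<lambda>\<omega>. gauss_mean d F (b \<omega>) (a \<omega>) (X \<omega>)) \<in> borel_measurable N"
proof -
  have "(\<lambda>(\<omega>, z). F (b \<omega>) (add_scaled d (X \<omega>) (a \<omega>) z)) \<in> borel_measurable (N \<Otimes>\<^sub>M std_normal_Rd d)"
    unfolding case_prod_unfold by (rule continuous_Rd_measurable[OF F]) measurable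
  then show ?thesis unfolding gauss_mean_def by (rule gauss.borel_measurable_lebesgue_integral)
qed

lemma integrable_indicator_bound:
  fixes \<phi> :: "real \<Rightarrow> real"
  assumes [measurable]: "\<phi> \<in> borel_measurable borel" and "\<And>q. q \<in> {a..b} \<Longrightarrow> \<bar>\<phi> q\<bar> \<le> B"
  shows "integrable lborel (\<lambda>q. indicator {a..b} q * \<phi> q)"
proof (rule Bochner_Integration.integrable_bound)
  show "integrable lborel (\<lambda>q. indicator {a..b} q * B)"
    by (intro integrable_mult_left integrable_real_indicator) (auto simp: emeasure_lborel_Icc_eq)
  show "AE q in lborel. norm (indicator {a..b} q * \<phi> q) \<le> norm (indicator {a..b} q * B)"
    using assms(2) by (intro AE_I2) (auto simp: indicator_def intro: order_trans[OF _ abs_ge_self])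
qed simp

context
  fixes d :: nat and F :: "real \<Rightarrow> rvec \<Rightarrow> real" and C :: real
  assumes F: "continuous_on (UNIV \<times> Rd d) (\<lambda>(t, x). F t x)" and gr: "lin_growth d C F"
begin

lemma gauss_mean_bound_time:
  assumes x: "x \<in> Rd d" and s: "s \<in> {0..S}"
  shows "\<bar>gauss_mean d F t (sqrt (2 * s)) x\<bar> \<le> C * (1 + norm1 d x + sqrt (2 * S) * d)"
proof -
  have "\<bar>gauss_mean d F t (sqrt (2 * s)) x\<bar> \<le> C * (1 + norm1 d x + \<bar>sqrt (2 * s)\<bar> * d)"
    by (rule gauss_mean_bound[OF F gr x])
  also have "\<dots> \<le> C * (1 + norm1 d x + sqrt (2 * S) * d)"
    using s lin_growth_nonneg[OF gr] by (intro mult_left_mono add_left_mono mult_right_mono) auto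
  finally show ?thesis .
qed

lemma heat_mean_tendsto:
  assumes b: "b \<longlonglongrightarrow> t" and s: "s \<longlonglongrightarrow> s'" "\<And>n. s n \<ge> 0" and X: "X \<longlonglongrightarrow> x" "\<And>n. X n \<in> Rd d" "x \<in> Rd d"
  shows "(\<lambda>n. heat_mean d F (b n) (s n) (X n)) \<longlonglongrightarrow> heat_mean d F t s' x"
proof -
  obtain B1 where B1: "\<And>n. norm1 d (X n) \<le> B1"
    using convergent_imp_Bseq[OF convergentI[OF norm1_tendsto[OF X(1), of d]]] unfolding Bseq_def by auto
  obtain B2 where B2: "B2 > 0" "\<And>n. \<bar>s n\<bar> \<le> B2"
    using convergent_imp_Bseq[OF convergentI[OF s(1)]] unfolding Bseq_def by auto
  define B where "B = C * (1 + B1 + sqrt (2 * B2) * d)"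
  show ?thesis unfolding heat_mean_def
  proof (rule integral_dominated_convergence[where w="\<lambda>q. indicator {0..1} q * B"])
    show "(\<lambda>q. indicator {0..1} q * gauss_mean d F (t - s' * q) (sqrt (2 * s' * q)) x) \<in> borel_measurable lborel"
      using X(3) by (intro borel_measurable_times gauss_mean_measurable[OF F]) auto
    show "(\<lambda>q. indicator {0..1} q * gauss_mean d F (b n - s n * q) (sqrt (2 * s n * q)) (X n)) \<in> borel_measurable lborel" for n
      using X(2) by (intro borel_measurable_times gauss_mean_measurable[OF F]) auto
    show "AE q in lborel. (\<lambda>n. indicator {0..1} q * gauss_mean d F (b n - s n * q) (sqrt (2 * s n * q)) (X n))
       \<longlonglongrightarrow> indicator {0..1} q * gauss_mean d F (t - s' * q) (sqrt (2 * s' * q)) x"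
      by (intro AE_I2 tendsto_intros gauss_mean_tendsto[OF F gr] b s X)
    fix n
    show "AE q in lborel. norm (indicator {0..1} q * gauss_mean d F (b n - s n * q) (sqrt (2 * s n * q)) (X n)) \<le> indicator {0..1} q * B"
    proof (rule AE_I2)
      fix q :: real
      show "norm (indicator {0..1} q * gauss_mean d F (b n - s n * q) (sqrt (2 * s n * q)) (X n)) \<le> indicator {0..1} q * B"
      proof (cases "q \<in> {0..1}")
        case True
        have "s n * q \<le> B2 * 1" using True s(2)[of n] B2(2)[of n] by (intro mult_mono) auto
        then have "\<bar>gauss_mean d F (b n - s n * q) (sqrt (2 * (s n * q))) (X n)\<bar> \<le> C * (1 + norm1 d (X n) + sqrt (2 * B2) * d)"
          using True s(2)[of n] by (intro gauss_mean_bound_time X(2)) simp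
        also have "\<dots> \<le> B" unfolding B_def using B1[of n] lin_growth_nonneg[OF gr] by (intro mult_left_mono) auto
        finally show ?thesis using True by (simp add: mult.assoc)
      qed simp
    qed
  qed simp
qed

lemma heat_mean_eq_integral:
  assumes s: "s > 0"
  shows "s * heat_mean d F t s x = (\<integral>r. indicator {0..s} r * gauss_mean d F (t - r) (sqrt (2 * r)) x \<partial>lborel)"
proof -
  have "(\<integral>r. indicator {0..s} r * gauss_mean d F (t - r) (sqrt (2 * r)) x \<partial>lborel)
     = \<bar>s\<bar> * (\<integral>q. indicator {0..s} (0 + s * q) * gauss_mean d F (t - (0 + s * q)) (sqrt (2 * (0 + s * q))) x \<partial>lborel)"
    using lborel_integral_real_affine[of s "\<lambda>r. indicator {0..s} r * gauss_mean d F (t - r) (sqrt (2 * r)) x" 0] s by simp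
  also have "(\<lambda>q. indicator {0..s} (0 + s * q) * gauss_mean d F (t - (0 + s * q)) (sqrt (2 * (0 + s * q))) x)
     = (\<lambda>q. indicator {0..1} q * gauss_mean d F (t - s * q) (sqrt (2 * s * q)) x)"
    using s by (auto simp: indicator_def zero_le_mult_iff mult.assoc)
  finally show ?thesis using s by (simp add: heat_mean_def)
qed

lemma heat_mean_bound:
  assumes x: "x \<in> Rd d" and s: "s \<in> {0..S}"
  shows "\<bar>heat_mean d F t s x\<bar> \<le> C * (1 + norm1 d x + sqrt (2 * S) * d)" (is "_ \<le> ?B")
proof -
  have *: "\<bar>gauss_mean d F (t - s * q) (sqrt (2 * s * q)) x\<bar> \<le> ?B" if "q \<in> {0..1}" for q
  proof -
    have "s * q \<le> S * 1" using that s by (intro mult_mono) auto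
    then show ?thesis using gauss_mean_bound_time[OF x, of "s * q" S "t - s * q"] that s by (simp add: mult.assoc)
  qed
  have "\<bar>heat_mean d F t s x\<bar> \<le> (\<integral>q. \<bar>indicator {0..1} q * gauss_mean d F (t - s * q) (sqrt (2 * s * q)) x\<bar> \<partial>lborel)"
    unfolding heat_mean_def by (rule integral_abs_bound)
  also have "\<dots> \<le> (\<integral>q. indicator {0..1} q * ?B \<partial>(lborel :: real measure))"
  proof (rule Bochner_Integration.integral_mono, rule integrable_abs)
    show "integrable lborel (\<lambda>q::real. indicator {0..1} q * ?B)" using integrable_indicator_bound[of "\<lambda>_. ?B" 0 1 "\<bar>?B\<bar>"] by simp
    have "(\<lambda>q. gauss_mean d F (t - s * q) (sqrt (2 * s * q)) x) \<in> borel_measurable borel"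
      using x by (intro gauss_mean_measurable[OF F]) auto
    then show "integrable lborel (\<lambda>q. indicator {0..1} q * gauss_mean d F (t - s * q) (sqrt (2 * s * q)) x)"
      by (rule integrable_indicator_bound[of _ 0 1 ?B]) (rule *)
    show "\<bar>indicator {0..1} q * gauss_mean d F (t - s * q) (sqrt (2 * s * q)) x\<bar> \<le> indicator {0..1} q * ?B" for q
      using *[of q] by (auto simp: indicator_def)
  qed
  finally show ?thesis by simp
qed

lemma gauss_mean_semigroup:
  assumes x: "x \<in> Rd d" and a: "a > 0" "b > 0"
  shows "(\<integral>z. gauss_mean d F t (sqrt (2 * b)) (add_scaled d x (sqrt (2 * a)) z) \<partial>std_normal_Rd d) = gauss_mean d F t (sqrt (2 * (a + b))) x"
  unfolding gauss_mean_def
proof (rule integral_std_normal_Rd_convolution[where c=1 and C=C])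
  show "F t \<in> borel_measurable (borel_Rd d)" by (rule continuous_Rd_measurable[OF F]) auto
  show "\<bar>F t z\<bar> \<le> C * exp (1 * (\<Sum>j=1..d. \<bar>z j\<bar>))" if "z \<in> Rd d" for z
  proof -
    have "\<bar>F t z\<bar> \<le> C * (1 + norm1 d z)" by (rule lin_growthD[OF gr that])
    also have "\<dots> \<le> C * exp (norm1 d z)" using lin_growth_nonneg[OF gr] by (intro mult_left_mono) auto
    finally show ?thesis by (simp add: norm1_def)
  qed
qed (use a x in auto)

text \<open>The Duhamel integral is split at age \<open>a\<close>. The older part is the Duhamel
  integral up to time \<open>t - a\<close>, carried on by a heat step of length \<open>a\<close>;
  Fubini and the semigroup law identify the two.\<close>

lemma heat_mean_semigroup:
  assumes x: "x \<in> Rd d" and a: "0 < a" "a < t"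
  shows "t * heat_mean d F t t x = a * heat_mean d F t a x
     + (\<integral>z. (t - a) * heat_mean d F (t - a) (t - a) (add_scaled d x (sqrt (2 * a)) z) \<partial>std_normal_Rd d)"
proof -
  interpret GL: pair_sigma_finite "std_normal_Rd d" lborel ..
  let ?g = "\<lambda>r. gauss_mean d F (t - r) (sqrt (2 * r)) x"
  have [measurable]: "x \<in> space (borel_Rd d)" using x by simp
  let ?k = "\<lambda>(z, r). indicator {0..t - a} r * gauss_mean d F (t - a - r) (sqrt (2 * r)) (add_scaled d x (sqrt (2 * a)) z)"
  let ?B = "\<lambda>(z, r). indicator {0..t - a} r * (C * (1 + norm1 d x + sqrt (2 * a) * norm1 d z + sqrt (2 * (t - a)) * d))"
  have k: "integrable (std_normal_Rd d \<Otimes>\<^sub>M lborel) ?k"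
  proof (rule Bochner_Integration.integrable_bound)
    define bb where "bb = (\<lambda>z. C * (1 + norm1 d x + sqrt (2 * a) * norm1 d z + sqrt (2 * (t - a)) * d))"
    have B: "?B = (\<lambda>(z, r). indicator {0..t - a} r * bb z)" by (simp add: bb_def)
    show "integrable (std_normal_Rd d \<Otimes>\<^sub>M lborel) ?B"
    proof (rule GL.Fubini_integrable)
      show "?B \<in> borel_measurable (std_normal_Rd d \<Otimes>\<^sub>M lborel)" by measurable
      have "bb z \<ge> 0" for z unfolding bb_def using lin_growth_nonneg[OF gr] a by (intro mult_nonneg_nonneg add_nonneg_nonneg) simp_all
      then have "norm (?B (z, r)) = indicator {0..t - a} r * bb z" for z r
        unfolding B by (simp add: abs_mult)
      then have "(\<integral>r. norm (?B (z, r)) \<partial>lborel) = (t - a) * bb z" for z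
        using a by simp
      then show "integrable (std_normal_Rd d) (\<lambda>z. \<integral>r. norm (?B (z, r)) \<partial>lborel)"
        using integrable_norm1 by (simp add: bb_def)
      show "AE z in std_normal_Rd d. integrable lborel (\<lambda>r. ?B (z, r))"
        unfolding B using integrable_indicator_bound[of "\<lambda>_. bb z" 0 "t - a" "\<bar>bb z\<bar>" for z] by simp
    qed
    show "?k \<in> borel_measurable (std_normal_Rd d \<Otimes>\<^sub>M lborel)"
      unfolding case_prod_unfold by (intro borel_measurable_times gauss_mean_measurable[OF F]) measurable
    show "AE p in std_normal_Rd d \<Otimes>\<^sub>M lborel. norm (?k p) \<le> norm (?B p)"
    proof (rule AE_I2)
      fix p :: "rvec \<times> real"
      obtain z r where p: "p = (z, r)" by (cases p)
      show "norm (?k p) \<le> norm (?B p)"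
      proof (cases "r \<in> {0..t - a}")
        case True
        let ?y = "add_scaled d x (sqrt (2 * a)) z"
        have "\<bar>gauss_mean d F (t - a - r) (sqrt (2 * r)) ?y\<bar> \<le> C * (1 + norm1 d ?y + sqrt (2 * (t - a)) * d)"
          by (rule gauss_mean_bound_time[OF _ True]) simp
        also have "\<dots> \<le> C * (1 + norm1 d x + sqrt (2 * a) * norm1 d z + sqrt (2 * (t - a)) * d)"
          using norm1_add_scaled_le[of d x "sqrt (2 * a)" z] lin_growth_nonneg[OF gr] a by (intro mult_left_mono) auto
        finally show ?thesis using True by (simp add: p)
      qed (simp add: p)
    qed
  qed
  have "(\<integral>z. (t - a) * heat_mean d F (t - a) (t - a) (add_scaled d x (sqrt (2 * a)) z) \<partial>std_normal_Rd d)
     = (\<integral>z. (\<integral>r. ?k (z, r) \<partial>lborel) \<partial>std_normal_Rd d)"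
    using a heat_mean_eq_integral[of "t - a" "t - a"] by simp
  also have "\<dots> = (\<integral>r. (\<integral>z. ?k (z, r) \<partial>std_normal_Rd d) \<partial>lborel)"
    using GL.Fubini_integral[OF k] by simp
  also have "\<dots> = (\<integral>r. indicator {0..t - a} r * gauss_mean d F (t - a - r) (sqrt (2 * (a + r))) x \<partial>lborel)"
  proof (rule integral_cong_AE)
    show "(\<lambda>r. \<integral>z. ?k (z, r) \<partial>std_normal_Rd d) \<in> borel_measurable lborel"
      unfolding case_prod_unfold fst_conv snd_conv
      by (intro gauss.borel_measurable_lebesgue_integral, unfold case_prod_unfold, intro borel_measurable_times gauss_mean_measurable[OF F]) measurable
    show "(\<lambda>r. indicator {0..t - a} r * gauss_mean d F (t - a - r) (sqrt (2 * (a + r))) x) \<in> borel_measurable lborel"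
      using x by (intro borel_measurable_times gauss_mean_measurable[OF F]) auto
    \<comment> \<open>The semigroup law is available for positive widths, so the single point
      \<open>r = 0\<close> is discarded as a null set.\<close>
    show "AE r in lborel. (\<integral>z. ?k (z, r) \<partial>std_normal_Rd d) = indicator {0..t - a} r * gauss_mean d F (t - a - r) (sqrt (2 * (a + r))) x"
      using AE_lborel_singleton[of 0]
    proof eventually_elim
      case (elim r)
      show ?case
      proof (cases "r \<in> {0..t - a}")
        case True
        then have "r > 0" using elim by auto
        then show ?thesis using gauss_mean_semigroup[OF x a(1), of r "t - a - r"] True by simp
      qed simp
    qed
  qed
  also have "\<dots> = (\<integral>r. indicator {a..t} r * ?g r \<partial>lborel)"
  proof -
    have "(\<integral>r. indicator {a..t} r * ?g r \<partial>lborel) = \<bar>1\<bar> * (\<integral>r. indicator {a..t} (a + 1 * r) * ?g (a + 1 * r) \<partial>lborel)"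
      using lborel_integral_real_affine[of 1 "\<lambda>r. indicator {a..t} r * ?g r" a] by simp
    also have "(\<lambda>r. indicator {a..t} (a + 1 * r) * ?g (a + 1 * r)) = (\<lambda>r. indicator {0..t - a} r * gauss_mean d F (t - a - r) (sqrt (2 * (a + r))) x)"
      by (auto simp: indicator_def algebra_simps fun_eq_iff)
    finally show ?thesis by simp
  qed
  finally have 1: "(\<integral>z. (t - a) * heat_mean d F (t - a) (t - a) (add_scaled d x (sqrt (2 * a)) z) \<partial>std_normal_Rd d) = (\<integral>r. indicator {a..t} r * ?g r \<partial>lborel)" .
  have gm: "?g \<in> borel_measurable borel" using x by (intro gauss_mean_measurable[OF F]) auto
  have int: "integrable lborel (\<lambda>r. indicator {b..c} r * ?g r)" if "0 \<le> b" for b c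
    using that by (intro integrable_indicator_bound[OF gm, of b c "C * (1 + norm1 d x + sqrt (2 * c) * d)"] gauss_mean_bound_time[OF x]) auto
  have "t * heat_mean d F t t x = (\<integral>r. indicator {0..t} r * ?g r \<partial>lborel)"
    using a heat_mean_eq_integral[of t t x] by simp
  also have "\<dots> = (\<integral>r. indicator {0..a} r * ?g r + indicator {a..t} r * ?g r \<partial>lborel)"
  proof (rule integral_cong_AE)
    show "AE r in lborel. indicator {0..t} r * ?g r = indicator {0..a} r * ?g r + indicator {a..t} r * ?g r"
      using AE_lborel_singleton[of a] by eventually_elim (use a in \<open>auto simp: indicator_def\<close>)
  qed (use gm in auto)
  also have "\<dots> = (\<integral>r. indicator {0..a} r * ?g r \<partial>lborel) + (\<integral>r. indicator {a..t} r * ?g r \<partial>lborel)"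
    using int a by (intro Bochner_Integration.integral_add) auto
  also have "(\<integral>r. indicator {0..a} r * ?g r \<partial>lborel) = a * heat_mean d F t a x"
    using a heat_mean_eq_integral[of a t x] by simp
  finally show ?thesis using 1 by simp
qed

end

section \<open>Duhamel's formula\<close>

context pde_solution
begin

text \<open>\<open>h\<close> is continuous up to the times \<open>0\<close> and \<open>T\<close> only; \<open>gc\<close> has the type that \<open>gauss_mean\<close> expects.\<close>

definition hc :: "real \<Rightarrow> rvec \<Rightarrow> real" where
  "hc t x = h (max 0 (min T t)) x"

definition gc :: "real \<Rightarrow> rvec \<Rightarrow> real" where
  "gc t x = g x"

definition Cg :: real where
  "Cg = (SOME C. C > 0 \<and> (\<forall>x\<in>Rd d. \<bar>g x\<bar> \<le> C * (1 + norm1 d x)) \<and>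
     (\<forall>t\<in>{0..T}. \<forall>x\<in>Rd d. \<bar>u t x\<bar> \<le> C * (1 + norm1 d x) \<and> \<bar>h t x\<bar> \<le> C * (1 + norm1 d x)))"

lemma Cg: "Cg > 0" "x \<in> Rd d \<Longrightarrow> \<bar>g x\<bar> \<le> Cg * (1 + norm1 d x)"
    "t \<in> {0..T} \<Longrightarrow> x \<in> Rd d \<Longrightarrow> \<bar>u t x\<bar> \<le> Cg * (1 + norm1 d x)"
    "t \<in> {0..T} \<Longrightarrow> x \<in> Rd d \<Longrightarrow> \<bar>h t x\<bar> \<le> Cg * (1 + norm1 d x)"
  using someI_ex[OF growth_constant] unfolding Cg_def[symmetric] by blast+

lemma hc_eq: "t \<in> {0..T} \<Longrightarrow> hc t x = h t x"
  by (simp add: hc_def)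

lemma hc_growth: "lin_growth d Cg hc"
  unfolding lin_growth_def hc_def using T by (intro allI ballI Cg(4)) auto

lemma gc_growth: "lin_growth d Cg gc"
  unfolding lin_growth_def gc_def by (intro allI ballI Cg(2)) auto

lemma hc_cont: "continuous_on (UNIV \<times> Rd d) (\<lambda>(t, x). hc t x)"
proof -
  have "continuous_on (UNIV \<times> Rd d) ((\<lambda>(t, x). h t x) \<circ> (\<lambda>p. (max 0 (min T (fst p)), snd p)))"
    using T by (intro continuous_on_compose continuous_on_subset[OF h_cont] continuous_intros) auto
  then show ?thesis by (simp add: hc_def comp_def case_prod_unfold)
qed

lemma gc_cont: "continuous_on (UNIV \<times> Rd d) (\<lambda>(t, x). gc t x)"
proof -
  have "continuous_on (UNIV \<times> Rd d) (g \<circ> (\<lambda>p::real \<times> rvec. snd p))"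
    by (intro continuous_on_compose continuous_on_subset[OF g_cont] continuous_intros) auto
  then show ?thesis by (simp add: gc_def comp_def case_prod_unfold)
qed

text \<open>The mild solution: the heat semigroup applied to the initial value plus the Duhamel
  integral of the source, the source being evaluated along the given solution
  \<open>u\<close>.\<close>

definition v :: "real \<Rightarrow> rvec \<Rightarrow> real" where
  "v t x = gauss_mean d gc t (sqrt (2 * t)) x + t * heat_mean d hc t t x"

lemma v_cont: "continuous_on ({0..T} \<times> Rd d) (\<lambda>(t, x). v t x)"
proof (rule continuous_on_sequentiallyI)
  fix p :: "nat \<Rightarrow> real \<times> rvec" and a
  assume p: "\<forall>n. p n \<in> {0..T} \<times> Rd d" "a \<in> {0..T} \<times> Rd d" "p \<longlonglongrightarrow> a"
  have pn: "fst (p n) \<ge> 0" "snd (p n) \<in> Rd d" for n using p(1)[rule_format, of n] by auto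
  have ad: "snd a \<in> Rd d" using p(2) by auto
  have 1: "(\<lambda>n. fst (p n)) \<longlonglongrightarrow> fst a" and 2: "(\<lambda>n. snd (p n)) \<longlonglongrightarrow> snd a"
    using p(3) by (auto intro: tendsto_fst tendsto_snd)
  show "(\<lambda>n. (\<lambda>(t, x). v t x) (p n)) \<longlonglongrightarrow> (\<lambda>(t, x). v t x) a"
    unfolding v_def case_prod_unfold
    by (intro tendsto_add tendsto_mult gauss_mean_tendsto[OF gc_cont gc_growth] heat_mean_tendsto[OF hc_cont hc_growth]
        tendsto_real_sqrt tendsto_const 1 2 pn ad)
qed

lemma v_bound:
  assumes t: "t \<in> {0..T}" and x: "x \<in> Rd d"
  shows "\<bar>v t x\<bar> \<le> Cg * (1 + T) * (1 + sqrt (2 * T) * d + norm1 d x)"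
proof -
  let ?B = "Cg * (1 + norm1 d x + sqrt (2 * T) * d)"
  have "\<bar>gauss_mean d gc t (sqrt (2 * t)) x\<bar> \<le> ?B"
    using t by (intro gauss_mean_bound_time[OF gc_cont gc_growth x]) auto
  moreover have "\<bar>heat_mean d hc t t x\<bar> \<le> ?B"
    using t by (intro heat_mean_bound[OF hc_cont hc_growth x]) auto
  then have "\<bar>t * heat_mean d hc t t x\<bar> \<le> T * ?B"
    using t unfolding abs_mult by (intro mult_mono) auto
  ultimately have "\<bar>v t x\<bar> \<le> ?B + T * ?B" unfolding v_def by linarith
  then show ?thesis by (simp add: algebra_simps)
qed

lemma v_initial: "x \<in> Rd d \<Longrightarrow> v 0 x = g x"
proof -
  assume x: "x \<in> Rd d"
  have "add_scaled d x 0 z = x" for z by (rule Rd_eqI[OF _ x]) auto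
  then show ?thesis using gauss.prob_space by (simp add: v_def gauss_mean_def gc_def)
qed

text \<open>Interpolates between \<open>x\<close> and \<open>x + a z\<close>, coordinate by coordinate.\<close>

definition part :: "real \<Rightarrow> rvec \<Rightarrow> rvec \<Rightarrow> nat \<Rightarrow> nat \<Rightarrow> real" where
  "part a x z k = (\<lambda>i\<in>{1..d}. x i + (if i \<le> k then a * z i else 0))"

lemma part_in_Rd [simp]: "part a x z k \<in> Rd d"
  by (simp add: part_def)

lemma part_0: "x \<in> Rd d \<Longrightarrow> part a x z 0 = x"
  by (rule Rd_eqI[OF part_in_Rd]) (auto simp: part_def)

lemma part_d: "part a x z d = add_scaled d x a z"
  by (rule Rd_eqI[OF part_in_Rd add_scaled_in_Rd]) (simp add: part_def)

lemma part_Suc: "k < d \<Longrightarrow> part a x z (Suc k) = (part a x z k)(Suc k := part a x z k (Suc k) + a * z (Suc k))"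
  by (rule Rd_eqI[OF part_in_Rd Rd_fun_upd[OF part_in_Rd]]) (auto simp: part_def)

section \<open>Expansion of u over a short heat step\<close>

lemma taylor_coordinate:
  assumes t: "t \<in> {0..T}" and y: "y \<in> Rd d" and j: "j \<in> {1..d}"
  shows "\<exists>\<zeta>. \<bar>\<zeta>\<bar> \<le> \<bar>b\<bar> \<and> u t (y(j := y j + b)) = u t y + b * space_deriv j (u t) y + b\<^sup>2 / 2 * space_deriv j (space_deriv j (u t)) (y(j := y j + \<zeta>))"
proof -
  define D where "D = (\<lambda>m h. if m = 0 then u t (y(j := y j + h)) else if m = Suc 0 then space_deriv j (u t) (y(j := y j + h))
     else space_deriv j (space_deriv j (u t)) (y(j := y j + h)))"
  have "\<forall>m h. m < 2 \<and> \<bar>h\<bar> \<le> \<bar>b\<bar> \<longrightarrow> (D m has_real_derivative D (Suc m) h) (at h)"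
  proof (intro allI impI)
    fix m :: nat and h :: real assume "m < 2 \<and> \<bar>h\<bar> \<le> \<bar>b\<bar>"
    then consider "m = 0" | "m = Suc 0" by linarith
    then show "(D m has_real_derivative D (Suc m) h) (at h)"
    proof cases
      case 1
      have "((\<lambda>h. u t (y(j := h))) has_real_derivative D 1 h) (at (h + y j))"
        using u_space_at(1)[OF t y j, of "h + y j"] by (simp add: D_def add.commute)
      then show ?thesis unfolding DERIV_shift using 1 by (simp add: D_def add.commute)
    next
      case 2
      have "((\<lambda>h. space_deriv j (u t) (y(j := h))) has_real_derivative D 2 h) (at (h + y j))"
        using u_space_at(2)[OF t y j, of "h + y j"] by (simp add: D_def add.commute)
      then show ?thesis unfolding DERIV_shift using 2 by (simp add: D_def add.commute)
    qed
  qed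
  from Maclaurin_bi_le[of D "D 0" 2 b, OF refl this]
  obtain \<zeta> where "\<bar>\<zeta>\<bar> \<le> \<bar>b\<bar>" "D 0 b = (\<Sum>m<2. D m 0 / fact m * b ^ m) + D 2 \<zeta> / fact 2 * b ^ 2"
    by blast
  then show ?thesis by (intro exI[of _ \<zeta>]) (simp add: D_def numeral_2_eq_2 field_simps power2_eq_square)
qed

lemma time_mean_value:
  assumes "0 \<le> t - s" "t \<le> T" "s > 0" and y: "y \<in> Rd d"
  shows "\<exists>\<xi>\<in>{t - s..t}. u (t - s) y - u t y = - s * time_deriv T u \<xi> y"
proof -
  have "\<exists>\<xi>\<in>{t - s..t}. u t y - u (t - s) y = (*) (time_deriv T u \<xi> y) (t - (t - s))"
  proof (rule mvt_very_simple[where f="\<lambda>t. u t y" and f'="\<lambda>\<xi>. (*) (time_deriv T u \<xi> y)"])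
    fix \<xi> assume "t - s \<le> \<xi>" "\<xi> \<le> t"
    then have "((\<lambda>s. u s y) has_real_derivative time_deriv T u \<xi> y) (at \<xi> within {t - s..t})"
      using assms by (intro has_field_derivative_subset[OF u_time[OF _ y]]) auto
    then show "((\<lambda>t. u t y) has_derivative (*) (time_deriv T u \<xi> y)) (at \<xi> within {t - s..t})"
      by (simp add: has_field_derivative_def)
  qed (use assms in auto)
  then show ?thesis by (auto simp: algebra_simps intro: bexI)
qed

text \<open>The first-order term in coordinate \<open>j\<close> is taken at
  \<open>part ... (j - 1)\<close>, a point that does not involve \<open>z j\<close>. It is therefore
  odd in \<open>z j\<close> and drops out of the mean, although its base point is random.\<close>

definition expansion_error :: "real \<Rightarrow> real \<Rightarrow> rvec \<Rightarrow> rvec \<Rightarrow> real" where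
  "expansion_error t s x z = u (t - s) (add_scaled d x (sqrt (2 * s)) z) - u t x
     - sqrt (2 * s) * (\<Sum>j=1..d. z j * space_deriv j (u t) (part (sqrt (2 * s)) x z (j - 1)))"

lemma expansion_error_eq:
  assumes s: "0 < s" "s \<le> t" "t \<le> T" and x: "x \<in> Rd d"
  shows "\<exists>\<xi>\<in>{t - s..t}. \<exists>\<zeta>. (\<forall>j\<in>{1..d}. \<bar>\<zeta> j\<bar> \<le> sqrt (2 * s) * \<bar>z j\<bar>) \<and>
    expansion_error t s x z = s * (- time_deriv T u \<xi> (add_scaled d x (sqrt (2 * s)) z)
       + (\<Sum>j=1..d. (z j)\<^sup>2 * space_deriv j (space_deriv j (u t)) ((part (sqrt (2 * s)) x z (j - 1))(j := x j + \<zeta> j))))"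
proof -
  let ?a = "sqrt (2 * s)" and ?p = "part (sqrt (2 * s)) x z"
  have t: "t \<in> {0..T}" using s by auto
  \<comment> \<open>This makes the second-order remainders \<open>?a\<^sup>2 / 2 * ...\<close> of
    the same order \<open>s\<close> as the time increment.\<close>
  have a2: "(?a)\<^sup>2 = 2 * s" using s by simp
  have pj: "?p (j - 1) j = x j" if "j \<in> {1..d}" for j using that by (auto simp: part_def)
  have "\<forall>j\<in>{1..d}. \<exists>\<zeta>. \<bar>\<zeta>\<bar> \<le> \<bar>?a * z j\<bar> \<and> u t ((?p (j - 1))(j := ?p (j - 1) j + ?a * z j)) = u t (?p (j - 1))
       + (?a * z j) * space_deriv j (u t) (?p (j - 1)) + (?a * z j)\<^sup>2 / 2 * space_deriv j (space_deriv j (u t)) ((?p (j - 1))(j := ?p (j - 1) j + \<zeta>))"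
    by (intro ballI taylor_coordinate[OF t part_in_Rd])
  then obtain \<zeta> where \<zeta>: "\<And>j. j \<in> {1..d} \<Longrightarrow> \<bar>\<zeta> j\<bar> \<le> \<bar>?a * z j\<bar>"
     "\<And>j. j \<in> {1..d} \<Longrightarrow> u t ((?p (j - 1))(j := ?p (j - 1) j + ?a * z j)) = u t (?p (j - 1))
       + (?a * z j) * space_deriv j (u t) (?p (j - 1)) + (?a * z j)\<^sup>2 / 2 * space_deriv j (space_deriv j (u t)) ((?p (j - 1))(j := ?p (j - 1) j + \<zeta> j))"
    unfolding bchoice_iff by blast
  let ?D = "\<lambda>j. space_deriv j (space_deriv j (u t)) ((?p (j - 1))(j := x j + \<zeta> j))"
  have step: "u t (?p j) - u t (?p (j - 1)) = ?a * (z j * space_deriv j (u t) (?p (j - 1))) + s * ((z j)\<^sup>2 * ?D j)" if j: "j \<in> {1..d}" for j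
  proof -
    have "?p j = (?p (j - 1))(j := ?p (j - 1) j + ?a * z j)"
    proof -
      have "j - 1 < d" "Suc (j - 1) = j" using j by auto
      then show ?thesis using part_Suc[of "j - 1" ?a x z] by simp
    qed
    then show ?thesis using \<zeta>(2)[OF j] pj[OF j] a2 by (simp add: power_mult_distrib)
  qed
  have "(\<Sum>j=1..k. u t (?p j) - u t (?p (j - 1))) = u t (?p k) - u t (?p 0)" for k
    by (induction k) simp_all
  then have "(\<Sum>j=1..d. u t (?p j) - u t (?p (j - 1))) = u t (?p d) - u t (?p 0)" .
  also have "\<dots> = u t (add_scaled d x ?a z) - u t x" by (simp add: part_d part_0[OF x])
  finally have "u t (add_scaled d x ?a z) - u t x = ?a * (\<Sum>j=1..d. z j * space_deriv j (u t) (?p (j - 1))) + s * (\<Sum>j=1..d. (z j)\<^sup>2 * ?D j)"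
    using step by (simp add: sum.distrib sum_distrib_left)
  moreover obtain \<xi> where "\<xi> \<in> {t - s..t}" "u (t - s) (add_scaled d x ?a z) - u t (add_scaled d x ?a z) = - s * time_deriv T u \<xi> (add_scaled d x ?a z)"
    using time_mean_value[of t s "add_scaled d x ?a z"] s by auto
  ultimately show ?thesis unfolding expansion_error_def using \<zeta>(1) s
    by (intro bexI[of _ \<xi>] exI[of _ \<zeta>]) (auto simp: algebra_simps abs_mult)
qed

lemma local_bound:
  "\<exists>B>0. \<forall>t\<in>{0..T}. \<forall>y\<in>Rd d. (\<forall>j\<in>{1..d}. \<bar>y j\<bar> \<le> R) \<longrightarrow> \<bar>time_deriv T u t y\<bar>
      \<le> B \<and> (\<forall>j\<in>{1..d}. \<bar>space_deriv j (space_deriv j (u t)) y\<bar> \<le> B)"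
proof -
  let ?K = "{0..T} \<times> {x \<in> Rd d. \<forall>j\<in>{1..d}. \<bar>x j\<bar> \<le> R}"
  let ?F = "\<lambda>p. \<bar>time_deriv T u (fst p) (snd p)\<bar> + (\<Sum>j=1..d. \<bar>space_deriv j (space_deriv j (u (fst p))) (snd p)\<bar>)"
  have "compact ?K" by (intro compact_Times compact_Rd_box) auto
  moreover have "continuous_on ({0..T} \<times> Rd d) ?F"
    using ut_cont ddu_cont by (intro continuous_on_add continuous_on_sum continuous_on_rabs) (auto simp: case_prod_unfold)
  then have "continuous_on ?K ?F" by (rule continuous_on_subset) auto
  ultimately have "compact (?F ` ?K)" by (intro compact_continuous_image)
  then obtain B where B: "B > 0" "\<And>p. p \<in> ?K \<Longrightarrow> \<bar>?F p\<bar> \<le> B"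
    using compact_imp_bounded bounded_pos[of "?F ` ?K"] by auto
  show ?thesis
  proof (intro exI[of _ B] conjI ballI impI B(1))
    fix t y assume ty: "t \<in> {0..T}" "y \<in> Rd d" "\<forall>j\<in>{1..d}. \<bar>y j\<bar> \<le> R"
    have F: "?F (t, y) \<le> B" using B(2)[of "(t, y)"] ty by auto
    have S: "0 \<le> (\<Sum>j=1..d. \<bar>space_deriv j (space_deriv j (u t)) y\<bar>)" by (simp add: sum_nonneg)
    then show "\<bar>time_deriv T u t y\<bar> \<le> B" using F unfolding fst_conv snd_conv by linarith
    fix j assume j: "j \<in> {1..d}"
    have "\<bar>space_deriv j (space_deriv j (u t)) y\<bar> \<le> (\<Sum>j=1..d. \<bar>space_deriv j (space_deriv j (u t)) y\<bar>)"
      using j by (intro member_le_sum) auto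
    then show "\<bar>space_deriv j (space_deriv j (u t)) y\<bar> \<le> B" using F unfolding fst_conv snd_conv by linarith
  qed
qed

lemma sum_squares_le_norm1: "(\<Sum>j=1..d. (z j)\<^sup>2) \<le> (norm1 d z)\<^sup>2"
proof -
  have "(\<Sum>j=1..d. (z j)\<^sup>2) \<le> (\<Sum>j=1..d. \<bar>z j\<bar> * norm1 d z)"
  proof (rule sum_mono)
    fix j assume "j \<in> {1..d}"
    then have "\<bar>z j\<bar> \<le> norm1 d z" unfolding norm1_def by (intro member_le_sum) auto
    then have "\<bar>z j\<bar> * \<bar>z j\<bar> \<le> \<bar>z j\<bar> * norm1 d z" by (intro mult_left_mono) auto
    then show "(z j)\<^sup>2 \<le> \<bar>z j\<bar> * norm1 d z" by (simp add: power2_eq_square)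
  qed
  also have "\<dots> = (norm1 d z)\<^sup>2" by (simp add: norm1_def sum_distrib_right power2_eq_square)
  finally show ?thesis .
qed

lemma coord_le_norm1: "j \<in> {1..d} \<Longrightarrow> \<bar>z j\<bar> \<le> norm1 d z"
  unfolding norm1_def by (intro member_le_sum) auto

text \<open>Two regimes. If all increments are at most one, every intermediate point lies in a fixed
  box, where the second derivatives are bounded by compactness. Otherwise only the linear growth of
  \<open>u\<close> and the gradient bound are used, and the size of \<open>z\<close> pays for the
  factor \<open>s\<close>. In both cases a cubic in \<open>norm1 d z\<close> remains, hence the
  exponential with factor \<open>3\<close>.\<close>

lemma expansion_error_bound:
  assumes t: "t \<in> {0..T}" and x: "x \<in> Rd d"
  shows "\<exists>C. \<forall>s z. 0 < s \<and> s \<le> t \<and> z \<in> Rd d \<longrightarrow> \<bar>expansion_error t s x z\<bar> \<le> s * (C * exp (3 * norm1 d z))"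
proof -
  obtain B where B: "B > 0" "\<And>t y. t \<in> {0..T} \<Longrightarrow> y \<in> Rd d \<Longrightarrow> (\<forall>j\<in>{1..d}. \<bar>y j\<bar> \<le> norm1 d x + 1) \<Longrightarrow> \<bar>time_deriv T u t y\<bar> \<le> B"
    "\<And>t y j. t \<in> {0..T} \<Longrightarrow> y \<in> Rd d \<Longrightarrow> (\<forall>j\<in>{1..d}. \<bar>y j\<bar> \<le> norm1 d x + 1) \<Longrightarrow> j \<in> {1..d}
        \<Longrightarrow> \<bar>space_deriv j (space_deriv j (u t)) y\<bar> \<le> B"
    using local_bound[of "norm1 d x + 1"] by blast
  define C1 where "C1 = 2 * Cg * (1 + norm1 d x) + sqrt (2 * T) * (Cg + Lip * lam)"
  have C1: "C1 \<ge> 0" using Cg(1) Lip_pos lam T by (simp add: C1_def)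
  show ?thesis
  proof (intro exI[of _ "B + 2 * C1"] allI impI, elim conjE)
    fix s z assume s: "0 < s" "s \<le> t" and z: "z \<in> Rd d"
    let ?a = "sqrt (2 * s)" and ?n = "norm1 d z"
    have a: "?a > 0" "?a\<^sup>2 = 2 * s" "?a \<le> sqrt (2 * T)" using s t by auto
    have n3: "(1 + ?n) ^ 3 \<le> exp (3 * ?n)"
    proof -
      have "(1 + ?n) ^ 3 \<le> exp ?n ^ 3" by (intro power_mono) auto
      then show ?thesis by (simp add: exp_of_nat_mult[of 3, symmetric])
    qed
    have e3: "(1 + ?n) ^ 3 = 1 + 3 * ?n + 3 * ?n\<^sup>2 + ?n ^ 3" by (simp add: power2_eq_square power3_eq_cube algebra_simps)
    have nn: "0 \<le> ?n\<^sup>2" "0 \<le> ?n ^ 3" "0 \<le> ?n" by auto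
    have "\<bar>expansion_error t s x z\<bar> \<le> s * ((B + 2 * C1) * (1 + ?n) ^ 3)"
    proof (cases "\<forall>i\<in>{1..d}. ?a * \<bar>z i\<bar> \<le> 1")
      case True
      obtain \<xi> \<zeta> where \<xi>: "\<xi> \<in> {t - s..t}" and \<zeta>: "\<forall>j\<in>{1..d}. \<bar>\<zeta> j\<bar> \<le> ?a * \<bar>z j\<bar>" and
        eq: "expansion_error t s x z = s * (- time_deriv T u \<xi> (add_scaled d x ?a z)
         + (\<Sum>j=1..d. (z j)\<^sup>2 * space_deriv j (space_deriv j (u t)) ((part ?a x z (j - 1))(j := x j + \<zeta> j))))"
        using expansion_error_eq[OF s _ x, of z] t by auto
      have xj: "\<bar>x i\<bar> \<le> norm1 d x" if "i \<in> {1..d}" for i by (rule coord_le_norm1[OF that])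
      have az: "\<bar>?a * z i\<bar> \<le> 1" if "i \<in> {1..d}" for i using True that a by (simp add: abs_mult)
      have "\<bar>time_deriv T u \<xi> (add_scaled d x ?a z)\<bar> \<le> B"
      proof (rule B(2))
        show "\<forall>j\<in>{1..d}. \<bar>add_scaled d x ?a z j\<bar> \<le> norm1 d x + 1"
        proof
          fix j assume j: "j \<in> {1..d}"
          show "\<bar>add_scaled d x ?a z j\<bar> \<le> norm1 d x + 1"
            using xj[OF j] az[OF j] by (simp only: add_scaled_apply[OF j])
        qed
      qed (use \<xi> s t in auto)
      moreover have "\<bar>\<Sum>j=1..d. (z j)\<^sup>2 * space_deriv j (space_deriv j (u t)) ((part ?a x z (j - 1))(j := x j + \<zeta> j))\<bar> \<le> (\<Sum>j=1..d. (z j)\<^sup>2 * B)"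
      proof (rule order_trans[OF sum_abs], rule sum_mono)
        fix j assume j: "j \<in> {1..d}"
        have "\<bar>space_deriv j (space_deriv j (u t)) ((part ?a x z (j - 1))(j := x j + \<zeta> j))\<bar> \<le> B"
        proof (rule B(3)[OF t _ _ j])
          show "\<forall>i\<in>{1..d}. \<bar>((part ?a x z (j - 1))(j := x j + \<zeta> j)) i\<bar> \<le> norm1 d x + 1"
          proof
            fix i assume i: "i \<in> {1..d}"
            have "\<bar>\<zeta> j\<bar> \<le> 1" using \<zeta> True j by force
            then show "\<bar>((part ?a x z (j - 1))(j := x j + \<zeta> j)) i\<bar> \<le> norm1 d x + 1"
              using xj[OF i] az[OF i] i by (cases "i = j"; cases "i \<le> j - 1") (simp_all add: part_def)
          qed
        qed (use j in auto)
        then show "\<bar>(z j)\<^sup>2 * space_deriv j (space_deriv j (u t)) ((part ?a x z (j - 1))(j := x j + \<zeta> j))\<bar> \<le> (z j)\<^sup>2 * B"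
          by (simp add: abs_mult mult_left_mono)
      qed
      moreover have "(\<Sum>j=1..d. (z j)\<^sup>2 * B) \<le> ?n\<^sup>2 * B"
        using sum_squares_le_norm1[of z] B(1) by (simp add: sum_distrib_right[symmetric])
      ultimately have "\<bar>expansion_error t s x z\<bar> \<le> s * (B + ?n\<^sup>2 * B)"
        unfolding eq abs_mult using s by (intro mult_mono) auto
      also have "\<dots> \<le> s * ((B + 2 * C1) * (1 + ?n) ^ 3)"
      proof (rule mult_left_mono)
        have "B + ?n\<^sup>2 * B = B * (1 + ?n\<^sup>2)" by (simp add: algebra_simps)
        also have "\<dots> \<le> (B + 2 * C1) * (1 + ?n) ^ 3" using B(1) C1 nn e3 by (intro mult_mono) auto
        finally show "B + ?n\<^sup>2 * B \<le> (B + 2 * C1) * (1 + ?n) ^ 3" .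
      qed (use s in auto)
      finally show ?thesis .
    next
      case False
      then obtain i where i: "i \<in> {1..d}" "1 < ?a * \<bar>z i\<bar>" by (auto simp: not_le)
      then have "1 < ?a * ?n" using coord_le_norm1[OF i(1), of z] a by (meson less_le_trans mult_left_mono less_imp_le)
      then have "1\<^sup>2 < (?a * ?n)\<^sup>2" by (intro power_strict_mono) auto
      \<comment> \<open>A large increment means that the noise is large compared with the step;
        multiplying by this quantity supplies the factor \<open>s\<close> that the crude bound
        lacks.\<close>
      then have big: "1 \<le> 2 * s * ?n\<^sup>2" using a(2) by (simp add: power_mult_distrib)
      have u1: "\<bar>u (t - s) (add_scaled d x ?a z)\<bar> \<le> Cg * (1 + (norm1 d x + ?a * ?n))"
      proof -
        have "\<bar>u (t - s) (add_scaled d x ?a z)\<bar> \<le> Cg * (1 + norm1 d (add_scaled d x ?a z))"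
          using s t by (intro Cg(3)) auto
        also have "\<dots> \<le> Cg * (1 + (norm1 d x + ?a * ?n))"
          using norm1_add_scaled_le[of d x ?a z] a Cg(1) by (intro mult_left_mono) auto
        finally show ?thesis .
      qed
      have u2: "\<bar>u t x\<bar> \<le> Cg * (1 + norm1 d x)" by (rule Cg(3)[OF t x])
      have "\<bar>\<Sum>j=1..d. z j * space_deriv j (u t) (part ?a x z (j - 1))\<bar> \<le> (\<Sum>j=1..d. \<bar>z j\<bar> * (Lip * lam))"
      proof (rule order_trans[OF sum_abs], rule sum_mono)
        fix j assume j: "j \<in> {1..d}"
        have "\<bar>space_deriv j (u t) (part ?a x z (j - 1))\<bar> \<le> Lip * L j" by (rule du_bound[OF j t part_in_Rd])
        also have "\<dots> \<le> Lip * lam"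
          using member_le_sum[of j "{1..d}" L] j L_nonneg L_sum Lip_pos by (intro mult_left_mono) fastforce+
        finally show "\<bar>z j * space_deriv j (u t) (part ?a x z (j - 1))\<bar> \<le> \<bar>z j\<bar> * (Lip * lam)"
          by (simp add: abs_mult mult_left_mono)
      qed
      also have "\<dots> = ?n * (Lip * lam)" by (simp add: norm1_def sum_distrib_right)
      finally have "?a * \<bar>\<Sum>j=1..d. z j * space_deriv j (u t) (part ?a x z (j - 1))\<bar> \<le> ?a * (?n * (Lip * lam))"
        using a by (intro mult_left_mono) auto
      then have "\<bar>expansion_error t s x z\<bar> \<le> Cg * (1 + (norm1 d x + ?a * ?n)) + Cg * (1 + norm1 d x) + ?a * (?n * (Lip * lam))"
        using u1 u2 a unfolding expansion_error_def
        by (intro order_trans[OF abs_triangle_ineq4] add_mono order_trans[OF abs_triangle_ineq4]) (simp_all add: abs_mult)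
      also have "\<dots> = 2 * Cg * (1 + norm1 d x) + ?a * ((Cg + Lip * lam) * ?n)" by (simp add: algebra_simps)
      also have "\<dots> \<le> 2 * Cg * (1 + norm1 d x) + sqrt (2 * T) * ((Cg + Lip * lam) * ?n)"
        using a Cg(1) Lip_pos lam by (intro add_left_mono mult_right_mono) auto
      also have "\<dots> \<le> C1 * (1 + ?n)"
        using Cg(1) Lip_pos lam T nn by (simp add: C1_def algebra_simps)
      finally have 1: "\<bar>expansion_error t s x z\<bar> \<le> C1 * (1 + ?n)" .
      also have "\<dots> \<le> (2 * s * ?n\<^sup>2) * (C1 * (1 + ?n))"
        using mult_right_mono[OF big, of "C1 * (1 + ?n)"] C1 nn by simp
      also have "\<dots> = s * (2 * C1 * (?n\<^sup>2 + ?n ^ 3))" by (simp add: power2_eq_square power3_eq_cube algebra_simps)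
      also have "\<dots> \<le> s * ((B + 2 * C1) * (1 + ?n) ^ 3)"
        using s B(1) C1 nn e3 by (intro mult_left_mono mult_mono) auto
      finally show ?thesis .
    qed
    also have "\<dots> \<le> s * ((B + 2 * C1) * exp (3 * ?n))"
      using n3 s B(1) C1 by (intro mult_left_mono) auto
    finally show "\<bar>expansion_error t s x z\<bar> \<le> s * ((B + 2 * C1) * exp (3 * ?n))" .
  qed
qed

lemma u_measurable:
  assumes t: "t \<in> {0..T}" and X: "X \<in> N \<rightarrow>\<^sub>M borel_Rd d"
  shows "(\<lambda>\<omega>. u t (X \<omega>)) \<in> borel_measurable N" "i \<in> {1..d} \<Longrightarrow> (\<lambda>\<omega>. space_deriv i (u t) (X \<omega>)) \<in> borel_measurable N"
  using borel_measurable_continuous_Rd[OF u_cont _ _ _ X, of "\<lambda>_. t"] borel_measurable_continuous_Rd[OF du_cont _ _ _ X, of i "\<lambda>_. t"] t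
  by auto

lemma u_add_scaled_integrable:
  assumes t: "t \<in> {0..T}" and x: "x \<in> Rd d"
  shows "integrable (std_normal_Rd d) (\<lambda>z. u t (add_scaled d x a z))"
proof (rule integrable_std_normal_Rd'[where c="\<bar>a\<bar>" and C="Cg * exp (norm1 d x)"])
  show "(\<lambda>z. u t (add_scaled d x a z)) \<in> borel_measurable (borel_Rd d)"
    using x by (intro u_measurable(1)[OF t] measurable_add_scaled) auto
  fix z
  have "\<bar>u t (add_scaled d x a z)\<bar> \<le> Cg * (1 + norm1 d (add_scaled d x a z))"
    by (rule Cg(3)[OF t add_scaled_in_Rd])
  also have "\<dots> \<le> Cg * exp (norm1 d (add_scaled d x a z))" using Cg(1) by (intro mult_left_mono) auto
  also have "\<dots> \<le> Cg * exp (norm1 d x + \<bar>a\<bar> * norm1 d z)"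
    using Cg(1) norm1_add_scaled_le by (intro mult_left_mono) auto
  finally show "\<bar>u t (add_scaled d x a z)\<bar> \<le> Cg * exp (norm1 d x) * exp (\<bar>a\<bar> * norm1 d z)" by (simp add: exp_add)
qed

lemma odd_term:
  assumes t: "t \<in> {0..T}" and x: "x \<in> Rd d" and j: "j \<in> {1..d}"
  shows "integrable (std_normal_Rd d) (\<lambda>z. z j * space_deriv j (u t) (part a x z (j - 1)))"
    and "(\<integral>z. z j * space_deriv j (u t) (part a x z (j - 1)) \<partial>std_normal_Rd d) = 0"
proof -
  have pm: "(\<lambda>z. part a x z (j - 1)) \<in> borel_Rd d \<rightarrow>\<^sub>M borel_Rd d"
    by (rule measurable_into_Rd) (auto simp: part_def)
  have zm: "(\<lambda>z. z j) \<in> borel_measurable (borel_Rd d)" by measurable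
  have m: "(\<lambda>z. z j * space_deriv j (u t) (part a x z (j - 1))) \<in> borel_measurable (borel_Rd d)"
    by (intro borel_measurable_times zm u_measurable(2)[OF t pm j])
  show "integrable (std_normal_Rd d) (\<lambda>z. z j * space_deriv j (u t) (part a x z (j - 1)))"
  proof (rule integrable_std_normal_Rd'[OF m, where c=1 and C="Lip * L j"])
    fix z
    have "\<bar>z j\<bar> * \<bar>space_deriv j (u t) (part a x z (j - 1))\<bar> \<le> norm1 d z * (Lip * L j)"
      using du_bound[OF j t part_in_Rd] coord_le_norm1[OF j] by (intro mult_mono) auto
    also have "\<dots> \<le> exp (norm1 d z) * (Lip * L j)"
      using norm1_le_exp Lip_pos L_nonneg[OF j] by (intro mult_right_mono) auto
    finally show "\<bar>z j * space_deriv j (u t) (part a x z (j - 1))\<bar> \<le> Lip * L j * exp (1 * norm1 d z)"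
      by (simp add: abs_mult mult_ac)
  qed
  show "(\<integral>z. z j * space_deriv j (u t) (part a x z (j - 1)) \<partial>std_normal_Rd d) = 0"
  proof (rule integral_std_normal_Rd_odd[OF j m])
    fix z
    have "part a x (z(j := - z j)) (j - 1) = part a x z (j - 1)"
      using j by (intro Rd_eqI[OF part_in_Rd part_in_Rd]) (auto simp: part_def)
    then show "(z(j := - z j)) j * space_deriv j (u t) (part a x (z(j := - z j)) (j - 1)) = - (z j * space_deriv j (u t) (part a x z (j - 1)))"
      by simp
  qed
qed

text \<open>
  Only the second derivatives along the coordinates are expanded, one coordinate at a time; the first-order
  terms vanish by symmetry, and no growth of the second derivatives at infinity is known, so the
  domination comes from the gradient bound.
\<close>

lemma local_consistency:
  assumes t: "0 < t" "t \<le> T" and x: "x \<in> Rd d" and s: "s \<longlonglongrightarrow> 0" "\<And>n. 0 < s n" "\<And>n. s n \<le> t"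
  shows "(\<lambda>n. ((\<integral>z. u (t - s n) (add_scaled d x (sqrt (2 * s n)) z) \<partial>std_normal_Rd d) - u t x) / s n)
     \<longlonglongrightarrow> - time_deriv T u t x + laplacian d (u t) x"
proof -
  have tT: "t \<in> {0..T}" using t by auto
  let ?a = "\<lambda>n. sqrt (2 * s n)"
  have a0: "?a \<longlonglongrightarrow> 0" using tendsto_real_sqrt[OF tendsto_mult_right_zero[OF s(1), of 2]] by simp
  let ?lim = "\<lambda>z. - time_deriv T u t x + (\<Sum>j=1..d. (z j)\<^sup>2 * space_deriv j (space_deriv j (u t)) x)"
  obtain C where C: "\<And>s z. 0 < s \<Longrightarrow> s \<le> t \<Longrightarrow> z \<in> Rd d \<Longrightarrow> \<bar>expansion_error t s x z\<bar> \<le> s * (C * exp (3 * norm1 d z))"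
    using expansion_error_bound[OF tT x] by blast
  have mean: "((\<integral>z. u (t - s n) (add_scaled d x (?a n) z) \<partial>std_normal_Rd d) - u t x) / s n
     = (\<integral>z. expansion_error t (s n) x z / s n \<partial>std_normal_Rd d)" for n
  proof -
    have ts: "t - s n \<in> {0..T}" using s(2)[of n] s(3)[of n] t by auto
    note i1 = u_add_scaled_integrable[OF ts x, of "?a n"] and i2 = odd_term(1)[OF tT x, of _ "?a n"] and i3 = odd_term(2)[OF tT x, of _ "?a n"]
    have i4: "integrable (std_normal_Rd d) (\<lambda>z. \<Sum>j=1..d. z j * space_deriv j (u t) (part (?a n) x z (j - 1)))"
      using i2 by (intro Bochner_Integration.integrable_sum) auto
    have "(\<integral>z. (\<Sum>j=1..d. z j * space_deriv j (u t) (part (?a n) x z (j - 1))) \<partial>std_normal_Rd d) = 0"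
      using i2 i3 by (subst Bochner_Integration.integral_sum) auto
    then have "(\<integral>z. expansion_error t (s n) x z \<partial>std_normal_Rd d) = (\<integral>z. u (t - s n) (add_scaled d x (?a n) z) \<partial>std_normal_Rd d) - u t x"
      unfolding expansion_error_def using i1 i4 gauss.prob_space by simp
    then show ?thesis by simp
  qed
  have lim: "(\<lambda>n. \<integral>z. expansion_error t (s n) x z / s n \<partial>std_normal_Rd d) \<longlonglongrightarrow> (\<integral>z. ?lim z \<partial>std_normal_Rd d)"
  proof (rule integral_dominated_convergence[where w="\<lambda>z. C * exp (3 * norm1 d z)"])
    show "integrable (std_normal_Rd d) (\<lambda>z. C * exp (3 * norm1 d z))"
      using integrable_std_normal_Rd_exp unfolding norm1_def by (intro integrable_mult_right) auto
    show "?lim \<in> borel_measurable (std_normal_Rd d)" by measurable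
    show "(\<lambda>z. expansion_error t (s n) x z / s n) \<in> borel_measurable (std_normal_Rd d)" for n
    proof -
      have ts: "t - s n \<in> {0..T}" using s(2)[of n] s(3)[of n] t by auto
      have "integrable (std_normal_Rd d) (\<lambda>z. \<Sum>j=1..d. z j * space_deriv j (u t) (part (?a n) x z (j - 1)))"
        using odd_term(1)[OF tT x] by (intro Bochner_Integration.integrable_sum) auto
      note borel_measurable_integrable[OF this] borel_measurable_integrable[OF u_add_scaled_integrable[OF ts x, of "?a n"]]
      then show ?thesis unfolding expansion_error_def
        by (intro borel_measurable_divide borel_measurable_diff borel_measurable_const borel_measurable_times[OF borel_measurable_const])
    qed
    show "AE z in std_normal_Rd d. norm (expansion_error t (s n) x z / s n) \<le> C * exp (3 * norm1 d z)" for n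
    proof (rule AE_I2)
      fix z assume "z \<in> space (std_normal_Rd d)"
      then show "norm (expansion_error t (s n) x z / s n) \<le> C * exp (3 * norm1 d z)"
        using C[OF s(2)[of n] s(3)[of n], of z] s(2)[of n] by (simp add: abs_divide divide_le_eq mult.commute)
    qed
    show "AE z in std_normal_Rd d. (\<lambda>n. expansion_error t (s n) x z / s n) \<longlonglongrightarrow> ?lim z"
    proof (rule AE_I2)
      fix z assume "z \<in> space (std_normal_Rd d)"
      define Q where "Q = (\<lambda>n \<xi> \<zeta>. \<xi> \<in> {t - s n..t} \<and> (\<forall>j\<in>{1..d}. \<bar>\<zeta> j\<bar> \<le> ?a n * \<bar>z j\<bar>) \<and>
        expansion_error t (s n) x z = s n * (- time_deriv T u \<xi> (add_scaled d x (?a n) z)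
         + (\<Sum>j=1..d. (z j)\<^sup>2 * space_deriv j (space_deriv j (u t)) ((part (?a n) x z (j - 1))(j := x j + \<zeta> j)))))"
      have A: "\<forall>n. \<exists>\<xi> \<zeta>. Q n \<xi> \<zeta>"
        using expansion_error_eq[OF s(2) s(3) t(2) x, of _ z] unfolding Q_def by blast
      from choice[OF A] obtain \<xi> where B: "\<forall>n. \<exists>\<zeta>. Q n (\<xi> n) \<zeta>" ..
      from choice[OF B] obtain \<zeta> where Q: "\<forall>n. Q n (\<xi> n) (\<zeta> n)" ..
      have \<xi>: "\<And>n. \<xi> n \<in> {t - s n..t}" and \<zeta>: "\<And>n j. j \<in> {1..d} \<Longrightarrow> \<bar>\<zeta> n j\<bar> \<le> ?a n * \<bar>z j\<bar>"
        and eq: "\<And>n. expansion_error t (s n) x z = s n * (- time_deriv T u (\<xi> n) (add_scaled d x (?a n) z)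
         + (\<Sum>j=1..d. (z j)\<^sup>2 * space_deriv j (space_deriv j (u t)) ((part (?a n) x z (j - 1))(j := x j + \<zeta> n j))))"
        using Q unfolding Q_def by blast+
      have e: "expansion_error t (s n) x z / s n = - time_deriv T u (\<xi> n) (add_scaled d x (?a n) z)
         + (\<Sum>j=1..d. (z j)\<^sup>2 * space_deriv j (space_deriv j (u t)) ((part (?a n) x z (j - 1))(j := x j + \<zeta> n j)))" for n
        using s(2)[of n] by (simp add: eq)
      have az: "(\<lambda>n. ?a n * c) \<longlonglongrightarrow> 0" for c using tendsto_mult_left_zero[OF a0] .
      have "\<xi> \<longlonglongrightarrow> t"
      proof (rule tendsto_sandwich[of "\<lambda>n. t - s n" _ _ "\<lambda>_. t"])
        show "(\<lambda>n. t - s n) \<longlonglongrightarrow> t" using tendsto_diff[OF tendsto_const s(1), of t] by simp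
      qed (use \<xi> in auto)
      moreover have "(\<lambda>n. add_scaled d x (?a n) z) \<longlonglongrightarrow> add_scaled d x 0 z"
        by (rule add_scaled_tendsto[OF a0 tendsto_const])
      moreover have "add_scaled d x 0 z = x" by (rule Rd_eqI[OF _ x]) auto
      moreover have "\<xi> n \<in> {0..T}" for n using \<xi>[of n] s(3)[of n] t by auto
      ultimately have l1: "(\<lambda>n. time_deriv T u (\<xi> n) (add_scaled d x (?a n) z)) \<longlonglongrightarrow> time_deriv T u t x"
        using tT x by (intro continuous_Rd_tendsto[OF ut_cont]) auto
      have l2: "(\<lambda>n. space_deriv j (space_deriv j (u t)) ((part (?a n) x z (j - 1))(j := x j + \<zeta> n j))) \<longlonglongrightarrow> space_deriv j (space_deriv j (u t)) x"
        if j: "j \<in> {1..d}" for j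
      proof (rule continuous_Rd_tendsto[OF ddu_cont[OF j], of "\<lambda>_. t"])
        show "(\<lambda>n. (part (?a n) x z (j - 1))(j := x j + \<zeta> n j)) \<longlonglongrightarrow> x"
        proof (rule LIMSEQ_funI)
          fix i
          have z0: "(\<lambda>n. \<zeta> n j) \<longlonglongrightarrow> 0"
            by (rule Lim_null_comparison[OF _ az[of "\<bar>z j\<bar>"]]) (use \<zeta>[OF j] in auto)
          show "(\<lambda>n. ((part (?a n) x z (j - 1))(j := x j + \<zeta> n j)) i) \<longlonglongrightarrow> x i"
          proof (cases "i = j")
            case True
            then show ?thesis using tendsto_add[OF tendsto_const z0, of "x j"] by simp
          next
            case False
            show ?thesis
            proof (cases "i \<in> {1..d}")
              case True
              then show ?thesis using False tendsto_add[OF tendsto_const az[of "z i"], of "x i"]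
                by (cases "i \<le> j - 1") (simp_all add: part_def)
            next
              case F: False
              then have "x i = undefined" using x by (auto simp: Rd_def PiE_def extensional_def)
              then show ?thesis using F False by (auto simp: part_def)
            qed
          qed
        qed
      qed (use tT x j in auto)
      show "(\<lambda>n. expansion_error t (s n) x z / s n) \<longlonglongrightarrow> ?lim z"
        unfolding e by (intro tendsto_add tendsto_minus l1 tendsto_sum tendsto_mult tendsto_const l2)
    qed
  qed
  have "(\<integral>z. ?lim z \<partial>std_normal_Rd d) = - time_deriv T u t x + (\<Sum>j=1..d. space_deriv j (space_deriv j (u t)) x)"
  proof -
    have i: "integrable (std_normal_Rd d) (\<lambda>z. (z j)\<^sup>2 * space_deriv j (space_deriv j (u t)) x)" if "j \<in> {1..d}" for j
      using integrable_std_normal_Rd_power[OF that, of 2] by simp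
    have "(\<integral>z. ?lim z \<partial>std_normal_Rd d) = - time_deriv T u t x + (\<integral>z. (\<Sum>j=1..d. (z j)\<^sup>2 * space_deriv j (space_deriv j (u t)) x) \<partial>std_normal_Rd d)"
      using i gauss.prob_space by (subst Bochner_Integration.integral_add) auto
    also have "(\<integral>z. (\<Sum>j=1..d. (z j)\<^sup>2 * space_deriv j (space_deriv j (u t)) x) \<partial>std_normal_Rd d) = (\<Sum>j=1..d. space_deriv j (space_deriv j (u t)) x)"
      using i std_normal_Rd_moment2 by (subst Bochner_Integration.integral_sum) auto
    finally show ?thesis .
  qed
  with lim show ?thesis unfolding mean laplacian_def by simp
qed

text \<open>\<open>cosh\<close> equals its own second derivative, so the penalty is an eigenfunction
  of the Laplacian with eigenvalue one and grows by \<open>exp s\<close> under a heat step.\<close>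

lemma cosh_sum_mean:
  assumes s: "s \<ge> 0"
  shows "integrable (std_normal_Rd d) (\<lambda>z. cosh_sum d (add_scaled d x (sqrt (2 * s)) z))"
    and "(\<integral>z. cosh_sum d (add_scaled d x (sqrt (2 * s)) z) \<partial>std_normal_Rd d) = exp s * cosh_sum d x"
proof -
  let ?a = "sqrt (2 * s)"
  have eq: "cosh (x j + ?a * z j) = exp (x j) / 2 * exp (?a * z j) + exp (- x j) / 2 * exp ((- ?a) * z j)" for j z
    by (simp add: cosh_field_def exp_add exp_diff exp_minus field_simps)
  have e: "exp (?a\<^sup>2 / 2) = exp s" "exp ((- ?a)\<^sup>2 / 2) = exp s" using s by simp_all
  have i: "integrable (std_normal_Rd d) (\<lambda>z. cosh (x j + ?a * z j))" if "j \<in> {1..d}" for j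
    unfolding eq by (intro Bochner_Integration.integrable_add integrable_mult_right std_normal_Rd_exp_integrable[OF that])
  have m: "(\<integral>z. cosh (x j + ?a * z j) \<partial>std_normal_Rd d) = exp s * cosh (x j)" if j: "j \<in> {1..d}" for j
  proof -
    have "(\<integral>z. cosh (x j + ?a * z j) \<partial>std_normal_Rd d) = exp (x j) / 2 * exp s + exp (- x j) / 2 * exp s"
      unfolding eq
      by (subst Bochner_Integration.integral_add)
        (intro integrable_mult_right std_normal_Rd_exp_integrable[OF j],
         intro integrable_mult_right std_normal_Rd_exp_integrable[OF j],
         simp only: integral_mult_right_zero std_normal_Rd_exp[OF j] e)
    also have "\<dots> = exp s * cosh (x j)" by (simp add: cosh_field_def field_simps)
    finally show ?thesis .
  qed
  have c: "cosh_sum d (add_scaled d x ?a z) = (\<Sum>j=1..d. cosh (x j + ?a * z j))" for z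
    unfolding cosh_sum_def by (intro sum.cong) auto
  show "integrable (std_normal_Rd d) (\<lambda>z. cosh_sum d (add_scaled d x ?a z))"
    unfolding c by (intro Bochner_Integration.integrable_sum i)
  show "(\<integral>z. cosh_sum d (add_scaled d x ?a z) \<partial>std_normal_Rd d) = exp s * cosh_sum d x"
    unfolding c by (subst Bochner_Integration.integral_sum[OF i]) (simp_all add: m cosh_sum_def sum_distrib_left)
qed

lemma v_add_scaled_integrable:
  assumes t: "t \<in> {0..T}" and x: "x \<in> Rd d"
  shows "integrable (std_normal_Rd d) (\<lambda>z. v t (add_scaled d x a z))"
proof (rule Bochner_Integration.integrable_bound)
  let ?w = "\<lambda>z. Cg * (1 + T) * (1 + sqrt (2 * T) * d + (norm1 d x + \<bar>a\<bar> * norm1 d z))"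
  show "integrable (std_normal_Rd d) ?w" using integrable_norm1 by simp
  show "(\<lambda>z. v t (add_scaled d x a z)) \<in> borel_measurable (std_normal_Rd d)"
    using t x by (intro borel_measurable_continuous_Rd[OF v_cont, of "\<lambda>_. t"] measurable_add_scaled) auto
  show "AE z in std_normal_Rd d. norm (v t (add_scaled d x a z)) \<le> norm (?w z)"
  proof (rule AE_I2)
    fix z
    have "\<bar>v t (add_scaled d x a z)\<bar> \<le> Cg * (1 + T) * (1 + sqrt (2 * T) * d + norm1 d (add_scaled d x a z))"
      by (rule v_bound[OF t add_scaled_in_Rd])
    also have "\<dots> \<le> ?w z" using norm1_add_scaled_le[of d x a z] Cg(1) T by (intro mult_left_mono) auto
    finally show "norm (v t (add_scaled d x a z)) \<le> norm (?w z)" by simp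
  qed
qed

text \<open>A heat step of length \<open>s\<close> reproduces \<open>v\<close> up to the source of
  the last \<open>s\<close> units of time. This exact identity takes the place of a differential
  equation for \<open>v\<close>.\<close>

lemma v_mean:
  assumes s: "0 < s" "s < t" and t: "t \<le> T" and x: "x \<in> Rd d"
  shows "(\<integral>z. v (t - s) (add_scaled d x (sqrt (2 * s)) z) \<partial>std_normal_Rd d) = v t x - s * heat_mean d hc t s x"
proof -
  let ?y = "add_scaled d x (sqrt (2 * s))"
  have ts: "t - s \<in> {0..T}" using s t by auto
  have gi: "integrable (std_normal_Rd d) (\<lambda>z. gauss_mean d gc (t - s) (sqrt (2 * (t - s))) (?y z))"
  proof (rule integrable_std_normal_Rd'[where c="sqrt (2 * s)" and C="Cg * (1 + sqrt (2 * T) * d) * exp (norm1 d x)"])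
    show "(\<lambda>z. gauss_mean d gc (t - s) (sqrt (2 * (t - s))) (?y z)) \<in> borel_measurable (borel_Rd d)"
      using x by (intro gauss_mean_measurable[OF gc_cont] measurable_add_scaled) auto
    fix z
    have "\<bar>gauss_mean d gc (t - s) (sqrt (2 * (t - s))) (?y z)\<bar> \<le> Cg * (1 + norm1 d (?y z) + sqrt (2 * T) * d)"
      using ts s by (intro gauss_mean_bound_time[OF gc_cont gc_growth]) auto
    also have "\<dots> \<le> Cg * ((1 + sqrt (2 * T) * d) * (1 + norm1 d (?y z)))"
      using Cg(1) T by (intro mult_left_mono) (simp_all add: algebra_simps)
    also have "\<dots> \<le> Cg * ((1 + sqrt (2 * T) * d) * exp (norm1 d x + sqrt (2 * s) * norm1 d z))"
    proof (intro mult_left_mono)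
      show "1 + norm1 d (?y z) \<le> exp (norm1 d x + sqrt (2 * s) * norm1 d z)"
        using norm1_add_scaled_le[of d x "sqrt (2 * s)" z] s
        by (intro order_trans[OF _ exp_ge_add_one_self]) simp
    qed (use Cg(1) T in simp_all)
    finally show "\<bar>gauss_mean d gc (t - s) (sqrt (2 * (t - s))) (?y z)\<bar> \<le> Cg * (1 + sqrt (2 * T) * d) * exp (norm1 d x) * exp (sqrt (2 * s) * norm1 d z)"
      by (simp add: exp_add mult_ac)
  qed
  have hi: "integrable (std_normal_Rd d) (\<lambda>z. (t - s) * heat_mean d hc (t - s) (t - s) (?y z))"
  proof -
    have "(\<lambda>z. (t - s) * heat_mean d hc (t - s) (t - s) (?y z)) = (\<lambda>z. v (t - s) (?y z) - gauss_mean d gc (t - s) (sqrt (2 * (t - s))) (?y z))"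
      by (simp add: v_def)
    then show ?thesis using v_add_scaled_integrable[OF ts x] gi by simp
  qed
  have gt: "gauss_mean d gc (t - s) a y = gauss_mean d gc t a y" for a y by (simp add: gauss_mean_def gc_def)
  have "(\<integral>z. v (t - s) (?y z) \<partial>std_normal_Rd d) = (\<integral>z. gauss_mean d gc (t - s) (sqrt (2 * (t - s))) (?y z) \<partial>std_normal_Rd d)
     + (\<integral>z. (t - s) * heat_mean d hc (t - s) (t - s) (?y z) \<partial>std_normal_Rd d)"
    unfolding v_def by (rule Bochner_Integration.integral_add[OF gi hi])
  also have "(\<integral>z. gauss_mean d gc (t - s) (sqrt (2 * (t - s))) (?y z) \<partial>std_normal_Rd d) = gauss_mean d gc t (sqrt (2 * t)) x"
    using gauss_mean_semigroup[OF gc_cont gc_growth x s(1), of "t - s" "t - s"] s by (simp add: gt)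
  finally show ?thesis
    using heat_mean_semigroup[OF hc_cont hc_growth x s] by (simp add: v_def)
qed

lemma heat_mean_0: assumes x: "x \<in> Rd d" shows "heat_mean d hc t 0 x = hc t x"
proof -
  have "add_scaled d x 0 z = x" for z by (rule Rd_eqI[OF _ x]) auto
  then show ?thesis using gauss.prob_space by (simp add: heat_mean_def gauss_mean_def)
qed

text \<open>
  The Duhamel integral \<open>v\<close> is not known to be differentiable here. Instead of its derivatives, the maximum
  principle uses the semigroup identity for \<open>v\<close> and the local consistency of \<open>u\<close> along small time steps.
\<close>

lemma duhamel_one_sided:
  assumes \<sigma>: "\<sigma> = 1 \<or> \<sigma> = - 1" and t1: "t1 \<in> {0..<T}" and x1: "x1 \<in> Rd d" and eps: "\<epsilon> > 0"
  shows "\<sigma> * (u t1 x1 - v t1 x1) \<le> \<epsilon> * exp (2 * t1) * cosh_sum d x1"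
proof (rule ccontr)
  assume neg: "\<not> ?thesis"
  \<comment> \<open>The rate \<open>2\<close> exceeds the growth rate \<open>1\<close> of the
    \<open>cosh\<close>-sum under heat steps, so going back by \<open>s\<close> and averaging
    multiplies the penalty by \<open>exp (- s)\<close>.\<close>
  define \<Phi> where "\<Phi> = (\<lambda>t x. \<sigma> * (u t x - v t x) - \<epsilon> * exp (2 * t) * cosh_sum d x)"
  have pos1: "\<Phi> t1 x1 > 0" using neg by (simp add: \<Phi>_def)
  define A where "A = 1 + sqrt (2 * T) * d"
  have A: "A > 0" using T by (simp add: A_def add_pos_nonneg)
  have gr: "\<sigma> * (u t x - v t x) \<le> Cg * (2 + T) * (A + (\<Sum>j=1..d. \<bar>x j\<bar>)) powr 1" if "t \<in> {0..T}" "x \<in> Rd d" for t x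
  proof -
    have "\<sigma> * (u t x - v t x) \<le> \<bar>u t x\<bar> + \<bar>v t x\<bar>" using \<sigma> by auto
    also have "\<dots> \<le> Cg * (A + norm1 d x) + Cg * (1 + T) * (A + norm1 d x)"
    proof (rule add_mono)
      have "\<bar>u t x\<bar> \<le> Cg * (1 + norm1 d x)" by (rule Cg(3)[OF that])
      also have "\<dots> \<le> Cg * (A + norm1 d x)" using Cg(1) T by (intro mult_left_mono) (simp_all add: A_def)
      finally show "\<bar>u t x\<bar> \<le> Cg * (A + norm1 d x)" .
      show "\<bar>v t x\<bar> \<le> Cg * (1 + T) * (A + norm1 d x)" using v_bound[OF that] by (simp add: A_def)
    qed
    also have "\<dots> = Cg * (2 + T) * (A + norm1 d x)" by (simp add: algebra_simps)
    finally show ?thesis using A norm1_nonneg[of d x] unfolding norm1_def[symmetric] by (simp add: powr_one)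
  qed
  obtain R where R: "\<And>x j. j \<in> {1..d} \<Longrightarrow> \<bar>x j\<bar> \<ge> R \<Longrightarrow> Cg * (2 + T) * (A + (\<Sum>j=1..d. \<bar>x j\<bar>)) powr 1 \<le> \<epsilon> * cosh_sum d x"
  proof -
    have "0 < Cg * (2 + T)" using Cg(1) T by simp
    from cosh_sum_dominates_poly[OF d A this zero_less_one eps] show ?thesis using that by blast
  qed
  obtain t0 x0 where tx: "t0 \<in> {0..t1}" "x0 \<in> Rd d" and Pos: "\<Phi> t0 x0 > 0" and Max: "\<And>t x. t \<in> {0..t1} \<Longrightarrow> x \<in> Rd d \<Longrightarrow> \<Phi> t x \<le> \<Phi> t0 x0"
  proof (rule attains_positive_max[of t1 d \<Phi> R t1 x1])
    have "continuous_on ({0..T} \<times> Rd d) (\<lambda>p. \<Phi> (fst p) (snd p))"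
      unfolding \<Phi>_def using u_cont v_cont
      by (intro continuous_intros cosh_sum_cont) (auto simp: case_prod_unfold)
    then show "continuous_on ({0..t1} \<times> Rd d) (\<lambda>(t, x). \<Phi> t x)"
      unfolding case_prod_unfold by (rule continuous_on_subset) (use t1 in auto)
    fix t x j assume h: "t \<in> {0..t1}" "x \<in> Rd d" "j \<in> {1..d}" "R \<le> \<bar>x j\<bar>"
    have c0: "0 \<le> \<epsilon> * cosh_sum d x" using eps cosh_sum_pos[OF d, of x] by simp
    have "\<sigma> * (u t x - v t x) \<le> 1 * (\<epsilon> * cosh_sum d x)" using gr[of t x] R[of j x] h t1 by auto
    also have "\<dots> \<le> exp (2 * t) * (\<epsilon> * cosh_sum d x)"
      using c0 h by (intro mult_right_mono) auto
    finally show "\<Phi> t x \<le> 0" by (simp add: \<Phi>_def mult_ac)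
  qed (use pos1 t1 x1 in auto)
  have c0: "cosh_sum d x0 > 0" by (rule cosh_sum_pos[OF d])
  have "t0 \<noteq> 0"
  proof
    assume "t0 = 0"
    moreover have "\<epsilon> * cosh_sum d x0 > 0" using c0 eps by simp
    ultimately show False using Pos tx by (simp add: \<Phi>_def initial v_initial)
  qed
  then have t0: "0 < t0" "t0 \<in> {0..<T}" "t0 \<in> {0..T}" "t0 \<le> T" "t0 \<le> t1" using tx t1 by auto
  \<comment> \<open>Steps strictly below \<open>t0\<close>: the identity for \<open>v\<close>
    requires a positive remaining time.\<close>
  define s where "s = (\<lambda>n. t0 * (1 / (real n + 2)))"
  have sn: "0 < s n" "s n < t0" for n using t0 by (auto simp: s_def field_simps intro: add_pos_nonneg)
  have s0: "s \<longlonglongrightarrow> 0"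
  proof -
    have "(\<lambda>n. 1 / (real n + 2)) \<longlonglongrightarrow> 0" by real_asymp
    then show ?thesis unfolding s_def by (rule tendsto_mult_right_zero)
  qed
  let ?c = "\<epsilon> * exp (2 * t0) * cosh_sum d x0"
  let ?Eu = "\<lambda>n. \<integral>z. u (t0 - s n) (add_scaled d x0 (sqrt (2 * s n)) z) \<partial>std_normal_Rd d"
  \<comment> \<open>The maximality of \<open>\<Phi> t0 x0\<close>, averaged over the Gaussian
    endpoints of a step back in time and divided by the step length.\<close>
  have main: "\<sigma> * ((?Eu n - u t0 x0) / s n + heat_mean d hc t0 (s n) x0) \<le> ?c * ((exp (- s n) - 1) / s n)" for n
  proof -
    let ?y = "add_scaled d x0 (sqrt (2 * s n))"
    have ts: "t0 - s n \<in> {0..T}" "t0 - s n \<in> {0..t1}" using sn[of n] t0 by auto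
    note i = u_add_scaled_integrable[OF ts(1) tx(2), of "sqrt (2 * s n)"] v_add_scaled_integrable[OF ts(1) tx(2), of "sqrt (2 * s n)"]
      cosh_sum_mean(1)[OF less_imp_le[OF sn(1)[of n]], of x0]
    have "(\<integral>z. \<Phi> (t0 - s n) (?y z) \<partial>std_normal_Rd d) \<le> (\<integral>z. \<Phi> t0 x0 \<partial>std_normal_Rd d)"
      using i ts(2) by (intro integral_mono Max) (auto simp: \<Phi>_def)
    then have "\<sigma> * (?Eu n - (\<integral>z. v (t0 - s n) (?y z) \<partial>std_normal_Rd d)) - \<epsilon> * exp (2 * (t0 - s n)) * (\<integral>z. cosh_sum d (?y z) \<partial>std_normal_Rd d) \<le> \<Phi> t0 x0"
      using i gauss.prob_space by (simp add: \<Phi>_def)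
    then have "\<sigma> * (?Eu n - u t0 x0 + s n * heat_mean d hc t0 (s n) x0) \<le> \<epsilon> * exp (2 * (t0 - s n)) * (exp (s n) * cosh_sum d x0) - ?c"
      unfolding v_mean[OF sn(1) sn(2) t0(4) tx(2)] cosh_sum_mean(2)[OF less_imp_le[OF sn(1)[of n]]]
      by (simp add: \<Phi>_def algebra_simps)
    also have "\<epsilon> * exp (2 * (t0 - s n)) * (exp (s n) * cosh_sum d x0) = ?c * exp (- s n)"
    proof -
      have "exp (2 * (t0 - s n)) * exp (s n) = exp (2 * t0) * exp (- s n)"
        by (simp flip: exp_add)
      then show ?thesis by (simp add: mult_ac)
    qed
    finally have "\<sigma> * (?Eu n - u t0 x0 + s n * heat_mean d hc t0 (s n) x0) / s n \<le> (?c * exp (- s n) - ?c) / s n"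
      using sn(1)[of n] by (intro divide_right_mono) auto
    moreover have "\<sigma> * (?Eu n - u t0 x0 + s n * heat_mean d hc t0 (s n) x0) / s n = \<sigma> * ((?Eu n - u t0 x0) / s n + heat_mean d hc t0 (s n) x0)"
    proof -
      have "\<sigma> * (A + r * B) / r = \<sigma> * (A / r + B)" if "r > 0" for A B r :: real
        using that by (simp add: field_simps)
      then show ?thesis using sn(1) by blast
    qed
    ultimately show ?thesis by (simp add: right_diff_distrib)
  qed
  have "(\<lambda>n. (?Eu n - u t0 x0) / s n) \<longlonglongrightarrow> - time_deriv T u t0 x0 + laplacian d (u t0) x0"
    using sn less_imp_le by (intro local_consistency[OF t0(1) t0(4) tx(2) s0]) auto
  moreover have "(\<lambda>n. heat_mean d hc t0 (s n) x0) \<longlonglongrightarrow> heat_mean d hc t0 0 x0"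
    using sn less_imp_le tx by (intro heat_mean_tendsto[OF hc_cont hc_growth] s0) auto
  ultimately have "(\<lambda>n. \<sigma> * ((?Eu n - u t0 x0) / s n + heat_mean d hc t0 (s n) x0))
     \<longlonglongrightarrow> \<sigma> * ((- time_deriv T u t0 x0 + laplacian d (u t0) x0) + heat_mean d hc t0 0 x0)"
    by (intro tendsto_mult tendsto_add tendsto_const)
  also have "(- time_deriv T u t0 x0 + laplacian d (u t0) x0) + heat_mean d hc t0 0 x0 = 0"
    using pde[OF t0(2) tx(2)] by (simp add: heat_mean_0[OF tx(2)] hc_eq[OF t0(3)] h_def)
  finally have lhs: "(\<lambda>n. \<sigma> * ((?Eu n - u t0 x0) / s n + heat_mean d hc t0 (s n) x0)) \<longlonglongrightarrow> 0" by simp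
  have "((\<lambda>y. (exp (- y) - 1) / y) \<longlongrightarrow> - 1) (at_right (0::real))" by real_asymp
  moreover have "filterlim s (at_right 0) sequentially"
    using s0 sn(1) less_imp_neq[OF sn(1)] by (auto simp: filterlim_at intro!: always_eventually)
  ultimately have "(\<lambda>n. (exp (- s n) - 1) / s n) \<longlonglongrightarrow> - 1" by (rule filterlim_compose)
  then have rhs: "(\<lambda>n. ?c * ((exp (- s n) - 1) / s n)) \<longlonglongrightarrow> ?c * (- 1)" by (intro tendsto_mult tendsto_const)
  \<comment> \<open>As the step shrinks, the left-hand side tends to \<open>0\<close> by the
    equation at \<open>(t0, x0)\<close> and the right-hand side to \<open>- ?c\<close>, which is
    negative.\<close>
  have "0 \<le> ?c * (- 1)" by (rule LIMSEQ_le[OF lhs rhs]) (use main in auto)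
  moreover have "?c > 0" using eps c0 by simp
  ultimately show False by simp
qed

text \<open>The one-sided estimate with both signs and a vanishing penalty gives equality before
  \<open>T\<close>, and continuity gives it at \<open>T\<close>.\<close>

lemma duhamel:
  assumes t: "t \<in> {0..T}" and x: "x \<in> Rd d"
  shows "u t x = v t x"
proof -
  have lt: "u s x - v s x = 0" if s: "s \<in> {0..<T}" for s
  proof -
    define C where "C = exp (2 * s) * cosh_sum d x"
    have C: "C > 0" using cosh_sum_pos[OF d] by (simp add: C_def)
    have "\<sigma> * (u s x - v s x) \<le> 0" if \<sigma>: "\<sigma> = 1 \<or> \<sigma> = - 1" for \<sigma>
    proof (rule field_le_epsilon)
      fix e :: real assume e: "e > 0"
      have "e / C * exp (2 * s) * cosh_sum d x = e / C * C" by (simp add: C_def mult.assoc)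
      then show "\<sigma> * (u s x - v s x) \<le> 0 + e" using duhamel_one_sided[OF \<sigma> s x, of "e / C"] C e by simp
    qed
    from this[of 1] this[of "- 1"] show ?thesis by simp
  qed
  have "continuous_on {0..T} (\<lambda>s. F s x)" if "continuous_on ({0..T} \<times> Rd d) (\<lambda>(t, x). F t x)" for F :: "real \<Rightarrow> rvec \<Rightarrow> real"
  proof -
    have "continuous_on {0..T} ((\<lambda>(t, x). F t x) \<circ> (\<lambda>s. (s, x)))"
      by (intro continuous_on_compose continuous_intros continuous_on_subset[OF that]) (use x in auto)
    then show ?thesis by (simp add: comp_def)
  qed
  from continuous_on_diff[OF this[OF u_cont] this[OF v_cont]]
  have c: "continuous_on {0..T} (\<lambda>s. u s x - v s x)" .
  have cl: "closure {0..<T} = {0..T}" using T by (rule closure_atLeastLessThan)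
  have "u t x - v t x = 0"
    by (rule continuous_constant_on_closure[of "{0..<T}" "\<lambda>s. u s x - v s x"]) (use c t lt in \<open>simp_all only: cl\<close>)
  then show ?thesis by simp
qed

end

section \<open>Gradient formula\<close>

text \<open>The antiderivative \<open>sqrt\<close> is continuous but not differentiable at
  \<open>0\<close>, hence the interior form of the fundamental theorem.\<close>

lemma has_integral_inv_sqrt:
  assumes "b \<ge> 0"
  shows "((\<lambda>q. 1 / (2 * sqrt q)) has_integral sqrt b) {0..b}"
proof -
  have "((\<lambda>q. 1 / (2 * sqrt q)) has_integral (sqrt b - sqrt 0)) {0..b}"
  proof (rule fundamental_theorem_of_calculus_interior)
    show "continuous_on {0..b} sqrt" by (intro continuous_intros)
    fix x assume "x \<in> {0<..<b}"
    then have "(sqrt has_real_derivative inverse (sqrt x) / 2) (at x)" by (intro DERIV_real_sqrt) auto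
    then show "(sqrt has_vector_derivative 1 / (2 * sqrt x)) (at x)"
      by (simp add: has_real_derivative_iff_has_vector_derivative[symmetric] field_simps)
  qed (rule assms)
  then show ?thesis by simp
qed

lemma inv_sqrt_measurable: "A \<in> sets borel \<Longrightarrow> (\<lambda>q. indicator A q / (2 * sqrt q)) \<in> borel_measurable borel"
  by (intro borel_measurable_divide borel_measurable_indicator borel_measurable_continuous_onI continuous_intros)

lemma nn_integral_inv_sqrt:
  assumes "b \<ge> 0"
  shows "(\<integral>\<^sup>+q. ennreal (indicator {0..b} q / (2 * sqrt q)) \<partial>lborel) = ennreal (sqrt b)"
proof (rule nn_integral_has_integral_lborel)
  have "((\<lambda>q. if q \<in> {0..b} then 1 / (2 * sqrt q) else 0) has_integral sqrt b) UNIV"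
    using has_integral_inv_sqrt[OF assms] by (simp only: has_integral_restrict_UNIV)
  moreover have "(\<lambda>q. if q \<in> {0..b} then 1 / (2 * sqrt q) else 0) = (\<lambda>q. indicator {0..b} q / (2 * sqrt q))"
    by (auto simp: indicator_def)
  ultimately show "((\<lambda>q. indicator {0..b} q / (2 * sqrt q)) has_integral sqrt b) UNIV" by simp
  show "0 \<le> indicator {0..b} q / (2 * sqrt q)" for q by (auto simp: indicator_def)
  show "(\<lambda>q. indicator {0..b} q / (2 * sqrt q)) \<in> borel_measurable borel"
    by (rule inv_sqrt_measurable) simp
qed

lemma integrable_inv_sqrt: "integrable lborel (\<lambda>q. indicator {0..1} q * (B / sqrt q))"
proof -
  have "integrable lborel (\<lambda>q. indicator {0..1} q / (2 * sqrt q))"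
  proof (rule integrableI_bounded)
    have "(\<integral>\<^sup>+q. ennreal (norm (indicator {0..1} q / (2 * sqrt q))) \<partial>lborel) = (\<integral>\<^sup>+q. ennreal (indicator {0..1} q / (2 * sqrt q)) \<partial>lborel)"
      by (intro nn_integral_cong arg_cong[where f=ennreal]) (auto simp: indicator_def)
    then show "(\<integral>\<^sup>+q. ennreal (norm (indicator {0..1} q / (2 * sqrt q))) \<partial>lborel) < \<infinity>"
      using nn_integral_inv_sqrt[of 1] by simp
    show "(\<lambda>q. indicator {0..1} q / (2 * sqrt q)) \<in> borel_measurable lborel"
      using inv_sqrt_measurable[of "{0..1}"] by simp
  qed
  from integrable_mult_right[OF this, of "2 * B"] show ?thesis by (simp add: mult.commute)
qed

text \<open>The law on the unit interval with distribution function \<open>sqrt\<close>, as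
  prescribed for the time variables.\<close>

definition sqrt_law :: "real measure" where
  "sqrt_law = density lborel (\<lambda>q. ennreal (indicator {0<..<1} q / (2 * sqrt q)))"

lemma sets_sqrt_law [measurable_cong, simp]: "sets sqrt_law = sets borel"
  by (simp add: sqrt_law_def)

lemma space_sqrt_law [simp]: "space sqrt_law = UNIV"
  by (simp add: sqrt_law_def)

lemma sqrt_law_cdf:
  assumes b: "b \<in> {0..1}"
  shows "emeasure sqrt_law {..b} = ennreal (sqrt b)"
proof -
  have "emeasure sqrt_law {..b} = (\<integral>\<^sup>+q. ennreal (indicator {0<..<1} q / (2 * sqrt q)) * indicator {..b} q \<partial>lborel)"
    unfolding sqrt_law_def by (subst emeasure_density) auto
  also have "\<dots> = (\<integral>\<^sup>+q. ennreal (indicator {0..b} q / (2 * sqrt q)) \<partial>lborel)"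
  proof (rule nn_integral_cong_AE)
    show "AE q in lborel. ennreal (indicator {0<..<1} q / (2 * sqrt q)) * indicator {..b} q = ennreal (indicator {0..b} q / (2 * sqrt q))"
      using AE_lborel_singleton[of 0] AE_lborel_singleton[of 1]
      by eventually_elim (use b in \<open>auto simp: indicator_def\<close>)
  qed
  also have "\<dots> = ennreal (sqrt b)" using b by (intro nn_integral_inv_sqrt) auto
  finally show ?thesis .
qed

lemma prob_space_sqrt_law: "prob_space sqrt_law"
proof
  have "emeasure sqrt_law (space sqrt_law) = (\<integral>\<^sup>+q. ennreal (indicator {0<..<1} q / (2 * sqrt q)) \<partial>lborel)"
    unfolding sqrt_law_def by (subst emeasure_density) auto
  also have "\<dots> = (\<integral>\<^sup>+q. ennreal (indicator {0..1} q / (2 * sqrt q)) \<partial>lborel)"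
  proof (rule nn_integral_cong_AE)
    show "AE q in lborel. ennreal (indicator {0<..<1} q / (2 * sqrt q)) = ennreal (indicator {0..1::real} q / (2 * sqrt q))"
      using AE_lborel_singleton[of 0] AE_lborel_singleton[of 1] by eventually_elim (auto simp: indicator_def)
  qed
  also have "\<dots> = 1" using nn_integral_inv_sqrt[of 1] by simp
  finally show "emeasure sqrt_law (space sqrt_law) = 1" .
qed

lemma abs_exp_minus_one_le: "\<bar>exp w - 1\<bar> \<le> \<bar>w\<bar> * exp \<bar>w\<bar>" for w :: real
proof (cases "w \<ge> 0")
  case True
  have "exp w * (1 - w) \<le> exp w * exp (- w)"
    using exp_ge_add_one_self[of "- w"] by (intro mult_left_mono) auto
  also have "\<dots> = 1" by (simp flip: exp_add)
  finally show ?thesis using True by (simp add: algebra_simps)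
next
  case False
  then have "exp w \<le> 1" by simp
  then have "\<bar>exp w - 1\<bar> \<le> \<bar>w\<bar> * 1" using False exp_ge_add_one_self[of w] by linarith
  also have "\<dots> \<le> \<bar>w\<bar> * exp \<bar>w\<bar>" by (intro mult_left_mono) auto
  finally show ?thesis .
qed

text \<open>A majorant, independent of \<open>k\<close>, for the difference quotients of the
  exponential tilt at \<open>k = 0\<close>; it permits differentiation under the Gaussian
  integral.\<close>

lemma exp_tilt_quotient_bound:
  fixes k y :: real
  assumes k: "\<bar>k\<bar> \<le> 1" "k \<noteq> 0"
  shows "\<bar>(exp (k * y - k\<^sup>2 / 2) - 1) / k\<bar> \<le> exp (2 * (\<bar>y\<bar> + 1))"
proof -
  let ?w = "k * y - k\<^sup>2 / 2" and ?r = "\<bar>y\<bar> + 1"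
  have "\<bar>?w\<bar> \<le> \<bar>k * y\<bar> + \<bar>k\<^sup>2 / 2\<bar>" by (rule abs_triangle_ineq4)
  also have "\<dots> \<le> \<bar>k\<bar> * \<bar>y\<bar> + \<bar>k\<bar> * 1"
  proof (intro add_mono)
    have "\<bar>k\<bar> * \<bar>k\<bar> \<le> \<bar>k\<bar> * 1" using k by (intro mult_left_mono) auto
    then have "k\<^sup>2 \<le> \<bar>k\<bar>" by (simp add: power2_eq_square)
    then show "\<bar>k\<^sup>2 / 2\<bar> \<le> \<bar>k\<bar> * 1" using zero_le_power2[of k] by simp
  qed (simp add: abs_mult)
  finally have w: "\<bar>?w\<bar> \<le> \<bar>k\<bar> * ?r" by (simp add: distrib_left)
  also have "\<dots> \<le> 1 * ?r" using k by (intro mult_right_mono) auto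
  finally have w1: "\<bar>?w\<bar> \<le> ?r" by simp
  have "\<bar>exp ?w - 1\<bar> \<le> \<bar>?w\<bar> * exp \<bar>?w\<bar>" by (rule abs_exp_minus_one_le)
  also have "\<dots> \<le> (\<bar>k\<bar> * ?r) * exp ?r" using w w1 by (intro mult_mono) auto
  also have "\<dots> \<le> (\<bar>k\<bar> * exp ?r) * exp ?r"
    using exp_ge_add_one_self[of ?r] by (intro mult_right_mono mult_left_mono) linarith+
  also have "\<dots> = \<bar>k\<bar> * exp (2 * ?r)" by (simp add: mult.assoc flip: exp_add)
  finally show ?thesis using k by (simp add: abs_divide divide_le_eq mult.commute)
qed

text \<open>Divided by \<open>s\<close> this is the derivative of \<open>gauss_mean\<close> in
  direction \<open>i\<close>, written without derivatives of \<open>F\<close>: integration by parts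
  against the Gaussian density.\<close>

definition gauss_mean1 :: "nat \<Rightarrow> nat \<Rightarrow> ('a \<Rightarrow> rvec \<Rightarrow> real) \<Rightarrow> 'a \<Rightarrow> real \<Rightarrow> rvec \<Rightarrow> real" where
  "gauss_mean1 d i F t s x = (\<integral>z. F t (add_scaled d x s z) * z i \<partial>std_normal_Rd d)"

context
  fixes d :: nat and F :: "real \<Rightarrow> rvec \<Rightarrow> real" and C :: real and i :: nat
  assumes F: "continuous_on (UNIV \<times> Rd d) (\<lambda>(t, x). F t x)" and gr: "lin_growth d C F" and i: "i \<in> {1..d}"
begin

lemma coord_le_norm1': "\<bar>z i\<bar> \<le> norm1 d z"
  unfolding norm1_def using i by (intro member_le_sum) auto

lemma F_add_scaled_measurable:
  assumes x: "x \<in> Rd d"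
  shows "(\<lambda>z. F t (add_scaled d x s z)) \<in> borel_measurable (borel_Rd d)"
  using x by (intro continuous_Rd_measurable[OF F] measurable_add_scaled) auto

lemma F_weighted_bound:
  assumes x: "x \<in> Rd d" and z: "\<bar>w\<bar> \<le> exp (c * (norm1 d z + 1))" "c \<ge> 0"
  shows "\<bar>w * F t (add_scaled d x s z)\<bar> \<le> C * exp (c + norm1 d x) * exp ((c + \<bar>s\<bar>) * norm1 d z)"
proof -
  have C: "C \<ge> 0" by (rule lin_growth_nonneg[OF gr])
  have "1 + norm1 d x + \<bar>s\<bar> * norm1 d z \<le> exp (norm1 d x + \<bar>s\<bar> * norm1 d z)"
    using exp_ge_add_one_self[of "norm1 d x + \<bar>s\<bar> * norm1 d z"] by linarith
  then have 1: "\<bar>F t (add_scaled d x s z)\<bar> \<le> C * exp (norm1 d x + \<bar>s\<bar> * norm1 d z)"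
    using lin_growth_add_scaled[OF gr, of t x s z] mult_left_mono[OF _ C] by (meson order_trans)
  have "\<bar>w * F t (add_scaled d x s z)\<bar> \<le> exp (c * (norm1 d z + 1)) * (C * exp (norm1 d x + \<bar>s\<bar> * norm1 d z))"
    unfolding abs_mult using 1 z by (intro mult_mono) auto
  also have "\<dots> = C * exp (c + norm1 d x) * exp ((c + \<bar>s\<bar>) * norm1 d z)"
    by (simp add: algebra_simps flip: exp_add)
  finally show ?thesis .
qed

lemma F_weighted_integrable:
  assumes x: "x \<in> Rd d" and w: "w \<in> borel_measurable (borel_Rd d)" "\<And>z. \<bar>w z\<bar> \<le> exp (c * (norm1 d z + 1))" "c \<ge> 0"
  shows "integrable (std_normal_Rd d) (\<lambda>z. w z * F t (add_scaled d x s z))"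
  by (rule integrable_std_normal_Rd'[OF _ F_weighted_bound[OF x w(2) w(3)]])
    (intro borel_measurable_times w F_add_scaled_measurable x)

lemma gauss_mean1_integrable:
  assumes x: "x \<in> Rd d"
  shows "integrable (std_normal_Rd d) (\<lambda>z. F t (add_scaled d x s z) * z i)"
proof -
  have b: "\<bar>z i\<bar> \<le> exp (1 * (norm1 d z + 1))" for z :: "nat \<Rightarrow> real"
    using coord_le_norm1'[of z] exp_ge_add_one_self[of "norm1 d z + 1"] by simp
  have m: "(\<lambda>z. z i) \<in> borel_measurable (borel_Rd d)" by measurable
  have "integrable (std_normal_Rd d) (\<lambda>z. z i * F t (add_scaled d x s z))"
    by (rule F_weighted_integrable[OF x m b]) simp
  then show ?thesis by (simp add: mult.commute)
qed

lemma tilted_mean_deriv: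
  assumes x: "x \<in> Rd d"
  shows "((\<lambda>k. \<integral>z. exp (k * z i - k\<^sup>2 / 2) * F t (add_scaled d x s z) \<partial>std_normal_Rd d) has_real_derivative gauss_mean1 d i F t s x) (at 0)"
proof -
  let ?F = "\<lambda>z. F t (add_scaled d x s z)"
  let ?\<psi> = "\<lambda>k. \<integral>z. exp (k * z i - k\<^sup>2 / 2) * ?F z \<partial>std_normal_Rd d"
  let ?q = "\<lambda>k y. (exp (k * y - k\<^sup>2 / 2) - 1) / k"
  have bound: "\<bar>?q k (z i)\<bar> \<le> exp (2 * (norm1 d z + 1))" if "\<bar>k\<bar> \<le> 1" "k \<noteq> 0" for k z
  proof -
    have "exp (2 * (\<bar>z i\<bar> + 1)) \<le> exp (2 * (norm1 d z + 1))" using coord_le_norm1'[of z] by simp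
    then show ?thesis using exp_tilt_quotient_bound[OF that, of "z i"] by (rule order_trans[rotated])
  qed
  have zm [measurable]: "(\<lambda>z. z i) \<in> borel_measurable (borel_Rd d)" by measurable
  have qm: "(\<lambda>z. ?q k (z i)) \<in> borel_measurable (borel_Rd d)" for k
  proof (cases "k = 0")
    case False
    then have "continuous_on UNIV (?q k)" by (intro continuous_intros) auto
    then show ?thesis by (intro measurable_compose[OF zm] borel_measurable_continuous_onI)
  qed simp
  have quot: "(?\<psi> k - ?\<psi> 0) / (k - 0) = (\<integral>z. ?q k (z i) * ?F z \<partial>std_normal_Rd d)" if k: "\<bar>k\<bar> \<le> 1" "k \<noteq> 0" for k
  proof -
    have i1: "integrable (std_normal_Rd d) (\<lambda>z. ?q k (z i) * ?F z)"
      by (rule F_weighted_integrable[OF x qm bound[OF k]]) simp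
    have i0: "integrable (std_normal_Rd d) ?F"
      using F_weighted_integrable[OF x, of "\<lambda>_. 1" 0] by simp
    have "(\<integral>z. exp (k * z i - k\<^sup>2 / 2) * ?F z \<partial>std_normal_Rd d) = (\<integral>z. k * (?q k (z i) * ?F z) + ?F z \<partial>std_normal_Rd d)"
    proof (intro Bochner_Integration.integral_cong refl)
      have "e * F0 = k * ((e - 1) / k * F0) + F0" for e F0 :: real using k by (simp add: left_diff_distrib)
      then show "exp (k * z i - k\<^sup>2 / 2) * ?F z = k * (?q k (z i) * ?F z) + ?F z" for z by blast
    qed
    also have "\<dots> = k * (\<integral>z. ?q k (z i) * ?F z \<partial>std_normal_Rd d) + (\<integral>z. ?F z \<partial>std_normal_Rd d)"
      by (subst Bochner_Integration.integral_add[OF integrable_mult_right[OF i1] i0]) (simp only: integral_mult_right_zero)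
    finally show ?thesis using k by simp
  qed
  \<comment> \<open>The majorant holds for \<open>\<bar>k\<bar> \<le> 1\<close>. The limit is taken
    within an open interval around \<open>0\<close>, where it agrees with the unrestricted
    limit.\<close>
  have "((\<lambda>k. (?\<psi> k - ?\<psi> 0) / (k - 0)) \<longlongrightarrow> gauss_mean1 d i F t s x) (at 0 within {-1<..<1})"
    unfolding tendsto_at_iff_sequentially
  proof (intro allI impI)
    fix k :: "nat \<Rightarrow> real" assume k: "\<forall>n. k n \<in> {-1<..<1} - {0}" "k \<longlonglongrightarrow> 0"
    have kn: "\<bar>k n\<bar> \<le> 1" "k n \<noteq> 0" for n using k(1)[rule_format, of n] by auto
    have "(\<lambda>n. \<integral>z. ?q (k n) (z i) * ?F z \<partial>std_normal_Rd d) \<longlonglongrightarrow> (\<integral>z. z i * ?F z \<partial>std_normal_Rd d)"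
    proof (rule integral_dominated_convergence[where w="\<lambda>z. C * exp (2 + norm1 d x) * exp ((2 + \<bar>s\<bar>) * norm1 d z)"])
      show "integrable (std_normal_Rd d) (\<lambda>z. C * exp (2 + norm1 d x) * exp ((2 + \<bar>s\<bar>) * norm1 d z))"
        using integrable_std_normal_Rd_exp unfolding norm1_def by (intro integrable_mult_right) auto
      show "(\<lambda>z. z i * ?F z) \<in> borel_measurable (std_normal_Rd d)"
        using borel_measurable_times[OF zm F_add_scaled_measurable[OF x]] by simp
      show "(\<lambda>z. ?q (k n) (z i) * ?F z) \<in> borel_measurable (std_normal_Rd d)" for n
        using borel_measurable_times[OF qm F_add_scaled_measurable[OF x]] by simp
      show "AE z in std_normal_Rd d. norm (?q (k n) (z i) * ?F z) \<le> C * exp (2 + norm1 d x) * exp ((2 + \<bar>s\<bar>) * norm1 d z)" for n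
        unfolding real_norm_def by (intro AE_I2 F_weighted_bound x bound kn) simp
      show "AE z in std_normal_Rd d. (\<lambda>n. ?q (k n) (z i) * ?F z) \<longlonglongrightarrow> z i * ?F z"
      proof (intro AE_I2 tendsto_mult tendsto_const)
        fix z :: "nat \<Rightarrow> real"
        have "((\<lambda>k. exp (k * z i - k\<^sup>2 / 2)) has_real_derivative z i) (at 0)"
          by (auto intro!: derivative_eq_intros)
        then have "((\<lambda>k. ?q k (z i)) \<longlongrightarrow> z i) (at 0)" by (simp add: has_field_derivative_iff)
        then have "((\<lambda>k. ?q k (z i)) \<circ> k) \<longlonglongrightarrow> z i"
          using k kn unfolding tendsto_at_iff_sequentially by auto
        then show "(\<lambda>n. ?q (k n) (z i)) \<longlonglongrightarrow> z i" by (simp add: comp_def)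
      qed
    qed
    then show "((\<lambda>k. (?\<psi> k - ?\<psi> 0) / (k - 0)) \<circ> k) \<longlonglongrightarrow> gauss_mean1 d i F t s x"
      unfolding comp_def quot[OF kn] by (simp add: gauss_mean1_def mult.commute)
  qed
  then have "((\<lambda>k. (?\<psi> k - ?\<psi> 0) / (k - 0)) \<longlongrightarrow> gauss_mean1 d i F t s x) (at 0)"
    by (subst (asm) at_within_open) auto
  then show ?thesis by (simp only: has_field_derivative_iff)
qed

text \<open>Moving \<open>x i\<close> to \<open>b\<close> amounts to shifting the noise by
  \<open>(b - x i) / s\<close>. The tilt formula makes this a tilted mean, and the chain rule
  contributes the factor \<open>1 / s\<close>.\<close>

lemma gauss_mean_deriv:
  assumes x: "x \<in> Rd d" and s: "s > 0"
  shows "((\<lambda>b. gauss_mean d F t s (x(i := b))) has_real_derivative gauss_mean1 d i F t s x / s) (at (x i))"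
proof -
  let ?\<psi> = "\<lambda>k. \<integral>z. exp (k * z i - k\<^sup>2 / 2) * F t (add_scaled d x s z) \<partial>std_normal_Rd d"
  have eq: "gauss_mean d F t s (x(i := b)) = ?\<psi> ((b - x i) / s)" for b
  proof -
    have "add_scaled d (x(i := b)) s z = add_scaled d x s (z(i := z i + (b - x i) / s))" for z
      using s by (intro Rd_eqI[of _ d]) (auto simp: field_simps)
    then have "gauss_mean d F t s (x(i := b)) = (\<integral>z. F t (add_scaled d x s (z(i := z i + (b - x i) / s))) \<partial>std_normal_Rd d)"
      by (simp add: gauss_mean_def)
    also have "\<dots> = ?\<psi> ((b - x i) / s)"
      by (rule integral_std_normal_Rd_shift[OF i F_add_scaled_measurable[OF x]])
    finally show ?thesis .
  qed
  have "((\<lambda>b. (b - x i) / s) has_real_derivative 1 / s) (at (x i))"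
    using s by (auto intro!: derivative_eq_intros)
  moreover have "(?\<psi> has_real_derivative gauss_mean1 d i F t s x) (at ((x i - x i) / s))"
    using tilted_mean_deriv[OF x] by simp
  ultimately have "((\<lambda>b. ?\<psi> ((b - x i) / s)) has_real_derivative gauss_mean1 d i F t s x * (1 / s)) (at (x i))"
    by (rule DERIV_chain2[rotated])
  then show ?thesis by (simp add: eq)
qed

definition norm1_sq_mean :: real where
  "norm1_sq_mean = (\<integral>z. (norm1 d z)\<^sup>2 \<partial>std_normal_Rd d)"

lemma norm1_sq_integrable: "integrable (std_normal_Rd d) (\<lambda>z. (norm1 d z)\<^sup>2)"
proof (rule integrable_std_normal_Rd'[where c=2 and C=1])
  fix z
  have "(norm1 d z)\<^sup>2 \<le> (exp (norm1 d z))\<^sup>2" using norm1_le_exp by (intro power_mono) auto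
  then show "\<bar>(norm1 d z)\<^sup>2\<bar> \<le> 1 * exp (2 * norm1 d z)" by (simp add: exp_of_nat_mult[of 2, symmetric])
qed measurable

lemma gauss_mean1_bound:
  assumes x: "x \<in> Rd d"
  shows "\<bar>gauss_mean1 d i F t s x\<bar> \<le> C * ((1 + norm1 d x) * d + \<bar>s\<bar> * norm1_sq_mean)"
proof -
  have C: "C \<ge> 0" by (rule lin_growth_nonneg[OF gr])
  have "\<bar>gauss_mean1 d i F t s x\<bar> \<le> (\<integral>z. \<bar>F t (add_scaled d x s z) * z i\<bar> \<partial>std_normal_Rd d)"
    unfolding gauss_mean1_def by (rule integral_abs_bound)
  also have "\<dots> \<le> (\<integral>z. C * ((1 + norm1 d x) * norm1 d z + \<bar>s\<bar> * (norm1 d z)\<^sup>2) \<partial>std_normal_Rd d)"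
  proof (intro integral_mono integrable_abs gauss_mean1_integrable x)
    show "integrable (std_normal_Rd d) (\<lambda>z. C * ((1 + norm1 d x) * norm1 d z + \<bar>s\<bar> * (norm1 d z)\<^sup>2))"
      using integrable_norm1 norm1_sq_integrable by simp
    fix z :: "nat \<Rightarrow> real"
    have "\<bar>F t (add_scaled d x s z)\<bar> * \<bar>z i\<bar> \<le> (C * (1 + norm1 d x + \<bar>s\<bar> * norm1 d z)) * norm1 d z"
      using lin_growth_add_scaled[OF gr] coord_le_norm1' C by (intro mult_mono mult_nonneg_nonneg add_nonneg_nonneg) auto
    then show "\<bar>F t (add_scaled d x s z) * z i\<bar> \<le> C * ((1 + norm1 d x) * norm1 d z + \<bar>s\<bar> * (norm1 d z)\<^sup>2)"
      by (simp add: abs_mult power2_eq_square algebra_simps)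
  qed
  also have "\<dots> = C * ((1 + norm1 d x) * (\<integral>z. norm1 d z \<partial>std_normal_Rd d) + \<bar>s\<bar> * norm1_sq_mean)"
    using integrable_norm1 norm1_sq_integrable by (simp add: norm1_sq_mean_def)
  also have "\<dots> \<le> C * ((1 + norm1 d x) * d + \<bar>s\<bar> * norm1_sq_mean)"
    using C expectation_norm1_le by (intro mult_left_mono add_right_mono) auto
  finally show ?thesis .
qed

lemma gauss_mean1_measurable:
  assumes [measurable]: "b \<in> borel_measurable N" "a \<in> borel_measurable N" "X \<in> N \<rightarrow>\<^sub>M borel_Rd d"
  shows "(\<lambda>\<omega>. gauss_mean1 d i F (b \<omega>) (a \<omega>) (X \<omega>)) \<in> borel_measurable N"
proof -
  have [measurable]: "(\<lambda>p. F (b (fst p)) (add_scaled d (X (fst p)) (a (fst p)) (snd p))) \<in> borel_measurable (N \<Otimes>\<^sub>M std_normal_Rd d)"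
    by (rule continuous_Rd_measurable[OF F]) measurable
  have "(\<lambda>(\<omega>, z). F (b \<omega>) (add_scaled d (X \<omega>) (a \<omega>) z) * z i) \<in> borel_measurable (N \<Otimes>\<^sub>M std_normal_Rd d)"
    unfolding case_prod_unfold by measurable
  then show ?thesis unfolding gauss_mean1_def by (rule gauss.borel_measurable_lebesgue_integral)
qed

lemma norm1_fun_upd_le: "norm1 d (x(i := b)) \<le> norm1 d x + \<bar>b - x i\<bar>"
proof -
  have "norm1 d (x(i := b)) \<le> (\<Sum>j=1..d. \<bar>x j\<bar> + (if j = i then \<bar>b - x i\<bar> else 0))"
    unfolding norm1_def by (intro sum_mono) auto
  also have "\<dots> = norm1 d x + \<bar>b - x i\<bar>" using i by (simp add: sum.distrib norm1_def)
  finally show ?thesis .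
qed

text \<open>The derivative of the Gaussian step brings in \<open>1 / sqrt (2 * s * q)\<close>,
  singular at \<open>q = 0\<close> but integrable.\<close>

definition heat_mean1 :: "real \<Rightarrow> real \<Rightarrow> rvec \<Rightarrow> real" where
  "heat_mean1 t s x = (\<integral>q. indicator {0..1} q * (gauss_mean1 d i F (t - s * q) (sqrt (2 * s * q)) x / sqrt (2 * s * q)) \<partial>lborel)"

text \<open>The mean value inequality on a unit neighbourhood of \<open>x i\<close>. Its only
  singular factor is \<open>1 / a\<close>, which for \<open>a = sqrt (2 * s * q)\<close> gives an
  integrable majorant of the difference quotients of \<open>heat_mean\<close>.\<close>

lemma gauss_mean_difference_bound:
  assumes x: "x \<in> Rd d" and a: "a > 0" and b: "\<bar>b - x i\<bar> \<le> 1"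
  shows "\<bar>gauss_mean d F t a (x(i := b)) - gauss_mean d F t a x\<bar> \<le> C * ((2 + norm1 d x) * d + a * norm1_sq_mean) / a * \<bar>b - x i\<bar>"
proof -
  have C: "C \<ge> 0" by (rule lin_growth_nonneg[OF gr])
  let ?B = "C * ((2 + norm1 d x) * d + a * norm1_sq_mean) / a"
  have "norm (gauss_mean d F t a (x(i := b)) - gauss_mean d F t a (x(i := x i))) \<le> ?B * norm (b - x i)"
  proof (rule field_differentiable_bound[where S="{x i - 1..x i + 1}" and f'="\<lambda>c. gauss_mean1 d i F t a (x(i := c)) / a"])
    fix c assume c: "c \<in> {x i - 1..x i + 1}"
    have "((\<lambda>b. gauss_mean d F t a ((x(i := c))(i := b))) has_real_derivative gauss_mean1 d i F t a (x(i := c)) / a) (at ((x(i := c)) i))"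
      using x i by (intro gauss_mean_deriv a) auto
    then have "((\<lambda>b. gauss_mean d F t a (x(i := b))) has_real_derivative gauss_mean1 d i F t a (x(i := c)) / a) (at c)"
      by (simp only: fun_upd_upd fun_upd_same)
    then show "((\<lambda>b. gauss_mean d F t a (x(i := b))) has_field_derivative gauss_mean1 d i F t a (x(i := c)) / a) (at c within {x i - 1..x i + 1})"
      by (rule has_field_derivative_at_within)
    have "\<bar>gauss_mean1 d i F t a (x(i := c))\<bar> \<le> C * ((1 + norm1 d (x(i := c))) * d + \<bar>a\<bar> * norm1_sq_mean)"
      using x i by (intro gauss_mean1_bound) auto
    also have "\<dots> \<le> C * ((2 + norm1 d x) * d + a * norm1_sq_mean)"
    proof (intro mult_left_mono add_mono C)
      have "\<bar>c - x i\<bar> \<le> 1" using c by (simp add: abs_le_iff)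
      then have "1 + norm1 d (x(i := c)) \<le> 2 + norm1 d x" using norm1_fun_upd_le[of x c] by linarith
      then show "(1 + norm1 d (x(i := c))) * real d \<le> (2 + norm1 d x) * real d" by (rule mult_right_mono) simp
      show "\<bar>a\<bar> * norm1_sq_mean \<le> a * norm1_sq_mean" using a by simp
    qed
    finally show "norm (gauss_mean1 d i F t a (x(i := c)) / a) \<le> ?B"
      using a by (simp add: abs_divide divide_right_mono)
  qed (use b in \<open>auto simp: abs_le_iff\<close>)
  then show ?thesis by simp
qed

lemma heat_mean_deriv:
  assumes x: "x \<in> Rd d" and s: "s > 0"
  shows "((\<lambda>b. heat_mean d F t s (x(i := b))) has_real_derivative heat_mean1 t s x) (at (x i))"
proof -
  have C: "C \<ge> 0" by (rule lin_growth_nonneg[OF gr])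
  have M0: "norm1_sq_mean \<ge> 0" unfolding norm1_sq_mean_def by (intro integral_nonneg_AE) simp
  let ?G = "\<lambda>b q. gauss_mean d F (t - s * q) (sqrt (2 * s * q)) (x(i := b))"
  \<comment> \<open>Chosen so that \<open>sqrt (2 * s * q) = sqrt (2 * s) * sqrt q\<close> turns the
    preceding bound into \<open>B / sqrt q\<close>.\<close>
  define B where "B = C * ((2 + norm1 d x) * d + sqrt (2 * s) * norm1_sq_mean) / sqrt (2 * s)"
  have xb: "x(i := b) \<in> Rd d" for b using x i by simp
  have Gm: "?G b \<in> borel_measurable borel" for b
    using xb by (intro gauss_mean_measurable[OF F]) auto
  have Gi: "integrable lborel (\<lambda>q. indicator {0..1} q * ?G b q)" for b
  proof (rule integrable_indicator_bound[OF Gm])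
    fix q :: real assume q: "q \<in> {0..1}"
    then have "s * q \<in> {0..s}" using s by (auto simp: mult_le_cancel_left1)
    then show "\<bar>?G b q\<bar> \<le> C * (1 + norm1 d (x(i := b)) + sqrt (2 * s) * d)"
      using gauss_mean_bound_time[OF F gr xb, of "s * q" s "t - s * q" b] by (simp add: mult.assoc)
  qed
  let ?Q = "\<lambda>b q. indicator {0..1} q * ((?G b q - ?G (x i) q) / (b - x i))"
  have quot: "(heat_mean d F t s (x(i := b)) - heat_mean d F t s (x(i := x i))) / (b - x i) = (\<integral>q. ?Q b q \<partial>lborel)" for b
  proof -
    have "heat_mean d F t s (x(i := b)) - heat_mean d F t s (x(i := x i)) = (\<integral>q. indicator {0..1} q * ?G b q - indicator {0..1} q * ?G (x i) q \<partial>lborel)"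
      unfolding heat_mean_def by (rule Bochner_Integration.integral_diff[OF Gi Gi, symmetric])
    then have "(heat_mean d F t s (x(i := b)) - heat_mean d F t s (x(i := x i))) / (b - x i) = (\<integral>q. (indicator {0..1} q * ?G b q - indicator {0..1} q * ?G (x i) q) / (b - x i) \<partial>lborel)"
      by simp
    also have "\<dots> = (\<integral>q. ?Q b q \<partial>lborel)" by (simp add: right_diff_distrib)
    finally show ?thesis .
  qed
  have "((\<lambda>b. (heat_mean d F t s (x(i := b)) - heat_mean d F t s (x(i := x i))) / (b - x i)) \<longlongrightarrow> heat_mean1 t s x) (at (x i) within {x i - 1<..<x i + 1})"
    unfolding tendsto_at_iff_sequentially
  proof (intro allI impI)
    fix b :: "nat \<Rightarrow> real" assume b: "\<forall>n. b n \<in> {x i - 1<..<x i + 1} - {x i}" "b \<longlonglongrightarrow> x i"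
    have bn: "\<bar>b n - x i\<bar> \<le> 1" "b n \<noteq> x i" for n using b(1)[rule_format, of n] by auto
    have "(\<lambda>n. \<integral>q. ?Q (b n) q \<partial>lborel) \<longlonglongrightarrow> heat_mean1 t s x"
      unfolding heat_mean1_def
    proof (rule integral_dominated_convergence[where w="\<lambda>q. indicator {0..1} q * (B / sqrt q)"])
      show "(\<lambda>q. indicator {0..1} q * (gauss_mean1 d i F (t - s * q) (sqrt (2 * s * q)) x / sqrt (2 * s * q))) \<in> borel_measurable lborel"
        using x by (intro borel_measurable_times borel_measurable_divide gauss_mean1_measurable) auto
      show "?Q (b n) \<in> borel_measurable lborel" for n
      proof -
        have "?G b \<in> borel_measurable lborel" for b using Gm[of b] by simp
        then show ?thesis
          by (intro borel_measurable_times borel_measurable_divide borel_measurable_diff borel_measurable_const borel_measurable_indicator) simp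
      qed
      show "integrable lborel (\<lambda>q. indicator {0..1} q * (B / sqrt q))" by (rule integrable_inv_sqrt)
      show "AE q in lborel. (\<lambda>n. ?Q (b n) q) \<longlonglongrightarrow> indicator {0..1} q * (gauss_mean1 d i F (t - s * q) (sqrt (2 * s * q)) x / sqrt (2 * s * q))"
        using AE_lborel_singleton[of 0]
      proof eventually_elim
        case (elim q)
        show ?case
        proof (cases "q \<in> {0..1}")
          case True
          then have "sqrt (2 * s * q) > 0" using elim s by simp
          from gauss_mean_deriv[OF x this, of "t - s * q"]
          have "((\<lambda>y. (?G y q - ?G (x i) q) / (y - x i)) \<longlongrightarrow> gauss_mean1 d i F (t - s * q) (sqrt (2 * s * q)) x / sqrt (2 * s * q)) (at (x i))"
            by (simp only: has_field_derivative_iff)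
          then have "((\<lambda>y. (?G y q - ?G (x i) q) / (y - x i)) \<circ> b) \<longlonglongrightarrow> gauss_mean1 d i F (t - s * q) (sqrt (2 * s * q)) x / sqrt (2 * s * q)"
            using b bn unfolding tendsto_at_iff_sequentially by auto
          then show ?thesis unfolding comp_def by (intro tendsto_mult tendsto_const)
        qed simp
      qed
      fix n
      show "AE q in lborel. norm (?Q (b n) q) \<le> indicator {0..1} q * (B / sqrt q)"
        using AE_lborel_singleton[of 0]
      proof eventually_elim
        case (elim q)
        show ?case
        proof (cases "q \<in> {0..1}")
          case True
          let ?a = "sqrt (2 * s * q)"
          have a: "?a > 0" "?a = sqrt (2 * s) * sqrt q" using True elim s by (simp_all add: real_sqrt_mult)
          have "2 * s * q \<le> 2 * s * 1" using True s by (intro mult_left_mono) auto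
          then have as: "?a \<le> sqrt (2 * s)" by simp
          have "\<bar>?G (b n) q - gauss_mean d F (t - s * q) ?a x\<bar> \<le> C * ((2 + norm1 d x) * d + ?a * norm1_sq_mean) / ?a * \<bar>b n - x i\<bar>"
            by (rule gauss_mean_difference_bound[OF x a(1) bn(1)])
          then have "\<bar>(?G (b n) q - ?G (x i) q) / (b n - x i)\<bar> \<le> C * ((2 + norm1 d x) * d + ?a * norm1_sq_mean) / ?a"
            using bn(2)[of n] by (simp add: abs_divide divide_le_eq)
          also have "\<dots> \<le> C * ((2 + norm1 d x) * d + sqrt (2 * s) * norm1_sq_mean) / ?a"
            using as C M0 a(1) by (intro divide_right_mono mult_left_mono add_left_mono mult_right_mono) auto
          also have "\<dots> = B / sqrt q" by (simp add: B_def a(2))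
          finally show ?thesis using True by simp
        qed simp
      qed
    qed
    then show "((\<lambda>b. (heat_mean d F t s (x(i := b)) - heat_mean d F t s (x(i := x i))) / (b - x i)) \<circ> b) \<longlonglongrightarrow> heat_mean1 t s x"
      unfolding comp_def quot .
  qed
  then have "((\<lambda>b. (heat_mean d F t s (x(i := b)) - heat_mean d F t s (x(i := x i))) / (b - x i)) \<longlongrightarrow> heat_mean1 t s x) (at (x i))"
    by (subst (asm) at_within_open) auto
  then show ?thesis by (simp only: has_field_derivative_iff)
qed

end

context pde_solution
begin

text \<open>Both sides differentiate the same function of \<open>x i\<close>: once as the classical
  solution, once through its Duhamel representation. Uniqueness of derivatives identifies
  them.\<close>

lemma gradient_formula:
  assumes t: "t \<in> {0<..T}" and x: "x \<in> Rd d" and i: "i \<in> {1..d}"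
  shows "space_deriv i (u t) x = gauss_mean1 d i gc t (sqrt (2 * t)) x / sqrt (2 * t) + t * heat_mean1 d hc i t t x"
proof (rule DERIV_unique)
  have tT: "t \<in> {0..T}" "t > 0" "sqrt (2 * t) > 0" using t by auto
  show "((\<lambda>b. u t (x(i := b))) has_real_derivative space_deriv i (u t) x) (at (x i))"
    by (rule u_space[OF tT(1) x i])
  have "(\<lambda>b. u t (x(i := b))) = (\<lambda>b. gauss_mean d gc t (sqrt (2 * t)) (x(i := b)) + t * heat_mean d hc t t (x(i := b)))"
    using duhamel[OF tT(1)] x i by (simp add: v_def fun_eq_iff)
  moreover have "((\<lambda>b. gauss_mean d gc t (sqrt (2 * t)) (x(i := b)) + t * heat_mean d hc t t (x(i := b)))
     has_real_derivative gauss_mean1 d i gc t (sqrt (2 * t)) x / sqrt (2 * t) + t * heat_mean1 d hc i t t x) (at (x i))"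
    by (intro DERIV_add DERIV_cmult gauss_mean_deriv[OF gc_cont gc_growth i x tT(3)] heat_mean_deriv[OF hc_cont hc_growth i x tT(2)])
  ultimately show "((\<lambda>b. u t (x(i := b))) has_real_derivative gauss_mean1 d i gc t (sqrt (2 * t)) x / sqrt (2 * t) + t * heat_mean1 d hc i t t x) (at (x i))"
    by simp
qed

end

section \<open>Fixed-point equation and dimension-free bounds\<close>

definition noise_law :: "nat \<Rightarrow> (rvec \<times> real) measure" where
  "noise_law d = std_normal_Rd d \<Otimes>\<^sub>M sqrt_law"

lemma prob_space_noise_law: "prob_space (noise_law d)"
proof -
  interpret pair_prob_space "std_normal_Rd d" sqrt_law
    by (intro pair_prob_space.intro pair_sigma_finite.intro prob_space_imp_sigma_finite prob_space_std_normal_Rd prob_space_sqrt_law)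
  show ?thesis unfolding noise_law_def by unfold_locales
qed

lemma sets_noise_law [measurable_cong, simp]: "sets (noise_law d) = sets (borel_Rd d \<Otimes>\<^sub>M borel)"
  unfolding noise_law_def by (intro sets_pair_measure_cong) auto

lemma space_noise_law [simp]: "space (noise_law d) = Rd d \<times> UNIV"
  by (simp add: noise_law_def space_pair_measure)

lemma AE_sqrt_law: "AE \<rho> in sqrt_law. \<rho> \<in> {0<..<1}"
  unfolding sqrt_law_def by (subst AE_density) (use inv_sqrt_measurable[of "{0<..<1}"] in \<open>auto simp: indicator_def\<close>)

lemma AE_noise_law: "AE p in noise_law d. snd p \<in> {0<..<1}"
proof -
  interpret pair_prob_space "std_normal_Rd d" sqrt_law
    by (intro pair_prob_space.intro pair_sigma_finite.intro prob_space_imp_sigma_finite prob_space_std_normal_Rd prob_space_sqrt_law)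
  have "(\<lambda>p. snd p) \<in> borel_measurable (std_normal_Rd d \<Otimes>\<^sub>M sqrt_law)" by measurable
  from measurable_sets[OF this, of "{0<..<1}"]
  have "{p \<in> space (std_normal_Rd d \<Otimes>\<^sub>M sqrt_law). snd p \<in> {0<..<1}} \<in> sets (std_normal_Rd d \<Otimes>\<^sub>M sqrt_law)"
    by (simp add: vimage_def Int_def conj_commute)
  then show ?thesis unfolding noise_law_def
    by (rule AE_pair_measure) (use AE_sqrt_law in simp)
qed

lemma noise_law_fst:
  fixes w :: "rvec \<Rightarrow> real"
  assumes "integrable (std_normal_Rd d) w"
  shows "integrable (noise_law d) (\<lambda>p. w (fst p))"
proof -
  interpret prob_space sqrt_law by (rule prob_space_sqrt_law)
  have "distr (noise_law d) (std_normal_Rd d) fst = std_normal_Rd d"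
    unfolding noise_law_def by (rule distr_pair_fst)
  with assms show ?thesis
    by (metis integrable_distr measurable_fst noise_law_def)
qed

text \<open>\<open>2 * t * sqrt \<rho>\<close> is \<open>t\<close> divided by the density
  \<open>1 / (2 * sqrt \<rho>)\<close> of the sampled time. In the gradient components its
  \<open>sqrt \<rho>\<close> cancels the singular factor \<open>1 / sqrt \<rho>\<close>, which is
  why this density is sampled: the weights keep finite second moments.\<close>

definition path_weight :: "real \<Rightarrow> nat \<Rightarrow> rvec \<times> real \<Rightarrow> real" where
  "path_weight t k = (\<lambda>(z, \<rho>). 2 * t * sqrt \<rho> * join_vec 1 (\<lambda>j. 1 / sqrt (2 * t * \<rho>) * z j) k)"

lemma path_weight_simps:
  assumes "t > 0" "\<rho> > 0"
  shows "path_weight t 0 (z, \<rho>) = 2 * t * sqrt \<rho>"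
    and "k \<noteq> 0 \<Longrightarrow> path_weight t k (z, \<rho>) = sqrt (2 * t) * z k"
proof -
  have "2 * t = sqrt (2 * t) * sqrt (2 * t)" using assms by simp
  then show "path_weight t k (z, \<rho>) = sqrt (2 * t) * z k" if "k \<noteq> 0"
    using assms that by (simp add: path_weight_def join_vec_def real_sqrt_mult field_simps)
qed (simp add: path_weight_def join_vec_def)

lemma path_weight_abs_le:
  assumes t: "t > 0" and \<rho>: "\<rho> \<in> {0<..<1}" and k: "k \<in> {0..d}"
  shows "\<bar>path_weight t k (z, \<rho>)\<bar> \<le> (2 * t + sqrt (2 * t)) * (1 + norm1 d z)"
proof (cases "k = 0")
  case True
  have "2 * t * sqrt \<rho> \<le> 2 * t * 1" using t \<rho> by (intro mult_left_mono) auto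
  also have "\<dots> \<le> (2 * t + sqrt (2 * t)) * (1 + norm1 d z)"
    using t by (simp add: distrib_right distrib_left add_nonneg_nonneg)
  finally show ?thesis using True t \<rho> by (simp add: path_weight_simps abs_mult)
next
  case False
  then have "\<bar>z k\<bar> \<le> norm1 d z" unfolding norm1_def using k by (intro member_le_sum) auto
  then have "sqrt (2 * t) * \<bar>z k\<bar> \<le> sqrt (2 * t) * norm1 d z" using t by (intro mult_left_mono) auto
  also have "\<dots> \<le> (2 * t + sqrt (2 * t)) * (1 + norm1 d z)"
    using t by (simp add: distrib_right distrib_left add_nonneg_nonneg)
  finally show ?thesis using False t \<rho> by (simp add: path_weight_simps abs_mult)
qed

lemma path_weight_measurable:
  assumes "k \<in> {0..d}"
  shows "path_weight t k \<in> borel_measurable (borel_Rd d \<Otimes>\<^sub>M borel)"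
proof -
  have [measurable]: "(\<lambda>p. fst p k) \<in> borel_measurable (borel_Rd d \<Otimes>\<^sub>M borel)"
    by (rule measurable_coord_Rd[OF measurable_fst])
  show ?thesis unfolding path_weight_def join_vec_def case_prod_unfold
    by (cases "k = 0") simp_all
qed

text \<open>\<open>\<kappa>\<close> collects the data at the origin, as in
  \<open>u_zero_bound\<close>, and \<open>E\<close> is the growth of the Lipschitz constant up to
  \<open>T\<close>. The three summands bound the square of the value at the origin, of the increment
  away from it, and of a partial derivative, each up to the factor
  \<open>Dl\<^sup>2\<close>.\<close>

definition u_const :: "real \<Rightarrow> real \<Rightarrow> real" where
  "u_const T lam = (let E = exp (lam * T); \<kappa> = lam * (1 + sqrt (2 * T)) + T * (lam + lam * (E * (lam * sqrt (2 * T))) + lam * (E * lam))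
     in 2 * (2 * \<kappa> * exp (2 * lam * T))\<^sup>2 + 2 * E\<^sup>2 * lam + (E * lam)\<^sup>2)"

context pde_solution
begin

definition uvec :: "real \<Rightarrow> rvec \<Rightarrow> nat \<Rightarrow> real" where
  "uvec t x = join_vec (u t x) (space_grad d (u t) x)"

definition source_term :: "real \<Rightarrow> rvec \<Rightarrow> nat \<Rightarrow> rvec \<times> real \<Rightarrow> real" where
  "source_term t x k p = path_weight t k p * hc (t * (1 - snd p)) (add_scaled d x (sqrt (2 * t * snd p)) (fst p))"

lemma source_term_measurable:
  assumes x: "x \<in> Rd d" and k: "k \<in> {0..d}"
  shows "source_term t x k \<in> borel_measurable (borel_Rd d \<Otimes>\<^sub>M borel)"
proof -
  have "(\<lambda>p. hc (t * (1 - snd p)) (add_scaled d x (sqrt (2 * t * snd p)) (fst p))) \<in> borel_measurable (borel_Rd d \<Otimes>\<^sub>M borel)"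
    using x by (intro continuous_Rd_measurable[OF hc_cont] measurable_add_scaled) auto
  with path_weight_measurable[OF k] show ?thesis
    unfolding source_term_def by (intro borel_measurable_times)
qed

lemma source_term_integrable:
  assumes t: "t \<in> {0<..T}" and x: "x \<in> Rd d" and k: "k \<in> {0..d}"
  shows "integrable (noise_law d) (source_term t x k)"
proof (rule Bochner_Integration.integrable_bound)
  let ?w = "\<lambda>z. ((2 * t + sqrt (2 * t)) * (1 + norm1 d z)) * (Cg * (1 + norm1 d x + sqrt (2 * t) * norm1 d z))"
  have "integrable (std_normal_Rd d) ?w"
  proof (rule integrable_std_normal_Rd'[where c="1 + sqrt (2 * t)" and C="(2 * t + sqrt (2 * t)) * (Cg * exp (norm1 d x))"])
    fix z
    have c0: "0 \<le> 2 * t + sqrt (2 * t)" using t by simp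
    have 1: "1 + norm1 d z \<le> exp (norm1 d z)" by (rule exp_ge_add_one_self)
    have 2: "1 + norm1 d x + sqrt (2 * t) * norm1 d z \<le> exp (norm1 d x + sqrt (2 * t) * norm1 d z)"
      using exp_ge_add_one_self[of "norm1 d x + sqrt (2 * t) * norm1 d z"] by linarith
    have nn: "0 \<le> 1 + norm1 d z" "0 \<le> 1 + norm1 d x + sqrt (2 * t) * norm1 d z" using t by (simp_all add: add_nonneg_nonneg)
    have "?w z \<le> ((2 * t + sqrt (2 * t)) * exp (norm1 d z)) * (Cg * exp (norm1 d x + sqrt (2 * t) * norm1 d z))"
      using 1 2 nn c0 Cg(1) by (intro mult_mono mult_left_mono mult_nonneg_nonneg) auto
    also have "\<dots> = (2 * t + sqrt (2 * t)) * (Cg * exp (norm1 d x)) * exp ((1 + sqrt (2 * t)) * norm1 d z)"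
      by (simp add: exp_add algebra_simps)
    finally have "?w z \<le> (2 * t + sqrt (2 * t)) * (Cg * exp (norm1 d x)) * exp ((1 + sqrt (2 * t)) * norm1 d z)" .
    moreover have "0 \<le> ?w z" using nn c0 Cg(1) by (intro mult_nonneg_nonneg) auto
    ultimately show "\<bar>?w z\<bar> \<le> (2 * t + sqrt (2 * t)) * (Cg * exp (norm1 d x)) * exp ((1 + sqrt (2 * t)) * norm1 d z)"
      by simp
  qed measurable
  then show "integrable (noise_law d) (\<lambda>p. ?w (fst p))" by (rule noise_law_fst)
  show "source_term t x k \<in> borel_measurable (noise_law d)" using source_term_measurable[OF x k] by simp
  show "AE p in noise_law d. norm (source_term t x k p) \<le> norm (?w (fst p))"
    using AE_noise_law
  proof eventually_elim
    case (elim p)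
    obtain z \<rho> where p: "p = (z, \<rho>)" by (cases p)
    have \<rho>: "\<rho> \<in> {0<..<1}" using elim by (simp add: p)
    have t0: "t > 0" using t by simp
    have "\<bar>sqrt (2 * t * \<rho>)\<bar> \<le> sqrt (2 * t)" using t \<rho> by (simp add: mult_le_cancel_left1)
    then have "Cg * (1 + norm1 d x + \<bar>sqrt (2 * t * \<rho>)\<bar> * norm1 d z) \<le> Cg * (1 + norm1 d x + sqrt (2 * t) * norm1 d z)"
      using Cg(1) by (intro mult_left_mono add_left_mono mult_right_mono) auto
    then have "\<bar>hc (t * (1 - \<rho>)) (add_scaled d x (sqrt (2 * t * \<rho>)) z)\<bar> \<le> Cg * (1 + norm1 d x + sqrt (2 * t) * norm1 d z)"
      using lin_growth_add_scaled[OF hc_growth] by (rule order_trans[rotated])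
    then have "\<bar>source_term t x k p\<bar> \<le> ?w z"
      unfolding source_term_def p abs_mult fst_conv snd_conv using path_weight_abs_le[OF t0 \<rho> k, of z] by (intro mult_mono) auto
    then show ?case by (simp add: p)
  qed
qed

text \<open>Once the time variable is integrated out, its density cancels against the weight and
  leaves \<open>t\<close> times the corresponding heat average; the endpoints of the unit interval
  are null.\<close>

lemma source_term_integral:
  assumes t: "t \<in> {0<..T}" and x: "x \<in> Rd d" and k: "k \<in> {0..d}"
  shows "(\<integral>p. source_term t x k p \<partial>noise_law d) = (if k = 0 then t * heat_mean d hc t t x else t * heat_mean1 d hc k t t x)"
proof -
  interpret pair_prob_space "std_normal_Rd d" sqrt_law
    by (intro pair_prob_space.intro pair_sigma_finite.intro prob_space_imp_sigma_finite prob_space_std_normal_Rd prob_space_sqrt_law)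
  have t0: "t > 0" using t by simp
  let ?S = "\<lambda>\<rho>. \<integral>z. source_term t x k (z, \<rho>) \<partial>std_normal_Rd d"
  have i: "integrable (std_normal_Rd d \<Otimes>\<^sub>M sqrt_law) (source_term t x k)"
    using source_term_integrable[OF t x k] by (simp add: noise_law_def)
  have "(\<lambda>(\<rho>, z). source_term t x k (z, \<rho>)) \<in> borel_measurable (sqrt_law \<Otimes>\<^sub>M std_normal_Rd d)"
    using source_term_measurable[OF x k, of t] by measurable
  then have m: "?S \<in> borel_measurable borel"
    using gauss.borel_measurable_lebesgue_integral[of "\<lambda>\<rho> z. source_term t x k (z, \<rho>)" sqrt_law] by simp
  have "(\<integral>p. source_term t x k p \<partial>noise_law d) = (\<integral>\<rho>. ?S \<rho> \<partial>sqrt_law)"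
    unfolding noise_law_def using integral_snd[of "\<lambda>z \<rho>. source_term t x k (z, \<rho>)"] i by simp
  also have "\<dots> = (\<integral>\<rho>. indicator {0<..<1} \<rho> / (2 * sqrt \<rho>) * ?S \<rho> \<partial>lborel)"
    unfolding sqrt_law_def using m inv_sqrt_measurable[of "{0<..<1}"]
    by (subst integral_density) (auto simp: indicator_def)
  also have "\<dots> = (\<integral>\<rho>. t * (if k = 0 then indicator {0..1} \<rho> * gauss_mean d hc (t - t * \<rho>) (sqrt (2 * t * \<rho>)) x
      else indicator {0..1} \<rho> * (gauss_mean1 d k hc (t - t * \<rho>) (sqrt (2 * t * \<rho>)) x / sqrt (2 * t * \<rho>))) \<partial>lborel)" (is "_ = (\<integral>\<rho>. t * ?R \<rho> \<partial>lborel)")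
  proof (rule integral_cong_AE)
    show "(\<lambda>\<rho>. indicator {0<..<1} \<rho> / (2 * sqrt \<rho>) * ?S \<rho>) \<in> borel_measurable lborel"
      using borel_measurable_times[OF inv_sqrt_measurable[of "{0<..<1}"] m] by simp
    show "(\<lambda>\<rho>. t * ?R \<rho>) \<in> borel_measurable lborel"
    proof (cases "k = 0")
      case True
      then show ?thesis using x by (simp, intro borel_measurable_times gauss_mean_measurable[OF hc_cont]) auto
    next
      case False
      then have "k \<in> {1..d}" using k by auto
      then show ?thesis using x False by (simp, intro borel_measurable_times borel_measurable_divide gauss_mean1_measurable[OF hc_cont hc_growth]) auto
    qed
    show "AE \<rho> in lborel. indicator {0<..<1} \<rho> / (2 * sqrt \<rho>) * ?S \<rho> = t * ?R \<rho>"
      using AE_lborel_singleton[of 0] AE_lborel_singleton[of 1]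
    proof eventually_elim
      case (elim \<rho>)
      show ?case
      proof (cases "\<rho> \<in> {0<..<1}")
        case True
        then have \<rho>: "\<rho> > 0" "sqrt \<rho> > 0" by auto
        have e: "t * (1 - \<rho>) = t - t * \<rho>" by (simp add: right_diff_distrib)
        show ?thesis
        proof (cases "k = 0")
          case True0: True
          have "?S \<rho> = 2 * t * sqrt \<rho> * gauss_mean d hc (t - t * \<rho>) (sqrt (2 * t * \<rho>)) x"
            unfolding source_term_def True0 fst_conv snd_conv path_weight_simps(1)[OF t0 \<rho>(1)] e by (simp add: gauss_mean_def)
          then show ?thesis using True True0 \<rho> by simp
        next
          case False
          have "?S \<rho> = (\<integral>z. sqrt (2 * t) * (hc (t - t * \<rho>) (add_scaled d x (sqrt (2 * t * \<rho>)) z) * z k) \<partial>std_normal_Rd d)"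
            unfolding source_term_def fst_conv snd_conv path_weight_simps(2)[OF t0 \<rho>(1) False] e by (simp add: mult_ac)
          also have "\<dots> = sqrt (2 * t) * gauss_mean1 d k hc (t - t * \<rho>) (sqrt (2 * t * \<rho>)) x"
            by (simp add: gauss_mean1_def)
          finally have S: "?S \<rho> = sqrt (2 * t) * gauss_mean1 d k hc (t - t * \<rho>) (sqrt (2 * t * \<rho>)) x" .
          have "1 / (2 * r) * (q * G) = t * (G / (q * r))" if "q * q = 2 * t" "r > 0" "q > 0" for q r G :: real
          proof -
            have "t = q * q / 2" using that by simp
            then show ?thesis using that(2,3) by (simp add: field_simps)
          qed
          then have "1 / (2 * sqrt \<rho>) * (sqrt (2 * t) * G) = t * (G / (sqrt (2 * t) * sqrt \<rho>))" for G
            using \<rho> t0 by simp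
          moreover have "sqrt (2 * t * \<rho>) = sqrt (2 * t) * sqrt \<rho>" by (rule real_sqrt_mult)
          moreover have "indicator {0<..<1} \<rho> = (1::real)" "indicator {0..1} \<rho> = (1::real)" using True by auto
          ultimately show ?thesis using False by (simp only: S if_False mult_1)
        qed
      qed (use elim in \<open>auto simp: indicator_def\<close>)
    qed
  qed
  also have "\<dots> = (if k = 0 then t * heat_mean d hc t t x else t * heat_mean1 d hc k t t x)"
  proof (cases "k = 0")
    case True
    then show ?thesis by (simp add: heat_mean_def)
  next
    case False
    then have "k \<in> {1..d}" using k by auto
    from heat_mean1_def[OF hc_cont hc_growth this] False show ?thesis by (simp only: if_False integral_mult_right_zero)
  qed
  finally show ?thesis .
qed

text \<open>Duhamel's formula and the gradient formula as one vector equation. The subtracted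
  \<open>g x\<close> is a control variate: in component \<open>0\<close> it cancels against the
  leading term, in the others it vanishes because \<open>z k\<close> has mean zero.\<close>

lemma uvec_fixed_point:
  assumes t: "t \<in> {0<..T}" and x: "x \<in> Rd d" and k: "k \<in> {0..d}"
  shows "uvec t x k = join_vec (g x) (\<lambda>_. 0) k
     + (\<integral>z. (g (add_scaled d x (sqrt (2 * t)) z) - g x) * join_vec 1 (\<lambda>j. 1 / sqrt (2 * t) * z j) k \<partial>std_normal_Rd d)
     + (\<integral>p. source_term t x k p \<partial>noise_law d)"
proof (cases "k = 0")
  case True
  have "integrable (std_normal_Rd d) (\<lambda>z. g (add_scaled d x (sqrt (2 * t)) z))"
    using integrable_gauss_mean[OF gc_cont gc_growth x, of t "sqrt (2 * t)"] by (simp add: gc_def)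
  then have "(\<integral>z. g (add_scaled d x (sqrt (2 * t)) z) - g x \<partial>std_normal_Rd d) = gauss_mean d gc t (sqrt (2 * t)) x - g x"
    using gauss.prob_space by (simp add: gauss_mean_def gc_def)
  then show ?thesis
    using True duhamel[of t x] t x unfolding source_term_integral[OF t x k] by (simp add: uvec_def join_vec_def v_def)
next
  case False
  then have i: "k \<in> {1..d}" using k by auto
  have i1: "integrable (std_normal_Rd d) (\<lambda>z. g (add_scaled d x (sqrt (2 * t)) z) * z k)"
    using gauss_mean1_integrable[OF gc_cont gc_growth i x, of t "sqrt (2 * t)"] by (simp add: gc_def)
  have i2: "integrable (std_normal_Rd d) (\<lambda>z. z k)"
    using integrable_std_normal_Rd_power[OF i, of 1] by simp
  have "(\<integral>z. (g (add_scaled d x (sqrt (2 * t)) z) - g x) * (1 / sqrt (2 * t) * z k) \<partial>std_normal_Rd d)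
     = (\<integral>z. 1 / sqrt (2 * t) * (g (add_scaled d x (sqrt (2 * t)) z) * z k - g x * z k) \<partial>std_normal_Rd d)"
    by (simp add: field_simps)
  also have "\<dots> = 1 / sqrt (2 * t) * (gauss_mean1 d k gc t (sqrt (2 * t)) x - g x * 0)"
    using i1 i2 std_normal_Rd_moment1[OF i] by (simp add: gauss_mean1_def gc_def)
  finally have e0: "(\<integral>z. (g (add_scaled d x (sqrt (2 * t)) z) - g x) * (1 / sqrt (2 * t) * z k) \<partial>std_normal_Rd d)
     = 1 / sqrt (2 * t) * (gauss_mean1 d k gc t (sqrt (2 * t)) x - g x * 0)" .
  have e: "gauss_mean1 d k gc t (sqrt (2 * t)) x / sqrt (2 * t)
     = (\<integral>z. (g (add_scaled d x (sqrt (2 * t)) z) - g x) * (1 / sqrt (2 * t) * z k) \<partial>std_normal_Rd d)" unfolding e0 by simp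
  have "uvec t x k = space_deriv k (u t) x" using False i by (simp add: uvec_def join_vec_def space_grad_def)
  also have "\<dots> = (\<integral>z. (g (add_scaled d x (sqrt (2 * t)) z) - g x) * (1 / sqrt (2 * t) * z k) \<partial>std_normal_Rd d) + t * heat_mean1 d hc k t t x"
    by (simp only: gradient_formula[OF t x i] e)
  finally show ?thesis
    unfolding source_term_integral[OF t x k] using False by (simp only: join_vec_def if_False add_0)
qed

text \<open>Weighting the squares by \<open>L j\<close> has two effects: a Gaussian step increases
  the weight by a dimension-free amount in the mean, since the \<open>L j\<close> sum to at most
  \<open>lam\<close>, and the weight controls the increments of \<open>u\<close> and
  \<open>g\<close> through Cauchy-Schwarz.\<close>

definition wt :: "rvec \<Rightarrow> real" where
  "wt x = 1 + (\<Sum>j=1..d. L j * (x j)\<^sup>2)"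

lemma wt_sum_nonneg: "0 \<le> (\<Sum>j=1..d. L j * (x j)\<^sup>2)"
  by (intro sum_nonneg mult_nonneg_nonneg L_nonneg) auto

lemma wt_ge_1: "wt x \<ge> 1"
  using wt_sum_nonneg[of x] by (simp add: wt_def)

text \<open>Cauchy-Schwarz with \<open>L j\<close> split as \<open>sqrt (L j) * sqrt (L j)\<close>;
  the total mass of the \<open>L j\<close> is at most \<open>lam\<close>.\<close>

lemma L_sum_square_le: "(\<Sum>j=1..d. L j * a j)\<^sup>2 \<le> lam * (\<Sum>j=1..d. L j * (a j)\<^sup>2)"
proof -
  have "(\<Sum>j=1..d. L j * a j)\<^sup>2 = (\<Sum>j=1..d. sqrt (L j) * (sqrt (L j) * a j))\<^sup>2"
    using L_nonneg by (intro arg_cong[where f="\<lambda>x. x\<^sup>2"] sum.cong) (auto simp flip: mult.assoc)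
  also have "\<dots> \<le> (\<Sum>j=1..d. (sqrt (L j))\<^sup>2) * (\<Sum>j=1..d. (sqrt (L j) * a j)\<^sup>2)"
    by (rule Cauchy_Schwarz_ineq_sum)
  also have "\<dots> = (\<Sum>j=1..d. L j) * (\<Sum>j=1..d. L j * (a j)\<^sup>2)"
    using L_nonneg by (simp add: power_mult_distrib)
  also have "\<dots> \<le> lam * (\<Sum>j=1..d. L j * (a j)\<^sup>2)"
    by (intro mult_right_mono L_sum wt_sum_nonneg)
  finally show ?thesis .
qed

lemma expectation_abs_coord_le: assumes "j \<in> {1..d}" shows "integrable (std_normal_Rd d) (\<lambda>z. \<bar>z j\<bar>)" "(\<integral>z. \<bar>z j\<bar> \<partial>std_normal_Rd d) \<le> 1"
proof -
  have i1: "integrable (std_normal_Rd d) (\<lambda>z. z j)" and i2: "integrable (std_normal_Rd d) (\<lambda>z. (z j)\<^sup>2)"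
    using integrable_std_normal_Rd_power[OF assms, of 1] integrable_std_normal_Rd_power[OF assms, of 2] by simp_all
  show i: "integrable (std_normal_Rd d) (\<lambda>z. \<bar>z j\<bar>)" using i1 by (rule integrable_abs)
  have "(\<integral>z. \<bar>z j\<bar> \<partial>std_normal_Rd d) \<le> (\<integral>z. (1 + (z j)\<^sup>2) / 2 \<partial>std_normal_Rd d)"
  proof (intro integral_mono i)
    show "integrable (std_normal_Rd d) (\<lambda>z. (1 + (z j)\<^sup>2) / 2)" using i2 by simp
    show "\<bar>z j\<bar> \<le> (1 + (z j)\<^sup>2) / 2" for z :: "nat \<Rightarrow> real"
      using zero_le_power2[of "\<bar>z j\<bar> - 1"] by (simp add: power2_diff)
  qed
  also have "\<dots> = 1" using i2 std_normal_Rd_moment2[OF assms] gauss.prob_space by simp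
  finally show "(\<integral>z. \<bar>z j\<bar> \<partial>std_normal_Rd d) \<le> 1" .
qed

text \<open>Dimension-free because each \<open>\<bar>z j\<bar>\<close> has mean at most one and the
  Lipschitz constants sum to at most \<open>lam\<close>.\<close>

lemma gauss_lipschitz_mean:
  assumes F: "integrable (std_normal_Rd d) (\<lambda>z. F (add_scaled d (zero_vec d) s z))" and s: "s \<in> {0..S}" and K: "K1 \<ge> 0" "K0 \<ge> 0"
    and bd: "\<And>y. y \<in> Rd d \<Longrightarrow> \<bar>F y\<bar> \<le> K0 + K1 * (\<Sum>j=1..d. L j * \<bar>y j\<bar>)"
  shows "\<bar>\<integral>z. F (add_scaled d (zero_vec d) s z) \<partial>std_normal_Rd d\<bar> \<le> K0 + K1 * (lam * S)"
proof -
  have "\<bar>\<integral>z. F (add_scaled d (zero_vec d) s z) \<partial>std_normal_Rd d\<bar> \<le> (\<integral>z. \<bar>F (add_scaled d (zero_vec d) s z)\<bar> \<partial>std_normal_Rd d)"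
    by (rule integral_abs_bound)
  also have "\<dots> \<le> (\<integral>z. K0 + K1 * s * (\<Sum>j=1..d. L j * \<bar>z j\<bar>) \<partial>std_normal_Rd d)"
  proof (intro integral_mono integrable_abs F)
    show "integrable (std_normal_Rd d) (\<lambda>z. K0 + K1 * s * (\<Sum>j=1..d. L j * \<bar>z j\<bar>))"
      using expectation_abs_coord_le(1) by (intro Bochner_Integration.integrable_add integrable_mult_right Bochner_Integration.integrable_sum) auto
    fix z
    have "(\<Sum>j=1..d. L j * \<bar>add_scaled d (zero_vec d) s z j\<bar>) = s * (\<Sum>j=1..d. L j * \<bar>z j\<bar>)"
      unfolding sum_distrib_left using s by (intro sum.cong) (auto simp: abs_mult)
    then show "\<bar>F (add_scaled d (zero_vec d) s z)\<bar> \<le> K0 + K1 * s * (\<Sum>j=1..d. L j * \<bar>z j\<bar>)"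
      using bd[of "add_scaled d (zero_vec d) s z"] by (simp add: mult.assoc)
  qed
  also have "\<dots> = K0 + K1 * s * (\<Sum>j=1..d. L j * (\<integral>z. \<bar>z j\<bar> \<partial>std_normal_Rd d))"
    using expectation_abs_coord_le(1) gauss.prob_space
    by (subst Bochner_Integration.integral_add) (auto intro!: Bochner_Integration.integrable_sum)
  also have "\<dots> \<le> K0 + K1 * s * (\<Sum>j=1..d. L j * 1)"
    using K s expectation_abs_coord_le(2) by (intro add_left_mono mult_left_mono sum_mono L_nonneg) auto
  also have "\<dots> \<le> K0 + K1 * S * lam"
    using K s L_sum by (intro add_left_mono mult_mono mult_nonneg_nonneg sum_nonneg L_nonneg) auto
  finally show ?thesis by (simp add: mult_ac)
qed

text \<open>Gronwall's argument through a weighted maximum \<open>S\<close> of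
  \<open>exp (- 2 * lam * s) * \<bar>u s\<bar>\<close> at the origin. At the rate
  \<open>2 * lam\<close> the feedback of \<open>u\<close> through the source, with Lipschitz
  constant at most \<open>lam\<close>, returns at most \<open>S / 2\<close>, and this half is
  absorbed. The remaining terms are Gaussian means at the origin, proportional to
  \<open>Dl\<close>.\<close>

lemma u_zero_bound:
  assumes t: "t \<in> {0..T}"
  shows "\<bar>u t (zero_vec d)\<bar> \<le> 2 * (Dl * (lam * (1 + sqrt (2 * T)) + T * (lam + lam * (exp (lam * T) * (lam * sqrt (2 * T))) + lam * (exp (lam * T) * lam)))) * exp (2 * lam * T)"
proof -
  let ?o = "zero_vec d"
  define E where "E = exp (lam * T)"
  define K0 where "K0 = Dl * (lam * (1 + sqrt (2 * T)))"
  define K1 where "K1 = Dl * (lam + lam * (E * (lam * sqrt (2 * T))) + lam * (E * lam))"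
  have LipE: "Lip = Dl * E" by (simp add: Lip_def E_def)
  have K: "K0 \<ge> 0" "K1 \<ge> 0" "E > 0" using Dl lam T by (simp_all add: K0_def K1_def E_def)
  define \<phi> where "\<phi> = (\<lambda>s. exp (- 2 * lam * s) * \<bar>u s ?o\<bar>)"
  have "continuous_on {0..T} ((\<lambda>(t, x). u t x) \<circ> (\<lambda>s. (s, ?o)))"
    by (intro continuous_on_compose continuous_intros continuous_on_subset[OF u_cont]) auto
  then have "continuous_on {0..T} \<phi>" unfolding \<phi>_def comp_def by (intro continuous_intros) simp
  then obtain s0 where s0: "s0 \<in> {0..T}" "\<And>s. s \<in> {0..T} \<Longrightarrow> \<phi> s \<le> \<phi> s0"
    using continuous_attains_sup[of "{0..T}" \<phi>] T by auto
  define S where "S = \<phi> s0"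
  have S0: "S \<ge> 0" by (simp add: S_def \<phi>_def)
  have uS: "\<bar>u s ?o\<bar> \<le> S * exp (2 * lam * s)" if "s \<in> {0..T}" for s
  proof -
    have "\<bar>u s ?o\<bar> = \<phi> s * exp (2 * lam * s)" by (simp add: \<phi>_def mult_ac flip: exp_add)
    also have "\<dots> \<le> S * exp (2 * lam * s)" using s0(2)[OF that] by (simp add: S_def)
    finally show ?thesis .
  qed
  have gb: "\<bar>gauss_mean d gc s (sqrt (2 * s)) ?o\<bar> \<le> K0" if s: "s \<in> {0..T}" for s
  proof -
    have "\<bar>\<integral>z. gc s (add_scaled d ?o (sqrt (2 * s)) z) \<partial>std_normal_Rd d\<bar> \<le> \<bar>g ?o\<bar> + Dl * (lam * sqrt (2 * T))"
    proof (rule gauss_lipschitz_mean)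
      show "integrable (std_normal_Rd d) (\<lambda>z. gc s (add_scaled d ?o (sqrt (2 * s)) z))"
        by (rule integrable_gauss_mean[OF gc_cont gc_growth]) simp
      fix y assume y: "y \<in> Rd d"
      have "(\<Sum>j=1..d. L j * \<bar>y j - ?o j\<bar>) = (\<Sum>j=1..d. L j * \<bar>y j\<bar>)" by (intro sum.cong) auto
      then show "\<bar>gc s y\<bar> \<le> \<bar>g ?o\<bar> + Dl * (\<Sum>j=1..d. L j * \<bar>y j\<bar>)"
        using g_lip[OF y, of ?o] by (simp add: gc_def)
    qed (use s Dl in auto)
    also have "\<dots> \<le> K0" using base by (simp add: K0_def algebra_simps)
    finally show ?thesis by (simp add: gauss_mean_def)
  qed
  have hb: "\<bar>gauss_mean d hc s (sqrt (2 * r)) ?o\<bar> \<le> K1 + lam * \<bar>u s ?o\<bar>" if s: "s \<in> {0..T}" and r: "r \<in> {0..T}" for s r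
  proof -
    have "\<bar>\<integral>z. hc s (add_scaled d ?o (sqrt (2 * r)) z) \<partial>std_normal_Rd d\<bar>
      \<le> (\<bar>f 0 ?o\<bar> + lam * \<bar>u s ?o\<bar> + lam * (Lip * lam)) + (lam * Lip) * (lam * sqrt (2 * T))"
    proof (rule gauss_lipschitz_mean)
      show "integrable (std_normal_Rd d) (\<lambda>z. hc s (add_scaled d ?o (sqrt (2 * r)) z))"
        by (rule integrable_gauss_mean[OF hc_cont hc_growth]) simp
      fix y assume y: "y \<in> Rd d"
      have "(\<Sum>j=1..d. L j * \<bar>y j - ?o j\<bar>) = (\<Sum>j=1..d. L j * \<bar>y j\<bar>)" by (intro sum.cong) auto
      then have "\<bar>u s y\<bar> \<le> \<bar>u s ?o\<bar> + Lip * (\<Sum>j=1..d. L j * \<bar>y j\<bar>)"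
        using u_lip[OF s y, of ?o] by simp
      then have "lam * \<bar>u s y\<bar> \<le> lam * (\<bar>u s ?o\<bar> + Lip * (\<Sum>j=1..d. L j * \<bar>y j\<bar>))"
        using lam by (intro mult_left_mono) auto
      then show "\<bar>hc s y\<bar> \<le> (\<bar>f 0 ?o\<bar> + lam * \<bar>u s ?o\<bar> + lam * (Lip * lam)) + (lam * Lip) * (\<Sum>j=1..d. L j * \<bar>y j\<bar>)"
        using h_bound[OF s y] by (simp add: hc_eq[OF s] algebra_simps)
    qed (use r lam Lip_pos in auto)
    also have "\<dots> \<le> K1 + lam * \<bar>u s ?o\<bar>" using base by (simp add: K1_def LipE algebra_simps)
    finally show ?thesis by (simp add: gauss_mean_def)
  qed
  have ub: "\<bar>u s ?o\<bar> \<le> K0 + T * K1 + S * exp (2 * lam * s) / 2" if s: "s \<in> {0..T}" for s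
  proof -
    \<comment> \<open>At time \<open>s - s * q\<close> the value of \<open>u\<close> at the origin
      is at most \<open>S * ?e q\<close>; up to the factor \<open>2 * lam * s\<close> this
      exponential has itself as antiderivative, with a sign.\<close>
    let ?e = "\<lambda>q. exp (2 * lam * (s - s * q))"
    have "(\<integral>q. indicator {0..1} q *\<^sub>R (2 * lam * s * ?e q) \<partial>lborel) = - ?e 1 - (- ?e 0)"
    proof (rule integral_FTC_atLeastAtMost)
      fix q :: real
      have "((\<lambda>q. - ?e q) has_real_derivative 2 * lam * s * ?e q) (at q within {0..1})"
        by (auto intro!: derivative_eq_intros)
      then show "((\<lambda>q. - ?e q) has_vector_derivative 2 * lam * s * ?e q) (at q within {0..1})"
        by (simp add: has_real_derivative_iff_has_vector_derivative)
    qed (auto intro!: continuous_intros)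
    then have I: "(\<integral>q. indicator {0..1} q * (2 * lam * s * ?e q) \<partial>lborel) = exp (2 * lam * s) - 1" by simp
    have ei: "integrable lborel (\<lambda>q. indicator {0..1} q * ?e q)"
      using lam s by (intro integrable_indicator_bound[of ?e 0 1 "exp (2 * lam * s)"] borel_measurable_continuous_onI continuous_intros) auto
    have "s * (\<integral>q. indicator {0..1} q * ?e q \<partial>lborel) * (2 * lam) = (\<integral>q. (2 * lam * s) * (indicator {0..1} q * ?e q) \<partial>lborel)"
      by (simp add: mult_ac)
    also have "\<dots> = exp (2 * lam * s) - 1" unfolding I[symmetric] by (intro Bochner_Integration.integral_cong) auto
    finally have I': "s * (\<integral>q. indicator {0..1} q * ?e q \<partial>lborel) = (exp (2 * lam * s) - 1) / (2 * lam)"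
      using lam by (simp add: field_simps)
    have "\<bar>heat_mean d hc s s ?o\<bar> \<le> (\<integral>q. \<bar>indicator {0..1} q * gauss_mean d hc (s - s * q) (sqrt (2 * s * q)) ?o\<bar> \<partial>lborel)"
      unfolding heat_mean_def by (rule integral_abs_bound)
    also have "\<dots> \<le> (\<integral>q. indicator {0..1} q * K1 + lam * S * (indicator {0..1} q * ?e q) \<partial>lborel)"
    proof (rule integral_mono, rule integrable_abs)
      show "integrable lborel (\<lambda>q. indicator {0..1} q * gauss_mean d hc (s - s * q) (sqrt (2 * s * q)) ?o)"
      proof (rule integrable_indicator_bound)
        show "(\<lambda>q. gauss_mean d hc (s - s * q) (sqrt (2 * s * q)) ?o) \<in> borel_measurable borel"
          by (intro gauss_mean_measurable[OF hc_cont]) auto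
        fix q :: real assume q: "q \<in> {0..1}"
        then have "s * q \<le> s * 1" using s by (intro mult_left_mono) auto
        then have "s * q \<in> {0..s}" using s q by auto
        then show "\<bar>gauss_mean d hc (s - s * q) (sqrt (2 * s * q)) ?o\<bar> \<le> Cg * (1 + norm1 d ?o + sqrt (2 * s) * d)"
          using gauss_mean_bound_time[OF hc_cont hc_growth, of ?o "s * q" s "s - s * q"] by (simp add: mult.assoc)
      qed
      show "integrable lborel (\<lambda>q. indicator {0..1} q * K1 + lam * S * (indicator {0..1} q * ?e q))"
        using ei integrable_indicator_bound[of "\<lambda>_. K1" 0 1 "\<bar>K1\<bar>"] by simp
      fix q :: real
      show "\<bar>indicator {0..1} q * gauss_mean d hc (s - s * q) (sqrt (2 * s * q)) ?o\<bar> \<le> indicator {0..1} q * K1 + lam * S * (indicator {0..1} q * ?e q)"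
      proof (cases "q \<in> {0..1}")
        case True
        have "s * q \<le> s * 1" using True s by (intro mult_left_mono) auto
        moreover have "0 \<le> s * q" using True s by (intro mult_nonneg_nonneg) auto
        ultimately have "s * q \<in> {0..T}" "s - s * q \<in> {0..T}" using s by auto
        then have "\<bar>gauss_mean d hc (s - s * q) (sqrt (2 * (s * q))) ?o\<bar> \<le> K1 + lam * (S * ?e q)"
          using hb[of "s - s * q" "s * q"] uS[of "s - s * q"] lam
          by (meson add_left_mono mult_left_mono less_imp_le order_trans)
        then show ?thesis using True by (simp add: mult.assoc)
      qed simp
    qed
    also have "\<dots> = K1 + lam * S * (\<integral>q. indicator {0..1} q * ?e q \<partial>lborel)"
      using ei integrable_indicator_bound[of "\<lambda>_. K1" 0 1 "\<bar>K1\<bar>"] by simp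
    finally have "s * \<bar>heat_mean d hc s s ?o\<bar> \<le> s * (K1 + lam * S * (\<integral>q. indicator {0..1} q * ?e q \<partial>lborel))"
      using s by (intro mult_left_mono) auto
    also have "\<dots> = s * K1 + lam * S * (s * (\<integral>q. indicator {0..1} q * ?e q \<partial>lborel))" by (simp add: algebra_simps)
    also have "\<dots> = s * K1 + S * (exp (2 * lam * s) - 1) / 2" unfolding I' using lam by simp
    also have "\<dots> \<le> T * K1 + S * exp (2 * lam * s) / 2"
      using s K S0 by (intro add_mono mult_right_mono divide_right_mono mult_left_mono) auto
    finally have "s * \<bar>heat_mean d hc s s ?o\<bar> \<le> T * K1 + S * exp (2 * lam * s) / 2" .
    moreover have "\<bar>u s ?o\<bar> \<le> \<bar>gauss_mean d gc s (sqrt (2 * s)) ?o\<bar> + s * \<bar>heat_mean d hc s s ?o\<bar>"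
    proof -
      have "s * \<bar>heat_mean d hc s s ?o\<bar> = \<bar>s * heat_mean d hc s s ?o\<bar>" using s by (simp add: abs_mult)
      then show ?thesis using duhamel[OF s zero_vec_in_Rd] abs_triangle_ineq unfolding v_def by simp
    qed
    ultimately show ?thesis using gb[OF s] by linarith
  qed
  have "S \<le> (K0 + T * K1) + S / 2"
  proof -
    have s0p: "0 \<le> s0" using s0(1) by simp
    have "S \<le> exp (- 2 * lam * s0) * (K0 + T * K1 + S * exp (2 * lam * s0) / 2)"
      unfolding S_def \<phi>_def using ub[OF s0(1)] by (simp add: S_def \<phi>_def)
    also have "\<dots> = exp (- 2 * lam * s0) * (K0 + T * K1) + S / 2 * (exp (- 2 * lam * s0) * exp (2 * lam * s0))" by (simp add: algebra_simps)
    also have "exp (- 2 * lam * s0) * exp (2 * lam * s0) = 1" by (simp flip: exp_add)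
    also have "exp (- 2 * lam * s0) * (K0 + T * K1) \<le> 1 * (K0 + T * K1)"
      using lam s0p K T by (intro mult_right_mono add_nonneg_nonneg mult_nonneg_nonneg) auto
    finally show ?thesis by simp
  qed
  then have S: "S \<le> 2 * (K0 + T * K1)" by simp
  have "\<bar>u t ?o\<bar> \<le> S * exp (2 * lam * t)" by (rule uS[OF t])
  also have "\<dots> \<le> 2 * (K0 + T * K1) * exp (2 * lam * T)"
    using S S0 lam t by (intro mult_mono) auto
  finally show ?thesis by (simp add: K0_def K1_def E_def algebra_simps)
qed

text \<open>This is the error bound for level \<open>0\<close>, where the approximation vanishes; it
  starts the induction over the levels.\<close>

lemma uvec_bound:
  assumes t: "t \<in> {0..T}" and x: "x \<in> Rd d" and k: "k \<in> {0..d}"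
  shows "(uvec t x k)\<^sup>2 \<le> Dl\<^sup>2 * u_const T lam * wt x"
proof -
  define E where "E = exp (lam * T)"
  define \<kappa> where "\<kappa> = lam * (1 + sqrt (2 * T)) + T * (lam + lam * (E * (lam * sqrt (2 * T))) + lam * (E * lam))"
  define A where "A = 2 * \<kappa> * exp (2 * lam * T)"
  have c: "u_const T lam = 2 * A\<^sup>2 + 2 * E\<^sup>2 * lam + (E * lam)\<^sup>2" by (simp add: u_const_def Let_def E_def \<kappa>_def A_def)
  have LipE: "Lip = Dl * E" by (simp add: Lip_def E_def)
  have ge: "X \<le> X * wt x" if "X \<ge> 0" for X using mult_left_mono[OF wt_ge_1[of x] that] by simp
  have nn: "0 \<le> Dl\<^sup>2 * (2 * A\<^sup>2)" "0 \<le> Dl\<^sup>2 * (2 * E\<^sup>2 * lam)" "0 \<le> Dl\<^sup>2 * (E * lam)\<^sup>2" using lam by simp_all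
  show ?thesis
  proof (cases "k = 0")
    case True
    let ?s = "\<Sum>j=1..d. L j * \<bar>x j\<bar>"
    have "(\<Sum>j=1..d. L j * \<bar>x j - zero_vec d j\<bar>) = ?s" by (intro sum.cong) auto
    then have "\<bar>u t x\<bar> \<le> \<bar>u t (zero_vec d)\<bar> + Lip * ?s"
      using u_lip[OF t x, of "zero_vec d"] by simp
    also have "\<dots> \<le> Dl * A + Dl * (E * ?s)"
      using u_zero_bound[OF t] by (simp add: A_def \<kappa>_def E_def LipE mult_ac)
    finally have "\<bar>u t x\<bar>\<^sup>2 \<le> (Dl * A + Dl * (E * ?s))\<^sup>2" by (intro power_mono) auto
    also have "\<dots> \<le> 2 * (Dl * A)\<^sup>2 + 2 * (Dl * (E * ?s))\<^sup>2"
      using zero_le_power2[of "Dl * A - Dl * (E * ?s)"] by (simp add: power2_sum power2_diff)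
    also have "\<dots> = Dl\<^sup>2 * (2 * A\<^sup>2) + Dl\<^sup>2 * (2 * E\<^sup>2 * ?s\<^sup>2)" by (simp add: power_mult_distrib algebra_simps)
    also have "\<dots> \<le> Dl\<^sup>2 * (2 * A\<^sup>2) * wt x + Dl\<^sup>2 * (2 * E\<^sup>2 * (lam * wt x))"
    proof (intro add_mono ge nn(1) mult_left_mono)
      have "?s\<^sup>2 \<le> lam * (\<Sum>j=1..d. L j * \<bar>x j\<bar>\<^sup>2)" by (rule L_sum_square_le)
      also have "\<dots> \<le> lam * wt x" using lam by (intro mult_left_mono) (auto simp: wt_def)
      finally show "?s\<^sup>2 \<le> lam * wt x" .
    qed auto
    also have "\<dots> \<le> Dl\<^sup>2 * u_const T lam * wt x"
      using mult_nonneg_nonneg[OF nn(3), of "wt x"] wt_ge_1[of x] by (simp add: c algebra_simps)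
    finally show ?thesis using True by (simp add: uvec_def join_vec_def)
  next
    case False
    then have i: "k \<in> {1..d}" using k by auto
    have "\<bar>space_deriv k (u t) x\<bar> \<le> Lip * L k" by (rule du_bound[OF i t x])
    also have "\<dots> \<le> Lip * lam"
      using member_le_sum[of k "{1..d}" L] i L_nonneg L_sum Lip_pos by (intro mult_left_mono) fastforce+
    finally have "\<bar>space_deriv k (u t) x\<bar>\<^sup>2 \<le> (Lip * lam)\<^sup>2" by (intro power_mono) auto
    also have "\<dots> = Dl\<^sup>2 * (E * lam)\<^sup>2" by (simp add: LipE power_mult_distrib)
    also have "\<dots> \<le> Dl\<^sup>2 * (E * lam)\<^sup>2 * wt x" by (rule ge[OF nn(3)])
    also have "\<dots> \<le> Dl\<^sup>2 * u_const T lam * wt x"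
      using mult_nonneg_nonneg[OF nn(1), of "wt x"] mult_nonneg_nonneg[OF nn(2), of "wt x"] wt_ge_1[of x] by (simp add: c algebra_simps)
    finally show ?thesis using False i by (simp add: uvec_def join_vec_def space_grad_def)
  qed
qed

end

section \<open>The scheme as a functional of the noise field\<close>

text \<open>Since \<open>[]\<close> is not in \<open>Theta\<close>, the subfield at \<open>a\<close>
  omits the entry \<open>\<xi> a\<close> itself. The pair and its subfield are therefore
  independent.\<close>

definition subfield :: "int list \<Rightarrow> (int list \<Rightarrow> 'a) \<Rightarrow> int list \<Rightarrow> 'a" where
  "subfield a \<xi> = (\<lambda>\<eta>\<in>Theta. \<xi> (a @ \<eta>))"

definition init_term :: "nat \<Rightarrow> (rvec \<Rightarrow> real) \<Rightarrow> real \<Rightarrow> rvec \<Rightarrow> nat \<Rightarrow> rvec \<Rightarrow> real" where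
  "init_term d g t x k z = (g (add_scaled d x (sqrt (2 * t)) z) - g x) * join_vec 1 (\<lambda>j. 1 / sqrt (2 * t) * z j) k"

definition step_term :: "nat \<Rightarrow> (real \<Rightarrow> rvec \<Rightarrow> real) \<Rightarrow> (real \<Rightarrow> rvec \<Rightarrow> 'b \<Rightarrow> nat \<Rightarrow> real)
    \<Rightarrow> real \<Rightarrow> rvec \<Rightarrow> nat \<Rightarrow> rvec \<times> real \<Rightarrow> 'b \<Rightarrow> real" where
  "step_term d f V t x k p \<zeta> = path_weight t k p * eval_joined d f (V (t * (1 - snd p)) (add_scaled d x (sqrt (2 * t * snd p)) (fst p)) \<zeta>)"

text \<open>
  \<open>\<xi> \<eta>\<close> stands for the pair of \<open>Z\<close> and \<open>r\<close> with index \<open>(\<theta>, \<eta>)\<close>; passing to the realisation with index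
  \<open>(\<theta>, l, i)\<close> is passing to a subfield.
\<close>

function mlp :: "nat \<Rightarrow> (real \<Rightarrow> rvec \<Rightarrow> real) \<Rightarrow> (rvec \<Rightarrow> real) \<Rightarrow> nat \<Rightarrow> nat
    \<Rightarrow> real \<Rightarrow> rvec \<Rightarrow> (int list \<Rightarrow> rvec \<times> real) \<Rightarrow> nat \<Rightarrow> real" where
  "mlp d f g M n t x \<xi> k = (if n = 0 then 0 else
     join_vec (g x) (\<lambda>_. 0) k
     + (\<Sum>i=1..M ^ n. 1 / real (M ^ n) * init_term d g t x k (fst (\<xi> [0, - int i])))
     + (\<Sum>l<n. \<Sum>i=1..M ^ (n - l). 1 / real (M ^ (n - l)) *
          (step_term d f (mlp d f g M l) t x k (\<xi> [int l, int i]) (subfield [int l, int i] \<xi>)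
           - indicator {1..} l * step_term d f (mlp d f g M (l - 1)) t x k (\<xi> [int l, int i]) (subfield [- int l, int i] \<xi>))))"
  by pat_completeness auto
termination by (relation "Wellfounded.measure (\<lambda>(d, f, g, M, n, _). n)") auto

declare mlp.simps [simp del]

lemma mlp_0 [simp]: "mlp d f g M 0 t x \<xi> k = 0"
  by (simp add: mlp.simps)

lemma eval_joined_cong:
  assumes "\<And>k. k \<in> {0..d} \<Longrightarrow> v k = w k"
  shows "eval_joined d f v = eval_joined d f w"
proof -
  have "restrict v {1..d} = restrict w {1..d}" using assms by (intro restrict_ext) auto
  then show ?thesis using assms[of 0] by (simp add: eval_joined_def)
qed

text \<open>A pathwise identity. As the time variables lie strictly between \<open>0\<close> and
  \<open>1\<close>, every recursive time \<open>t * (1 - \<rho>)\<close> stays in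
  \<open>{0<..T}\<close>, the only range on which the scheme is specified.\<close>

lemma mlp_scheme_eq_mlp:
  assumes U: "mlp_scheme P T f g Z r U" and d: "d \<ge> 1" and M: "M \<ge> 1" and \<omega>: "\<omega> \<in> space P"
    and r: "\<And>\<theta>. \<theta> \<in> Theta \<Longrightarrow> r \<theta> \<omega> \<in> {0<..<1::real}"
  shows "\<theta> \<in> Theta \<Longrightarrow> t \<in> {0<..T} \<Longrightarrow> x \<in> Rd d \<Longrightarrow> k \<in> {0..d} \<Longrightarrow>
    U d \<theta> (int n) M t x \<omega> k = mlp d (f d) (g d) M n t x (\<lambda>\<eta>\<in>Theta. (Z d (\<theta> @ \<eta>) \<omega>, r (\<theta> @ \<eta>) \<omega>)) k"
proof (induction n arbitrary: \<theta> t x k rule: less_induct)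
  case (less n)
  let ?\<xi> = "\<lambda>\<theta>. \<lambda>\<eta>\<in>Theta. (Z d (\<theta> @ \<eta>) \<omega>, r (\<theta> @ \<eta>) \<omega>)"
  have Th: "[a, b] \<in> Theta" "\<theta> @ [a, b] \<in> Theta" for a b by (auto simp: Theta_def)
  have sub: "subfield [a, b] (?\<xi> \<theta>) = ?\<xi> (\<theta> @ [a, b])" for a b
    by (auto simp: subfield_def Theta_def)
  show ?case
  proof (cases "n = 0")
    case True
    \<comment> \<open>The vanishing of level \<open>0\<close> is stated under the quantifier over
      \<open>n \<ge> 1\<close>, so it is read off at \<open>n = 1\<close>.\<close>
    then show ?thesis
      using U[unfolded mlp_scheme_def, rule_format, of 1 M d \<theta> t x \<omega> k] d M \<omega> less.prems by simp
  next
    case False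
    let ?p = "\<lambda>l i. ?\<xi> \<theta> [int l, int i]"
    have p: "?p l i = (Z d (\<theta> @ [int l, int i]) \<omega>, r (\<theta> @ [int l, int i]) \<omega>)" for l i using Th by simp
    have step: "eval_joined d (f d) (U d (\<theta> @ [a, int i]) (int m) M (t * (1 - snd (?p l i))) (add_scaled d x (sqrt (2 * t * snd (?p l i))) (fst (?p l i))) \<omega>)
       = eval_joined d (f d) (mlp d (f d) (g d) M m (t * (1 - snd (?p l i))) (add_scaled d x (sqrt (2 * t * snd (?p l i))) (fst (?p l i))) (subfield [a, int i] (?\<xi> \<theta>)))"
      if "m < n" for a i m l
    proof (rule eval_joined_cong)
      fix k' assume k': "k' \<in> {0..d}"
      have \<rho>: "snd (?p l i) \<in> {0<..<1}" using r[OF Th(2)] by (simp only: p snd_conv)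
      then have "0 < t * (1 - snd (?p l i))" "t * (1 - snd (?p l i)) \<le> t * 1"
        using less.prems(2) by (auto intro!: mult_pos_pos mult_left_mono)
      then have "t * (1 - snd (?p l i)) \<in> {0<..T}" using less.prems(2) by auto
      from less.IH[OF that Th(2) this add_scaled_in_Rd k', of a "int i"]
      show "U d (\<theta> @ [a, int i]) (int m) M (t * (1 - snd (?p l i))) (add_scaled d x (sqrt (2 * t * snd (?p l i))) (fst (?p l i))) \<omega> k'
       = mlp d (f d) (g d) M m (t * (1 - snd (?p l i))) (add_scaled d x (sqrt (2 * t * snd (?p l i))) (fst (?p l i))) (subfield [a, int i] (?\<xi> \<theta>)) k'"
        unfolding sub .
    qed
    have "U d \<theta> (int n) M t x \<omega> k = join_vec (g d x) (\<lambda>_. 0) k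
          + (\<Sum>i=1..M ^ n.
               let z = Z d (\<theta> @ [0, - int i]) \<omega> in
                 1 / real (M ^ n) * (g d (add_scaled d x (sqrt (2 * t)) z) - g d x)
                 * join_vec 1 (\<lambda>j. 1 / sqrt (2 * t) * z j) k)
          + (\<Sum>l<n. \<Sum>i=1..M ^ (n - l).
               let z = Z d (\<theta> @ [int l, int i]) \<omega>;
                   \<rho> = r (\<theta> @ [int l, int i]) \<omega>;
                   s = t * (1 - \<rho>);
                   y = add_scaled d x (sqrt (2 * t * \<rho>)) z
               in
                 2 * t * sqrt \<rho> / real (M ^ (n - l))
                 * (eval_joined d (f d) (U d (\<theta> @ [int l, int i]) (int l) M s y \<omega>)
                    - indicator {1..} l
                      * eval_joined d (f d) (U d (\<theta> @ [- int l, int i]) (int l - 1) M s y \<omega>))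
                 * join_vec 1 (\<lambda>j. 1 / sqrt (2 * t * \<rho>) * z j) k)"
      using U[unfolded mlp_scheme_def, rule_format, of n M d \<theta> t x \<omega> k] d M \<omega> less.prems False by linarith
    also have "\<dots> = mlp d (f d) (g d) M n t x (?\<xi> \<theta>) k"
      unfolding mlp.simps[of d "f d" "g d" M n]
    proof (simp only: False if_False, intro arg_cong2[where f="(+)"] sum.cong refl)
      fix i assume "i \<in> {1..M ^ n}"
      show "(let z = Z d (\<theta> @ [0, - int i]) \<omega> in
                 1 / real (M ^ n) * (g d (add_scaled d x (sqrt (2 * t)) z) - g d x)
                 * join_vec 1 (\<lambda>j. 1 / sqrt (2 * t) * z j) k)
         = 1 / real (M ^ n) * init_term d (g d) t x k (fst (?\<xi> \<theta> [0, - int i]))"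
        using Th by (simp add: init_term_def Let_def)
    next
      fix l i assume l: "l \<in> {..<n}"
      have s1: "eval_joined d (f d) (U d (\<theta> @ [int l, int i]) (int l) M (t * (1 - snd (?p l i))) (add_scaled d x (sqrt (2 * t * snd (?p l i))) (fst (?p l i))) \<omega>)
         = eval_joined d (f d) (mlp d (f d) (g d) M l (t * (1 - snd (?p l i))) (add_scaled d x (sqrt (2 * t * snd (?p l i))) (fst (?p l i))) (subfield [int l, int i] (?\<xi> \<theta>)))"
        using l by (intro step) auto
      \<comment> \<open>For \<open>l = 0\<close> the scheme refers to level \<open>- 1\<close> and
        the functional, by truncated subtraction, to level \<open>0\<close>; the indicator removes
        both.\<close>
      have s2: "indicator {1..} l * eval_joined d (f d) (U d (\<theta> @ [- int l, int i]) (int l - 1) M (t * (1 - snd (?p l i))) (add_scaled d x (sqrt (2 * t * snd (?p l i))) (fst (?p l i))) \<omega>)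
         = indicator {1..} l * eval_joined d (f d) (mlp d (f d) (g d) M (l - 1) (t * (1 - snd (?p l i))) (add_scaled d x (sqrt (2 * t * snd (?p l i))) (fst (?p l i))) (subfield [- int l, int i] (?\<xi> \<theta>)))"
      proof (cases "l \<ge> 1")
        case True
        then have e: "int l - 1 = int (l - 1)" by simp
        show ?thesis unfolding e using l by (intro arg_cong2[where f="(*)"] refl step) auto
      qed simp
      show "(let z = Z d (\<theta> @ [int l, int i]) \<omega>;
                   \<rho> = r (\<theta> @ [int l, int i]) \<omega>;
                   s = t * (1 - \<rho>);
                   y = add_scaled d x (sqrt (2 * t * \<rho>)) z
               in
                 2 * t * sqrt \<rho> / real (M ^ (n - l))
                 * (eval_joined d (f d) (U d (\<theta> @ [int l, int i]) (int l) M s y \<omega>)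
                    - indicator {1..} l
                      * eval_joined d (f d) (U d (\<theta> @ [- int l, int i]) (int l - 1) M s y \<omega>))
                 * join_vec 1 (\<lambda>j. 1 / sqrt (2 * t * \<rho>) * z j) k)
        = 1 / real (M ^ (n - l)) *
          (step_term d (f d) (mlp d (f d) (g d) M l) t x k (?\<xi> \<theta> [int l, int i]) (subfield [int l, int i] (?\<xi> \<theta>))
           - indicator {1..} l * step_term d (f d) (mlp d (f d) (g d) M (l - 1)) t x k (?\<xi> \<theta> [int l, int i]) (subfield [- int l, int i] (?\<xi> \<theta>)))"
        unfolding step_term_def s1[symmetric] mult.left_commute[of "indicator {1..} l"] s2[symmetric]
        unfolding p path_weight_def Let_def fst_conv snd_conv case_prod_conv by (simp add: algebra_simps)
    qed
    finally show ?thesis .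
  qed
qed

section \<open>Measurability of the functional and the laws of its subfields\<close>

abbreviation noise_space :: "nat \<Rightarrow> (int list \<Rightarrow> rvec \<times> real) measure" where
  "noise_space d \<equiv> Pi\<^sub>M Theta (\<lambda>_. noise_law d)"

abbreviation noise_pair :: "nat \<Rightarrow> (((nat \<Rightarrow> real) \<times> real) \<times> (int list \<Rightarrow> (nat \<Rightarrow> real) \<times> real)) measure" where
  "noise_pair d \<equiv> noise_law d \<Otimes>\<^sub>M noise_space d"

lemma prob_space_noise_space: "prob_space (noise_space d)"
  by (intro prob_space_PiM prob_space_noise_law)

lemma eval_joined_measurable:
  assumes f: "continuous_on (UNIV \<times> Rd d) (\<lambda>(y, z). f y z)"
    and v: "\<And>k. k \<in> {0..d} \<Longrightarrow> (\<lambda>\<omega>. v \<omega> k) \<in> borel_measurable N"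
  shows "(\<lambda>\<omega>. eval_joined d f (v \<omega>)) \<in> borel_measurable N"
proof -
  have "(\<lambda>\<omega>. restrict (v \<omega>) {1..d}) \<in> N \<rightarrow>\<^sub>M borel_Rd d"
    using v by (intro measurable_into_Rd) auto
  then show ?thesis unfolding eval_joined_def
    using v[of 0] by (intro continuous_Rd_measurable[OF f]) auto
qed

lemma init_term_measurable:
  assumes g: "continuous_on (Rd d) g" and k: "k \<in> {0..d}" and a: "a \<in> borel_measurable N" and X: "X \<in> N \<rightarrow>\<^sub>M borel_Rd d" and z: "z \<in> N \<rightarrow>\<^sub>M borel_Rd d"
  shows "(\<lambda>\<omega>. init_term d g (a \<omega>) (X \<omega>) k (z \<omega>)) \<in> borel_measurable N"
proof -
  have gm: "(\<lambda>\<omega>. g (Y \<omega>)) \<in> borel_measurable N" if "Y \<in> N \<rightarrow>\<^sub>M borel_Rd d" for Y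
  proof -
    have "continuous_on (UNIV \<times> Rd d) (g \<circ> (\<lambda>p::real \<times> rvec. snd p))"
      by (intro continuous_on_compose continuous_on_subset[OF g] continuous_intros) auto
    then have "continuous_on (UNIV \<times> Rd d) (\<lambda>(t::real, x). g x)" by (simp add: comp_def case_prod_unfold)
    from continuous_Rd_measurable[OF this, of "\<lambda>_. 0" N Y] that show ?thesis by simp
  qed
  have sq: "(\<lambda>\<omega>. sqrt (2 * a \<omega>)) \<in> borel_measurable N" using a by simp
  have zk: "(\<lambda>\<omega>. z \<omega> k) \<in> borel_measurable N" by (rule measurable_coord_Rd[OF z])
  have "(\<lambda>\<omega>. join_vec 1 (\<lambda>j. 1 / sqrt (2 * a \<omega>) * z \<omega> j) k) \<in> borel_measurable N"
    unfolding join_vec_def using sq zk by (cases "k = 0") simp_all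
  then show ?thesis unfolding init_term_def
    by (intro borel_measurable_times borel_measurable_diff gm X measurable_add_scaled[OF X sq z])
qed

lemma path_weight_measurable':
  assumes k: "k \<in> {0..d}" and a: "a \<in> borel_measurable N" and p: "p \<in> N \<rightarrow>\<^sub>M noise_law d"
  shows "(\<lambda>\<omega>. path_weight (a \<omega>) k (p \<omega>)) \<in> borel_measurable N"
proof -
  have p': "p \<in> N \<rightarrow>\<^sub>M (borel_Rd d \<Otimes>\<^sub>M borel)" using p by (simp cong: measurable_cong_sets)
  have "(\<lambda>\<omega>. fst (p \<omega>)) \<in> N \<rightarrow>\<^sub>M borel_Rd d" and s: "(\<lambda>\<omega>. snd (p \<omega>)) \<in> borel_measurable N"
    using p' by (auto intro: measurable_compose[OF p'])
  then have z: "(\<lambda>\<omega>. fst (p \<omega>) k) \<in> borel_measurable N" by (intro measurable_coord_Rd)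
  show ?thesis unfolding path_weight_def join_vec_def case_prod_unfold
    using a s z by (cases "k = 0") simp_all
qed

lemma step_term_measurable:
  assumes f: "continuous_on (UNIV \<times> Rd d) (\<lambda>(y, z). f y z)" and k: "k \<in> {0..d}"
    and V: "\<And>a X \<Xi> k. k \<in> {0..d} \<Longrightarrow> a \<in> borel_measurable N \<Longrightarrow> X \<in> N \<rightarrow>\<^sub>M borel_Rd d
        \<Longrightarrow> \<Xi> \<in> N \<rightarrow>\<^sub>M R \<Longrightarrow> (\<lambda>\<omega>. V (a \<omega>) (X \<omega>) (\<Xi> \<omega>) k) \<in> borel_measurable N"
    and a: "a \<in> borel_measurable N" and X: "X \<in> N \<rightarrow>\<^sub>M borel_Rd d" and p: "p \<in> N \<rightarrow>\<^sub>M noise_law d" and \<zeta>: "\<zeta> \<in> N \<rightarrow>\<^sub>M R"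
  shows "(\<lambda>\<omega>. step_term d f V (a \<omega>) (X \<omega>) k (p \<omega>) (\<zeta> \<omega>)) \<in> borel_measurable N"
proof -
  have p': "p \<in> N \<rightarrow>\<^sub>M (borel_Rd d \<Otimes>\<^sub>M borel)" using p by (simp cong: measurable_cong_sets)
  have z: "(\<lambda>\<omega>. fst (p \<omega>)) \<in> N \<rightarrow>\<^sub>M borel_Rd d" and s: "(\<lambda>\<omega>. snd (p \<omega>)) \<in> borel_measurable N"
    using p' by (auto intro: measurable_compose[OF p'])
  have s1: "(\<lambda>\<omega>. a \<omega> * (1 - snd (p \<omega>))) \<in> borel_measurable N" "(\<lambda>\<omega>. sqrt (2 * a \<omega> * snd (p \<omega>))) \<in> borel_measurable N"
    using a s by simp_all
  show ?thesis unfolding step_term_def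
    by (intro borel_measurable_times path_weight_measurable'[OF k a p] eval_joined_measurable[OF f] V s1 \<zeta> measurable_add_scaled X z)
qed

lemma noise_component_measurable:
  assumes "a \<in> Theta" "\<Xi> \<in> N \<rightarrow>\<^sub>M noise_space d"
  shows "(\<lambda>\<omega>. \<Xi> \<omega> a) \<in> N \<rightarrow>\<^sub>M noise_law d"
  using measurable_compose[OF assms(2) measurable_component_singleton[OF assms(1)]] .

lemma append_in_Theta: "a \<noteq> [] \<Longrightarrow> a @ \<eta> \<in> Theta" "\<eta> \<in> Theta \<Longrightarrow> a @ \<eta> \<in> Theta"
  by (auto simp: Theta_def)

lemma subfield_measurable:
  assumes "\<Xi> \<in> N \<rightarrow>\<^sub>M noise_space d"
  shows "(\<lambda>\<omega>. subfield a (\<Xi> \<omega>)) \<in> N \<rightarrow>\<^sub>M noise_space d"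
  unfolding subfield_def using assms
  by (intro measurable_restrict noise_component_measurable append_in_Theta(2))

text \<open>Stated for random time, point and field, because the recursion evaluates the lower
  levels at a random time and a random point.\<close>

lemma mlp_measurable:
  assumes f: "continuous_on (UNIV \<times> Rd d) (\<lambda>(y, z). f y z)" and g: "continuous_on (Rd d) g"
  shows "k \<in> {0..d} \<Longrightarrow> a \<in> borel_measurable N \<Longrightarrow> X \<in> N \<rightarrow>\<^sub>M borel_Rd d \<Longrightarrow> \<Xi> \<in> N \<rightarrow>\<^sub>M noise_space d \<Longrightarrow>
    (\<lambda>\<omega>. mlp d f g M n (a \<omega>) (X \<omega>) (\<Xi> \<omega>) k) \<in> borel_measurable N"
proof (induction n arbitrary: a X \<Xi> k rule: less_induct)
  case (less n)
  note a = less.prems(2) and X = less.prems(3) and \<Xi> = less.prems(4) and k = less.prems(1)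
  have Th: "[b, c] \<in> Theta" for b c by (simp add: Theta_def)
  show ?case
  proof (cases "n = 0")
    case False
    have gm: "(\<lambda>\<omega>. g (X \<omega>)) \<in> borel_measurable N"
    proof -
      have "continuous_on (UNIV \<times> Rd d) (g \<circ> (\<lambda>p::real \<times> rvec. snd p))"
        by (intro continuous_on_compose continuous_on_subset[OF g] continuous_intros) auto
      then have "continuous_on (UNIV \<times> Rd d) (\<lambda>(t::real, x). g x)" by (simp add: comp_def case_prod_unfold)
      from continuous_Rd_measurable[OF this, of "\<lambda>_. 0" N X] X show ?thesis by simp
    qed
    have jm: "(\<lambda>\<omega>. join_vec (g (X \<omega>)) (\<lambda>_. 0) k) \<in> borel_measurable N"
      using gm by (cases "k = 0") (simp_all add: join_vec_def)
    have z: "(\<lambda>\<omega>. fst (\<Xi> \<omega> [b, c])) \<in> N \<rightarrow>\<^sub>M borel_Rd d" for b c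
    proof -
      have "(\<lambda>\<omega>. \<Xi> \<omega> [b, c]) \<in> N \<rightarrow>\<^sub>M (borel_Rd d \<Otimes>\<^sub>M borel)"
        using noise_component_measurable[OF Th \<Xi>, of b c] by (simp cong: measurable_cong_sets)
      then show ?thesis by (rule measurable_compose[OF _ measurable_fst])
    qed
    have st: "(\<lambda>\<omega>. step_term d f (mlp d f g M m) (a \<omega>) (X \<omega>) k (\<Xi> \<omega> [b, c]) (subfield e (\<Xi> \<omega>))) \<in> borel_measurable N" if "m < n" for m b c e
      by (rule step_term_measurable[OF f k less.IH[OF that] a X noise_component_measurable[OF Th \<Xi>] subfield_measurable[OF \<Xi>]])
    show ?thesis unfolding mlp.simps[of d f g M n] using False
      by (simp only: if_False, intro borel_measurable_add borel_measurable_sum borel_measurable_times borel_measurable_diff borel_measurable_const jm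
          init_term_measurable[OF g k a X z] st) auto
  qed simp
qed

lemma distr_noise_component:
  assumes "a \<in> Theta"
  shows "distr (noise_space d) (noise_law d) (\<lambda>\<xi>. \<xi> a) = noise_law d"
  using assms by (intro distr_PiM_component prob_space_noise_law)

text \<open>Reindexing an i.i.d. field along an injective map preserves its law. The length
  condition keeps \<open>a\<close> from being a proper extension of \<open>b\<close>, so the single
  pair never reappears in the subfield. It covers \<open>b = a\<close> as well as the index with
  negated level.\<close>

lemma distr_noise_pair:
  assumes a: "a \<noteq> []" and ab: "length a \<le> length b"
  shows "distr (noise_space d) (noise_law d \<Otimes>\<^sub>M noise_space d) (\<lambda>\<xi>. (\<xi> a, subfield b \<xi>)) = noise_law d \<Otimes>\<^sub>M noise_space d"
proof -
  let ?N = "noise_law d" and ?Q = "noise_space d" and ?R = "Pi\<^sub>M UNIV (\<lambda>_::int list. noise_law d)"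
  \<comment> \<open>The empty word is the one index missing from \<open>Theta\<close>; it hosts the
    single pair, so that pair and subfield become one field over all words.\<close>
  define \<phi> where "\<phi> \<eta> = (if \<eta> = [] then a else b @ \<eta>)" for \<eta> :: "int list"
  have ins: "insert [] Theta = UNIV" by (auto simp: Theta_def)
  have ab': "a \<noteq> b @ \<eta>" if "\<eta> \<noteq> []" for \<eta> using ab that by auto
  have "inj \<phi>" unfolding inj_def \<phi>_def using ab' by (metis append_same_eq same_append_eq)
  have R1: "distr ?Q ?R (\<lambda>\<xi>. \<lambda>\<eta>\<in>UNIV. \<xi> (\<phi> \<eta>)) = ?R"
    by (intro distr_PiM_reindex prob_space_noise_law \<open>inj \<phi>\<close>) (use a in \<open>auto simp: \<phi>_def Theta_def\<close>)
  have R2: "distr (?N \<Otimes>\<^sub>M ?Q) ?R (\<lambda>(x, X). X([] := x)) = ?R"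
    using distr_pair_PiM_eq_PiM[of Theta "\<lambda>_. noise_law d" "[]"] prob_space_noise_law by (simp add: ins)
  let ?S = "\<lambda>\<omega>. (\<omega> [], restrict \<omega> Theta)"
  have S: "?S \<in> ?R \<rightarrow>\<^sub>M (?N \<Otimes>\<^sub>M ?Q)"
    by (intro measurable_Pair measurable_component_singleton measurable_restrict_subset) auto
  have m1: "(\<lambda>\<xi>. \<lambda>\<eta>\<in>UNIV. \<xi> (\<phi> \<eta>)) \<in> ?Q \<rightarrow>\<^sub>M ?R"
    using a by (intro measurable_restrict measurable_component_singleton) (auto simp: \<phi>_def Theta_def)
  have m2: "(\<lambda>(x, X). X([] := x)) \<in> (?N \<Otimes>\<^sub>M ?Q) \<rightarrow>\<^sub>M ?R"
  proof (rule measurable_PiM_single')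
    fix \<eta> :: "int list"
    show "(\<lambda>p. (\<lambda>(x, X). X([] := x)) p \<eta>) \<in> (?N \<Otimes>\<^sub>M ?Q) \<rightarrow>\<^sub>M ?N"
    proof (cases "\<eta> = []")
      case False
      then have "\<eta> \<in> Theta" by (simp add: Theta_def)
      from measurable_compose[OF measurable_snd measurable_component_singleton[OF this]]
      show ?thesis using False by (simp add: case_prod_unfold)
    qed (simp add: case_prod_unfold)
  qed (auto simp: space_pair_measure space_PiM Theta_def PiE_def Pi_def)
  have "distr ?Q (?N \<Otimes>\<^sub>M ?Q) (\<lambda>\<xi>. (\<xi> a, subfield b \<xi>)) = distr (distr ?Q ?R (\<lambda>\<xi>. \<lambda>\<eta>\<in>UNIV. \<xi> (\<phi> \<eta>))) (?N \<Otimes>\<^sub>M ?Q) ?S"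
    unfolding distr_distr[OF S m1]
    by (intro distr_cong refl) (auto simp: \<phi>_def subfield_def Theta_def fun_eq_iff)
  also have "\<dots> = distr (distr (?N \<Otimes>\<^sub>M ?Q) ?R (\<lambda>(x, X). X([] := x))) (?N \<Otimes>\<^sub>M ?Q) ?S"
    unfolding R1 R2 ..
  also have "\<dots> = distr (?N \<Otimes>\<^sub>M ?Q) (?N \<Otimes>\<^sub>M ?Q) (\<lambda>p. p)"
    unfolding distr_distr[OF S m2]
    by (intro distr_cong refl)
      (auto simp: space_pair_measure space_PiM Theta_def PiE_def extensional_def fun_eq_iff)
  finally show ?thesis by simp
qed

section \<open>Mean squares of sums of independent variables\<close>

lemma (in prob_space) variance_indep_sum:
  fixes Z :: "'j \<Rightarrow> 'a \<Rightarrow> real"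
  assumes J: "finite J"
  shows "indep_vars (\<lambda>_. borel) Z J \<Longrightarrow> (\<And>j. j \<in> J \<Longrightarrow> integrable M (\<lambda>\<omega>. (Z j \<omega>)\<^sup>2))
      \<Longrightarrow> (\<And>j. j \<in> J \<Longrightarrow> expectation (Z j) = 0) \<Longrightarrow>
    integrable M (\<lambda>\<omega>. (\<Sum>j\<in>J. Z j \<omega>)\<^sup>2) \<and> expectation (\<lambda>\<omega>. (\<Sum>j\<in>J. Z j \<omega>)\<^sup>2) = (\<Sum>j\<in>J. expectation (\<lambda>\<omega>. (Z j \<omega>)\<^sup>2))"
  using J
proof (induction J rule: finite_induct)
  case (insert i J)
  let ?S = "\<lambda>\<omega>. \<Sum>j\<in>J. Z j \<omega>"
  have rv: "random_variable borel (Z j)" if "j \<in> insert i J" for j using insert.prems(1) that by (auto simp: indep_vars_def)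
  have i1: "integrable M (Z j)" if "j \<in> insert i J" for j
    by (rule square_integrable_imp_integrable[OF rv[OF that] insert.prems(2)[OF that]])
  have IH: "integrable M (\<lambda>\<omega>. (?S \<omega>)\<^sup>2)" "expectation (\<lambda>\<omega>. (?S \<omega>)\<^sup>2) = (\<Sum>j\<in>J. expectation (\<lambda>\<omega>. (Z j \<omega>)\<^sup>2))"
    using insert.IH indep_vars_subset[OF insert.prems(1)] insert.prems(2,3) by auto
  have iS: "integrable M ?S" using i1 by (intro Bochner_Integration.integrable_sum) auto
  have ind: "indep_var borel (Z i) borel ?S" using insert by (intro indep_vars_sum) auto
  have c: "integrable M (\<lambda>\<omega>. Z i \<omega> * ?S \<omega>)" "expectation (\<lambda>\<omega>. Z i \<omega> * ?S \<omega>) = 0"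
    using indep_var_integrable[OF ind i1 iS] indep_var_lebesgue_integral[OF ind i1 iS] insert.prems(3) by auto
  have e: "(\<Sum>j\<in>insert i J. Z j \<omega>)\<^sup>2 = (Z i \<omega>)\<^sup>2 + (2 * (Z i \<omega> * ?S \<omega>) + (?S \<omega>)\<^sup>2)" for \<omega>
    using insert.hyps by (simp add: power2_sum)
  have i2: "integrable M (\<lambda>\<omega>. (Z i \<omega>)\<^sup>2)" using insert.prems(2) by simp
  have i3: "integrable M (\<lambda>\<omega>. 2 * (Z i \<omega> * ?S \<omega>) + (?S \<omega>)\<^sup>2)" using c(1) IH(1) by simp
  have "expectation (\<lambda>\<omega>. 2 * (Z i \<omega> * ?S \<omega>) + (?S \<omega>)\<^sup>2) = expectation (\<lambda>\<omega>. (?S \<omega>)\<^sup>2)"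
    using c IH(1) by (subst Bochner_Integration.integral_add) auto
  then show ?case unfolding e using i2 i3 insert.hyps IH(2) by simp
qed simp

text \<open>Variance plus squared bias, with each variance replaced by the second moment. The bias
  is a square of a sum and must not be split into summands, since its terms telescope later.\<close>

lemma (in prob_space) mean_square_indep_sum:
  fixes Y :: "'j \<Rightarrow> 'a \<Rightarrow> real" and c :: real
  assumes J: "finite J" and ind: "indep_vars (\<lambda>_. borel) Y J" and sq: "\<And>j. j \<in> J \<Longrightarrow> integrable M (\<lambda>\<omega>. (Y j \<omega>)\<^sup>2)"
  shows "integrable M (\<lambda>\<omega>. ((\<Sum>j\<in>J. Y j \<omega>) - c)\<^sup>2)"
    and "expectation (\<lambda>\<omega>. ((\<Sum>j\<in>J. Y j \<omega>) - c)\<^sup>2) \<le> (\<Sum>j\<in>J. expectation (\<lambda>\<omega>. (Y j \<omega>)\<^sup>2)) + ((\<Sum>j\<in>J. expectation (Y j)) - c)\<^sup>2"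
proof -
  have rv: "random_variable borel (Y j)" if "j \<in> J" for j using ind that by (auto simp: indep_vars_def)
  have i1: "integrable M (Y j)" if "j \<in> J" for j by (rule square_integrable_imp_integrable[OF rv[OF that] sq[OF that]])
  define Z where "Z j \<omega> = Y j \<omega> - expectation (Y j)" for j \<omega>
  define B where "B = (\<Sum>j\<in>J. expectation (Y j)) - c"
  have zsq: "(Z j \<omega>)\<^sup>2 = (Y j \<omega>)\<^sup>2 - 2 * expectation (Y j) * Y j \<omega> + (expectation (Y j))\<^sup>2" for j \<omega>
    by (simp add: Z_def power2_diff)
  have zi: "integrable M (\<lambda>\<omega>. (Z j \<omega>)\<^sup>2)" if "j \<in> J" for j
    unfolding zsq using sq[OF that] i1[OF that] by simp
  have zv: "expectation (\<lambda>\<omega>. (Z j \<omega>)\<^sup>2) \<le> expectation (\<lambda>\<omega>. (Y j \<omega>)\<^sup>2)" if "j \<in> J" for j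
  proof -
    have "expectation (\<lambda>\<omega>. (Z j \<omega>)\<^sup>2) = expectation (\<lambda>\<omega>. (Y j \<omega>)\<^sup>2) - (expectation (Y j))\<^sup>2"
      unfolding zsq using sq[OF that] i1[OF that] prob_space by (simp add: power2_eq_square)
    then show ?thesis by simp
  qed
  have zm: "expectation (Z j) = 0" "integrable M (Z j)" if "j \<in> J" for j
    unfolding Z_def using i1[OF that] prob_space by simp_all
  have zind: "indep_vars (\<lambda>_. borel) Z J"
    unfolding Z_def using ind by (rule indep_vars_compose2[where Y="\<lambda>j y. y - expectation (Y j)"]) simp
  note V = variance_indep_sum[OF J zind zi zm(1)]
  have zs: "integrable M (\<lambda>\<omega>. \<Sum>j\<in>J. Z j \<omega>)" "expectation (\<lambda>\<omega>. \<Sum>j\<in>J. Z j \<omega>) = 0"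
    using zm by (auto intro!: Bochner_Integration.integrable_sum simp: Bochner_Integration.integral_sum)
  have e: "((\<Sum>j\<in>J. Y j \<omega>) - c)\<^sup>2 = (\<Sum>j\<in>J. Z j \<omega>)\<^sup>2 + (2 * B * (\<Sum>j\<in>J. Z j \<omega>) + B\<^sup>2)" for \<omega>
  proof -
    have "(\<Sum>j\<in>J. Y j \<omega>) - c = (\<Sum>j\<in>J. Z j \<omega>) + B" by (simp add: Z_def B_def sum_subtractf)
    then show ?thesis by (simp add: power2_sum algebra_simps)
  qed
  show "integrable M (\<lambda>\<omega>. ((\<Sum>j\<in>J. Y j \<omega>) - c)\<^sup>2)" unfolding e using V zs by simp
  have "expectation (\<lambda>\<omega>. ((\<Sum>j\<in>J. Y j \<omega>) - c)\<^sup>2) = (\<Sum>j\<in>J. expectation (\<lambda>\<omega>. (Z j \<omega>)\<^sup>2)) + B\<^sup>2"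
    unfolding e using V zs prob_space by simp
  also have "\<dots> \<le> (\<Sum>j\<in>J. expectation (\<lambda>\<omega>. (Y j \<omega>)\<^sup>2)) + B\<^sup>2"
    by (intro add_right_mono sum_mono zv)
  finally show "expectation (\<lambda>\<omega>. ((\<Sum>j\<in>J. Y j \<omega>) - c)\<^sup>2) \<le> (\<Sum>j\<in>J. expectation (\<lambda>\<omega>. (Y j \<omega>)\<^sup>2)) + ((\<Sum>j\<in>J. expectation (Y j)) - c)\<^sup>2"
    by (simp add: B_def)
qed

section \<open>Second moments of the weights\<close>

lemma has_integral_arctan_sqrt:
  assumes a: "a > 0"
  shows "((\<lambda>q. 1 / ((1 + a * q) * (2 * sqrt q))) has_integral arctan (sqrt a) / sqrt a) {0..1}"
proof -
  have "((\<lambda>q. 1 / ((1 + a * q) * (2 * sqrt q))) has_integral (arctan (sqrt a * sqrt 1) / sqrt a - arctan (sqrt a * sqrt 0) / sqrt a)) {0..1}"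
  proof (rule fundamental_theorem_of_calculus_interior[where f="\<lambda>q. arctan (sqrt a * sqrt q) / sqrt a"])
    show "continuous_on {0..1} (\<lambda>q. arctan (sqrt a * sqrt q) / sqrt a)" using a by (intro continuous_intros) auto
    fix x :: real assume "x \<in> {0<..<1}"
    then have x: "x > 0" by simp
    have "((\<lambda>q. arctan (sqrt a * sqrt q)) has_real_derivative inverse (1 + (sqrt a * sqrt x)\<^sup>2) * (sqrt a * (inverse (sqrt x) / 2))) (at x)"
      by (intro DERIV_chain2[OF DERIV_arctan] DERIV_cmult DERIV_real_sqrt x)
    then have "((\<lambda>q. arctan (sqrt a * sqrt q) / sqrt a) has_real_derivative inverse (1 + (sqrt a * sqrt x)\<^sup>2) * (sqrt a * (inverse (sqrt x) / 2)) / sqrt a) (at x)"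
      by (rule DERIV_cdivide)
    also have "inverse (1 + (sqrt a * sqrt x)\<^sup>2) * (sqrt a * (inverse (sqrt x) / 2)) / sqrt a = 1 / ((1 + a * x) * (2 * sqrt x))"
    proof -
      have "inverse c * (s * (inverse r / 2)) / s = 1 / (c * (2 * r))" if "s > 0" for c s r :: real
        using that by (cases "c = 0"; cases "r = 0") (simp_all add: field_simps)
      moreover have "(sqrt a * sqrt x)\<^sup>2 = a * x" using x a by (simp add: power_mult_distrib)
      ultimately show ?thesis using a by simp
    qed
    finally show "((\<lambda>q. arctan (sqrt a * sqrt q) / sqrt a) has_vector_derivative 1 / ((1 + a * x) * (2 * sqrt x))) (at x)"
      by (simp add: has_real_derivative_iff_has_vector_derivative)
  qed simp
  then show ?thesis by simp
qed

lemma measurable_sqrt_law [simp]: "borel_measurable sqrt_law = borel_measurable borel"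
  by (rule measurable_cong_sets) simp_all

text \<open>Origin of the contraction. By \<open>exp (- y) \<le> 1 / (1 + y)\<close> the integral is
  at most \<open>arctan (sqrt a) / sqrt a\<close>, and \<open>arctan\<close> stays below
  \<open>pi / 2 < 2\<close>. The density concentrates near \<open>0\<close>, which makes the decay
  as slow as \<open>1 / sqrt a\<close>.\<close>

lemma sqrt_law_exp_le:
  assumes a: "a > 0"
  shows "(\<integral>\<^sup>+\<rho>. ennreal (exp (- a * \<rho>)) \<partial>sqrt_law) \<le> ennreal (2 / sqrt a)"
proof -
  have em: "(\<lambda>\<rho>. ennreal (exp (- a * \<rho>))) \<in> borel_measurable lborel"
    by (intro measurable_compose[OF _ measurable_ennreal]) (simp add: borel_measurable_continuous_onI continuous_intros)
  have "(\<integral>\<^sup>+\<rho>. ennreal (exp (- a * \<rho>)) \<partial>sqrt_law) = (\<integral>\<^sup>+q. ennreal (indicator {0<..<1} q / (2 * sqrt q)) * ennreal (exp (- a * q)) \<partial>lborel)"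
    unfolding sqrt_law_def using inv_sqrt_measurable[of "{0<..<1}"] em by (subst nn_integral_density) auto
  also have "\<dots> \<le> (\<integral>\<^sup>+q. ennreal (indicator {0..1} q * (1 / ((1 + a * q) * (2 * sqrt q)))) \<partial>lborel)"
  proof (rule nn_integral_mono)
    fix q :: real
    show "ennreal (indicator {0<..<1} q / (2 * sqrt q)) * ennreal (exp (- a * q)) \<le> ennreal (indicator {0..1} q * (1 / ((1 + a * q) * (2 * sqrt q))))"
    proof (cases "q \<in> {0<..<1}")
      case True
      then have q: "q > 0" by simp
      have p: "0 < 1 + a * q" using a q by (simp add: add_pos_pos)
      have "exp (- a * q) = 1 / exp (a * q)" by (simp add: exp_minus field_simps)
      also have "\<dots> \<le> 1 / (1 + a * q)"
        using exp_ge_add_one_self[of "a * q"] p by (intro divide_left_mono) auto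
      finally have "1 / (2 * sqrt q) * exp (- a * q) \<le> 1 / (2 * sqrt q) * (1 / (1 + a * q))"
        using q by (intro mult_left_mono) auto
      then show ?thesis using True q by (simp add: ennreal_mult'[symmetric] mult.commute ennreal_leI)
    qed simp
  qed
  also have "\<dots> = ennreal (arctan (sqrt a) / sqrt a)"
  proof (rule nn_integral_has_integral_lborel)
    have "((\<lambda>q. if q \<in> {0..1} then 1 / ((1 + a * q) * (2 * sqrt q)) else 0) has_integral arctan (sqrt a) / sqrt a) UNIV"
      using has_integral_arctan_sqrt[OF a] by (simp only: has_integral_restrict_UNIV)
    moreover have "(\<lambda>q. if q \<in> {0..1} then 1 / ((1 + a * q) * (2 * sqrt q)) else 0) = (\<lambda>q. indicator {0..1} q * (1 / ((1 + a * q) * (2 * sqrt q))))"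
      by (auto simp: indicator_def)
    ultimately show "((\<lambda>q. indicator {0..1} q * (1 / ((1 + a * q) * (2 * sqrt q)))) has_integral arctan (sqrt a) / sqrt a) UNIV" by simp
    show "0 \<le> indicator {0..1} q * (1 / ((1 + a * q) * (2 * sqrt q)))" for q using a by (auto simp: indicator_def)
    show "(\<lambda>q. indicator {0..1} q * (1 / ((1 + a * q) * (2 * sqrt q)))) \<in> borel_measurable borel"
      by (intro borel_measurable_times borel_measurable_indicator borel_measurable_divide borel_measurable_const borel_measurable_continuous_onI continuous_intros) simp
  qed
  also have "\<dots> \<le> ennreal (2 / sqrt a)"
    using arctan_ubound[of "sqrt a"] pi_less_4 a by (intro ennreal_leI divide_right_mono) auto
  finally show ?thesis .
qed

lemma std_normal_Rd_moment22:
  assumes "i \<in> {1..d}" "j \<in> {1..d}"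
  shows "integrable (std_normal_Rd d) (\<lambda>z. (z i)\<^sup>2 * (z j)\<^sup>2)" "(\<integral>z. (z i)\<^sup>2 * (z j)\<^sup>2 \<partial>std_normal_Rd d) \<le> 3"
proof -
  note i4 = integrable_std_normal_Rd_power[OF assms(1), of 4] integrable_std_normal_Rd_power[OF assms(2), of 4]
  have le: "(z i)\<^sup>2 * (z j)\<^sup>2 \<le> ((z i) ^ 4 + (z j) ^ 4) / 2" for z :: "nat \<Rightarrow> real"
    using zero_le_power2[of "(z i)\<^sup>2 - (z j)\<^sup>2"] by (simp add: power2_diff flip: power_mult)
  have i: "integrable (std_normal_Rd d) (\<lambda>z. ((z i) ^ 4 + (z j) ^ 4) / 2)" using i4 by simp
  show p: "integrable (std_normal_Rd d) (\<lambda>z. (z i)\<^sup>2 * (z j)\<^sup>2)"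
  proof (rule Bochner_Integration.integrable_bound[OF i])
    have "(\<lambda>z. z i) \<in> borel_measurable (std_normal_Rd d)" "(\<lambda>z. z j) \<in> borel_measurable (std_normal_Rd d)" by measurable
    then show "(\<lambda>z. (z i)\<^sup>2 * (z j)\<^sup>2) \<in> borel_measurable (std_normal_Rd d)" by simp
    show "AE z in std_normal_Rd d. norm ((z i)\<^sup>2 * (z j)\<^sup>2) \<le> norm (((z i) ^ 4 + (z j) ^ 4) / 2)"
      using le by (intro AE_I2) (simp add: abs_mult)
  qed
  have "(\<integral>z. (z i)\<^sup>2 * (z j)\<^sup>2 \<partial>std_normal_Rd d) \<le> (\<integral>z. ((z i) ^ 4 + (z j) ^ 4) / 2 \<partial>std_normal_Rd d)"
    by (rule integral_mono[OF p i le])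
  also have "\<dots> = 3" using i4 std_normal_Rd_moment4[OF assms(1)] std_normal_Rd_moment4[OF assms(2)] by simp
  finally show "(\<integral>z. (z i)\<^sup>2 * (z j)\<^sup>2 \<partial>std_normal_Rd d) \<le> 3" .
qed

text \<open>The Gaussian part of the squared weight in component \<open>k\<close>, so that value and
  gradient components can be treated alike.\<close>

definition comp_sq :: "nat \<Rightarrow> rvec \<Rightarrow> real" where
  "comp_sq k z = (if k = 0 then 1 else (z k)\<^sup>2)"

lemma comp_sq_nonneg [simp]: "0 \<le> comp_sq k z" by (simp add: comp_sq_def)

lemma comp_sq_moment:
  assumes k: "k \<in> {0..d}"
  shows "integrable (std_normal_Rd d) (comp_sq k)" "(\<integral>z. comp_sq k z \<partial>std_normal_Rd d) = 1"
    and "j \<in> {1..d} \<Longrightarrow> integrable (std_normal_Rd d) (\<lambda>z. comp_sq k z * (z j)\<^sup>2)"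
    and "j \<in> {1..d} \<Longrightarrow> (\<integral>z. comp_sq k z * (z j)\<^sup>2 \<partial>std_normal_Rd d) \<le> 3"
proof -
  have c: "k = 0 \<or> k \<in> {1..d}" using k by auto
  have eq: "comp_sq k = (\<lambda>z. if k = 0 then 1 else (z k)\<^sup>2)" by (simp add: comp_sq_def fun_eq_iff)
  show "integrable (std_normal_Rd d) (comp_sq k)"
    unfolding eq using c integrable_std_normal_Rd_power[of k d 2] by auto
  show "(\<integral>z. comp_sq k z \<partial>std_normal_Rd d) = 1"
    using c std_normal_Rd_moment2[of k d] gauss.prob_space by (auto simp: comp_sq_def)
  show "j \<in> {1..d} \<Longrightarrow> integrable (std_normal_Rd d) (\<lambda>z. comp_sq k z * (z j)\<^sup>2)"
    using c integrable_std_normal_Rd_power[of j d 2] std_normal_Rd_moment22(1)[of k d j] by (auto simp: comp_sq_def)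
  show "j \<in> {1..d} \<Longrightarrow> (\<integral>z. comp_sq k z * (z j)\<^sup>2 \<partial>std_normal_Rd d) \<le> 3"
    using c std_normal_Rd_moment2[of j d] std_normal_Rd_moment22(2)[of k d j] by (auto simp: comp_sq_def)
qed

lemma comp_sq_measurable: "comp_sq k \<in> borel_measurable (borel_Rd d)"
proof -
  have "(\<lambda>z. z k) \<in> borel_measurable (borel_Rd d)" by measurable
  then show ?thesis unfolding comp_sq_def by (cases "k = 0") simp_all
qed

lemma path_weight_sq_le:
  assumes t: "t \<in> {0<..T}" and \<rho>: "\<rho> \<in> {0<..<1}"
  shows "(path_weight t k (z, \<rho>))\<^sup>2 \<le> t * (4 * T + 2) * comp_sq k z"
proof -
  have t0: "t > 0" and r0: "\<rho> > 0" using t \<rho> by auto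
  show ?thesis
  proof (cases "k = 0")
    case True
    have "(path_weight t k (z, \<rho>))\<^sup>2 = t * (4 * (t * \<rho>))"
      using True r0 t0 by (simp add: path_weight_simps power_mult_distrib) (simp add: power2_eq_square)
    also have "\<dots> \<le> t * (4 * T + 2)"
    proof (intro mult_left_mono)
      have "t * \<rho> \<le> T * 1" using t \<rho> by (intro mult_mono) auto
      then show "4 * (t * \<rho>) \<le> 4 * T + 2" by simp
    qed (use t0 in simp)
    finally show ?thesis using True by (simp add: comp_sq_def)
  next
    case False
    have "(path_weight t k (z, \<rho>))\<^sup>2 = t * 2 * (z k)\<^sup>2"
      using False r0 t0 by (simp add: path_weight_simps power_mult_distrib)
    also have "\<dots> \<le> t * (4 * T + 2) * (z k)\<^sup>2"
      using t by (intro mult_right_mono mult_left_mono) auto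
    finally show ?thesis using False by (simp add: comp_sq_def)
  qed
qed

lemma noise_law_nn_integral_product:
  assumes a: "\<alpha> \<in> borel_measurable (borel_Rd d)" "\<And>z. \<alpha> z \<ge> 0" and b: "\<beta> \<in> borel_measurable borel" "\<And>\<rho>. \<beta> \<rho> \<ge> 0"
  shows "(\<integral>\<^sup>+p. ennreal (\<alpha> (fst p) * \<beta> (snd p)) \<partial>noise_law d)
      = (\<integral>\<^sup>+z. ennreal (\<alpha> z) \<partial>std_normal_Rd d) * (\<integral>\<^sup>+\<rho>. ennreal (\<beta> \<rho>) \<partial>sqrt_law)"
proof -
  interpret prob_space sqrt_law by (rule prob_space_sqrt_law)
  have m: "(\<lambda>z. ennreal (\<alpha> z)) \<in> borel_measurable (std_normal_Rd d)" "(\<lambda>\<rho>. ennreal (\<beta> \<rho>)) \<in> borel_measurable sqrt_law"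
    using a b by auto
  have "(\<lambda>p. ennreal (\<alpha> (fst p)) * ennreal (\<beta> (snd p))) \<in> borel_measurable (std_normal_Rd d \<Otimes>\<^sub>M sqrt_law)"
    using m by measurable
  then have "(\<integral>\<^sup>+p. ennreal (\<alpha> (fst p)) * ennreal (\<beta> (snd p)) \<partial>noise_law d)
    = (\<integral>\<^sup>+z. \<integral>\<^sup>+\<rho>. ennreal (\<alpha> z) * ennreal (\<beta> \<rho>) \<partial>sqrt_law \<partial>std_normal_Rd d)"
    unfolding noise_law_def by (subst nn_integral_fst[symmetric]) auto
  also have "\<dots> = (\<integral>\<^sup>+z. ennreal (\<alpha> z) \<partial>std_normal_Rd d) * (\<integral>\<^sup>+\<rho>. ennreal (\<beta> \<rho>) \<partial>sqrt_law)"
    using m by (simp add: nn_integral_cmult nn_integral_multc)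
  finally show ?thesis using a b by (simp add: ennreal_mult)
qed

lemma path_weight_second_moment:
  assumes t: "t \<in> {0<..T}" and k: "k \<in> {0..d}"
  shows "(\<integral>\<^sup>+p. ennreal ((path_weight t k p)\<^sup>2) \<partial>noise_law d) \<le> ennreal (T * (4 * T + 2))"
proof -
  interpret prob_space sqrt_law by (rule prob_space_sqrt_law)
  have "(\<integral>\<^sup>+p. ennreal ((path_weight t k p)\<^sup>2) \<partial>noise_law d) \<le> (\<integral>\<^sup>+p. ennreal (comp_sq k (fst p) * (t * (4 * T + 2))) \<partial>noise_law d)"
  proof (rule nn_integral_mono_AE)
    show "AE p in noise_law d. ennreal ((path_weight t k p)\<^sup>2) \<le> ennreal (comp_sq k (fst p) * (t * (4 * T + 2)))"
      using AE_noise_law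
    proof eventually_elim
      case (elim p)
      then show ?case using path_weight_sq_le[OF t, of "snd p" k "fst p"] by (intro ennreal_leI) (simp add: mult_ac)
    qed
  qed
  also have "\<dots> = (\<integral>\<^sup>+z. ennreal (comp_sq k z) \<partial>std_normal_Rd d) * (\<integral>\<^sup>+\<rho>. ennreal (t * (4 * T + 2)) \<partial>sqrt_law)"
    using t by (intro noise_law_nn_integral_product comp_sq_measurable) auto
  also have "(\<integral>\<^sup>+z. ennreal (comp_sq k z) \<partial>std_normal_Rd d) = 1"
    using comp_sq_moment(1,2)[OF k] by (subst nn_integral_eq_integral) auto
  also have "1 * (\<integral>\<^sup>+\<rho>. ennreal (t * (4 * T + 2)) \<partial>sqrt_law) = ennreal (t * (4 * T + 2))"
    using emeasure_space_1 by simp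
  also have "\<dots> \<le> ennreal (T * (4 * T + 2))" using t by (intro ennreal_leI mult_right_mono) auto
  finally show ?thesis .
qed

context pde_solution
begin

lemma wt_measurable: "wt \<in> borel_measurable (borel_Rd d)"
proof -
  have "(\<lambda>x. x j) \<in> borel_measurable (borel_Rd d)" for j by measurable
  then show ?thesis unfolding wt_def
    by (intro borel_measurable_add borel_measurable_sum borel_measurable_times borel_measurable_power borel_measurable_const)
qed

lemma wt_add_scaled_le:
  assumes "s \<le> T" "s \<ge> 0"
  shows "wt (add_scaled d x (sqrt (2 * s)) z) \<le> 2 * wt x + 4 * T * (\<Sum>j=1..d. L j * (z j)\<^sup>2)"
proof -
  have "(\<Sum>j=1..d. L j * (add_scaled d x (sqrt (2 * s)) z j)\<^sup>2) \<le> (\<Sum>j=1..d. 2 * (L j * (x j)\<^sup>2) + 4 * T * (L j * (z j)\<^sup>2))"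
  proof (rule sum_mono)
    fix j assume j: "j \<in> {1..d}"
    have "(x j + sqrt (2 * s) * z j)\<^sup>2 \<le> 2 * (x j)\<^sup>2 + 2 * (sqrt (2 * s) * z j)\<^sup>2"
      using zero_le_power2[of "x j - sqrt (2 * s) * z j"] by (simp add: power2_sum power2_diff)
    also have "2 * (sqrt (2 * s) * z j)\<^sup>2 = 4 * s * (z j)\<^sup>2" using assms by (simp add: power_mult_distrib)
    also have "\<dots> \<le> 4 * T * (z j)\<^sup>2" using assms by (intro mult_right_mono) auto
    finally have "L j * (x j + sqrt (2 * s) * z j)\<^sup>2 \<le> L j * (2 * (x j)\<^sup>2 + 4 * T * (z j)\<^sup>2)"
      using L_nonneg[OF j] by (intro mult_left_mono) auto
    then show "L j * (add_scaled d x (sqrt (2 * s)) z j)\<^sup>2 \<le> 2 * (L j * (x j)\<^sup>2) + 4 * T * (L j * (z j)\<^sup>2)"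
      using j by (simp add: algebra_simps)
  qed
  also have "\<dots> = 2 * (\<Sum>j=1..d. L j * (x j)\<^sup>2) + 4 * T * (\<Sum>j=1..d. L j * (z j)\<^sup>2)"
    by (simp add: sum.distrib sum_distrib_left)
  finally show ?thesis by (simp add: wt_def)
qed

text \<open>\<open>12 = 4 * 3\<close>: the factor \<open>4 * T\<close> of the squared increment
  times the bound \<open>3\<close> for mixed fourth moments. The sum over the coordinates costs only
  \<open>lam\<close>.\<close>

lemma weighted_gauss_moment:
  assumes k: "k \<in> {0..d}"
  shows "(\<integral>\<^sup>+z. ennreal (comp_sq k z * (2 * wt x + 4 * T * (\<Sum>j=1..d. L j * (z j)\<^sup>2))) \<partial>std_normal_Rd d) \<le> ennreal ((2 + 12 * T * lam) * wt x)"
proof -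
  have e: "comp_sq k z * (2 * wt x + 4 * T * (\<Sum>j=1..d. L j * (z j)\<^sup>2)) = 2 * wt x * comp_sq k z + (\<Sum>j=1..d. 4 * T * L j * (comp_sq k z * (z j)\<^sup>2))" for z
    by (simp add: distrib_left sum_distrib_left mult_ac)
  have i: "integrable (std_normal_Rd d) (\<lambda>z. 2 * wt x * comp_sq k z + (\<Sum>j=1..d. 4 * T * L j * (comp_sq k z * (z j)\<^sup>2)))"
    using comp_sq_moment[OF k] by (intro Bochner_Integration.integrable_add integrable_mult_right Bochner_Integration.integrable_sum) auto
  have "(\<integral>z. 2 * wt x * comp_sq k z + (\<Sum>j=1..d. 4 * T * L j * (comp_sq k z * (z j)\<^sup>2)) \<partial>std_normal_Rd d)
     = 2 * wt x + (\<Sum>j=1..d. 4 * T * L j * (\<integral>z. comp_sq k z * (z j)\<^sup>2 \<partial>std_normal_Rd d))"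
    using comp_sq_moment[OF k]
    by (subst Bochner_Integration.integral_add) (auto intro!: Bochner_Integration.integrable_sum simp: Bochner_Integration.integral_sum)
  also have "\<dots> \<le> 2 * wt x + (\<Sum>j=1..d. 4 * T * L j * 3)"
    using comp_sq_moment(4)[OF k] T L_nonneg by (intro add_left_mono sum_mono mult_left_mono mult_nonneg_nonneg) auto
  also have "\<dots> = 2 * wt x + 12 * T * (\<Sum>j=1..d. L j)" by (simp add: sum_distrib_left sum_distrib_right mult_ac)
  also have "\<dots> \<le> 2 * wt x + 12 * T * (lam * wt x)"
  proof -
    have "lam * 1 \<le> lam * wt x" using lam wt_ge_1 by (intro mult_left_mono) auto
    then have "(\<Sum>j=1..d. L j) \<le> lam * wt x" using L_sum by simp
    then show ?thesis using T by (intro add_left_mono mult_left_mono) auto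
  qed
  finally have "(\<integral>z. 2 * wt x * comp_sq k z + (\<Sum>j=1..d. 4 * T * L j * (comp_sq k z * (z j)\<^sup>2)) \<partial>std_normal_Rd d) \<le> (2 + 12 * T * lam) * wt x"
    by (simp add: algebra_simps)
  moreover have "0 \<le> 2 * wt x * comp_sq k z + (\<Sum>j=1..d. 4 * T * L j * (comp_sq k z * (z j)\<^sup>2))" for z
    using wt_ge_1[of x] T L_nonneg by (intro add_nonneg_nonneg mult_nonneg_nonneg sum_nonneg) auto
  ultimately show ?thesis unfolding e using i by (subst nn_integral_eq_integral) (auto intro: ennreal_leI)
qed

text \<open>A step back in time by \<open>t * \<rho>\<close> gains
  \<open>exp (- \<mu> * t * \<rho>)\<close> against the weighted norm, and the mean of this gain is
  of order \<open>1 / sqrt (\<mu> * t)\<close>. The Gaussian step reproduces the spatial weight up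
  to a constant.\<close>

lemma weighted_path_moment:
  assumes t: "t \<in> {0<..T}" and k: "k \<in> {0..d}" and \<mu>: "\<mu> > 0"
  shows "(\<integral>\<^sup>+p. ennreal ((path_weight t k p)\<^sup>2 * (exp (\<mu> * (t * (1 - snd p))) * wt (add_scaled d x (sqrt (2 * t * snd p)) (fst p)))) \<partial>noise_law d)
    \<le> ennreal ((4 * T + 2) * (2 * sqrt T / sqrt \<mu>) * (2 + 12 * T * lam) * (exp (\<mu> * t) * wt x))" (is "?L \<le> _")
proof -
  have t0: "t > 0" using t by simp
  let ?\<alpha> = "\<lambda>z. comp_sq k z * (2 * wt x + 4 * T * (\<Sum>j=1..d. L j * (z j)\<^sup>2))"
  let ?\<beta> = "\<lambda>\<rho>. t * (4 * T + 2) * exp (\<mu> * t) * exp (- (\<mu> * t) * \<rho>)"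
  have ann: "0 \<le> 2 * wt x + 4 * T * (\<Sum>j=1..d. L j * (z j)\<^sup>2)" for z
    using wt_ge_1[of x] T wt_sum_nonneg[of z] by (intro add_nonneg_nonneg mult_nonneg_nonneg) auto
  have "?L \<le> (\<integral>\<^sup>+p. ennreal (?\<alpha> (fst p) * ?\<beta> (snd p)) \<partial>noise_law d)"
  proof (rule nn_integral_mono_AE)
    show "AE p in noise_law d. ennreal ((path_weight t k p)\<^sup>2 * (exp (\<mu> * (t * (1 - snd p))) * wt (add_scaled d x (sqrt (2 * t * snd p)) (fst p)))) \<le> ennreal (?\<alpha> (fst p) * ?\<beta> (snd p))"
      using AE_noise_law
    proof eventually_elim
      case (elim p)
      obtain z \<rho> where p: "p = (z, \<rho>)" by (cases p)
      have \<rho>: "\<rho> \<in> {0<..<1}" using elim by (simp add: p)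
      have tr: "t * \<rho> \<le> T" "0 \<le> t * \<rho>"
      proof -
        have "t * \<rho> \<le> T * 1" using t \<rho> by (intro mult_mono) auto
        then show "t * \<rho> \<le> T" "0 \<le> t * \<rho>" using t \<rho> by auto
      qed
      have "exp (\<mu> * (t * (1 - \<rho>))) = exp (\<mu> * t) * exp (- (\<mu> * t) * \<rho>)"
        by (simp add: right_diff_distrib mult.assoc flip: exp_add)
      moreover have "(path_weight t k (z, \<rho>))\<^sup>2 * (exp (\<mu> * t) * exp (- (\<mu> * t) * \<rho>) * wt (add_scaled d x (sqrt (2 * (t * \<rho>))) z))
         \<le> (t * (4 * T + 2) * comp_sq k z) * (exp (\<mu> * t) * exp (- (\<mu> * t) * \<rho>) * (2 * wt x + 4 * T * (\<Sum>j=1..d. L j * (z j)\<^sup>2)))"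
        using path_weight_sq_le[OF t \<rho>, of k z] wt_add_scaled_le[OF tr] wt_ge_1[of "add_scaled d x (sqrt (2 * (t * \<rho>))) z"] t
        by (intro mult_mono mult_left_mono mult_nonneg_nonneg) auto
      ultimately show ?case unfolding p by (intro ennreal_leI) (simp add: mult_ac)
    qed
  qed
  also have "\<dots> = (\<integral>\<^sup>+z. ennreal (?\<alpha> z) \<partial>std_normal_Rd d) * (\<integral>\<^sup>+\<rho>. ennreal (?\<beta> \<rho>) \<partial>sqrt_law)"
  proof (rule noise_law_nn_integral_product)
    have "(\<lambda>z. z j) \<in> borel_measurable (borel_Rd d)" for j by measurable
    then show "?\<alpha> \<in> borel_measurable (borel_Rd d)"
      by (intro borel_measurable_times comp_sq_measurable borel_measurable_add borel_measurable_sum borel_measurable_power borel_measurable_const)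
    show "?\<beta> \<in> borel_measurable borel" by (intro borel_measurable_continuous_onI continuous_intros)
  qed (use t ann in \<open>auto intro!: mult_nonneg_nonneg\<close>)
  also have "\<dots> \<le> ennreal ((2 + 12 * T * lam) * wt x) * ennreal (t * (4 * T + 2) * exp (\<mu> * t) * (2 / sqrt (\<mu> * t)))"
  proof (rule mult_mono[OF weighted_gauss_moment[OF k]])
    have "(\<integral>\<^sup>+\<rho>. ennreal (?\<beta> \<rho>) \<partial>sqrt_law) = ennreal (t * (4 * T + 2) * exp (\<mu> * t)) * (\<integral>\<^sup>+\<rho>. ennreal (exp (- (\<mu> * t) * \<rho>)) \<partial>sqrt_law)"
    proof -
      have "(\<lambda>\<rho>. exp (- (\<mu> * t) * \<rho>)) \<in> borel_measurable borel" by (intro borel_measurable_continuous_onI continuous_intros)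
      then have "(\<lambda>\<rho>. ennreal (exp (- (\<mu> * t) * \<rho>))) \<in> borel_measurable sqrt_law"
        by (intro measurable_compose[OF _ measurable_ennreal]) simp
      then show ?thesis using t by (subst nn_integral_cmult[symmetric]) (auto simp: ennreal_mult'[symmetric])
    qed
    also have "\<dots> \<le> ennreal (t * (4 * T + 2) * exp (\<mu> * t)) * ennreal (2 / sqrt (\<mu> * t))"
      using \<mu> t0 by (intro mult_left_mono sqrt_law_exp_le) auto
    also have "\<dots> = ennreal (t * (4 * T + 2) * exp (\<mu> * t) * (2 / sqrt (\<mu> * t)))"
      using t by (intro ennreal_mult[symmetric]) (auto intro!: mult_nonneg_nonneg simp: \<mu> less_imp_le)
    finally show "(\<integral>\<^sup>+\<rho>. ennreal (?\<beta> \<rho>) \<partial>sqrt_law) \<le> ennreal (t * (4 * T + 2) * exp (\<mu> * t) * (2 / sqrt (\<mu> * t)))" .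
  qed auto
  also have "\<dots> = ennreal ((2 + 12 * T * lam) * wt x * (t * (4 * T + 2) * exp (\<mu> * t) * (2 / sqrt (\<mu> * t))))"
    using T lam wt_ge_1[of x] t \<mu> by (intro ennreal_mult[symmetric]) (auto intro!: mult_nonneg_nonneg add_nonneg_nonneg simp: less_imp_le)
  also have "\<dots> \<le> ennreal ((4 * T + 2) * (2 * sqrt T / sqrt \<mu>) * (2 + 12 * T * lam) * (exp (\<mu> * t) * wt x))"
  proof (rule ennreal_leI)
    \<comment> \<open>The factor \<open>t\<close> of the squared weight cancels the singularity at
      small \<open>t\<close>, so the bound is uniform up to the initial time.\<close>
    have "t * (2 / sqrt (\<mu> * t)) = 2 * sqrt t / sqrt \<mu>"
    proof -
      have "t = sqrt t * sqrt t" using t0 by simp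
      then have "t * (2 / sqrt (\<mu> * t)) = sqrt t * sqrt t * (2 / (sqrt \<mu> * sqrt t))" by (simp add: real_sqrt_mult)
      also have "\<dots> = 2 * sqrt t / sqrt \<mu>"
      proof -
        have "q * q * (2 / (m * q)) = 2 * q / m" if "q > 0" for q m :: real
          using that by (cases "m = 0") (simp_all add: field_simps)
        from this[of "sqrt t" "sqrt \<mu>"] real_sqrt_gt_zero[OF t0] show ?thesis by (simp only:)
      qed
      finally show ?thesis .
    qed
    then have "t * (2 / sqrt (\<mu> * t)) \<le> 2 * sqrt T / sqrt \<mu>"
      using t \<mu> by (simp add: divide_right_mono)
    then have "(t * (2 / sqrt (\<mu> * t))) * ((4 * T + 2) * (2 + 12 * T * lam) * (exp (\<mu> * t) * wt x)) \<le> (2 * sqrt T / sqrt \<mu>) * ((4 * T + 2) * (2 + 12 * T * lam) * (exp (\<mu> * t) * wt x))"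
      using T lam wt_ge_1[of x] by (intro mult_right_mono mult_nonneg_nonneg add_nonneg_nonneg) auto
    then show "(2 + 12 * T * lam) * wt x * (t * (4 * T + 2) * exp (\<mu> * t) * (2 / sqrt (\<mu> * t))) \<le> (4 * T + 2) * (2 * sqrt T / sqrt \<mu>) * (2 + 12 * T * lam) * (exp (\<mu> * t) * wt x)"
      by (simp only: mult_ac)
  qed
  finally show ?thesis .
qed

end

section \<open>Mean square error of the scheme\<close>

text \<open>A summand is indexed by the address of its noise pair. Initial terms have a negative
  second entry, which separates them from the steps of level \<open>0\<close>, although both have
  first entry \<open>0\<close>.\<close>

definition summand :: "nat \<Rightarrow> (real \<Rightarrow> rvec \<Rightarrow> real) \<Rightarrow> (rvec \<Rightarrow> real) \<Rightarrow> nat \<Rightarrow> nat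
    \<Rightarrow> real \<Rightarrow> rvec \<Rightarrow> nat \<Rightarrow> int \<times> int \<Rightarrow> (int list \<Rightarrow> rvec \<times> real) \<Rightarrow> real" where
  "summand d f g M n t x k j \<xi> =
    (if snd j < 0 then 1 / real (M ^ n) * init_term d g t x k (fst (\<xi> [fst j, snd j]))
     else let l = nat (fst j) in 1 / real (M ^ (n - l)) *
       (step_term d f (mlp d f g M l) t x k (\<xi> [fst j, snd j]) (subfield [fst j, snd j] \<xi>)
        - indicator {1..} l * step_term d f (mlp d f g M (l - 1)) t x k (\<xi> [fst j, snd j]) (subfield [- fst j, snd j] \<xi>)))"

definition init_index :: "nat \<Rightarrow> nat \<Rightarrow> (int \<times> int) set" where
  "init_index M n = (\<lambda>i. (0, - int i)) ` {1..M ^ n}"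

definition step_index :: "nat \<Rightarrow> nat \<Rightarrow> nat \<Rightarrow> (int \<times> int) set" where
  "step_index M n l = (\<lambda>i. (int l, int i)) ` {1..M ^ (n - l)}"

definition all_index :: "nat \<Rightarrow> nat \<Rightarrow> (int \<times> int) set" where
  "all_index M n = init_index M n \<union> (\<Union>l<n. step_index M n l)"

lemma finite_all_index: "finite (all_index M n)"
  by (simp add: all_index_def init_index_def step_index_def)

lemma sum_all_index:
  "(\<Sum>j\<in>all_index M n. F j) = (\<Sum>i=1..M ^ n. F (0, - int i)) + (\<Sum>l<n. \<Sum>i=1..M ^ (n - l). F (int l, int i))" for F :: "int \<times> int \<Rightarrow> real"
proof -
  have "(\<Sum>j\<in>all_index M n. F j) = (\<Sum>j\<in>init_index M n. F j) + (\<Sum>j\<in>(\<Union>l<n. step_index M n l). F j)"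
    unfolding all_index_def by (rule sum.union_disjoint) (auto simp: init_index_def step_index_def)
  also have "(\<Sum>j\<in>init_index M n. F j) = (\<Sum>i=1..M ^ n. F (0, - int i))"
    unfolding init_index_def by (subst sum.reindex) (auto simp: inj_on_def)
  also have "(\<Sum>j\<in>(\<Union>l<n. step_index M n l). F j) = (\<Sum>l<n. \<Sum>j\<in>step_index M n l. F j)"
    by (rule sum.UNION_disjoint) (auto simp: step_index_def)
  also have "\<dots> = (\<Sum>l<n. \<Sum>i=1..M ^ (n - l). F (int l, int i))"
    unfolding step_index_def by (intro sum.cong refl, subst sum.reindex) (auto simp: inj_on_def)
  finally show ?thesis .
qed

lemma mlp_eq_sum_summand:
  assumes "n \<ge> 1"
  shows "mlp d f g M n t x \<xi> k = join_vec (g x) (\<lambda>_. 0) k + (\<Sum>j\<in>all_index M n. summand d f g M n t x k j \<xi>)"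
proof -
  have "(\<Sum>j\<in>all_index M n. summand d f g M n t x k j \<xi>)
     = (\<Sum>i=1..M ^ n. 1 / real (M ^ n) * init_term d g t x k (fst (\<xi> [0, - int i])))
     + (\<Sum>l<n. \<Sum>i=1..M ^ (n - l). 1 / real (M ^ (n - l)) *
          (step_term d f (mlp d f g M l) t x k (\<xi> [int l, int i]) (subfield [int l, int i] \<xi>)
           - indicator {1..} l * step_term d f (mlp d f g M (l - 1)) t x k (\<xi> [int l, int i]) (subfield [- int l, int i] \<xi>)))"
    unfolding sum_all_index by (intro arg_cong2[where f="(+)"] sum.cong refl) (auto simp: summand_def)
  then show ?thesis using assms by (simp add: mlp.simps[of d f g M n] add.assoc)
qed

text \<open>The indices of all noise variables that enter one summand.\<close>

definition block :: "int \<times> int \<Rightarrow> int list set" where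
  "block j = {\<eta>. \<exists>\<eta>'. \<eta> = [fst j, snd j] @ \<eta>' \<or> \<eta> = [- fst j, snd j] @ \<eta>'}"

lemma block_subset_Theta: "block j \<subseteq> Theta"
  by (auto simp: block_def Theta_def)

lemma all_index_fst_nonneg: "j \<in> all_index M n \<Longrightarrow> fst j \<ge> 0"
  by (auto simp: all_index_def init_index_def step_index_def)

text \<open>A block contains the addresses with level \<open>l\<close> and those with level
  \<open>- l\<close>. Different blocks stay disjoint because all levels in \<open>all_index\<close>
  are nonnegative.\<close>

lemma block_disjoint: "disjoint_family_on block (all_index M n)"
proof (unfold disjoint_family_on_def, intro ballI impI)
  fix i j assume "i \<in> all_index M n" "j \<in> all_index M n" "i \<noteq> j"
  then have "fst i \<ge> 0" "fst j \<ge> 0" "i \<noteq> j" using all_index_fst_nonneg by blast+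
  then show "block i \<inter> block j = {}" by (cases i; cases j) (auto simp: block_def)
qed

lemma subfield_restrict_block:
  "subfield [fst j, snd j] (restrict \<xi> (block j)) = subfield [fst j, snd j] \<xi>"
  "subfield [- fst j, snd j] (restrict \<xi> (block j)) = subfield [- fst j, snd j] \<xi>"
  by (auto simp: subfield_def block_def fun_eq_iff)

lemma block_self: "[fst j, snd j] \<in> block j"
  unfolding block_def by (intro CollectI exI[of _ "[]"]) simp

lemma summand_restrict_block: "summand d f g M n t x k j (restrict \<xi> (block j)) = summand d f g M n t x k j \<xi>"
proof -
  have "restrict \<xi> (block j) [fst j, snd j] = \<xi> [fst j, snd j]" by (simp add: block_self)
  then show ?thesis unfolding summand_def subfield_restrict_block by simp
qed

lemma summand_measurable:
  assumes f: "continuous_on (UNIV \<times> Rd d) (\<lambda>(y, z). f y z)" and g: "continuous_on (Rd d) g" and k: "k \<in> {0..d}" and x: "x \<in> Rd d"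
    and p: "(\<lambda>\<omega>. \<Xi> \<omega> [fst j, snd j]) \<in> N \<rightarrow>\<^sub>M noise_law d"
    and s: "(\<lambda>\<omega>. subfield [fst j, snd j] (\<Xi> \<omega>)) \<in> N \<rightarrow>\<^sub>M noise_space d" "(\<lambda>\<omega>. subfield [- fst j, snd j] (\<Xi> \<omega>)) \<in> N \<rightarrow>\<^sub>M noise_space d"
  shows "(\<lambda>\<omega>. summand d f g M n t x k j (\<Xi> \<omega>)) \<in> borel_measurable N"
proof -
  have X: "(\<lambda>_. x) \<in> N \<rightarrow>\<^sub>M borel_Rd d" using x by simp
  have "(\<lambda>\<omega>. \<Xi> \<omega> [fst j, snd j]) \<in> N \<rightarrow>\<^sub>M (borel_Rd d \<Otimes>\<^sub>M borel)"
    using p by (simp cong: measurable_cong_sets)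
  then have z: "(\<lambda>\<omega>. fst (\<Xi> \<omega> [fst j, snd j])) \<in> N \<rightarrow>\<^sub>M borel_Rd d" by (rule measurable_compose[OF _ measurable_fst])
  have im: "(\<lambda>\<omega>. init_term d g t x k (fst (\<Xi> \<omega> [fst j, snd j]))) \<in> borel_measurable N"
    by (rule init_term_measurable[OF g k _ X z]) simp
  have st: "(\<lambda>\<omega>. step_term d f (mlp d f g M m) t x k (\<Xi> \<omega> [fst j, snd j]) (\<zeta> \<omega>)) \<in> borel_measurable N"
    if "\<zeta> \<in> N \<rightarrow>\<^sub>M noise_space d" for m \<zeta>
    by (rule step_term_measurable[OF f k mlp_measurable[OF f g] _ X p that]) simp_all
  show ?thesis
  proof (cases "snd j < 0")
    case True
    then show ?thesis unfolding summand_def by (simp only: if_True) (intro borel_measurable_times borel_measurable_const im)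
  next
    case False
    then show ?thesis unfolding summand_def Let_def
      by (simp only: if_False) (intro borel_measurable_times borel_measurable_diff borel_measurable_const st s)
  qed
qed

lemma indep_coordinates:
  "prob_space.indep_vars (noise_space d) (\<lambda>_. noise_law d) (\<lambda>\<eta> \<xi>. \<xi> \<eta>) Theta"
proof -
  interpret Q: prob_space "noise_space d" by (rule prob_space_noise_space)
  have ne: "Theta \<noteq> {}" by (auto simp: Theta_def)
  have "distr (noise_space d) (noise_space d) (\<lambda>\<xi>. \<lambda>\<eta>\<in>Theta. \<xi> \<eta>) = distr (noise_space d) (noise_space d) (\<lambda>\<xi>. \<xi>)"
    by (rule distr_cong) (auto simp: space_PiM PiE_def extensional_restrict)
  also have "\<dots> = noise_space d" by simp
  also have "\<dots> = (\<Pi>\<^sub>M \<eta>\<in>Theta. distr (noise_space d) (noise_law d) (\<lambda>\<xi>. \<xi> \<eta>))"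
    by (intro PiM_cong refl) (simp add: distr_noise_component)
  finally show ?thesis
    by (subst Q.indep_vars_iff_distr_eq_PiM'[OF ne]) (auto intro: measurable_component_singleton)
qed

text \<open>Restricting the field to the block of a summand leaves its value unchanged, and
  restrictions of independent coordinates to disjoint blocks are independent.\<close>

lemma indep_summands:
  assumes f: "continuous_on (UNIV \<times> Rd d) (\<lambda>(y, z). f y z)" and g: "continuous_on (Rd d) g" and k: "k \<in> {0..d}" and x: "x \<in> Rd d"
  shows "prob_space.indep_vars (noise_space d) (\<lambda>_. borel) (summand d f g M n t x k) (all_index M n)"
proof -
  interpret Q: prob_space "noise_space d" by (rule prob_space_noise_space)
  have 1: "Q.indep_vars (\<lambda>j. Pi\<^sub>M (block j) (\<lambda>_. noise_law d)) (\<lambda>j \<xi>. restrict (\<lambda>\<eta>. \<xi> \<eta>) (block j)) (all_index M n)"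
    by (rule Q.indep_vars_restrict[OF indep_coordinates block_subset_Theta block_disjoint])
  have 2: "summand d f g M n t x k j \<in> borel_measurable (Pi\<^sub>M (block j) (\<lambda>_. noise_law d))" for j
  proof (rule summand_measurable[OF f g k x])
    show "(\<lambda>\<xi>. \<xi> [fst j, snd j]) \<in> Pi\<^sub>M (block j) (\<lambda>_. noise_law d) \<rightarrow>\<^sub>M noise_law d"
      by (rule measurable_component_singleton) (rule block_self)
    show "subfield [fst j, snd j] \<in> Pi\<^sub>M (block j) (\<lambda>_. noise_law d) \<rightarrow>\<^sub>M noise_space d"
      unfolding subfield_def by (intro measurable_restrict measurable_component_singleton) (simp add: block_def, blast?)
    show "subfield [- fst j, snd j] \<in> Pi\<^sub>M (block j) (\<lambda>_. noise_law d) \<rightarrow>\<^sub>M noise_space d"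
      unfolding subfield_def by (intro measurable_restrict measurable_component_singleton) (simp add: block_def, blast)
  qed
  have "Q.indep_vars (\<lambda>_. borel) (\<lambda>j \<xi>. summand d f g M n t x k j (restrict (\<lambda>\<eta>. \<xi> \<eta>) (block j))) (all_index M n)"
    by (rule Q.indep_vars_compose2[OF 1 2])
  then show ?thesis unfolding summand_restrict_block .
qed

lemma integral_le_of_nn_integral:
  fixes F :: "'a \<Rightarrow> real"
  assumes "F \<in> borel_measurable M" "\<And>x. F x \<ge> 0" "(\<integral>\<^sup>+x. ennreal (F x) \<partial>M) \<le> ennreal B" "B \<ge> 0"
  shows "integrable M F" "(\<integral>x. F x \<partial>M) \<le> B"
proof -
  show "integrable M F"
    using assms by (intro integrableI_nonneg) (auto intro: le_less_trans)
  show "(\<integral>x. F x \<partial>M) \<le> B" using assms(3,4) by (rule integral_real_bounded[rotated])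
qed

lemma (in prob_space) square_expectation_le:
  fixes X :: "'a \<Rightarrow> real"
  assumes "X \<in> borel_measurable M" "integrable M (\<lambda>\<omega>. (X \<omega>)\<^sup>2)"
  shows "(expectation X)\<^sup>2 \<le> expectation (\<lambda>\<omega>. (X \<omega>)\<^sup>2)"
proof -
  have "integrable M X" by (rule square_integrable_imp_integrable[OF assms])
  then have "variance X = expectation (\<lambda>\<omega>. (X \<omega>)\<^sup>2) - (expectation X)\<^sup>2" using assms(2) by (rule variance_eq)
  then show ?thesis using variance_positive[of X] by simp
qed

text \<open>With the rate \<open>1 + 5 * \<kappa>\<close> the geometric sum times
  \<open>5 * \<kappa>\<close> is \<open>(1 + 5 * \<kappa>)^n - 1\<close>, and the \<open>- 1\<close>
  makes room for \<open>G\<close>. Each level contributes at most \<open>4 * \<kappa>\<close>, from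
  two neighbouring levels with the factor \<open>2\<close> of a squared difference, and the bias one
  more \<open>\<kappa>\<close>. All terms carry \<open>1 / M^n\<close>: averaging gives
  \<open>1 / M^(n - l)\<close>, the error of level \<open>l\<close> gives \<open>1 / M^l\<close>,
  and for level \<open>l - 1\<close> the contraction factor \<open>1 / M\<close> supplies the
  missing power.\<close>

lemma geometric_recursion_bound:
  fixes \<kappa> B G :: real and M n :: nat
  assumes \<kappa>: "\<kappa> \<ge> 0" and B: "B \<ge> G" "G \<ge> 0" and M: "M \<ge> 1" and n: "n \<ge> 1"
  defines "b \<equiv> \<lambda>l. B * (1 + 5 * \<kappa>) ^ l / real M ^ l"
  shows "G / real M ^ n + (\<Sum>l\<in>{1..<n}. 1 / real M ^ (n - l) * (2 * (\<kappa> / real M * b l + \<kappa> / real M * b (l - 1)))) + \<kappa> / real M * b (n - 1) \<le> b n"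
proof -
  let ?r = "1 + 5 * \<kappa>" and ?M = "real M"
  have M0: "?M > 0" "?M \<ge> 1" using M by auto
  have B0: "B \<ge> 0" using B by simp
  have r: "?r \<ge> 1" using \<kappa> by simp
  have t1: "1 / ?M ^ (n - l) * (2 * (\<kappa> / ?M * b l + \<kappa> / ?M * b (l - 1))) \<le> (4 * \<kappa> * B * ?r ^ l) / ?M ^ n" if l: "l \<in> {1..<n}" for l
  proof -
    have p: "?M ^ n = ?M ^ (n - l) * ?M ^ l" using l by (simp flip: power_add)
    have pl: "?M ^ l = ?M * ?M ^ (l - 1)" using l by (simp flip: power_Suc)
    have "\<kappa> / ?M * b l \<le> \<kappa> * B * ?r ^ l / ?M ^ l"
    proof -
      have "\<kappa> / ?M \<le> \<kappa> / 1" using \<kappa> M0 by (intro divide_left_mono) auto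
      then have "\<kappa> / ?M * b l \<le> \<kappa> * b l" using B0 r M0 unfolding b_def by (intro mult_right_mono) auto
      then show ?thesis by (simp add: b_def mult_ac)
    qed
    moreover have "\<kappa> / ?M * b (l - 1) \<le> \<kappa> * B * ?r ^ l / ?M ^ l"
    proof -
      have "\<kappa> / ?M * b (l - 1) = \<kappa> * B * ?r ^ (l - 1) / ?M ^ l" unfolding b_def pl by simp
      also have "\<dots> \<le> \<kappa> * B * ?r ^ l / ?M ^ l"
        using \<kappa> B0 r M0 by (intro divide_right_mono mult_left_mono power_increasing) auto
      finally show ?thesis .
    qed
    ultimately have "2 * (\<kappa> / ?M * b l + \<kappa> / ?M * b (l - 1)) \<le> 2 * (\<kappa> * B * ?r ^ l / ?M ^ l + \<kappa> * B * ?r ^ l / ?M ^ l)"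
      by (intro mult_left_mono add_mono) auto
    also have "\<dots> = 4 * \<kappa> * B * ?r ^ l / ?M ^ l" by simp
    finally have "2 * (\<kappa> / ?M * b l + \<kappa> / ?M * b (l - 1)) \<le> 4 * \<kappa> * B * ?r ^ l / ?M ^ l" .
    then have "1 / ?M ^ (n - l) * (2 * (\<kappa> / ?M * b l + \<kappa> / ?M * b (l - 1))) \<le> 1 / ?M ^ (n - l) * (4 * \<kappa> * B * ?r ^ l / ?M ^ l)"
      using M0 by (intro mult_left_mono) auto
    then show ?thesis unfolding p by simp
  qed
  have t2: "\<kappa> / ?M * b (n - 1) = \<kappa> * B * ?r ^ (n - 1) / ?M ^ n"
  proof -
    have "?M ^ n = ?M * ?M ^ (n - 1)" using n by (simp flip: power_Suc)
    then show ?thesis by (simp add: b_def)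
  qed
  have "(\<Sum>l\<in>{1..<n}. 4 * \<kappa> * B * ?r ^ l) + \<kappa> * B * ?r ^ (n - 1) \<le> (\<Sum>l<n. 4 * \<kappa> * B * ?r ^ l) + (\<Sum>l<n. \<kappa> * B * ?r ^ l)"
  proof (rule add_mono)
    show "(\<Sum>l\<in>{1..<n}. 4 * \<kappa> * B * ?r ^ l) \<le> (\<Sum>l<n. 4 * \<kappa> * B * ?r ^ l)"
      using \<kappa> B0 by (intro sum_mono2) auto
    show "\<kappa> * B * ?r ^ (n - 1) \<le> (\<Sum>l<n. \<kappa> * B * ?r ^ l)"
      using \<kappa> B0 n by (intro member_le_sum[of "n - 1" "{..<n}" "\<lambda>l. \<kappa> * B * ?r ^ l"]) auto
  qed
  also have "\<dots> = B * (5 * \<kappa> * (\<Sum>l<n. ?r ^ l))"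
    by (simp add: sum_distrib_left flip: sum.distrib) (simp add: algebra_simps)
  also have "5 * \<kappa> * (\<Sum>l<n. ?r ^ l) = ?r ^ n - 1"
    using power_diff_1_eq[of ?r n] by simp
  finally have "(\<Sum>l\<in>{1..<n}. 4 * \<kappa> * B * ?r ^ l) + \<kappa> * B * ?r ^ (n - 1) \<le> B * ?r ^ n - B" by (simp add: right_diff_distrib)
  then have le: "G + ((\<Sum>l\<in>{1..<n}. 4 * \<kappa> * B * ?r ^ l) + \<kappa> * B * ?r ^ (n - 1)) \<le> B * ?r ^ n" using B by simp
  have "G / ?M ^ n + (\<Sum>l\<in>{1..<n}. 1 / ?M ^ (n - l) * (2 * (\<kappa> / ?M * b l + \<kappa> / ?M * b (l - 1)))) + \<kappa> / ?M * b (n - 1)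
     \<le> G / ?M ^ n + (\<Sum>l\<in>{1..<n}. (4 * \<kappa> * B * ?r ^ l) / ?M ^ n) + \<kappa> * B * ?r ^ (n - 1) / ?M ^ n"
    unfolding t2 by (intro add_right_mono add_left_mono sum_mono t1)
  also have "\<dots> = (G + ((\<Sum>l\<in>{1..<n}. 4 * \<kappa> * B * ?r ^ l) + \<kappa> * B * ?r ^ (n - 1))) / ?M ^ n"
    by (simp add: add_divide_distrib sum_divide_distrib)
  also have "\<dots> \<le> B * ?r ^ n / ?M ^ n" using le M0 by (intro divide_right_mono) auto
  finally show ?thesis by (simp add: b_def)
qed

text \<open>The factor \<open>4 * lam\<^sup>2\<close> is the squared Lipschitz cost of
  \<open>f\<close> from \<open>nonlinearity_error\<close>; the rest is the constant of
  \<open>weighted_path_moment\<close> without \<open>1 / sqrt \<mu>\<close>.\<close>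

definition contraction_const :: "real \<Rightarrow> real \<Rightarrow> real" where
  "contraction_const T lam = 4 * lam\<^sup>2 * ((4 * T + 2) * (2 * sqrt T) * (2 + 12 * T * lam))"

context pde_solution
begin

abbreviation V :: "nat \<Rightarrow> nat \<Rightarrow> real \<Rightarrow> rvec \<Rightarrow> (int list \<Rightarrow> rvec \<times> real) \<Rightarrow> nat \<Rightarrow> real" where
  "V M n \<equiv> mlp d f g M n"

lemma V_measurable:
  assumes "k \<in> {0..d}" "x \<in> Rd d"
  shows "(\<lambda>\<xi>. V M n t x \<xi> k) \<in> borel_measurable (noise_space d)"
  using assms by (intro mlp_measurable[OF f_cont g_cont]) auto

lemma h_eq_eval_joined: "h s y = eval_joined d f (uvec s y)"
proof -
  have "restrict (join_vec (u s y) (space_grad d (u s) y)) {1..d} = space_grad d (u s) y"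
    by (rule Rd_eqI) (auto simp: join_vec_def)
  then show ?thesis by (simp add: h_def eval_joined_def uvec_def join_vec_def)
qed

lemma eval_joined_lip_sq:
  "(eval_joined d f p - eval_joined d f q)\<^sup>2 \<le> 2 * lam * (\<Sum>j=1..d. L j * ((p 0 - q 0)\<^sup>2 + (p j - q j)\<^sup>2))"
proof -
  have "\<bar>eval_joined d f p - eval_joined d f q\<bar> \<le> (\<Sum>j=1..d. L j * (\<bar>p 0 - q 0\<bar> + \<bar>restrict p {1..d} j - restrict q {1..d} j\<bar>))"
    unfolding eval_joined_def by (rule f_lip) auto
  also have "\<dots> = (\<Sum>j=1..d. L j * (\<bar>p 0 - q 0\<bar> + \<bar>p j - q j\<bar>))" by (intro sum.cong) auto
  finally have "\<bar>eval_joined d f p - eval_joined d f q\<bar>\<^sup>2 \<le> (\<Sum>j=1..d. L j * (\<bar>p 0 - q 0\<bar> + \<bar>p j - q j\<bar>))\<^sup>2"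
    by (intro power_mono) auto
  also have "\<dots> \<le> lam * (\<Sum>j=1..d. L j * (\<bar>p 0 - q 0\<bar> + \<bar>p j - q j\<bar>)\<^sup>2)" by (rule L_sum_square_le)
  also have "\<dots> \<le> lam * (\<Sum>j=1..d. L j * (2 * ((p 0 - q 0)\<^sup>2 + (p j - q j)\<^sup>2)))"
  proof (intro mult_left_mono sum_mono L_nonneg)
    show "(\<bar>p 0 - q 0\<bar> + \<bar>p j - q j\<bar>)\<^sup>2 \<le> 2 * ((p 0 - q 0)\<^sup>2 + (p j - q j)\<^sup>2)" for j
      using zero_le_power2[of "\<bar>p 0 - q 0\<bar> - \<bar>p j - q j\<bar>"] by (simp add: power2_sum power2_diff)
  qed (use lam in auto)
  also have "\<dots> = 2 * lam * (\<Sum>j=1..d. L j * ((p 0 - q 0)\<^sup>2 + (p j - q j)\<^sup>2))"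
    by (simp add: sum_distrib_left mult_ac)
  finally show ?thesis by simp
qed

text \<open>The squared error in the weighted norm, uniform in time, point and component. As a
  nonnegative integral it carries integrability along with the bound.\<close>

definition error_bound :: "real \<Rightarrow> nat \<Rightarrow> nat \<Rightarrow> real \<Rightarrow> bool" where
  "error_bound \<mu> M n b \<longleftrightarrow> (\<forall>t\<in>{0<..T}. \<forall>x\<in>Rd d. \<forall>k\<in>{0..d}.
     (\<integral>\<^sup>+\<xi>. ennreal ((V M n t x \<xi> k - uvec t x k)\<^sup>2) \<partial>noise_space d) \<le> ennreal (b * (exp (\<mu> * t) * wt x)))"

text \<open>The constant \<open>4 * lam\<^sup>2\<close>: Cauchy-Schwarz over the \<open>L j\<close>
  gives one \<open>lam\<close>, their sum another, splitting the square of value plus gradient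
  difference a factor \<open>2\<close>, and adding the error of component \<open>0\<close> to that
  of component \<open>j\<close> a second \<open>2\<close>.\<close>

lemma nonlinearity_error:
  assumes E: "error_bound \<mu> M n b" and b: "b \<ge> 0" and s: "s \<in> {0<..T}" and y: "y \<in> Rd d"
  shows "(\<integral>\<^sup>+\<xi>. ennreal ((eval_joined d f (V M n s y \<xi>) - h s y)\<^sup>2) \<partial>noise_space d) \<le> ennreal (4 * lam\<^sup>2 * (b * (exp (\<mu> * s) * wt y)))"
proof -
  let ?B = "b * (exp (\<mu> * s) * wt y)"
  have B: "?B \<ge> 0" using b wt_ge_1[of y] by simp
  let ?D = "\<lambda>k \<xi>. (V M n s y \<xi> k - uvec s y k)\<^sup>2"
  have Dm: "(\<lambda>\<xi>. ennreal (?D k \<xi>)) \<in> borel_measurable (noise_space d)" if "k \<in> {0..d}" for k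
    using V_measurable[OF that y] by simp
  have "(\<integral>\<^sup>+\<xi>. ennreal ((eval_joined d f (V M n s y \<xi>) - h s y)\<^sup>2) \<partial>noise_space d)
     \<le> (\<integral>\<^sup>+\<xi>. (\<Sum>j=1..d. ennreal (2 * lam * L j) * (ennreal (?D 0 \<xi>) + ennreal (?D j \<xi>))) \<partial>noise_space d)"
  proof (rule nn_integral_mono)
    fix \<xi>
    have "(eval_joined d f (V M n s y \<xi>) - h s y)\<^sup>2 \<le> (\<Sum>j=1..d. 2 * lam * L j * (?D 0 \<xi> + ?D j \<xi>))"
      using eval_joined_lip_sq[of "V M n s y \<xi>" "uvec s y"] by (simp add: h_eq_eval_joined sum_distrib_left mult_ac)
    then have "ennreal ((eval_joined d f (V M n s y \<xi>) - h s y)\<^sup>2) \<le> ennreal (\<Sum>j=1..d. 2 * lam * L j * (?D 0 \<xi> + ?D j \<xi>))"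
      by (rule ennreal_leI)
    also have "\<dots> = (\<Sum>j=1..d. ennreal (2 * lam * L j * (?D 0 \<xi> + ?D j \<xi>)))"
      using lam L_nonneg by (intro sum_ennreal[symmetric]) auto
    also have "\<dots> = (\<Sum>j=1..d. ennreal (2 * lam * L j) * (ennreal (?D 0 \<xi>) + ennreal (?D j \<xi>)))"
      using lam L_nonneg by (intro sum.cong refl) (simp add: ennreal_mult)
    finally show "ennreal ((eval_joined d f (V M n s y \<xi>) - h s y)\<^sup>2) \<le> (\<Sum>j=1..d. ennreal (2 * lam * L j) * (ennreal (?D 0 \<xi>) + ennreal (?D j \<xi>)))" .
  qed
  also have "\<dots> = (\<Sum>j=1..d. ennreal (2 * lam * L j) * ((\<integral>\<^sup>+\<xi>. ennreal (?D 0 \<xi>) \<partial>noise_space d) + (\<integral>\<^sup>+\<xi>. ennreal (?D j \<xi>) \<partial>noise_space d)))"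
  proof (subst nn_integral_sum)
    show "(\<lambda>\<xi>. ennreal (2 * lam * L j) * (ennreal (?D 0 \<xi>) + ennreal (?D j \<xi>))) \<in> borel_measurable (noise_space d)" if "j \<in> {1..d}" for j
      using Dm[of 0] Dm[of j] that by (intro borel_measurable_times_ennreal borel_measurable_add) auto
    show "(\<Sum>j=1..d. \<integral>\<^sup>+\<xi>. ennreal (2 * lam * L j) * (ennreal (?D 0 \<xi>) + ennreal (?D j \<xi>)) \<partial>noise_space d)
       = (\<Sum>j=1..d. ennreal (2 * lam * L j) * ((\<integral>\<^sup>+\<xi>. ennreal (?D 0 \<xi>) \<partial>noise_space d) + (\<integral>\<^sup>+\<xi>. ennreal (?D j \<xi>) \<partial>noise_space d)))"
    proof (intro sum.cong refl)
      fix j assume "j \<in> {1..d}"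
      then have m: "(\<lambda>\<xi>. ennreal (?D 0 \<xi>)) \<in> borel_measurable (noise_space d)" "(\<lambda>\<xi>. ennreal (?D j \<xi>)) \<in> borel_measurable (noise_space d)"
        using Dm[of 0] Dm[of j] by auto
      show "(\<integral>\<^sup>+\<xi>. ennreal (2 * lam * L j) * (ennreal (?D 0 \<xi>) + ennreal (?D j \<xi>)) \<partial>noise_space d)
        = ennreal (2 * lam * L j) * ((\<integral>\<^sup>+\<xi>. ennreal (?D 0 \<xi>) \<partial>noise_space d) + (\<integral>\<^sup>+\<xi>. ennreal (?D j \<xi>) \<partial>noise_space d))"
        by (subst nn_integral_cmult[OF borel_measurable_add[OF m]], subst nn_integral_add[OF m]) (rule refl)
    qed
  qed
  also have "\<dots> \<le> (\<Sum>j=1..d. ennreal (2 * lam * L j) * (ennreal ?B + ennreal ?B))"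
    using E[unfolded error_bound_def, rule_format, OF s y] by (intro sum_mono mult_left_mono add_mono) auto
  also have "\<dots> = (\<Sum>j=1..d. ennreal (2 * lam * L j * (?B + ?B)))"
  proof (intro sum.cong refl)
    fix j assume "j \<in> {1..d}"
    then show "ennreal (2 * lam * L j) * (ennreal ?B + ennreal ?B) = ennreal (2 * lam * L j * (?B + ?B))"
      unfolding ennreal_plus[OF B B, symmetric] using lam L_nonneg[of j] B by (intro ennreal_mult[symmetric] mult_nonneg_nonneg[of "2 * lam"] add_increasing) simp_all
  qed
  also have "\<dots> = ennreal (\<Sum>j=1..d. 2 * lam * L j * (?B + ?B))"
  proof (rule sum_ennreal)
    fix j assume "j \<in> {1..d}"
    then have "0 \<le> 2 * lam * L j" using lam L_nonneg by simp
    moreover have "0 \<le> ?B + ?B" using B by linarith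
    ultimately show "0 \<le> 2 * lam * L j * (?B + ?B)" by (rule mult_nonneg_nonneg)
  qed
  also have "(\<Sum>j=1..d. 2 * lam * L j * (?B + ?B)) = 4 * lam * (\<Sum>j=1..d. L j) * ?B"
    by (simp add: sum_distrib_left sum_distrib_right mult_ac)
  also have "ennreal \<dots> \<le> ennreal (4 * lam\<^sup>2 * ?B)"
  proof (rule ennreal_leI, rule mult_right_mono[OF _ B])
    have "4 * lam * (\<Sum>j=1..d. L j) \<le> 4 * lam * lam" using L_sum lam by (intro mult_left_mono) auto
    then show "4 * lam * (\<Sum>j=1..d. L j) \<le> 4 * lam\<^sup>2" by (simp add: power2_eq_square)
  qed
  finally show ?thesis .
qed

definition step_error_bound :: "real \<Rightarrow> real \<Rightarrow> real \<Rightarrow> rvec \<Rightarrow> real" where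
  "step_error_bound \<mu> b t x = contraction_const T lam / sqrt \<mu> * b * (exp (\<mu> * t) * wt x)"

lemma step_term_V_measurable:
  assumes x: "x \<in> Rd d" and k: "k \<in> {0..d}"
  shows "(\<lambda>q. step_term d f (V M n) t x k (fst q) (snd q)) \<in> borel_measurable (noise_pair d)"
  using x by (intro step_term_measurable[OF f_cont k mlp_measurable[OF f_cont g_cont]]) auto

lemma source_term_measurable':
  assumes x: "x \<in> Rd d" and k: "k \<in> {0..d}"
  shows "(\<lambda>q. source_term t x k (fst q)) \<in> borel_measurable (noise_pair d)"
proof -
  have "source_term t x k \<in> borel_measurable (noise_law d)" using source_term_measurable[OF x k] by simp
  then show ?thesis by (rule measurable_compose[OF measurable_fst])
qed

text \<open>The outer pair is frozen first. The subfield is independent of it, so the inner integral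
  is \<open>nonlinearity_error\<close> at the reached time and point, which is why
  \<open>error_bound\<close> is uniform in both. The outer integral of the weights is then
  \<open>weighted_path_moment\<close>.\<close>

lemma step_error:
  assumes E: "error_bound \<mu> M n b" and b: "b \<ge> 0" and \<mu>: "\<mu> > 0" and t: "t \<in> {0<..T}" and x: "x \<in> Rd d" and k: "k \<in> {0..d}"
  shows "(\<integral>\<^sup>+q. ennreal ((step_term d f (V M n) t x k (fst q) (snd q) - source_term t x k (fst q))\<^sup>2) \<partial>noise_pair d) \<le> ennreal (step_error_bound \<mu> b t x)"
    (is "?L \<le> _")
proof -
  interpret Q: prob_space "noise_space d" by (rule prob_space_noise_space)
  let ?y = "\<lambda>p. add_scaled d x (sqrt (2 * t * snd p)) (fst p)" and ?s = "\<lambda>p. t * (1 - snd p)"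
  let ?c = "4 * lam\<^sup>2 * b"
  have m: "(\<lambda>q. ennreal ((step_term d f (V M n) t x k (fst q) (snd q) - source_term t x k (fst q))\<^sup>2)) \<in> borel_measurable (noise_pair d)"
    using step_term_V_measurable[OF x k] source_term_measurable'[OF x k]
    by (intro measurable_compose[OF _ measurable_ennreal] borel_measurable_power borel_measurable_diff)
  have "?L = (\<integral>\<^sup>+p. \<integral>\<^sup>+\<xi>. ennreal ((step_term d f (V M n) t x k p \<xi> - source_term t x k p)\<^sup>2) \<partial>noise_space d \<partial>noise_law d)"
    using Q.nn_integral_fst[OF m] by simp
  also have "\<dots> \<le> (\<integral>\<^sup>+p. ennreal ?c * ennreal ((path_weight t k p)\<^sup>2 * (exp (\<mu> * ?s p) * wt (?y p))) \<partial>noise_law d)"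
  proof (rule nn_integral_mono_AE)
    show "AE p in noise_law d. (\<integral>\<^sup>+\<xi>. ennreal ((step_term d f (V M n) t x k p \<xi> - source_term t x k p)\<^sup>2) \<partial>noise_space d)
       \<le> ennreal ?c * ennreal ((path_weight t k p)\<^sup>2 * (exp (\<mu> * ?s p) * wt (?y p)))"
      using AE_noise_law
    proof eventually_elim
      case (elim p)
      have s: "?s p \<in> {0<..T}"
      proof -
        have "0 < t * (1 - snd p)" "t * (1 - snd p) \<le> t * 1"
          using t elim by (auto intro!: mult_pos_pos mult_left_mono)
        then show ?thesis using t by auto
      qed
      then have hs: "hc (?s p) (?y p) = h (?s p) (?y p)" by (intro hc_eq) auto
      have em: "(\<lambda>\<xi>. ennreal ((eval_joined d f (V M n (?s p) (?y p) \<xi>) - h (?s p) (?y p))\<^sup>2)) \<in> borel_measurable (noise_space d)"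
        by (intro measurable_compose[OF _ measurable_ennreal] borel_measurable_power borel_measurable_diff borel_measurable_const
            eval_joined_measurable[OF f_cont] V_measurable) auto
      have "(\<integral>\<^sup>+\<xi>. ennreal ((step_term d f (V M n) t x k p \<xi> - source_term t x k p)\<^sup>2) \<partial>noise_space d)
        = (\<integral>\<^sup>+\<xi>. ennreal ((path_weight t k p)\<^sup>2) * ennreal ((eval_joined d f (V M n (?s p) (?y p) \<xi>) - h (?s p) (?y p))\<^sup>2) \<partial>noise_space d)"
        unfolding step_term_def source_term_def hs
        by (intro nn_integral_cong) (simp add: ennreal_mult'[symmetric] power_mult_distrib flip: right_diff_distrib)
      also have "\<dots> = ennreal ((path_weight t k p)\<^sup>2) * (\<integral>\<^sup>+\<xi>. ennreal ((eval_joined d f (V M n (?s p) (?y p) \<xi>) - h (?s p) (?y p))\<^sup>2) \<partial>noise_space d)"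
        by (rule nn_integral_cmult[OF em])
      also have "\<dots> \<le> ennreal ((path_weight t k p)\<^sup>2) * ennreal (4 * lam\<^sup>2 * (b * (exp (\<mu> * ?s p) * wt (?y p))))"
        by (intro mult_left_mono nonlinearity_error[OF E b s]) auto
      also have "\<dots> = ennreal ?c * ennreal ((path_weight t k p)\<^sup>2 * (exp (\<mu> * ?s p) * wt (?y p)))"
        using b wt_ge_1[of "?y p"] by (simp add: ennreal_mult'[symmetric] mult_ac)
      finally show ?case .
    qed
  qed
  also have "\<dots> = ennreal ?c * (\<integral>\<^sup>+p. ennreal ((path_weight t k p)\<^sup>2 * (exp (\<mu> * ?s p) * wt (?y p))) \<partial>noise_law d)"
  proof (rule nn_integral_cmult)
    have y: "?y \<in> noise_law d \<rightarrow>\<^sub>M borel_Rd d" and sm: "(\<lambda>p. snd p) \<in> borel_measurable (noise_law d)"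
    proof -
      have "?y \<in> (borel_Rd d \<Otimes>\<^sub>M borel) \<rightarrow>\<^sub>M borel_Rd d" using x by (intro measurable_add_scaled) auto
      then show "?y \<in> noise_law d \<rightarrow>\<^sub>M borel_Rd d" by (simp cong: measurable_cong_sets)
      have "(\<lambda>p. snd p) \<in> borel_measurable (borel_Rd d \<Otimes>\<^sub>M borel)" by (rule measurable_snd)
      then show "(\<lambda>p. snd p) \<in> borel_measurable (noise_law d)" by (simp cong: measurable_cong_sets)
    qed
    have e: "(\<lambda>p. exp (\<mu> * ?s p)) \<in> borel_measurable (noise_law d)" using sm by simp
    show "(\<lambda>p. ennreal ((path_weight t k p)\<^sup>2 * (exp (\<mu> * ?s p) * wt (?y p)))) \<in> borel_measurable (noise_law d)"
      using path_weight_measurable'[OF k, of "\<lambda>_. t" "noise_law d" "\<lambda>p. p"] measurable_compose[OF y wt_measurable] e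
      by (intro measurable_compose[OF _ measurable_ennreal] borel_measurable_times borel_measurable_power) auto
  qed
  also have "\<dots> \<le> ennreal ?c * ennreal ((4 * T + 2) * (2 * sqrt T / sqrt \<mu>) * (2 + 12 * T * lam) * (exp (\<mu> * t) * wt x))"
    by (intro mult_left_mono weighted_path_moment[OF t k \<mu>]) simp
  also have "\<dots> = ennreal (step_error_bound \<mu> b t x)"
    using b by (simp add: ennreal_mult'[symmetric] step_error_bound_def contraction_const_def mult_ac)
  finally show ?thesis .
qed

end

lemma sum_lessThan_split_0: "n \<ge> 1 \<Longrightarrow> (\<Sum>l<n. F l) = F 0 + (\<Sum>l\<in>{1..<n}. F l)" for F :: "nat \<Rightarrow> real"
  using sum.atLeast_Suc_lessThan[of 0 n F] by (simp add: lessThan_atLeast0 One_nat_def)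

lemma sum_telescope_1: "n \<ge> 1 \<Longrightarrow> (\<Sum>l\<in>{1..<n}. F l - F (l - 1)) = F (n - 1) - F 0" for F :: "nat \<Rightarrow> real"
  by (induction n rule: nat_induct_at_least) (simp_all add: sum.atLeastLessThan_Suc)

lemma noise_fst_transfer:
  fixes F :: "rvec \<Rightarrow> real"
  assumes a: "a \<in> Theta" and F: "F \<in> borel_measurable (borel_Rd d)"
  shows "(\<integral>\<^sup>+\<xi>. ennreal (F (fst (\<xi> a))) \<partial>noise_space d) = (\<integral>\<^sup>+z. ennreal (F z) \<partial>std_normal_Rd d)"
    and "(\<integral>\<xi>. F (fst (\<xi> a)) \<partial>noise_space d) = (\<integral>z. F z \<partial>std_normal_Rd d)"
proof -
  interpret prob_space sqrt_law by (rule prob_space_sqrt_law)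
  have f1: "distr (noise_law d) (std_normal_Rd d) fst = std_normal_Rd d"
    unfolding noise_law_def by (rule distr_pair_fst)
  have m: "(\<lambda>\<xi>. \<xi> a) \<in> noise_space d \<rightarrow>\<^sub>M noise_law d" by (rule measurable_component_singleton[OF a])
  have mf: "fst \<in> noise_law d \<rightarrow>\<^sub>M std_normal_Rd d" unfolding noise_law_def by (rule measurable_fst)
  have eq: "distr (noise_space d) (std_normal_Rd d) (\<lambda>\<xi>. fst (\<xi> a)) = std_normal_Rd d"
    using distr_distr[OF mf m] by (simp add: comp_def distr_noise_component[OF a] f1)
  have mm: "(\<lambda>\<xi>. fst (\<xi> a)) \<in> noise_space d \<rightarrow>\<^sub>M std_normal_Rd d" by (rule measurable_compose[OF m mf])
  have F': "F \<in> borel_measurable (std_normal_Rd d)" using F by simp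
  show "(\<integral>\<^sup>+\<xi>. ennreal (F (fst (\<xi> a))) \<partial>noise_space d) = (\<integral>\<^sup>+z. ennreal (F z) \<partial>std_normal_Rd d)"
    using nn_integral_distr[OF mm, of "\<lambda>z. ennreal (F z)"] F' unfolding eq by simp
  show "(\<integral>\<xi>. F (fst (\<xi> a)) \<partial>noise_space d) = (\<integral>z. F z \<partial>std_normal_Rd d)"
    using integral_distr[OF mm F'] unfolding eq by simp
qed

lemma noise_pair_transfer:
  fixes F :: "(rvec \<times> real) \<times> (int list \<Rightarrow> rvec \<times> real) \<Rightarrow> real"
  assumes a: "a \<noteq> []" "length a \<le> length b" and F: "F \<in> borel_measurable (noise_pair d)"
  shows "(\<integral>\<^sup>+\<xi>. ennreal (F (\<xi> a, subfield b \<xi>)) \<partial>noise_space d) = (\<integral>\<^sup>+q. ennreal (F q) \<partial>noise_pair d)"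
    and "(\<integral>\<xi>. F (\<xi> a, subfield b \<xi>) \<partial>noise_space d) = (\<integral>q. F q \<partial>noise_pair d)"
    and "(\<lambda>\<xi>. F (\<xi> a, subfield b \<xi>)) \<in> borel_measurable (noise_space d)"
proof -
  have "a \<in> Theta" using a by (simp add: Theta_def)
  then have m: "(\<lambda>\<xi>. (\<xi> a, subfield b \<xi>)) \<in> noise_space d \<rightarrow>\<^sub>M (noise_pair d)"
    by (intro measurable_Pair noise_component_measurable subfield_measurable measurable_ident_sets refl)
  note eq = distr_noise_pair[OF a, of d]
  show "(\<integral>\<^sup>+\<xi>. ennreal (F (\<xi> a, subfield b \<xi>)) \<partial>noise_space d) = (\<integral>\<^sup>+q. ennreal (F q) \<partial>noise_pair d)"
    by (subst eq[symmetric], rule nn_integral_distr[symmetric, OF m]) (use F in simp)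
  show "(\<integral>\<xi>. F (\<xi> a, subfield b \<xi>) \<partial>noise_space d) = (\<integral>q. F q \<partial>noise_pair d)"
    by (subst eq[symmetric], rule integral_distr[symmetric, OF m]) (use F in simp)
  show "(\<lambda>\<xi>. F (\<xi> a, subfield b \<xi>)) \<in> borel_measurable (noise_space d)"
    using measurable_compose[OF m F] .
qed

context pde_solution
begin

text \<open>The subtracted \<open>g x\<close> leaves an increment of order
  \<open>sqrt (2 * t)\<close>, which compensates the factor \<open>1 / sqrt (2 * t)\<close> of the
  gradient components.\<close>

lemma init_term_sq_le:
  assumes t: "t \<in> {0<..T}" and x: "x \<in> Rd d"
  shows "(init_term d g t x k z)\<^sup>2 \<le> (\<Sum>j=1..d. Dl\<^sup>2 * lam * (2 * T + 1) * L j * (comp_sq k z * (z j)\<^sup>2))"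
proof -
  have t0: "t > 0" using t by simp
  let ?S = "\<Sum>j=1..d. L j * (z j)\<^sup>2"
  have S0: "?S \<ge> 0" by (rule wt_sum_nonneg)
  have "\<bar>g (add_scaled d x (sqrt (2 * t)) z) - g x\<bar> \<le> Dl * (\<Sum>j=1..d. L j * \<bar>add_scaled d x (sqrt (2 * t)) z j - x j\<bar>)"
    by (rule g_lip) (simp_all add: x)
  also have "(\<Sum>j=1..d. L j * \<bar>add_scaled d x (sqrt (2 * t)) z j - x j\<bar>) = (\<Sum>j=1..d. L j * \<bar>sqrt (2 * t) * z j\<bar>)"
    by (intro sum.cong refl) (simp add: add_scaled_def)
  finally have "\<bar>g (add_scaled d x (sqrt (2 * t)) z) - g x\<bar>\<^sup>2 \<le> (Dl * (\<Sum>j=1..d. L j * \<bar>sqrt (2 * t) * z j\<bar>))\<^sup>2"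
    by (intro power_mono) auto
  also have "\<dots> = Dl\<^sup>2 * (\<Sum>j=1..d. L j * \<bar>sqrt (2 * t) * z j\<bar>)\<^sup>2" by (simp add: power_mult_distrib)
  also have "\<dots> \<le> Dl\<^sup>2 * (lam * (\<Sum>j=1..d. L j * \<bar>sqrt (2 * t) * z j\<bar>\<^sup>2))"
    by (intro mult_left_mono L_sum_square_le) auto
  also have "(\<Sum>j=1..d. L j * \<bar>sqrt (2 * t) * z j\<bar>\<^sup>2) = 2 * t * ?S"
    using t0 by (simp add: power_mult_distrib sum_distrib_left mult_ac)
  finally have gle: "(g (add_scaled d x (sqrt (2 * t)) z) - g x)\<^sup>2 \<le> Dl\<^sup>2 * (lam * (2 * t * ?S))" by simp
  have w: "2 * t * (join_vec 1 (\<lambda>j. 1 / sqrt (2 * t) * z j) k)\<^sup>2 \<le> (2 * T + 1) * comp_sq k z"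
  proof (cases "k = 0")
    case True then show ?thesis using t by (simp add: join_vec_def comp_sq_def)
  next
    case False
    have "2 * t * (1 / sqrt (2 * t) * z k)\<^sup>2 = 1 * (z k)\<^sup>2" using t0 by (simp add: power_mult_distrib power_divide)
    also have "\<dots> \<le> (2 * T + 1) * (z k)\<^sup>2" using T by (intro mult_right_mono) auto
    finally show ?thesis using False by (simp add: join_vec_def comp_sq_def)
  qed
  have "(init_term d g t x k z)\<^sup>2 \<le> Dl\<^sup>2 * (lam * (2 * t * ?S)) * (join_vec 1 (\<lambda>j. 1 / sqrt (2 * t) * z j) k)\<^sup>2"
    unfolding init_term_def power_mult_distrib by (intro mult_right_mono gle) auto
  also have "\<dots> = Dl\<^sup>2 * lam * ?S * (2 * t * (join_vec 1 (\<lambda>j. 1 / sqrt (2 * t) * z j) k)\<^sup>2)" by (simp add: mult_ac)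
  also have "\<dots> \<le> Dl\<^sup>2 * lam * ?S * ((2 * T + 1) * comp_sq k z)"
    using lam S0 by (intro mult_left_mono w mult_nonneg_nonneg) auto
  also have "\<dots> = (\<Sum>j=1..d. Dl\<^sup>2 * lam * (2 * T + 1) * L j * (comp_sq k z * (z j)\<^sup>2))"
    by (simp add: sum_distrib_left sum_distrib_right mult_ac)
  finally show ?thesis .
qed

lemma init_term_measurable': "k \<in> {0..d} \<Longrightarrow> x \<in> Rd d \<Longrightarrow> init_term d g t x k \<in> borel_measurable (borel_Rd d)"
  by (rule init_term_measurable[OF g_cont]) auto

lemma init_term_second_moment:
  assumes t: "t \<in> {0<..T}" and x: "x \<in> Rd d" and k: "k \<in> {0..d}"
  shows "(\<integral>\<^sup>+z. ennreal ((init_term d g t x k z)\<^sup>2) \<partial>std_normal_Rd d) \<le> ennreal (Dl\<^sup>2 * lam\<^sup>2 * (3 * (2 * T + 1)))"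
proof -
  let ?C = "Dl\<^sup>2 * lam * (2 * T + 1)"
  have C: "?C \<ge> 0" using lam T by (intro mult_nonneg_nonneg) auto
  have i: "integrable (std_normal_Rd d) (\<lambda>z. \<Sum>j=1..d. ?C * L j * (comp_sq k z * (z j)\<^sup>2))"
    using comp_sq_moment(3)[OF k] by (intro Bochner_Integration.integrable_sum integrable_mult_right) auto
  have nn: "0 \<le> (\<Sum>j=1..d. ?C * L j * (comp_sq k z * (z j)\<^sup>2))" for z
    by (intro sum_nonneg mult_nonneg_nonneg[OF mult_nonneg_nonneg[OF C]] L_nonneg) auto
  have "(\<integral>\<^sup>+z. ennreal ((init_term d g t x k z)\<^sup>2) \<partial>std_normal_Rd d) \<le> (\<integral>\<^sup>+z. ennreal (\<Sum>j=1..d. ?C * L j * (comp_sq k z * (z j)\<^sup>2)) \<partial>std_normal_Rd d)"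
    by (intro nn_integral_mono ennreal_leI init_term_sq_le[OF t x])
  also have "\<dots> = ennreal (\<integral>z. (\<Sum>j=1..d. ?C * L j * (comp_sq k z * (z j)\<^sup>2)) \<partial>std_normal_Rd d)"
    using nn by (intro nn_integral_eq_integral i) auto
  also have "(\<integral>z. (\<Sum>j=1..d. ?C * L j * (comp_sq k z * (z j)\<^sup>2)) \<partial>std_normal_Rd d) = (\<Sum>j=1..d. ?C * L j * (\<integral>z. comp_sq k z * (z j)\<^sup>2 \<partial>std_normal_Rd d))"
    using comp_sq_moment(3)[OF k] by (subst Bochner_Integration.integral_sum) (auto intro!: sum.cong)
  also have "ennreal \<dots> \<le> ennreal (Dl\<^sup>2 * lam\<^sup>2 * (3 * (2 * T + 1)))"
  proof (rule ennreal_leI)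
    have "(\<Sum>j=1..d. ?C * L j * (\<integral>z. comp_sq k z * (z j)\<^sup>2 \<partial>std_normal_Rd d)) \<le> (\<Sum>j=1..d. ?C * L j * 3)"
      by (intro sum_mono mult_left_mono comp_sq_moment(4)[OF k] mult_nonneg_nonneg[OF C] L_nonneg)
    also have "\<dots> = 3 * ?C * (\<Sum>j=1..d. L j)" by (simp add: sum_distrib_left sum_distrib_right mult_ac)
    also have "\<dots> \<le> 3 * ?C * lam" using C L_sum by (intro mult_left_mono) auto
    finally show "(\<Sum>j=1..d. ?C * L j * (\<integral>z. comp_sq k z * (z j)\<^sup>2 \<partial>std_normal_Rd d)) \<le> Dl\<^sup>2 * lam\<^sup>2 * (3 * (2 * T + 1))"
      by (simp add: power2_eq_square mult_ac)
  qed
  finally show ?thesis .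
qed

lemma f_zero_sq_le: "(f 0 (zero_vec d))\<^sup>2 \<le> Dl\<^sup>2 * lam\<^sup>2"
proof -
  have "\<bar>f 0 (zero_vec d)\<bar> \<le> Dl * lam" using base by simp
  then have "\<bar>f 0 (zero_vec d)\<bar>\<^sup>2 \<le> (Dl * lam)\<^sup>2" by (intro power_mono) auto
  then show ?thesis by (simp add: power_mult_distrib)
qed

lemma step_term_0: "step_term d f (V M 0) t x k p \<zeta> = path_weight t k p * f 0 (zero_vec d)"
proof -
  have "V M 0 s y \<zeta> = (\<lambda>_. 0)" for s y by (simp add: fun_eq_iff)
  then show ?thesis by (simp add: step_term_def eval_joined_def zero_vec_def)
qed

text \<open>Level \<open>0\<close> enters the scheme without a level to subtract, so its summands
  are bounded through \<open>f\<close> at zero instead of through an error.\<close>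

lemma step_term_0_second_moment:
  assumes t: "t \<in> {0<..T}" and x: "x \<in> Rd d" and k: "k \<in> {0..d}"
  shows "(\<integral>\<^sup>+q. ennreal ((step_term d f (V M 0) t x k (fst q) (snd q))\<^sup>2) \<partial>noise_pair d) \<le> ennreal (Dl\<^sup>2 * lam\<^sup>2 * (T * (4 * T + 2)))"
proof -
  interpret Q: prob_space "noise_space d" by (rule prob_space_noise_space)
  let ?c = "f 0 (zero_vec d)"
  have pm: "path_weight t k \<in> borel_measurable (noise_law d)" using path_weight_measurable[OF k] by simp
  have m: "(\<lambda>q. ennreal ((step_term d f (V M 0) t x k (fst q) (snd q))\<^sup>2)) \<in> borel_measurable (noise_pair d)"
    using step_term_V_measurable[OF x k] by (intro measurable_compose[OF _ measurable_ennreal] borel_measurable_power)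
  have "(\<integral>\<^sup>+q. ennreal ((step_term d f (V M 0) t x k (fst q) (snd q))\<^sup>2) \<partial>noise_pair d)
     = (\<integral>\<^sup>+p. \<integral>\<^sup>+\<xi>. ennreal ((path_weight t k p * ?c)\<^sup>2) \<partial>noise_space d \<partial>noise_law d)"
    using Q.nn_integral_fst[OF m] by (simp add: step_term_0)
  also have "\<dots> = (\<integral>\<^sup>+p. ennreal (?c\<^sup>2) * ennreal ((path_weight t k p)\<^sup>2) \<partial>noise_law d)"
    using Q.emeasure_space_1 by (intro nn_integral_cong) (simp add: power_mult_distrib ennreal_mult'[symmetric] mult.commute)
  also have "\<dots> = ennreal (?c\<^sup>2) * (\<integral>\<^sup>+p. ennreal ((path_weight t k p)\<^sup>2) \<partial>noise_law d)"
    using pm by (intro nn_integral_cmult measurable_compose[OF _ measurable_ennreal] borel_measurable_power)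
  also have "\<dots> \<le> ennreal (Dl\<^sup>2 * lam\<^sup>2) * ennreal (T * (4 * T + 2))"
    by (intro mult_mono path_weight_second_moment[OF t k] ennreal_leI f_zero_sq_le) auto
  also have "\<dots> = ennreal (Dl\<^sup>2 * lam\<^sup>2 * (T * (4 * T + 2)))" by (simp add: ennreal_mult'[symmetric])
  finally show ?thesis .
qed

text \<open>The bias that remains when the fixed-point map is applied to level \<open>n\<close>:
  expected sampled source minus exact source.\<close>

definition step_mean :: "nat \<Rightarrow> nat \<Rightarrow> real \<Rightarrow> rvec \<Rightarrow> nat \<Rightarrow> real" where
  "step_mean M n t x k = (\<integral>q. step_term d f (V M n) t x k (fst q) (snd q) - source_term t x k (fst q) \<partial>noise_pair d)"

lemma prob_space_noise_pair: "prob_space (noise_pair d)"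
proof -
  interpret pair_prob_space "noise_law d" "noise_space d"
    by (intro pair_prob_space.intro pair_sigma_finite.intro prob_space_imp_sigma_finite prob_space_noise_law prob_space_noise_space)
  show ?thesis by unfold_locales
qed

lemma step_error_measurable:
  assumes x: "x \<in> Rd d" and k: "k \<in> {0..d}"
  shows "(\<lambda>q. step_term d f (V M n) t x k (fst q) (snd q) - source_term t x k (fst q)) \<in> borel_measurable (noise_pair d)"
  using step_term_V_measurable[OF x k] source_term_measurable'[OF x k] by (rule borel_measurable_diff)

lemma step_error_bound_nonneg: "b \<ge> 0 \<Longrightarrow> \<mu> > 0 \<Longrightarrow> step_error_bound \<mu> b t x \<ge> 0"
  using T lam wt_ge_1[of x] unfolding step_error_bound_def contraction_const_def by (intro mult_nonneg_nonneg divide_nonneg_nonneg add_nonneg_nonneg) auto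

lemma step_mean_sq_le:
  assumes E: "error_bound \<mu> M n b" and b: "b \<ge> 0" and \<mu>: "\<mu> > 0" and t: "t \<in> {0<..T}" and x: "x \<in> Rd d" and k: "k \<in> {0..d}"
  shows "(step_mean M n t x k)\<^sup>2 \<le> step_error_bound \<mu> b t x"
    and "integrable (noise_pair d) (\<lambda>q. step_term d f (V M n) t x k (fst q) (snd q) - source_term t x k (fst q))"
proof -
  interpret W: prob_space "noise_pair d" by (rule prob_space_noise_pair)
  let ?D = "\<lambda>q. step_term d f (V M n) t x k (fst q) (snd q) - source_term t x k (fst q)"
  note m = step_error_measurable[OF x k, of M n t]
  have m2: "(\<lambda>q. (?D q)\<^sup>2) \<in> borel_measurable (noise_pair d)" using m by (rule borel_measurable_power)
  note i = integral_le_of_nn_integral[OF m2 zero_le_power2 step_error[OF E b \<mu> t x k] step_error_bound_nonneg[OF b \<mu>]]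
  show "integrable (noise_pair d) ?D" by (rule W.square_integrable_imp_integrable[OF m i(1)])
  show "(step_mean M n t x k)\<^sup>2 \<le> step_error_bound \<mu> b t x"
    unfolding step_mean_def by (rule order_trans[OF W.square_expectation_le[OF m i(1)] i(2)])
qed

lemma init_summand:
  assumes t: "t \<in> {0<..T}" and x: "x \<in> Rd d" and k: "k \<in> {0..d}" and i: "i \<ge> 1"
  shows "integrable (noise_space d) (\<lambda>\<xi>. (summand d f g M n t x k (0, - int i) \<xi>)\<^sup>2)"
    and "(\<integral>\<xi>. (summand d f g M n t x k (0, - int i) \<xi>)\<^sup>2 \<partial>noise_space d) \<le> (1 / real (M ^ n))\<^sup>2 * (Dl\<^sup>2 * lam\<^sup>2 * (3 * (2 * T + 1)))"
    and "(\<integral>\<xi>. summand d f g M n t x k (0, - int i) \<xi> \<partial>noise_space d) = 1 / real (M ^ n) * (\<integral>z. init_term d g t x k z \<partial>std_normal_Rd d)"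
proof -
  have a: "[0, - int i] \<in> Theta" by (simp add: Theta_def)
  have e: "summand d f g M n t x k (0, - int i) = (\<lambda>\<xi>. 1 / real (M ^ n) * init_term d g t x k (fst (\<xi> [0, - int i])))"
    using i by (simp add: summand_def fun_eq_iff)
  note im = init_term_measurable'[OF k x, of t]
  have im2: "(\<lambda>z. (init_term d g t x k z)\<^sup>2) \<in> borel_measurable (borel_Rd d)" using im by (rule borel_measurable_power)
  have C: "Dl\<^sup>2 * lam\<^sup>2 * (3 * (2 * T + 1)) \<ge> 0" using T by simp
  have imq: "(\<lambda>\<xi>. (init_term d g t x k (fst (\<xi> [0, - int i])))\<^sup>2) \<in> borel_measurable (noise_space d)"
  proof -
    have "(\<lambda>\<xi>. \<xi> [0, - int i]) \<in> noise_space d \<rightarrow>\<^sub>M (borel_Rd d \<Otimes>\<^sub>M borel)"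
      using measurable_component_singleton[OF a, of "\<lambda>_. noise_law d"] by (simp cong: measurable_cong_sets)
    then show ?thesis by (rule measurable_compose[OF measurable_compose[OF _ measurable_fst] im2])
  qed
  have le: "(\<integral>\<^sup>+\<xi>. ennreal ((init_term d g t x k (fst (\<xi> [0, - int i])))\<^sup>2) \<partial>noise_space d) \<le> ennreal (Dl\<^sup>2 * lam\<^sup>2 * (3 * (2 * T + 1)))"
    unfolding noise_fst_transfer(1)[OF a im2] by (rule init_term_second_moment[OF t x k])
  note s = integral_le_of_nn_integral[OF imq zero_le_power2 le C]
  show "integrable (noise_space d) (\<lambda>\<xi>. (summand d f g M n t x k (0, - int i) \<xi>)\<^sup>2)"
    unfolding e power_mult_distrib using s(1) by (rule integrable_mult_right)
  show "(\<integral>\<xi>. (summand d f g M n t x k (0, - int i) \<xi>)\<^sup>2 \<partial>noise_space d) \<le> (1 / real (M ^ n))\<^sup>2 * (Dl\<^sup>2 * lam\<^sup>2 * (3 * (2 * T + 1)))"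
    unfolding e power_mult_distrib integral_mult_right_zero by (intro mult_left_mono s(2)) simp
  show "(\<integral>\<xi>. summand d f g M n t x k (0, - int i) \<xi> \<partial>noise_space d) = 1 / real (M ^ n) * (\<integral>z. init_term d g t x k z \<partial>std_normal_Rd d)"
    unfolding e integral_mult_right_zero noise_fst_transfer(2)[OF a im] ..
qed

lemma zero_summand:
  assumes t: "t \<in> {0<..T}" and x: "x \<in> Rd d" and k: "k \<in> {0..d}"
  shows "integrable (noise_space d) (\<lambda>\<xi>. (summand d f g M n t x k (int 0, int i) \<xi>)\<^sup>2)"
    and "(\<integral>\<xi>. (summand d f g M n t x k (int 0, int i) \<xi>)\<^sup>2 \<partial>noise_space d) \<le> (1 / real (M ^ n))\<^sup>2 * (Dl\<^sup>2 * lam\<^sup>2 * (T * (4 * T + 2)))"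
    and "(\<integral>\<xi>. summand d f g M n t x k (int 0, int i) \<xi> \<partial>noise_space d)
      = 1 / real (M ^ n) * (\<integral>q. step_term d f (V M 0) t x k (fst q) (snd q) \<partial>noise_pair d)"
proof -
  let ?a = "[0, int i]"
  have a: "?a \<noteq> []" "length ?a \<le> length ?a" by auto
  let ?F = "\<lambda>q. step_term d f (V M 0) t x k (fst q) (snd q)"
  have e: "summand d f g M n t x k (int 0, int i) = (\<lambda>\<xi>. 1 / real (M ^ n) * ?F (\<xi> ?a, subfield ?a \<xi>))"
    by (simp add: summand_def fun_eq_iff)
  note m = step_term_V_measurable[OF x k, of M 0 t]
  have m2: "(\<lambda>q. (?F q)\<^sup>2) \<in> borel_measurable (noise_pair d)" using m by (rule borel_measurable_power)
  have C: "Dl\<^sup>2 * lam\<^sup>2 * (T * (4 * T + 2)) \<ge> 0" using T by simp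
  have le: "(\<integral>\<^sup>+\<xi>. ennreal ((?F (\<xi> ?a, subfield ?a \<xi>))\<^sup>2) \<partial>noise_space d) \<le> ennreal (Dl\<^sup>2 * lam\<^sup>2 * (T * (4 * T + 2)))"
    unfolding noise_pair_transfer(1)[OF a m2] by (rule step_term_0_second_moment[OF t x k])
  note s = integral_le_of_nn_integral[OF noise_pair_transfer(3)[OF a m2] zero_le_power2 le C]
  show "integrable (noise_space d) (\<lambda>\<xi>. (summand d f g M n t x k (int 0, int i) \<xi>)\<^sup>2)"
    unfolding e power_mult_distrib using s(1) by (rule integrable_mult_right)
  show "(\<integral>\<xi>. (summand d f g M n t x k (int 0, int i) \<xi>)\<^sup>2 \<partial>noise_space d) \<le> (1 / real (M ^ n))\<^sup>2 * (Dl\<^sup>2 * lam\<^sup>2 * (T * (4 * T + 2)))"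
    unfolding e power_mult_distrib integral_mult_right_zero by (intro mult_left_mono s(2)) simp
  show "(\<integral>\<xi>. summand d f g M n t x k (int 0, int i) \<xi> \<partial>noise_space d) = 1 / real (M ^ n) * (\<integral>q. ?F q \<partial>noise_pair d)"
    unfolding e integral_mult_right_zero noise_pair_transfer(2)[OF a m] ..
qed

text \<open>Both levels are evaluated with the same pair at \<open>[l, i]\<close> but with different
  subfields. The exact source at this common pair is inserted and cancels, so the summand is a
  difference of two step errors \<open>X\<close> and \<open>Y\<close>, each already bounded; its
  mean needs no independence of the two.\<close>

lemma step_summand:
  assumes t: "t \<in> {0<..T}" and x: "x \<in> Rd d" and k: "k \<in> {0..d}" and l: "l \<ge> 1" and \<mu>: "\<mu> > 0"
    and E: "error_bound \<mu> M l b" "error_bound \<mu> M (l - 1) b'" and b: "b \<ge> 0" "b' \<ge> 0"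
  shows "integrable (noise_space d) (\<lambda>\<xi>. (summand d f g M n t x k (int l, int i) \<xi>)\<^sup>2)"
    and "(\<integral>\<xi>. (summand d f g M n t x k (int l, int i) \<xi>)\<^sup>2 \<partial>noise_space d)
      \<le> (1 / real (M ^ (n - l)))\<^sup>2 * (2 * (step_error_bound \<mu> b t x + step_error_bound \<mu> b' t x))"
    and "(\<integral>\<xi>. summand d f g M n t x k (int l, int i) \<xi> \<partial>noise_space d)
      = 1 / real (M ^ (n - l)) * (step_mean M l t x k - step_mean M (l - 1) t x k)"
proof -
  let ?a = "[int l, int i]" and ?a' = "[- int l, int i]"
  let ?w = "1 / real (M ^ (n - l))"
  have a: "?a \<noteq> []" "length ?a \<le> length ?a" "length ?a \<le> length ?a'" by auto
  let ?D = "\<lambda>m q. step_term d f (V M m) t x k (fst q) (snd q) - source_term t x k (fst q)"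
  define X where "X \<xi> = ?D l (\<xi> ?a, subfield ?a \<xi>)" for \<xi>
  define Y where "Y \<xi> = ?D (l - 1) (\<xi> ?a, subfield ?a' \<xi>)" for \<xi>
  have e: "summand d f g M n t x k (int l, int i) = (\<lambda>\<xi>. ?w * (X \<xi> - Y \<xi>))"
    using l by (simp add: summand_def fun_eq_iff X_def Y_def Let_def)
  note m = step_error_measurable[OF x k, of M _ t]
  have m2: "(\<lambda>q. (?D n q)\<^sup>2) \<in> borel_measurable (noise_pair d)" for n using m by (rule borel_measurable_power)
  have Xm: "X \<in> borel_measurable (noise_space d)" unfolding X_def by (rule noise_pair_transfer(3)[OF a(1,2) m])
  have Ym: "Y \<in> borel_measurable (noise_space d)" unfolding Y_def by (rule noise_pair_transfer(3)[OF a(1,3) m])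
  have X2: "(\<integral>\<^sup>+\<xi>. ennreal ((X \<xi>)\<^sup>2) \<partial>noise_space d) \<le> ennreal (step_error_bound \<mu> b t x)"
    unfolding X_def noise_pair_transfer(1)[OF a(1,2) m2] by (rule step_error[OF E(1) b(1) \<mu> t x k])
  have Y2: "(\<integral>\<^sup>+\<xi>. ennreal ((Y \<xi>)\<^sup>2) \<partial>noise_space d) \<le> ennreal (step_error_bound \<mu> b' t x)"
    unfolding Y_def noise_pair_transfer(1)[OF a(1,3) m2] by (rule step_error[OF E(2) b(2) \<mu> t x k])
  interpret Q: prob_space "noise_space d" by (rule prob_space_noise_space)
  note iX = integral_le_of_nn_integral[OF borel_measurable_power[OF Xm] zero_le_power2 X2 step_error_bound_nonneg[OF b(1) \<mu>]]
  note iY = integral_le_of_nn_integral[OF borel_measurable_power[OF Ym] zero_le_power2 Y2 step_error_bound_nonneg[OF b(2) \<mu>]]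
  have iX1: "integrable (noise_space d) X" by (rule Q.square_integrable_imp_integrable[OF Xm iX(1)])
  have iY1: "integrable (noise_space d) Y" by (rule Q.square_integrable_imp_integrable[OF Ym iY(1)])
  have le: "(X \<xi> - Y \<xi>)\<^sup>2 \<le> 2 * ((X \<xi>)\<^sup>2 + (Y \<xi>)\<^sup>2)" for \<xi>
    using zero_le_power2[of "X \<xi> + Y \<xi>"] by (simp add: power2_sum power2_diff)
  have i2: "integrable (noise_space d) (\<lambda>\<xi>. 2 * ((X \<xi>)\<^sup>2 + (Y \<xi>)\<^sup>2))"
    by (intro integrable_mult_right Bochner_Integration.integrable_add iX iY)
  have i: "integrable (noise_space d) (\<lambda>\<xi>. (X \<xi> - Y \<xi>)\<^sup>2)"
    by (rule Bochner_Integration.integrable_bound[OF i2]) (use Xm Ym le in auto)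
  show "integrable (noise_space d) (\<lambda>\<xi>. (summand d f g M n t x k (int l, int i) \<xi>)\<^sup>2)"
    unfolding e power_mult_distrib using i by (rule integrable_mult_right)
  have "(\<integral>\<xi>. (X \<xi> - Y \<xi>)\<^sup>2 \<partial>noise_space d) \<le> (\<integral>\<xi>. 2 * ((X \<xi>)\<^sup>2 + (Y \<xi>)\<^sup>2) \<partial>noise_space d)"
    by (rule integral_mono[OF i i2 le])
  also have "\<dots> = 2 * ((\<integral>\<xi>. (X \<xi>)\<^sup>2 \<partial>noise_space d) + (\<integral>\<xi>. (Y \<xi>)\<^sup>2 \<partial>noise_space d))"
    using iX iY by simp
  also have "\<dots> \<le> 2 * (step_error_bound \<mu> b t x + step_error_bound \<mu> b' t x)"
    by (intro mult_left_mono add_mono iX iY) auto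
  finally show "(\<integral>\<xi>. (summand d f g M n t x k (int l, int i) \<xi>)\<^sup>2 \<partial>noise_space d)
      \<le> ?w\<^sup>2 * (2 * (step_error_bound \<mu> b t x + step_error_bound \<mu> b' t x))"
    unfolding e power_mult_distrib integral_mult_right_zero by (intro mult_left_mono) auto
  have "(\<integral>\<xi>. X \<xi> - Y \<xi> \<partial>noise_space d) = step_mean M l t x k - step_mean M (l - 1) t x k"
    unfolding Bochner_Integration.integral_diff[OF iX1 iY1] unfolding X_def Y_def step_mean_def
      noise_pair_transfer(2)[OF a(1,2) m] noise_pair_transfer(2)[OF a(1,3) m] ..
  then show "(\<integral>\<xi>. summand d f g M n t x k (int l, int i) \<xi> \<partial>noise_space d) = ?w * (step_mean M l t x k - step_mean M (l - 1) t x k)"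
    unfolding e integral_mult_right_zero by simp
qed

lemma source_term_pair_integral:
  assumes t: "t \<in> {0<..T}" and x: "x \<in> Rd d" and k: "k \<in> {0..d}"
  shows "integrable (noise_pair d) (\<lambda>q. source_term t x k (fst q))"
    and "(\<integral>q. source_term t x k (fst q) \<partial>noise_pair d) = (\<integral>p. source_term t x k p \<partial>noise_law d)"
proof -
  interpret Q: prob_space "noise_space d" by (rule prob_space_noise_space)
  have eq: "distr (noise_pair d) (noise_law d) fst = noise_law d" by (rule Q.distr_pair_fst)
  have i: "integrable (noise_law d) (source_term t x k)" by (rule source_term_integrable[OF t x k])
  have m: "source_term t x k \<in> borel_measurable (noise_law d)" using i by (rule borel_measurable_integrable)
  show "integrable (noise_pair d) (\<lambda>q. source_term t x k (fst q))"
    using integrable_distr_eq[OF measurable_fst m, of "noise_space d"] i unfolding eq by simp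
  show "(\<integral>q. source_term t x k (fst q) \<partial>noise_pair d) = (\<integral>p. source_term t x k p \<partial>noise_law d)"
    using integral_distr[OF measurable_fst m, of "noise_space d"] unfolding eq by simp
qed

text \<open>
  The expectations of the summands telescope over the levels, which leaves the bias of level \<open>n - 1\<close>.
\<close>

lemma mlp_error_step:
  fixes \<beta> :: "nat \<Rightarrow> real"
  assumes t: "t \<in> {0<..T}" and x: "x \<in> Rd d" and k: "k \<in> {0..d}" and n: "n \<ge> 1" and M: "M \<ge> 1" and \<mu>: "\<mu> > 0"
    and E: "\<And>m. m < n \<Longrightarrow> error_bound \<mu> M m (\<beta> m)" and \<beta>: "\<And>m. \<beta> m \<ge> 0"
  defines "G \<equiv> Dl\<^sup>2 * lam\<^sup>2 * (3 * (2 * T + 1) + T * (4 * T + 2))"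
  shows "integrable (noise_space d) (\<lambda>\<xi>. (V M n t x \<xi> k - uvec t x k)\<^sup>2)"
    and "(\<integral>\<xi>. (V M n t x \<xi> k - uvec t x k)\<^sup>2 \<partial>noise_space d)
      \<le> G / real M ^ n + (\<Sum>l\<in>{1..<n}. 1 / real M ^ (n - l) * (2 * (step_error_bound \<mu> (\<beta> l) t x + step_error_bound \<mu> (\<beta> (l - 1)) t x)))
        + step_error_bound \<mu> (\<beta> (n - 1)) t x"
proof -
  interpret Q: prob_space "noise_space d" by (rule prob_space_noise_space)
  let ?Y = "summand d f g M n t x k"
  let ?se = "\<lambda>l. step_error_bound \<mu> (\<beta> l) t x"
  let ?I = "\<integral>z. init_term d g t x k z \<partial>std_normal_Rd d"
  let ?S = "\<integral>p. source_term t x k p \<partial>noise_law d"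
  let ?A = "\<integral>q. step_term d f (V M 0) t x k (fst q) (snd q) \<partial>noise_pair d"
  have Mp: "real (M ^ j) > 0" for j using M by simp
  have ws: "(\<Sum>i=1..M ^ j. 1 / real (M ^ j) * c) = c" "(\<Sum>i=1..M ^ j. (1 / real (M ^ j))\<^sup>2 * c) = 1 / real M ^ j * c" for j c
    using Mp[of j] M by (simp_all add: power2_eq_square)
  have El: "error_bound \<mu> M l (\<beta> l)" "error_bound \<mu> M (l - 1) (\<beta> (l - 1))" if "l \<in> {1..<n}" for l using that by (auto intro: E)
  note st = step_summand[OF t x k _ \<mu> El \<beta> \<beta>]
  define c where "c = uvec t x k - join_vec (g x) (\<lambda>_. 0) k"
  have c: "c = ?I + ?S" unfolding c_def uvec_fixed_point[OF t x k] init_term_def by simp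
  have V: "V M n t x \<xi> k - uvec t x k = (\<Sum>j\<in>all_index M n. ?Y j \<xi>) - c" for \<xi>
    unfolding mlp_eq_sum_summand[OF n] c_def by simp
  have ind: "Q.indep_vars (\<lambda>_. borel) ?Y (all_index M n)" by (rule indep_summands[OF f_cont g_cont k x])
  have sq: "integrable (noise_space d) (\<lambda>\<xi>. (?Y j \<xi>)\<^sup>2)" if j: "j \<in> all_index M n" for j
  proof -
    consider i where "i \<ge> 1" "j = (0, - int i)" | i where "j = (int 0, int i)" | l i where "l \<in> {1..<n}" "j = (int l, int i)"
    proof -
      from j have "j \<in> init_index M n \<or> (\<exists>l<n. j \<in> step_index M n l)" by (auto simp: all_index_def)
      then show thesis
      proof
        assume "j \<in> init_index M n"
        then show thesis using that(1) by (auto simp: init_index_def)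
      next
        assume "\<exists>l<n. j \<in> step_index M n l"
        then obtain l i where li: "l < n" "j = (int l, int i)" by (auto simp: step_index_def)
        show thesis
        proof (cases "l = 0")
          case True then show thesis using that(2) li by simp
        next
          case False then show thesis using that(3)[of l i] li by simp
        qed
      qed
    qed
    then show ?thesis
    proof cases
      case 1 then show ?thesis using init_summand(1)[OF t x k] by simp
    next
      case 2 show ?thesis unfolding 2 by (rule zero_summand(1)[OF t x k])
    next
      case 3 show ?thesis unfolding 3(2) by (rule st(1)) (use 3 in auto)
    qed
  qed
  note ms = Q.mean_square_indep_sum[OF finite_all_index ind sq, of c]
  show "integrable (noise_space d) (\<lambda>\<xi>. (V M n t x \<xi> k - uvec t x k)\<^sup>2)" unfolding V by (rule ms(1))
  have second: "(\<Sum>j\<in>all_index M n. Q.expectation (\<lambda>\<xi>. (?Y j \<xi>)\<^sup>2)) \<le> G / real M ^ n + (\<Sum>l\<in>{1..<n}. 1 / real M ^ (n - l) * (2 * (?se l + ?se (l - 1))))"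
  proof -
    have "(\<Sum>j\<in>all_index M n. Q.expectation (\<lambda>\<xi>. (?Y j \<xi>)\<^sup>2))
      = (\<Sum>i=1..M ^ n. Q.expectation (\<lambda>\<xi>. (?Y (0, - int i) \<xi>)\<^sup>2))
      + ((\<Sum>i=1..M ^ n. Q.expectation (\<lambda>\<xi>. (?Y (int 0, int i) \<xi>)\<^sup>2))
      + (\<Sum>l\<in>{1..<n}. \<Sum>i=1..M ^ (n - l). Q.expectation (\<lambda>\<xi>. (?Y (int l, int i) \<xi>)\<^sup>2)))"
      unfolding sum_all_index sum_lessThan_split_0[OF n] by simp
    also have "\<dots> \<le> (\<Sum>i=1..M ^ n. (1 / real (M ^ n))\<^sup>2 * (Dl\<^sup>2 * lam\<^sup>2 * (3 * (2 * T + 1))))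
      + ((\<Sum>i=1..M ^ n. (1 / real (M ^ n))\<^sup>2 * (Dl\<^sup>2 * lam\<^sup>2 * (T * (4 * T + 2))))
      + (\<Sum>l\<in>{1..<n}. \<Sum>i=1..M ^ (n - l). (1 / real (M ^ (n - l)))\<^sup>2 * (2 * (?se l + ?se (l - 1)))))"
      by (intro add_mono sum_mono init_summand(2)[OF t x k] zero_summand(2)[OF t x k] st(2)) auto
    also have "\<dots> = G / real M ^ n + (\<Sum>l\<in>{1..<n}. 1 / real M ^ (n - l) * (2 * (?se l + ?se (l - 1))))"
      unfolding ws G_def by (simp add: distrib_left add_divide_distrib)
    finally show ?thesis .
  qed
  have "(\<Sum>j\<in>all_index M n. Q.expectation (?Y j)) = ?I + (?A + (step_mean M (n - 1) t x k - step_mean M 0 t x k))"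
  proof -
    have "(\<Sum>j\<in>all_index M n. Q.expectation (?Y j))
      = (\<Sum>i=1..M ^ n. Q.expectation (?Y (0, - int i)))
      + ((\<Sum>i=1..M ^ n. Q.expectation (?Y (int 0, int i)))
      + (\<Sum>l\<in>{1..<n}. \<Sum>i=1..M ^ (n - l). Q.expectation (?Y (int l, int i))))"
      unfolding sum_all_index sum_lessThan_split_0[OF n] by simp
    also have "(\<Sum>i=1..M ^ n. Q.expectation (?Y (0, - int i))) = (\<Sum>i=1..M ^ n. 1 / real (M ^ n) * ?I)"
      by (intro sum.cong refl init_summand(3)[OF t x k]) auto
    also have "(\<Sum>i=1..M ^ n. Q.expectation (?Y (int 0, int i))) = (\<Sum>i=1..M ^ n. 1 / real (M ^ n) * ?A)"
      by (intro sum.cong refl zero_summand(3)[OF t x k])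
    also have "(\<Sum>l\<in>{1..<n}. \<Sum>i=1..M ^ (n - l). Q.expectation (?Y (int l, int i)))
      = (\<Sum>l\<in>{1..<n}. \<Sum>i=1..M ^ (n - l). 1 / real (M ^ (n - l)) * (step_mean M l t x k - step_mean M (l - 1) t x k))"
      by (intro sum.cong refl st(3)) auto
    finally show ?thesis unfolding ws sum_telescope_1[OF n, of "\<lambda>l. step_mean M l t x k"] .
  qed
  \<comment> \<open>The summands of level \<open>0\<close> have no counterpart to subtract and
    therefore carry the full source. Written relative to it, they cancel the lower end of the
    telescoping sum.\<close>
  also have "?A = step_mean M 0 t x k + ?S"
  proof -
    have E0: "error_bound \<mu> M 0 (\<beta> 0)" using n by (intro E) simp
    have "?A = (\<integral>q. (step_term d f (V M 0) t x k (fst q) (snd q) - source_term t x k (fst q)) + source_term t x k (fst q) \<partial>noise_pair d)"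
      by simp
    also have "\<dots> = step_mean M 0 t x k + ?S"
      unfolding step_mean_def source_term_pair_integral(2)[OF t x k, symmetric]
      by (rule Bochner_Integration.integral_add[OF step_mean_sq_le(2)[OF E0 \<beta> \<mu> t x k] source_term_pair_integral(1)[OF t x k]])
    finally show ?thesis .
  qed
  finally have bias: "(\<Sum>j\<in>all_index M n. Q.expectation (?Y j)) - c = step_mean M (n - 1) t x k" unfolding c by simp
  have En: "error_bound \<mu> M (n - 1) (\<beta> (n - 1))" using n by (intro E) simp
  have "Q.expectation (\<lambda>\<xi>. (V M n t x \<xi> k - uvec t x k)\<^sup>2)
     \<le> (\<Sum>j\<in>all_index M n. Q.expectation (\<lambda>\<xi>. (?Y j \<xi>)\<^sup>2)) + ((\<Sum>j\<in>all_index M n. Q.expectation (?Y j)) - c)\<^sup>2"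
    unfolding V by (rule ms(2))
  also have "\<dots> \<le> G / real M ^ n + (\<Sum>l\<in>{1..<n}. 1 / real M ^ (n - l) * (2 * (?se l + ?se (l - 1)))) + ?se (n - 1)"
    unfolding bias by (intro add_mono second step_mean_sq_le(1)[OF En \<beta> \<mu> t x k])
  finally show "(\<integral>\<xi>. (V M n t x \<xi> k - uvec t x k)\<^sup>2 \<partial>noise_space d)
      \<le> G / real M ^ n + (\<Sum>l\<in>{1..<n}. 1 / real M ^ (n - l) * (2 * (?se l + ?se (l - 1)))) + ?se (n - 1)" .
qed

text \<open>\<open>B\<close> dominates both the level-\<open>0\<close> error, through
  \<open>u_const\<close>, and the sampling variance of the initial and level-\<open>0\<close> terms;
  this is what the geometric recursion asks of its starting value.\<close>

lemma mlp_error_bound: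
  assumes M: "M \<ge> 1"
  defines "B \<equiv> Dl\<^sup>2 * (u_const T lam + lam\<^sup>2 * (3 * (2 * T + 1) + T * (4 * T + 2)))"
    and "\<kappa> \<equiv> contraction_const T lam"
  shows "error_bound ((real M)\<^sup>2) M n (B * (1 + 5 * \<kappa>) ^ n / real M ^ n)"
    and "t \<in> {0<..T} \<Longrightarrow> x \<in> Rd d \<Longrightarrow> k \<in> {0..d} \<Longrightarrow> integrable (noise_space d) (\<lambda>\<xi>. (V M n t x \<xi> k - uvec t x k)\<^sup>2)"
proof -
  interpret Q: prob_space "noise_space d" by (rule prob_space_noise_space)
  let ?G = "Dl\<^sup>2 * lam\<^sup>2 * (3 * (2 * T + 1) + T * (4 * T + 2))"
  let ?b = "\<lambda>n. B * (1 + 5 * \<kappa>) ^ n / real M ^ n"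
  have \<kappa>: "\<kappa> \<ge> 0" unfolding \<kappa>_def contraction_const_def using T lam by (intro mult_nonneg_nonneg add_nonneg_nonneg) auto
  have u0: "u_const T lam \<ge> 0" unfolding u_const_def Let_def using lam by (intro add_nonneg_nonneg mult_nonneg_nonneg) auto
  have G: "?G \<ge> 0" "B \<ge> ?G" "B \<ge> Dl\<^sup>2 * u_const T lam"
    using T u0 by (auto simp: B_def distrib_left)
  have B: "B \<ge> 0" using G by simp
  have M0: "real M > 0" using M by simp
  have \<mu>: "(real M)\<^sup>2 > 0" using M0 by simp
  have b0: "?b m \<ge> 0" for m using B \<kappa> M0 by simp
  have main: "error_bound ((real M)\<^sup>2) M n (?b n)" for n
  proof (induction n rule: less_induct)
    case (less n)
    show ?case
    proof (cases "n = 0")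
      case True
      show ?thesis unfolding error_bound_def
      proof (intro ballI)
        fix t x k assume t: "t \<in> {0<..T}" and x: "x \<in> Rd d" and k: "k \<in> {0..d}"
        have "(uvec t x k)\<^sup>2 \<le> Dl\<^sup>2 * u_const T lam * wt x" using t by (intro uvec_bound x k) auto
        also have "\<dots> \<le> B * wt x" using G wt_ge_1[of x] by (intro mult_right_mono) auto
        also have "\<dots> \<le> B * (exp ((real M)\<^sup>2 * t) * wt x)"
        proof (intro mult_left_mono B)
          have "1 * wt x \<le> exp ((real M)\<^sup>2 * t) * wt x" using t wt_ge_1[of x] by (intro mult_right_mono) auto
          then show "wt x \<le> exp ((real M)\<^sup>2 * t) * wt x" by simp
        qed
        finally show "(\<integral>\<^sup>+\<xi>. ennreal ((V M n t x \<xi> k - uvec t x k)\<^sup>2) \<partial>noise_space d) \<le> ennreal (?b n * (exp ((real M)\<^sup>2 * t) * wt x))"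
          using Q.emeasure_space_1 by (simp add: True ennreal_leI)
      qed
    next
      case False
      then have n: "n \<ge> 1" by simp
      show ?thesis unfolding error_bound_def
      proof (intro ballI)
        fix t x k assume t: "t \<in> {0<..T}" and x: "x \<in> Rd d" and k: "k \<in> {0..d}"
        define W where "W = exp ((real M)\<^sup>2 * t) * wt x"
        have W: "W \<ge> 1"
        proof -
          have "1 * 1 \<le> exp ((real M)\<^sup>2 * t) * wt x" using t wt_ge_1[of x] by (intro mult_mono) auto
          then show ?thesis by (simp add: W_def)
        qed
        \<comment> \<open>Here \<open>sqrt \<mu> = M\<close>: the contraction factor becomes
          \<open>\<kappa> / M\<close>.\<close>
        have se: "step_error_bound ((real M)\<^sup>2) b t x = W * (\<kappa> / real M * b)" for b
          using M0 by (simp add: step_error_bound_def W_def \<kappa>_def)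
        note st = mlp_error_step[OF t x k n M \<mu> less.IH b0]
        have "(\<integral>\<xi>. (V M n t x \<xi> k - uvec t x k)\<^sup>2 \<partial>noise_space d)
          \<le> ?G / real M ^ n + (\<Sum>l\<in>{1..<n}. 1 / real M ^ (n - l) * (2 * (W * (\<kappa> / real M * ?b l) + W * (\<kappa> / real M * ?b (l - 1))))) + W * (\<kappa> / real M * ?b (n - 1))"
          using st(2) unfolding se .
        \<comment> \<open>The sampling variance carries no weight of its own;
          \<open>W \<ge> 1\<close> puts it under the common factor.\<close>
        also have "\<dots> \<le> W * (?G / real M ^ n) + (\<Sum>l\<in>{1..<n}. 1 / real M ^ (n - l) * (2 * (W * (\<kappa> / real M * ?b l) + W * (\<kappa> / real M * ?b (l - 1))))) + W * (\<kappa> / real M * ?b (n - 1))"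
        proof (intro add_right_mono)
          have "1 * (?G / real M ^ n) \<le> W * (?G / real M ^ n)" using W G(1) M0 by (intro mult_right_mono divide_nonneg_nonneg) auto
          then show "?G / real M ^ n \<le> W * (?G / real M ^ n)" by simp
        qed
        also have "\<dots> = W * (?G / real M ^ n + (\<Sum>l\<in>{1..<n}. 1 / real M ^ (n - l) * (2 * (\<kappa> / real M * ?b l + \<kappa> / real M * ?b (l - 1)))) + \<kappa> / real M * ?b (n - 1))"
          by (simp add: distrib_left sum_distrib_left mult_ac)
        also have "\<dots> \<le> W * ?b n"
          using W by (intro mult_left_mono geometric_recursion_bound[OF \<kappa> G(2) G(1) M n]) auto
        finally have le: "(\<integral>\<xi>. (V M n t x \<xi> k - uvec t x k)\<^sup>2 \<partial>noise_space d) \<le> W * ?b n" .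
        show "(\<integral>\<^sup>+\<xi>. ennreal ((V M n t x \<xi> k - uvec t x k)\<^sup>2) \<partial>noise_space d) \<le> ennreal (?b n * (exp ((real M)\<^sup>2 * t) * wt x))"
          using le by (subst nn_integral_eq_integral[OF st(1)]) (auto simp: W_def mult_ac intro!: ennreal_leI)
      qed
    qed
  qed
  then show "error_bound ((real M)\<^sup>2) M n (?b n)" .
  show "integrable (noise_space d) (\<lambda>\<xi>. (V M n t x \<xi> k - uvec t x k)\<^sup>2)" if "t \<in> {0<..T}" "x \<in> Rd d" "k \<in> {0..d}"
  proof (cases "n = 0")
    case False
    then show ?thesis using mlp_error_step(1)[OF that _ M \<mu> main b0, of n] by simp
  qed simp
qed

lemma mlp_mean_square_error:
  assumes M: "M \<ge> 1" and k: "k \<in> {0..d}"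
  defines "c \<equiv> u_const T lam + lam\<^sup>2 * (3 * (2 * T + 1) + T * (4 * T + 2))"
  shows "integrable (noise_space d) (\<lambda>\<xi>. (V M n T (zero_vec d) \<xi> k - uvec T (zero_vec d) k)\<^sup>2)"
    and "(\<integral>\<xi>. (V M n T (zero_vec d) \<xi> k - uvec T (zero_vec d) k)\<^sup>2 \<partial>noise_space d)
      \<le> Dl\<^sup>2 * c * (1 + 5 * contraction_const T lam) ^ n / real M ^ n * exp ((real M)\<^sup>2 * T)"
proof -
  have t: "T \<in> {0<..T}" using T by simp
  have x: "zero_vec d \<in> Rd d" by simp
  show i: "integrable (noise_space d) (\<lambda>\<xi>. (V M n T (zero_vec d) \<xi> k - uvec T (zero_vec d) k)\<^sup>2)"
    by (rule mlp_error_bound(2)[OF M t x k])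
  let ?X = "Dl\<^sup>2 * c * (1 + 5 * contraction_const T lam) ^ n / real M ^ n * exp ((real M)\<^sup>2 * T)"
  \<comment> \<open>At the origin the spatial weight is trivial, so the only remaining trace of the
    dimension is \<open>Dl\<^sup>2\<close>.\<close>
  have w: "wt (zero_vec d) = 1" by (simp add: wt_def zero_vec_def)
  have le: "(\<integral>\<^sup>+\<xi>. ennreal ((V M n T (zero_vec d) \<xi> k - uvec T (zero_vec d) k)\<^sup>2) \<partial>noise_space d) \<le> ennreal ?X"
    using mlp_error_bound(1)[OF M, of n, unfolded error_bound_def, rule_format, OF t x k] by (simp add: w c_def)
  have "0 \<le> ?X" unfolding c_def contraction_const_def u_const_def Let_def using T lam Dl
    by (intro mult_nonneg_nonneg divide_nonneg_nonneg zero_le_power add_nonneg_nonneg) auto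
  with le show "(\<integral>\<xi>. (V M n T (zero_vec d) \<xi> k - uvec T (zero_vec d) k)\<^sup>2 \<partial>noise_space d) \<le> ?X"
    by (rule integral_real_bounded[rotated])
qed

end

section \<open>Law of the noise field\<close>

text \<open>The distribution function is prescribed inside the unit interval; outside it is
  determined by the range of \<open>X\<close>.\<close>

lemma (in prob_space) distr_eq_sqrt_law:
  fixes X :: "'a \<Rightarrow> real"
  assumes X: "random_variable borel X" and range: "\<And>\<omega>. \<omega> \<in> space M \<Longrightarrow> X \<omega> \<in> {0<..<1}"
    and cdf: "\<And>b. b \<in> {0<..<1} \<Longrightarrow> prob {\<omega> \<in> space M. X \<omega> \<le> b} = sqrt b"
  shows "distr M borel X = sqrt_law"
proof (rule cdf_unique)
  interpret S: prob_space sqrt_law by (rule prob_space_sqrt_law)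
  show "real_distribution (distr M borel X)" using X by (rule real_distribution_distr)
  show "real_distribution sqrt_law"
    by (intro real_distribution.intro prob_space_sqrt_law real_distribution_axioms.intro) simp
  have S: "measure sqrt_law {..b} = sqrt b" if "b \<in> {0..1}" for b
    using sqrt_law_cdf[OF that] that by (simp add: measure_def)
  show "cdf (distr M borel X) = cdf sqrt_law"
  proof
    fix b
    have D: "cdf (distr M borel X) b = prob {\<omega> \<in> space M. X \<omega> \<le> b}"
      unfolding cdf_def using X by (subst measure_distr) (auto intro!: arg_cong[where f=prob])
    consider "b \<le> 0" | "b \<in> {0<..<1}" | "b \<ge> 1" by force
    then show "cdf (distr M borel X) b = cdf sqrt_law b"
    proof cases
      case 1
      then have e: "{\<omega> \<in> space M. X \<omega> \<le> b} = {}" using range by fastforce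
      have "measure sqrt_law {..b} \<le> measure sqrt_law {..0}" using 1 by (intro S.finite_measure_mono) auto
      then have "measure sqrt_law {..b} = 0" using S[of 0] by (simp add: measure_le_0_iff)
      then show ?thesis unfolding D e by (simp add: cdf_def)
    next
      case 2
      then show ?thesis unfolding D using cdf[OF 2] S[of b] by (simp add: cdf_def)
    next
      case 3
      then have e: "{\<omega> \<in> space M. X \<omega> \<le> b} = space M" using range by fastforce
      have "measure sqrt_law {..1} \<le> measure sqrt_law {..b}" using 3 by (intro S.finite_measure_mono) auto
      then have "measure sqrt_law {..b} = 1" using S[of 1] S.prob_le_1[of "{..b}"] by simp
      then show ?thesis unfolding D e by (simp add: cdf_def prob_space)
    qed
  qed
qed

lemma (in prob_space) indep_vars_reindex:
  assumes X: "indep_vars N X K" and inj: "inj_on \<phi> I" and sub: "\<phi> ` I \<subseteq> K"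
  shows "indep_vars (\<lambda>i. N (\<phi> i)) (\<lambda>i. X (\<phi> i)) I"
  unfolding indep_vars_def2
proof (intro conjI ballI)
  let ?F = "\<lambda>k. {X k -` A \<inter> space M | A. A \<in> sets (N k)}"
  have rv: "random_variable (N k) (X k)" if "k \<in> K" for k using X that by (auto simp: indep_vars_def2)
  show "random_variable (N (\<phi> i)) (X (\<phi> i))" if "i \<in> I" for i using rv that sub by auto
  show "indep_sets (\<lambda>i. ?F (\<phi> i)) I"
  proof (rule indep_setsI)
    show "?F (\<phi> i) \<subseteq> events" if "i \<in> I" for i
      using rv[of "\<phi> i"] that sub by (auto intro: measurable_sets)
    fix A J assume J: "J \<noteq> {}" "J \<subseteq> I" "finite J" and A: "\<forall>j\<in>J. A j \<in> ?F (\<phi> j)"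
    have injJ: "inj_on \<phi> J" using inj J(2) by (rule inj_on_subset)
    let ?B = "\<lambda>k. A (inv_into J \<phi> k)"
    have B: "?B (\<phi> j) = A j" if "j \<in> J" for j using that injJ by simp
    have "indep_sets ?F K" using X by (simp add: indep_vars_def2)
    then have "prob (\<Inter>k\<in>\<phi> ` J. ?B k) = (\<Prod>k\<in>\<phi> ` J. prob (?B k))"
      by (rule indep_setsD) (use J sub A B in auto)
    also have "(\<Inter>k\<in>\<phi> ` J. ?B k) = (\<Inter>j\<in>J. A j)" using B by simp
    also have "(\<Prod>k\<in>\<phi> ` J. prob (?B k)) = (\<Prod>j\<in>J. prob (A j))"
      unfolding prod.reindex[OF injJ] by (rule prod.cong) (simp_all add: B)
    finally show "prob (\<Inter>j\<in>J. A j) = (\<Prod>j\<in>J. prob (A j))" .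
  qed
qed

text \<open>It suffices to test on rectangles, which generate the product and are stable under
  intersection. There the independence of the two families splits the event into its
  \<open>X\<close> part and its \<open>Y\<close> part, each family factorises over the indices, and
  a last use of independence joins the factors index by index.\<close>

lemma (in prob_space) indep_vars_pair:
  assumes X: "indep_vars MX X I" and Y: "indep_vars MY Y I" and ind: "indep_set (sets SX) (sets SY)"
    and spc: "space SX = space M" "space SY = space M"
    and mX: "\<And>i. i \<in> I \<Longrightarrow> X i \<in> SX \<rightarrow>\<^sub>M MX i" and mY: "\<And>i. i \<in> I \<Longrightarrow> Y i \<in> SY \<rightarrow>\<^sub>M MY i"
  shows "indep_vars (\<lambda>i. MX i \<Otimes>\<^sub>M MY i) (\<lambda>i \<omega>. (X i \<omega>, Y i \<omega>)) I"
    and "\<And>i. i \<in> I \<Longrightarrow> distr M (MX i \<Otimes>\<^sub>M MY i) (\<lambda>\<omega>. (X i \<omega>, Y i \<omega>)) = distr M (MX i) (X i) \<Otimes>\<^sub>M distr M (MY i) (Y i)"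
proof -
  have rX: "random_variable (MX i) (X i)" and rY: "random_variable (MY i) (Y i)" if "i \<in> I" for i
    using X Y that by (auto simp: indep_vars_def2)
  have rXY: "random_variable (MX i \<Otimes>\<^sub>M MY i) (\<lambda>\<omega>. (X i \<omega>, Y i \<omega>))" if "i \<in> I" for i
    by (intro measurable_Pair rX rY that)
  let ?X = "\<lambda>i A. X i -` A \<inter> space M" and ?Y = "\<lambda>i B. Y i -` B \<inter> space M"
  have sX: "?X i A \<in> sets SX" if "i \<in> I" "A \<in> sets (MX i)" for i A
    using measurable_sets[OF mX that(2)] that(1) by (simp add: spc)
  have sY: "?Y i A \<in> sets SY" if "i \<in> I" "A \<in> sets (MY i)" for i A
    using measurable_sets[OF mY that(2)] that(1) by (simp add: spc)
  let ?F = "\<lambda>i. {?X i A \<inter> ?Y i B | A B. A \<in> sets (MX i) \<and> B \<in> sets (MY i)}"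
  have "indep_sets ?F I"
  proof (rule indep_setsI)
    show "?F i \<subseteq> events" if "i \<in> I" for i
      using rX[OF that] rY[OF that] by (auto intro!: sets.Int measurable_sets)
    fix A J assume J: "J \<noteq> {}" "J \<subseteq> I" "finite J" and A: "\<forall>j\<in>J. A j \<in> ?F j"
    from A have "\<forall>j\<in>J. \<exists>p. A j = ?X j (fst p) \<inter> ?Y j (snd p) \<and> fst p \<in> sets (MX j) \<and> snd p \<in> sets (MY j)" by fastforce
    from bchoice[OF this] obtain p where p: "\<forall>j\<in>J. A j = ?X j (fst (p j)) \<inter> ?Y j (snd (p j)) \<and> fst (p j) \<in> sets (MX j) \<and> snd (p j) \<in> sets (MY j)" ..
    then have pX: "fst (p j) \<in> sets (MX j)" and pY: "snd (p j) \<in> sets (MY j)" and Aj: "A j = ?X j (fst (p j)) \<inter> ?Y j (snd (p j))" if "j \<in> J" for j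
      using that by auto
    have JI: "j \<in> I" if "j \<in> J" for j using J that by auto
    have 1: "(\<Inter>j\<in>J. A j) = (\<Inter>j\<in>J. ?X j (fst (p j))) \<inter> (\<Inter>j\<in>J. ?Y j (snd (p j)))"
      using Aj J(1) by auto
    have "prob (\<Inter>j\<in>J. A j) = prob (\<Inter>j\<in>J. ?X j (fst (p j))) * prob (\<Inter>j\<in>J. ?Y j (snd (p j)))"
      unfolding 1
    proof (rule indep_setD[OF ind])
      show "(\<Inter>j\<in>J. ?X j (fst (p j))) \<in> sets SX" using J by (intro sets.finite_INT sX JI pX)
      show "(\<Inter>j\<in>J. ?Y j (snd (p j))) \<in> sets SY" using J by (intro sets.finite_INT sY JI pY)
    qed
    also have "prob (\<Inter>j\<in>J. ?X j (fst (p j))) = (\<Prod>j\<in>J. prob (?X j (fst (p j))))"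
      by (rule indep_setsD[of "\<lambda>i. {?X i A | A. A \<in> sets (MX i)}" I]) (use X J pX in \<open>auto simp: indep_vars_def2\<close>)
    also have "prob (\<Inter>j\<in>J. ?Y j (snd (p j))) = (\<Prod>j\<in>J. prob (?Y j (snd (p j))))"
      by (rule indep_setsD[of "\<lambda>i. {?Y i A | A. A \<in> sets (MY i)}" I]) (use Y J pY in \<open>auto simp: indep_vars_def2\<close>)
    also have "(\<Prod>j\<in>J. prob (?X j (fst (p j)))) * (\<Prod>j\<in>J. prob (?Y j (snd (p j)))) = (\<Prod>j\<in>J. prob (A j))"
      unfolding prod.distrib[symmetric]
    proof (intro prod.cong refl)
      fix j assume j: "j \<in> J"
      show "prob (?X j (fst (p j))) * prob (?Y j (snd (p j))) = prob (A j)"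
        unfolding Aj[OF j] by (rule indep_setD[OF ind sX[OF JI[OF j] pX[OF j]] sY[OF JI[OF j] pY[OF j]], symmetric])
    qed
    finally show "prob (\<Inter>j\<in>J. A j) = (\<Prod>j\<in>J. prob (A j))" .
  qed
  then have sg: "indep_sets (\<lambda>i. sigma_sets (space M) (?F i)) I"
  proof (rule indep_sets_sigma)
    show "Int_stable (?F i)" for i
    proof (rule Int_stableI)
      fix a b assume "a \<in> ?F i" "b \<in> ?F i"
      then obtain A B A' B' where "a = ?X i A \<inter> ?Y i B" "b = ?X i A' \<inter> ?Y i B'"
        and s: "A \<in> sets (MX i)" "B \<in> sets (MY i)" "A' \<in> sets (MX i)" "B' \<in> sets (MY i)" by blast
      then have "a \<inter> b = ?X i (A \<inter> A') \<inter> ?Y i (B \<inter> B')" by blast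
      with s show "a \<inter> b \<in> ?F i" by blast
    qed
  qed
  have eq: "{(\<lambda>\<omega>. (X i \<omega>, Y i \<omega>)) -` C \<inter> space M | C. C \<in> sets (MX i \<Otimes>\<^sub>M MY i)} = sigma_sets (space M) (?F i)" if i: "i \<in> I" for i
  proof -
    have "(\<lambda>\<omega>. (X i \<omega>, Y i \<omega>)) \<in> space M \<rightarrow> space (MX i) \<times> space (MY i)"
      using measurable_space[OF rX[OF i]] measurable_space[OF rY[OF i]] by auto
    from sigma_sets_vimage_commute[OF this, of "{a \<times> b | a b. a \<in> sets (MX i) \<and> b \<in> sets (MY i)}"]
    have "{(\<lambda>\<omega>. (X i \<omega>, Y i \<omega>)) -` C \<inter> space M | C. C \<in> sets (MX i \<Otimes>\<^sub>M MY i)}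
      = sigma_sets (space M) {(\<lambda>\<omega>. (X i \<omega>, Y i \<omega>)) -` C \<inter> space M | C. C \<in> {a \<times> b | a b. a \<in> sets (MX i) \<and> b \<in> sets (MY i)}}"
      by (simp only: sets_pair_measure)
    also have "{(\<lambda>\<omega>. (X i \<omega>, Y i \<omega>)) -` C \<inter> space M | C. C \<in> {a \<times> b | a b. a \<in> sets (MX i) \<and> b \<in> sets (MY i)}} = ?F i"
    proof -
      have "(\<lambda>\<omega>. (X i \<omega>, Y i \<omega>)) -` (a \<times> b) \<inter> space M = ?X i a \<inter> ?Y i b" for a b by auto
      then show ?thesis by (auto; metis)
    qed
    finally show ?thesis .
  qed
  show "indep_vars (\<lambda>i. MX i \<Otimes>\<^sub>M MY i) (\<lambda>i \<omega>. (X i \<omega>, Y i \<omega>)) I"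
    unfolding indep_vars_def2 using rXY sg eq by (simp cong: indep_sets_cong)
  show "distr M (MX i \<Otimes>\<^sub>M MY i) (\<lambda>\<omega>. (X i \<omega>, Y i \<omega>)) = distr M (MX i) (X i) \<Otimes>\<^sub>M distr M (MY i) (Y i)" if i: "i \<in> I" for i
  proof (rule pair_measure_eqI[symmetric])
    show "sigma_finite_measure (distr M (MX i) (X i))" by (intro prob_space_imp_sigma_finite prob_space_distr rX i)
    show "sigma_finite_measure (distr M (MY i) (Y i))" by (intro prob_space_imp_sigma_finite prob_space_distr rY i)
    show "sets (distr M (MX i) (X i) \<Otimes>\<^sub>M distr M (MY i) (Y i)) = sets (distr M (MX i \<Otimes>\<^sub>M MY i) (\<lambda>\<omega>. (X i \<omega>, Y i \<omega>)))"
      unfolding sets_distr by (intro sets_pair_measure_cong sets_distr)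
    fix A B assume "A \<in> sets (distr M (MX i) (X i))" "B \<in> sets (distr M (MY i) (Y i))"
    then have AB: "A \<in> sets (MX i)" "B \<in> sets (MY i)" by simp_all
    have e: "(\<lambda>\<omega>. (X i \<omega>, Y i \<omega>)) -` (A \<times> B) \<inter> space M = ?X i A \<inter> ?Y i B" by auto
    have "emeasure (distr M (MX i) (X i)) A * emeasure (distr M (MY i) (Y i)) B = ennreal (prob (?X i A) * prob (?Y i B))"
      using AB rX[OF i] rY[OF i] by (simp add: emeasure_distr emeasure_eq_measure ennreal_mult)
    also have "prob (?X i A) * prob (?Y i B) = prob (?X i A \<inter> ?Y i B)"
      by (rule indep_setD[OF ind sX[OF i AB(1)] sY[OF i AB(2)], symmetric])
    also have "ennreal (prob (?X i A \<inter> ?Y i B)) = emeasure (distr M (MX i \<Otimes>\<^sub>M MY i) (\<lambda>\<omega>. (X i \<omega>, Y i \<omega>))) (A \<times> B)"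
      using AB by (subst emeasure_distr[OF rXY[OF i]]) (auto simp: e emeasure_eq_measure)
    finally show "emeasure (distr M (MX i) (X i)) A * emeasure (distr M (MY i) (Y i)) B
      = emeasure (distr M (MX i \<Otimes>\<^sub>M MY i) (\<lambda>\<omega>. (X i \<omega>, Y i \<omega>))) (A \<times> B)" .
  qed
qed

lemma measurable_generated:
  assumes "i \<in> I" and rv: "\<And>i. i \<in> I \<Longrightarrow> X i \<in> P \<rightarrow>\<^sub>M N i"
  shows "X i \<in> vimage_algebra (space P) (\<lambda>\<omega>. \<lambda>i\<in>I. X i \<omega>) (Pi\<^sub>M I N) \<rightarrow>\<^sub>M N i"
proof -
  let ?V = "vimage_algebra (space P) (\<lambda>\<omega>. \<lambda>i\<in>I. X i \<omega>) (Pi\<^sub>M I N)"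
  have "(\<lambda>\<omega>. \<lambda>i\<in>I. X i \<omega>) \<in> ?V \<rightarrow>\<^sub>M Pi\<^sub>M I N"
    by (rule measurable_vimage_algebra1) (use measurable_space[OF rv] in \<open>auto simp: space_PiM\<close>)
  from measurable_compose[OF this measurable_component_singleton[OF assms(1)]] assms(1)
  show ?thesis by simp
qed

text \<open>The field seen from any address \<open>\<theta>\<close> has the product law. With the
  pathwise identity this moves the whole error analysis from \<open>P\<close> to the canonical space
  \<open>noise_space d\<close>.\<close>

lemma noise_field_law:
  fixes Z :: "nat \<Rightarrow> int list \<Rightarrow> 'w \<Rightarrow> nat \<Rightarrow> real" and r :: "int list \<Rightarrow> 'w \<Rightarrow> real"
  assumes P: "prob_space P" and d: "d \<ge> 1"
    and Z_indep: "prob_space.indep_vars P (\<lambda>(d, \<theta>). borel_Rd d) (\<lambda>(d, \<theta>). Z d \<theta>) ({1..} \<times> Theta)"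
    and Z_normal: "\<And>\<theta>. \<theta> \<in> Theta \<Longrightarrow> distr P (borel_Rd d) (Z d \<theta>) = std_normal_Rd d"
    and r_range: "\<And>\<theta> \<omega>. \<lbrakk>\<theta> \<in> Theta; \<omega> \<in> space P\<rbrakk> \<Longrightarrow> r \<theta> \<omega> \<in> {0<..<1}"
    and r_indep: "prob_space.indep_vars P (\<lambda>_. borel) r Theta"
    and r_ident: "\<And>\<theta>. \<theta> \<in> Theta \<Longrightarrow> distr P borel (r \<theta>) = distr P borel (r [0])"
    and r_dist: "\<And>b. b \<in> {0<..<1} \<Longrightarrow> measure P {\<omega> \<in> space P. r [0] \<omega> \<le> b} = sqrt b"
    and Z_r_indep: "prob_space.indep_set P
        (generated_sets P ({1..} \<times> Theta) (\<lambda>(d, \<theta>). borel_Rd d) (\<lambda>(d, \<theta>). Z d \<theta>))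
        (generated_sets P Theta (\<lambda>_. borel) r)"
    and \<theta>: "\<theta> \<in> Theta"
  shows "(\<lambda>\<omega>. \<lambda>\<eta>\<in>Theta. (Z d (\<theta> @ \<eta>) \<omega>, r (\<theta> @ \<eta>) \<omega>)) \<in> P \<rightarrow>\<^sub>M noise_space d"
    and "distr P (noise_space d) (\<lambda>\<omega>. \<lambda>\<eta>\<in>Theta. (Z d (\<theta> @ \<eta>) \<omega>, r (\<theta> @ \<eta>) \<omega>)) = noise_space d"
proof -
  interpret prob_space P by (rule P)
  let ?X = "\<lambda>\<eta>. Z d (\<theta> @ \<eta>)" and ?Y = "\<lambda>\<eta>. r (\<theta> @ \<eta>)"
  let ?Zf = "\<lambda>(d, \<theta>). Z d \<theta>" and ?N = "\<lambda>(d, \<theta>::int list). borel_Rd d"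
  have Th: "\<theta> @ \<eta> \<in> Theta" if "\<eta> \<in> Theta" for \<eta> using that by (rule append_in_Theta(2))
  have T0: "[0] \<in> Theta" by (simp add: Theta_def)
  have ne: "Theta \<noteq> {}" using T0 by blast
  have X: "indep_vars (\<lambda>\<eta>. borel_Rd d) ?X Theta"
    using indep_vars_reindex[OF Z_indep, of "\<lambda>\<eta>. (d, \<theta> @ \<eta>)" Theta] d Th by (force simp: inj_on_def)
  have Y: "indep_vars (\<lambda>\<eta>. borel) ?Y Theta"
    using indep_vars_reindex[OF r_indep, of "\<lambda>\<eta>. \<theta> @ \<eta>" Theta] Th by (force simp: inj_on_def)
  have rvZ: "?Zf p \<in> P \<rightarrow>\<^sub>M ?N p" if "p \<in> {1..} \<times> Theta" for p
    using Z_indep that unfolding indep_vars_def2 by blast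
  have rvr: "random_variable borel (r \<eta>)" if "\<eta> \<in> Theta" for \<eta>
    using r_indep that unfolding indep_vars_def2 by blast
  let ?SX = "vimage_algebra (space P) (\<lambda>\<omega>. \<lambda>p\<in>{1..} \<times> Theta. ?Zf p \<omega>) (Pi\<^sub>M ({1..} \<times> Theta) ?N)"
  let ?SY = "vimage_algebra (space P) (\<lambda>\<omega>. \<lambda>\<eta>\<in>Theta. r \<eta> \<omega>) (Pi\<^sub>M Theta (\<lambda>_. borel))"
  have ind: "indep_set (sets ?SX) (sets ?SY)" using Z_r_indep unfolding generated_sets_def .
  have mX: "?X \<eta> \<in> ?SX \<rightarrow>\<^sub>M borel_Rd d" if "\<eta> \<in> Theta" for \<eta>
    using measurable_generated[of "(d, \<theta> @ \<eta>)" "{1..} \<times> Theta" ?Zf P ?N, OF _ rvZ] d Th[OF that] by simp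
  have mY: "?Y \<eta> \<in> ?SY \<rightarrow>\<^sub>M borel" if "\<eta> \<in> Theta" for \<eta>
    using measurable_generated[OF Th[OF that] rvr] by simp
  have pair1: "indep_vars (\<lambda>_. borel_Rd d \<Otimes>\<^sub>M borel) (\<lambda>\<eta> \<omega>. (?X \<eta> \<omega>, ?Y \<eta> \<omega>)) Theta"
    by (rule indep_vars_pair(1)[OF X Y ind space_vimage_algebra space_vimage_algebra mX mY])
  have pair2: "distr P (borel_Rd d \<Otimes>\<^sub>M borel) (\<lambda>\<omega>. (?X \<eta> \<omega>, ?Y \<eta> \<omega>)) = distr P (borel_Rd d) (?X \<eta>) \<Otimes>\<^sub>M distr P borel (?Y \<eta>)"
    if "\<eta> \<in> Theta" for \<eta>
    by (rule indep_vars_pair(2)[OF X Y ind space_vimage_algebra space_vimage_algebra]) (erule mX, erule mY, rule that)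
  have law_r: "distr P borel (r \<eta>) = sqrt_law" if "\<eta> \<in> Theta" for \<eta>
    unfolding r_ident[OF that] by (rule distr_eq_sqrt_law[OF rvr[OF T0] r_range[OF T0] r_dist])
  have law: "distr P (borel_Rd d \<Otimes>\<^sub>M borel) (\<lambda>\<omega>. (?X \<eta> \<omega>, ?Y \<eta> \<omega>)) = noise_law d" if "\<eta> \<in> Theta" for \<eta>
    unfolding pair2[OF that] Z_normal[OF Th[OF that]] law_r[OF Th[OF that]] noise_law_def ..
  have rv: "(\<lambda>\<omega>. (?X \<eta> \<omega>, ?Y \<eta> \<omega>)) \<in> P \<rightarrow>\<^sub>M (borel_Rd d \<Otimes>\<^sub>M borel)" if "\<eta> \<in> Theta" for \<eta>
    using pair1 that unfolding indep_vars_def2 by blast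
  have sets: "sets (noise_space d) = sets (Pi\<^sub>M Theta (\<lambda>_. borel_Rd d \<Otimes>\<^sub>M borel))"
    by (intro sets_PiM_cong refl) simp
  show "(\<lambda>\<omega>. \<lambda>\<eta>\<in>Theta. (?X \<eta> \<omega>, ?Y \<eta> \<omega>)) \<in> P \<rightarrow>\<^sub>M noise_space d"
    using measurable_restrict[of Theta "\<lambda>\<eta> \<omega>. (?X \<eta> \<omega>, ?Y \<eta> \<omega>)" P "\<lambda>_. borel_Rd d \<Otimes>\<^sub>M borel", OF rv] sets by (simp cong: measurable_cong_sets)
  have "distr P (noise_space d) (\<lambda>\<omega>. \<lambda>\<eta>\<in>Theta. (?X \<eta> \<omega>, ?Y \<eta> \<omega>))
      = distr P (Pi\<^sub>M Theta (\<lambda>_. borel_Rd d \<Otimes>\<^sub>M borel)) (\<lambda>\<omega>. \<lambda>\<eta>\<in>Theta. (?X \<eta> \<omega>, ?Y \<eta> \<omega>))"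
    by (intro distr_cong refl sets)
  also have "\<dots> = (\<Pi>\<^sub>M \<eta>\<in>Theta. distr P (borel_Rd d \<Otimes>\<^sub>M borel) (\<lambda>\<omega>. (?X \<eta> \<omega>, ?Y \<eta> \<omega>)))"
    using pair1 rv by (subst (asm) indep_vars_iff_distr_eq_PiM'[OF ne]) simp_all
  also have "\<dots> = noise_space d" by (intro PiM_cong refl law)
  finally show "distr P (noise_space d) (\<lambda>\<omega>. \<lambda>\<eta>\<in>Theta. (?X \<eta> \<omega>, ?Y \<eta> \<omega>)) = noise_space d" .
qed

section \<open>Computational cost\<close>

definition level_size :: "nat \<Rightarrow> nat" where
  "level_size n = nat \<lfloor>real n powr (1/4)\<rfloor>"

lemma level_size_bounds:
  assumes "n \<ge> 1"
  shows "level_size n \<ge> 1" "real (level_size n) \<le> real n powr (1/4)" "real n powr (1/4) \<le> 2 * real (level_size n)"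
    and "real (level_size n) \<le> real n" "(real (level_size n))\<^sup>2 \<le> real n"
proof -
  have n: "real n \<ge> 1" using assms by simp
  have "1 powr (1/4) \<le> real n powr (1/4)" by (rule powr_mono2) (use n in auto)
  then have p: "real n powr (1/4) \<ge> 1" by simp
  then have fl: "\<lfloor>real n powr (1/4)\<rfloor> \<ge> 1" by simp
  then have e: "real (level_size n) = of_int \<lfloor>real n powr (1/4)\<rfloor>" by (simp add: level_size_def)
  show l1: "level_size n \<ge> 1" using fl by (simp add: level_size_def nat_le_iff le_nat_iff)
  show l2: "real (level_size n) \<le> real n powr (1/4)" unfolding e by simp
  have "real n powr (1/4) \<le> real (level_size n) + 1" unfolding e by linarith
  then show "real n powr (1/4) \<le> 2 * real (level_size n)" using l1 by simp
  have "real n powr (1/4) \<le> real n powr 1" by (rule powr_mono) (use n in auto)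
  with l2 show "real (level_size n) \<le> real n" using n by simp
  have "(real (level_size n))\<^sup>2 \<le> (real n powr (1/4))\<^sup>2" using l2 by (intro power_mono) auto
  also have "\<dots> = real n powr (1/2)" using n by (simp add: powr_power)
  also have "\<dots> \<le> real n powr 1" by (rule powr_mono) (use n in auto)
  finally show "(real (level_size n))\<^sup>2 \<le> real n" using n by simp
qed

lemma level_size_mono: "m \<le> n \<Longrightarrow> level_size m \<le> level_size n"
  unfolding level_size_def by (intro nat_mono floor_mono powr_mono2) auto

text \<open>Because \<open>(y + 1)^4 \<ge> y^4 + 1\<close>, the fourth root grows by at most one
  from \<open>n\<close> to \<open>n + 1\<close>, and one is at most
  \<open>level_size n\<close>.\<close>

lemma level_size_Suc_le:
  assumes "n \<ge> 1"
  shows "level_size (Suc n) \<le> 2 * level_size n"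
proof -
  define y where "y = real n powr (1/4)"
  have y: "y > 0" using assms by (simp add: y_def)
  have "y ^ 4 = real n" using assms by (simp add: y_def powr_power)
  then have "real (Suc n) \<le> y ^ 4 + 4 * y ^ 3 + 6 * y\<^sup>2 + 4 * y + 1" using y by simp
  also have "\<dots> = (y + 1) ^ 4" by (simp add: algebra_simps numeral_eq_Suc)
  finally have "real (Suc n) powr (1/4) \<le> ((y + 1) ^ 4) powr (1/4)" by (intro powr_mono2) auto
  also have "\<dots> = y + 1" using y by (simp add: powr_powr flip: powr_numeral)
  finally have "level_size (Suc n) \<le> nat \<lfloor>y + 1\<rfloor>" unfolding level_size_def by (intro nat_mono floor_mono)
  also have "\<dots> = level_size n + 1" using y by (simp add: level_size_def y_def nat_add_distrib)
  finally show ?thesis using level_size_bounds(1)[OF assms] by simp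
qed

text \<open>Rounding down loses at most a factor two, and the unbounded base in the denominator
  beats every fixed \<open>C\<close>.\<close>

lemma error_rate_tendsto_0:
  assumes "C > 0"
  shows "(\<lambda>n. C ^ n / real (level_size n) ^ n) \<longlonglongrightarrow> 0"
proof (rule Lim_null_comparison)
  show "(\<lambda>n::nat. (2 * C / real n powr (1/4)) powr real n) \<longlonglongrightarrow> 0" using assms by real_asymp
  show "eventually (\<lambda>n. norm (C ^ n / real (level_size n) ^ n) \<le> (2 * C / real n powr (1/4)) powr real n) sequentially"
    using eventually_ge_at_top[of 1]
  proof eventually_elim
    case (elim n)
    note b = level_size_bounds[OF elim]
    have p: "real n powr (1/4) > 0" "real (level_size n) > 0" using b(1) elim by auto
    have "C / real (level_size n) \<le> 2 * C / real n powr (1/4)"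
      using b(3) p assms by (simp add: field_simps)
    then have "(C / real (level_size n)) ^ n \<le> (2 * C / real n powr (1/4)) ^ n"
      using assms p by (intro power_mono) auto
    also have "\<dots> = (2 * C / real n powr (1/4)) powr real n" using assms p by (subst powr_realpow) auto
    finally show ?case using assms by (simp add: power_divide)
  qed
qed

text \<open>With \<open>m = level_size n\<close> the factor \<open>m^n\<close> of the cost cancels
  \<open>m^(- n)\<close> in the power of the error. What remains is
  \<open>m powr (- \<delta> / 2 * n)\<close> with \<open>m\<close> of order
  \<open>n powr (1/4)\<close>, which decays faster than any exponential grows.\<close>

lemma cost_times_error_bounded:
  assumes C: "C \<ge> 1" and \<delta>: "\<delta> > 0"
  shows "\<exists>S. \<forall>n\<ge>1. real (Suc n) * (8 * real (level_size (Suc n))) ^ Suc n * (C ^ n / real (level_size n) ^ n) powr (1 + \<delta> / 2) \<le> S"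
proof -
  let ?a = "\<lambda>n. real (Suc n) * (8 * real (level_size (Suc n))) ^ Suc n * (C ^ n / real (level_size n) ^ n) powr (1 + \<delta> / 2)"
  \<comment> \<open>\<open>16 = 8 * 2\<close>: the base of the cost times the factor by which the
    next level may be larger.\<close>
  let ?R = "16 * C powr (1 + \<delta> / 2)"
  let ?b = "\<lambda>n::nat. 16 * (real n + 1) * real n * (?R powr real n * (real n powr (1/4) / 2) powr (- (\<delta> / 2 * real n)))"
  have le: "?a n \<le> ?b n" if n: "n \<ge> 1" for n
  proof -
    define m where "m = real (level_size n)"
    have m: "m \<ge> 1" "real n powr (1/4) / 2 \<le> m" "m \<le> real n" using level_size_bounds[OF n] by (auto simp: m_def)
    have s: "real (level_size (Suc n)) \<le> 2 * m" using level_size_Suc_le[OF n] by (simp add: m_def)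
    have p: "real n powr (1/4) / 2 > 0" using n by simp
    have "(8 * real (level_size (Suc n))) ^ Suc n \<le> (16 * m) ^ Suc n" using s by (intro power_mono) auto
    also have "\<dots> = 16 * m * (16 powr real n * m powr real n)" using m by (simp add: power_mult_distrib powr_realpow)
    also have "\<dots> \<le> 16 * real n * (16 powr real n * m powr real n)" using m by (intro mult_right_mono) auto
    finally have 1: "(8 * real (level_size (Suc n))) ^ Suc n \<le> 16 * real n * (16 powr real n * m powr real n)" .
    have pos: "C > 0" "m > 0" using C m by auto
    have "C ^ n / m ^ n = C powr real n * m powr (- real n)"
      by (simp only: powr_minus powr_realpow[OF pos(1)] powr_realpow[OF pos(2)] divide_inverse)
    then have "(C ^ n / m ^ n) powr (1 + \<delta> / 2) = (C powr (1 + \<delta> / 2)) powr real n * m powr (- real n * (1 + \<delta> / 2))"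
      using C m by (simp add: powr_mult powr_powr mult.commute)
    also have "m powr (- real n * (1 + \<delta> / 2)) = m powr (- real n) * m powr (- (\<delta> / 2 * real n))"
      by (simp add: powr_add[symmetric] algebra_simps)
    finally have 2: "(C ^ n / m ^ n) powr (1 + \<delta> / 2) = (C powr (1 + \<delta> / 2)) powr real n * (m powr (- real n) * m powr (- (\<delta> / 2 * real n)))" .
    have 3: "m powr real n * m powr (- real n) = 1" using m by (simp add: powr_add[symmetric])
    have "?a n \<le> real (Suc n) * (16 * real n * (16 powr real n * m powr real n)) * (C ^ n / m ^ n) powr (1 + \<delta> / 2)"
      unfolding m_def[symmetric] by (intro mult_right_mono mult_left_mono 1) auto
    also have "\<dots> = 16 * real (Suc n) * real n * ((16 powr real n * (C powr (1 + \<delta> / 2)) powr real n) * ((m powr real n * m powr (- real n)) * m powr (- (\<delta> / 2 * real n))))"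
      unfolding 2 by (simp only: mult_ac)
    also have "\<dots> = 16 * (real n + 1) * real n * (?R powr real n * m powr (- (\<delta> / 2 * real n)))"
      unfolding 3 using C by (simp add: powr_mult add.commute)
    also have "\<dots> \<le> ?b n"
    proof (intro mult_left_mono)
      have "- (\<delta> / 2 * real n) \<le> 0" using \<delta> by simp
      then show "m powr (- (\<delta> / 2 * real n)) \<le> (real n powr (1/4) / 2) powr (- (\<delta> / 2 * real n))"
        using powr_mono2'[OF _ p m(2)] by simp
    qed auto
    finally show ?thesis .
  qed
  have R: "?R > 0" using C by simp
  \<comment> \<open>The exponential rate of all factors with fixed base, including the
    \<open>2\<close> lost by rounding; the rate \<open>\<delta> / 8\<close> of the logarithm below
    is \<open>\<delta> / 2\<close> times the exponent \<open>1 / 4\<close>.\<close>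
  define \<rho> where "\<rho> = ln ?R + \<delta> / 2 * ln 2"
  have e: "?R powr real n * (real n powr (1/4) / 2) powr (- (\<delta> / 2 * real n)) = exp (real n * (\<rho> - \<delta> / 8 * ln (real n)))"
    if n: "n \<ge> 1" for n :: nat
  proof -
    have y: "real n powr (1/4) / 2 > 0" using n by simp
    have pe: "x powr a = exp (a * ln x)" if "x > 0" for x a :: real using that by (simp add: powr_def)
    have l: "ln (real n powr (1/4) / 2) = ln (real n) / 4 - ln 2" using n by (simp add: ln_div ln_powr)
    have "?R powr real n * (real n powr (1/4) / 2) powr (- (\<delta> / 2 * real n))
      = exp (real n * ln ?R) * exp (- (\<delta> / 2 * real n) * (ln (real n) / 4 - ln 2))"
      unfolding pe[OF R] pe[OF y] l ..
    also have "\<dots> = exp (real n * (\<rho> - \<delta> / 8 * ln (real n)))"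
      unfolding \<rho>_def exp_add[symmetric] by (simp add: algebra_simps)
    finally show ?thesis .
  qed
  have "\<delta> / 8 > 0" using \<delta> by simp
  then have "(\<lambda>n::nat. 16 * (real n + 1) * real n * exp (real n * (\<rho> - \<delta> / 8 * ln (real n)))) \<longlonglongrightarrow> 0" by real_asymp
  moreover have "eventually (\<lambda>n. 16 * (real n + 1) * real n * exp (real n * (\<rho> - \<delta> / 8 * ln (real n))) = ?b n) sequentially"
    using eventually_ge_at_top[of 1] by eventually_elim (simp only: e)
  ultimately have "?b \<longlonglongrightarrow> 0" by (rule Lim_transform_eventually)
  then have "Bseq ?b" by (intro convergent_imp_Bseq) (auto simp: convergent_def)
  then obtain S where S: "\<And>n. \<bar>?b n\<bar> \<le> S" by (auto simp: Bseq_def)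
  show ?thesis
  proof (intro exI allI impI)
    fix n :: nat assume "1 \<le> n"
    show "?a n \<le> S" using le[OF \<open>1 \<le> n\<close>] S[of n] abs_ge_self[of "?b n"] by linarith
  qed
qed

text \<open>Minimality of \<open>N d \<epsilon>\<close> does the work. If
  \<open>N d \<epsilon> = n + 1\<close> with \<open>n \<ge> 1\<close>, then level \<open>n\<close>
  misses the target, so a power of its error times \<open>\<epsilon> powr (- (2 + \<delta>))\<close>
  is at least one. This factor is multiplied to the cost, and the boundedness of cost times error
  leaves the claimed rate.\<close>

lemma complexity_bound:
  assumes C: "C \<ge> 1" and K: "K > 0" and \<delta>: "\<delta> > 0" and a: "a \<ge> 0"
  obtains c :: real and N :: "nat \<Rightarrow> real \<Rightarrow> nat" where
    "\<And>d \<epsilon>. d \<ge> 1 \<Longrightarrow> \<epsilon> \<in> {0<..1} \<Longrightarrow> N d \<epsilon> \<ge> 1"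
    "\<And>d \<epsilon> n. d \<ge> 1 \<Longrightarrow> \<epsilon> \<in> {0<..1} \<Longrightarrow> n \<ge> N d \<epsilon> \<Longrightarrow> K * real d powr a * (C ^ n / real (level_size n) ^ n) \<le> \<epsilon>\<^sup>2"
    "\<And>d \<epsilon>. d \<ge> 1 \<Longrightarrow> \<epsilon> \<in> {0<..1} \<Longrightarrow> (\<Sum>n=1..N d \<epsilon>. real d * (8 * real (level_size n)) ^ n) \<le> c * real d powr c * \<epsilon> powr (- (2 + \<delta>))"
proof -
  define p where "p = 1 + \<delta> / 2"
  have p: "p > 0" using \<delta> by (simp add: p_def)
  let ?q = "\<lambda>n. C ^ n / real (level_size n) ^ n"
  have q0: "?q n \<ge> 0" for n using C by simp
  obtain S where S: "\<And>n. n \<ge> 1 \<Longrightarrow> real (Suc n) * (8 * real (level_size (Suc n))) ^ Suc n * ?q n powr p \<le> S"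
    using cost_times_error_bounded[OF C \<delta>] unfolding p_def by blast
  define ok where "ok d \<epsilon> N \<longleftrightarrow> N \<ge> 1 \<and> (\<forall>n\<ge>N. K * real d powr a * ?q n \<le> \<epsilon>\<^sup>2)" for d :: nat and \<epsilon> N
  define N where "N d \<epsilon> = (LEAST N. ok d \<epsilon> N)" for d \<epsilon>
  have ex: "\<exists>N. ok d \<epsilon> N" if "\<epsilon> \<in> {0<..1}" for d \<epsilon>
  proof -
    have "(\<lambda>n. K * real d powr a * ?q n) \<longlonglongrightarrow> K * real d powr a * 0"
      using C by (intro tendsto_mult_left error_rate_tendsto_0) simp
    then have "eventually (\<lambda>n. K * real d powr a * ?q n < \<epsilon>\<^sup>2) sequentially"
      using that by (intro order_tendstoD(2)) auto
    then obtain N0 where "\<And>n. n \<ge> N0 \<Longrightarrow> K * real d powr a * ?q n < \<epsilon>\<^sup>2" by (auto simp: eventually_sequentially)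
    then have "ok d \<epsilon> (max 1 N0)" unfolding ok_def by (auto intro: less_imp_le)
    then show ?thesis ..
  qed
  have ok: "ok d \<epsilon> (N d \<epsilon>)" if "\<epsilon> \<in> {0<..1}" for d \<epsilon>
    unfolding N_def using ex[OF that] by (rule LeastI_ex)
  \<comment> \<open>\<open>8\<close> covers the case \<open>N d \<epsilon> = 1\<close>,
    \<open>K powr p * S\<close> is the constant of the general case, and \<open>1 + a * p\<close> is
    its power of \<open>d\<close>. The same number must serve as factor and as exponent, hence the
    maximum.\<close>
  define c where "c = max (max 8 (K powr p * S)) (1 + a * p)"
  have c: "c \<ge> 8" "c \<ge> K powr p * S" "c \<ge> 1 + a * p" by (auto simp: c_def)
  show thesis
  proof (rule that[of N c])
    fix d :: nat and \<epsilon> :: real assume d: "d \<ge> 1" and \<epsilon>: "\<epsilon> \<in> {0<..1}"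
    note okd = ok[OF \<epsilon>, of d]
    show "N d \<epsilon> \<ge> 1" using okd by (simp add: ok_def)
    show "K * real d powr a * ?q n \<le> \<epsilon>\<^sup>2" if "n \<ge> N d \<epsilon>" for n using okd that by (simp add: ok_def)
    have d1: "real d \<ge> 1" using d by simp
    have e1: "\<epsilon> powr (- (2 + \<delta>)) \<ge> 1"
    proof -
      have "1 powr (- (2 + \<delta>)) \<le> \<epsilon> powr (- (2 + \<delta>))" using \<epsilon> \<delta> by (intro powr_mono2') auto
      then show ?thesis by simp
    qed
    show "(\<Sum>n=1..N d \<epsilon>. real d * (8 * real (level_size n)) ^ n) \<le> c * real d powr c * \<epsilon> powr (- (2 + \<delta>))"
    proof (cases "N d \<epsilon> = 1")
      case True
      have "level_size 1 = 1" by (simp add: level_size_def)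
      then have "(\<Sum>n=1..N d \<epsilon>. real d * (8 * real (level_size n)) ^ n) = 8 * real d powr 1 * 1" using True d1 by simp
      also have "\<dots> \<le> c * real d powr c * \<epsilon> powr (- (2 + \<delta>))"
        using c d1 e1 by (intro mult_mono powr_mono) auto
      finally show ?thesis .
    next
      case False
      then obtain n where n: "N d \<epsilon> = Suc n" "n \<ge> 1" using okd by (cases "N d \<epsilon>") (auto simp: ok_def)
      have "\<not> ok d \<epsilon> n" using not_less_Least[of n "ok d \<epsilon>"] n by (simp add: N_def)
      then obtain m where m: "m \<ge> n" "\<not> K * real d powr a * ?q m \<le> \<epsilon>\<^sup>2" using n by (auto simp: ok_def)
      \<comment> \<open>From \<open>Suc n\<close> on every level meets the target, so the failure
        can only occur at \<open>n\<close>.\<close>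
      have "m = n"
      proof (rule ccontr)
        assume "m \<noteq> n"
        then have "m \<ge> N d \<epsilon>" using m n by simp
        then show False using okd m(2) by (simp add: ok_def)
      qed
      with m have big: "\<epsilon>\<^sup>2 \<le> K * real d powr a * ?q n" by simp
      \<comment> \<open>\<open>p = 1 + \<delta> / 2\<close> is chosen to make
        \<open>(\<epsilon>\<^sup>2) powr p\<close> equal to
        \<open>\<epsilon> powr (2 + \<delta>)\<close>.\<close>
      have "1 = (\<epsilon>\<^sup>2) powr p * \<epsilon> powr (- (2 + \<delta>))"
      proof -
        have "(\<epsilon>\<^sup>2) powr p = \<epsilon> powr (2 + \<delta>)" using \<epsilon> by (simp add: p_def powr_powr algebra_simps flip: powr_numeral)
        then show ?thesis using \<epsilon> by (simp add: powr_add[symmetric])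
      qed
      also have "\<dots> \<le> (K * real d powr a * ?q n) powr p * \<epsilon> powr (- (2 + \<delta>))"
        using big p by (intro mult_right_mono powr_mono2) auto
      also have "(K * real d powr a * ?q n) powr p = K powr p * real d powr (a * p) * ?q n powr p"
        using K q0[of n] by (simp only: powr_mult powr_powr zero_le_mult_iff)
      finally have one: "1 \<le> K powr p * real d powr (a * p) * ?q n powr p * \<epsilon> powr (- (2 + \<delta>))" .
      \<comment> \<open>All levels up to the last are charged at the price of the last; this is the
        origin of the factor \<open>Suc n\<close> in the product that was shown to be
        bounded.\<close>
      have "(\<Sum>i=1..Suc n. real d * (8 * real (level_size i)) ^ i) \<le> (\<Sum>i=1..Suc n. real d * (8 * real (level_size (Suc n))) ^ Suc n)"
      proof (intro sum_mono mult_left_mono)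
        fix i assume i: "i \<in> {1..Suc n}"
        have l: "real (level_size i) \<le> real (level_size (Suc n))" using i by (simp add: level_size_mono)
        have l1: "real (level_size (Suc n)) \<ge> 1" using level_size_bounds(1)[of "Suc n"] by simp
        have "(8 * real (level_size i)) ^ i \<le> (8 * real (level_size (Suc n))) ^ i" using l by (intro power_mono) auto
        also have "\<dots> \<le> (8 * real (level_size (Suc n))) ^ Suc n" using i l1 by (intro power_increasing) auto
        finally show "(8 * real (level_size i)) ^ i \<le> (8 * real (level_size (Suc n))) ^ Suc n" .
      qed simp
      also have "\<dots> = real d * (real (Suc n) * (8 * real (level_size (Suc n))) ^ Suc n) * 1" by simp
      also have "\<dots> \<le> real d * (real (Suc n) * (8 * real (level_size (Suc n))) ^ Suc n) * (K powr p * real d powr (a * p) * ?q n powr p * \<epsilon> powr (- (2 + \<delta>)))"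
        by (intro mult_left_mono one) auto
      also have "\<dots> = K powr p * (real (Suc n) * (8 * real (level_size (Suc n))) ^ Suc n * ?q n powr p) * (real d powr 1 * real d powr (a * p)) * \<epsilon> powr (- (2 + \<delta>))"
        using d1 by simp
      also have "\<dots> \<le> K powr p * S * (real d powr 1 * real d powr (a * p)) * \<epsilon> powr (- (2 + \<delta>))"
        by (intro mult_right_mono mult_left_mono S n) auto
      also have "\<dots> = K powr p * S * real d powr (1 + a * p) * \<epsilon> powr (- (2 + \<delta>))" by (simp add: powr_add)
      also have "\<dots> \<le> c * real d powr c * \<epsilon> powr (- (2 + \<delta>))"
        using c d1 by (intro mult_right_mono mult_mono powr_mono) auto
      finally show ?thesis unfolding n(1) .
    qed
  qed
qed

text \<open>Each of the four terms in the bracket is at most \<open>d * (8 * M)^l\<close>, and the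
  factor \<open>M^(n - l)\<close> completes the power of \<open>M\<close> to \<open>M^n\<close>. The
  base \<open>8\<close> works because \<open>1 + 4 * (1 + 8 + ... + 8^(n - 1)) \<le> 8^n\<close>.
  Only upper bounds are propagated.\<close>

lemma cost_recursion_bound:
  fixes RV :: "int \<Rightarrow> int \<Rightarrow> int \<Rightarrow> int"
  assumes d: "d \<ge> 1" and M: "M \<ge> 1" and RV_0: "RV (int d) 0 (int M) = 0"
    and RV_rec: "\<And>n :: nat. n \<ge> 1 \<Longrightarrow>
        RV (int d) (int n) (int M)
          \<le> int d * int M ^ n
            + (\<Sum>l<n. int M ^ (n - l)
                 * (int d + 1 + RV (int d) (int l) (int M)
                    + indicator {1..} l * RV (int d) (int l - 1) (int M)))"
  shows "RV (int d) (int n) (int M) \<le> int d * (8 * int M) ^ n"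
proof (induction n rule: less_induct)
  case (less n)
  have M1: "int M \<ge> 1" and d1: "int d \<ge> 1" using M d by auto
  show ?case
  proof (cases "n = 0")
    case False
    then have n: "n \<ge> 1" by simp
    have step: "int M ^ (n - l) * (int d + 1 + RV (int d) (int l) (int M) + indicator {1..} l * RV (int d) (int l - 1) (int M))
      \<le> int M ^ n * int d * (4 * 8 ^ l)" if l: "l < n" for l
    proof -
      have i1: "RV (int d) (int l) (int M) \<le> int d * (8 * int M) ^ l" by (rule less.IH[OF l])
      have i2: "indicator {1..} l * RV (int d) (int l - 1) (int M) \<le> int d * (8 * int M) ^ l"
      proof (cases "l \<ge> 1")
        case True
        have "RV (int d) (int (l - 1)) (int M) \<le> int d * (8 * int M) ^ (l - 1)" by (rule less.IH) (use l in simp)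
        also have "\<dots> \<le> int d * (8 * int M) ^ l" using M1 by (intro mult_left_mono power_increasing) auto
        finally show ?thesis using True by (simp add: of_nat_diff)
      qed (use M1 in simp)
      have "(1::int) \<le> (8 * int M) ^ l" using M1 by (intro one_le_power) simp
      then have "int d * 1 \<le> int d * (8 * int M) ^ l" by (intro mult_left_mono) auto
      then have "int d + 1 + RV (int d) (int l) (int M) + indicator {1..} l * RV (int d) (int l - 1) (int M) \<le> 4 * (int d * (8 * int M) ^ l)"
        using i1 i2 d1 by linarith
      then have "int M ^ (n - l) * (int d + 1 + RV (int d) (int l) (int M) + indicator {1..} l * RV (int d) (int l - 1) (int M)) \<le> int M ^ (n - l) * (4 * (int d * (8 * int M) ^ l))"
        using M1 by (intro mult_left_mono) auto
      also have "\<dots> = (int M ^ (n - l) * int M ^ l) * int d * (4 * 8 ^ l)" by (simp add: power_mult_distrib)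
      also have "int M ^ (n - l) * int M ^ l = int M ^ n" using l by (simp flip: power_add)
      finally show ?thesis .
    qed
    have geo: "1 + (\<Sum>l<k. 4 * 8 ^ l) \<le> (8::int) ^ k" for k
    proof (induction k)
      case (Suc k)
      have "1 + (\<Sum>l<Suc k. 4 * 8 ^ l) = 1 + (\<Sum>l<k. 4 * 8 ^ l) + 4 * (8::int) ^ k" by simp
      also have "\<dots> \<le> 8 ^ k + 4 * 8 ^ k" by (intro add_right_mono Suc)
      also have "\<dots> \<le> 8 ^ Suc k" by simp
      finally show ?case .
    qed simp
    have "RV (int d) (int n) (int M) \<le> int d * int M ^ n + (\<Sum>l<n. int M ^ n * int d * (4 * 8 ^ l))"
      by (rule order_trans[OF RV_rec[OF n] add_left_mono[OF sum_mono]]) (rule step, simp)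
    also have "\<dots> = int M ^ n * int d * (1 + (\<Sum>l<n. 4 * 8 ^ l))" by (simp add: sum_distrib_left distrib_left mult_ac)
    also have "\<dots> \<le> int M ^ n * int d * 8 ^ n" using M1 by (intro mult_left_mono geo) auto
    finally show ?thesis by (simp add: power_mult_distrib mult_ac)
  qed (use RV_0 in simp)
qed

lemma mlp_const_nonneg:
  assumes "T > 0" "lam > 0"
  shows "u_const T lam + lam\<^sup>2 * (3 * (2 * T + 1) + T * (4 * T + 2)) \<ge> 0" "contraction_const T lam \<ge> 0"
  unfolding contraction_const_def u_const_def Let_def using assms
  by (intro mult_nonneg_nonneg add_nonneg_nonneg; simp)+

theorem theorem1p1:
  fixes T \<delta> lam :: real
    and u :: "nat \<Rightarrow> real \<Rightarrow> (nat \<Rightarrow> real) \<Rightarrow> real"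
    and f :: "nat \<Rightarrow> real \<Rightarrow> (nat \<Rightarrow> real) \<Rightarrow> real"
    and g :: "nat \<Rightarrow> (nat \<Rightarrow> real) \<Rightarrow> real"
    and L :: "nat \<Rightarrow> nat \<Rightarrow> real"
    and P :: "'w measure"
    and Z :: "nat \<Rightarrow> int list \<Rightarrow> 'w \<Rightarrow> nat \<Rightarrow> real"
    and r :: "int list \<Rightarrow> 'w \<Rightarrow> real"
    and U :: "nat \<Rightarrow> int list \<Rightarrow> int \<Rightarrow> nat \<Rightarrow> real \<Rightarrow> (nat \<Rightarrow> real) \<Rightarrow> 'w \<Rightarrow> nat \<Rightarrow> real"
    and RV :: "int \<Rightarrow> int \<Rightarrow> int \<Rightarrow> int"
  assumes pos: "T > 0" "\<delta> > 0" "lam > 0"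
    and u_C12: "\<And>d. d \<ge> 1 \<Longrightarrow> C12 T d (u d)"
    and u_growth: "\<And>d. d \<ge> 1 \<Longrightarrow> at_most_poly_growing T d (u d)"
    and f_cont: "\<And>d. d \<ge> 1 \<Longrightarrow> continuous_on (UNIV \<times> Rd d) (\<lambda>(y, z). f d y z)"
    and g_cont: "\<And>d. d \<ge> 1 \<Longrightarrow> continuous_on (Rd d) (g d)"
    and lipschitz: "\<And>d x x' z z' y y'.
        \<lbrakk>d \<ge> 1; x \<in> Rd d; x' \<in> Rd d; z \<in> Rd d; z' \<in> Rd d\<rbrakk> \<Longrightarrow>
        max \<bar>f d y z - f d y' z'\<bar> \<bar>g d x - g d x'\<bar>
          \<le> (\<Sum>j=1..d. L d j * (real d powr lam * \<bar>x j - x' j\<bar> + \<bar>y - y'\<bar> + \<bar>z j - z' j\<bar>))"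
    and pde: "\<And>d t x. \<lbrakk>d \<ge> 1; t \<in> {0..<T}; x \<in> Rd d\<rbrakk> \<Longrightarrow>
        time_deriv T (u d) t x = laplacian d (u d t) x + f d (u d t x) (space_grad d (u d t) x)"
    and initial: "\<And>d x. \<lbrakk>d \<ge> 1; x \<in> Rd d\<rbrakk> \<Longrightarrow> u d 0 x = g d x"
    and bound: "\<And>d. d \<ge> 1 \<Longrightarrow>
        real d powr (- lam) * (\<bar>g d (zero_vec d)\<bar> + \<bar>f d 0 (zero_vec d)\<bar>) + (\<Sum>i=1..d. L d i) \<le> lam"
    and P: "prob_space P"
    and Z_indep: "prob_space.indep_vars P (\<lambda>(d, \<theta>). borel_Rd d) (\<lambda>(d, \<theta>). Z d \<theta>) ({1..} \<times> Theta)"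
    and Z_normal: "\<And>d \<theta>. \<lbrakk>d \<ge> 1; \<theta> \<in> Theta\<rbrakk> \<Longrightarrow> distr P (borel_Rd d) (Z d \<theta>) = std_normal_Rd d"
    and r_range: "\<And>\<theta> \<omega>. \<lbrakk>\<theta> \<in> Theta; \<omega> \<in> space P\<rbrakk> \<Longrightarrow> r \<theta> \<omega> \<in> {0<..<1}"
    and r_indep: "prob_space.indep_vars P (\<lambda>_. borel) r Theta"
    and r_ident: "\<And>\<theta>. \<theta> \<in> Theta \<Longrightarrow> distr P borel (r \<theta>) = distr P borel (r [0])"
    and r_dist: "\<And>b. b \<in> {0<..<1} \<Longrightarrow> measure P {\<omega> \<in> space P. r [0] \<omega> \<le> b} = sqrt b"
    and Z_r_indep: "prob_space.indep_set P
        (generated_sets P ({1..} \<times> Theta) (\<lambda>(d, \<theta>). borel_Rd d) (\<lambda>(d, \<theta>). Z d \<theta>))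
        (generated_sets P Theta (\<lambda>_. borel) r)"
    and U: "mlp_scheme P T f g Z r U"
    and RV_0: "\<And>d M. \<lbrakk>d \<ge> 1; M \<ge> 1\<rbrakk> \<Longrightarrow> RV d 0 M = 0"
    and RV_rec: "\<And>d n M :: nat. \<lbrakk>d \<ge> 1; n \<ge> 1; M \<ge> 1\<rbrakk> \<Longrightarrow>
        RV (int d) (int n) (int M)
          \<le> int d * int M ^ n
            + (\<Sum>l<n. int M ^ (n - l)
                 * (int d + 1 + RV (int d) (int l) (int M)
                    + indicator {1..} l * RV (int d) (int l - 1) (int M)))"
  shows "\<exists>(c :: real) (N :: nat \<Rightarrow> real \<Rightarrow> nat). \<forall>d\<ge>1. \<forall>\<epsilon>\<in>{0<..1}.
      N d \<epsilon> \<ge> 1 \<and>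
      real_of_int (\<Sum>n=1..N d \<epsilon>. RV (int d) (int n) \<lfloor>real n powr (1/4)\<rfloor>)
        \<le> c * real d powr c * \<epsilon> powr (- (2 + \<delta>)) \<and>
      (\<forall>n\<ge>N d \<epsilon>. \<forall>k\<in>{0..d}. integrable P (\<lambda>\<omega>.
          \<bar>U d [0] (int n) (nat \<lfloor>real n powr (1/4)\<rfloor>) T (zero_vec d) \<omega> k
            - join_vec (u d T (zero_vec d)) (space_grad d (u d T) (zero_vec d)) k\<bar>\<^sup>2)) \<and>
      (SUP n\<in>{N d \<epsilon>..}. ereal (sqrt (
          (LINT \<omega>|P. \<bar>U d [0] (int n) (nat \<lfloor>real n powr (1/4)\<rfloor>) T (zero_vec d) \<omega> 0
                       - u d T (zero_vec d)\<bar>\<^sup>2)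
          + (MAX i\<in>{1..d}.
              LINT \<omega>|P. \<bar>U d [0] (int n) (nat \<lfloor>real n powr (1/4)\<rfloor>) T (zero_vec d) \<omega> i
                          - space_deriv i (u d T) (zero_vec d)\<bar>\<^sup>2)))) \<le> ereal \<epsilon>"
proof -
  define c1 where "c1 = u_const T lam + lam\<^sup>2 * (3 * (2 * T + 1) + T * (4 * T + 2))"
  define \<kappa> where "\<kappa> = contraction_const T lam"
  \<comment> \<open>The factor \<open>exp T\<close> absorbs the exponential weight:
    \<open>exp (M\<^sup>2 * T) \<le> (exp T)^n\<close> for \<open>M = level_size n\<close>.\<close>
  define C where "C = (1 + 5 * \<kappa>) * exp T"
  define err where "err d M n k \<omega> =
    \<bar>U d [0] (int n) M T (zero_vec d) \<omega> k - join_vec (u d T (zero_vec d)) (space_grad d (u d T) (zero_vec d)) k\<bar>\<^sup>2" for d M n k \<omega>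
  \<comment> \<open>The factor \<open>2\<close> brings each of the two error terms below
    \<open>\<epsilon>\<^sup>2 / 2\<close>; \<open>+ 1\<close> gives positivity at once.\<close>
  define K where "K = 2 * (c1 + 1)"
  have c1: "c1 \<ge> 0" and \<kappa>: "\<kappa> \<ge> 0" using mlp_const_nonneg[OF pos(1,3)] by (simp_all add: c1_def \<kappa>_def)
  have C: "C \<ge> 1"
  proof -
    have "1 * 1 \<le> (1 + 5 * \<kappa>) * exp T" using \<kappa> pos by (intro mult_mono) auto
    then show ?thesis by (simp add: C_def)
  qed
  have K: "K > 0" using c1 by (simp add: K_def)
  have a: "2 * lam \<ge> 0" using pos by simp
  obtain c :: real and N :: "nat \<Rightarrow> real \<Rightarrow> nat" where
    N1: "\<And>d \<epsilon>. d \<ge> 1 \<Longrightarrow> \<epsilon> \<in> {0<..1} \<Longrightarrow> N d \<epsilon> \<ge> 1" and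
    N_err: "\<And>d \<epsilon> n. d \<ge> 1 \<Longrightarrow> \<epsilon> \<in> {0<..1} \<Longrightarrow> n \<ge> N d \<epsilon>
        \<Longrightarrow> K * real d powr (2 * lam) * (C ^ n / real (level_size n) ^ n) \<le> \<epsilon>\<^sup>2" and
    N_cost: "\<And>d \<epsilon>. d \<ge> 1 \<Longrightarrow> \<epsilon> \<in> {0<..1} \<Longrightarrow> (\<Sum>n=1..N d \<epsilon>. real d * (8 * real (level_size n)) ^ n)
        \<le> c * real d powr c * \<epsilon> powr (- (2 + \<delta>))"
    by (rule complexity_bound[OF C K pos(2) a]) blast
  have sol: "pde_solution d T (u d) (f d) (g d) (L d) (real d powr lam) lam" if d: "d \<ge> 1" for d
  proof
    \<comment> \<open>The Lipschitz condition at two values \<open>1\<close> and \<open>0\<close> of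
      \<open>y\<close>, all other arguments being equal, has the plain sum of the constants on its
      right-hand side.\<close>
    have L0: "0 \<le> (\<Sum>j=1..d. L d j)"
      using order_trans[OF max.coboundedI1[OF abs_ge_zero] lipschitz[OF d, of "zero_vec d" "zero_vec d" "zero_vec d" "zero_vec d" 1 0]]
      by simp
    have "0 \<le> real d powr (- lam) * (\<bar>g d (zero_vec d)\<bar> + \<bar>f d 0 (zero_vec d)\<bar>)" by simp
    with bound[OF d] show "(\<Sum>j=1..d. L d j) \<le> lam" by linarith
    show "real d powr lam \<ge> 1" using d pos by (intro ge_one_powr_ge_zero) auto
    \<comment> \<open>Multiplying the hypothesis by \<open>real d powr lam\<close> turns it into the
      form with \<open>Dl\<close> that the locale expects.\<close>
    have "real d powr lam * (real d powr (- lam) * (\<bar>g d (zero_vec d)\<bar> + \<bar>f d 0 (zero_vec d)\<bar>)) \<le> real d powr lam * lam"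
      using bound[OF d] L0 by (intro mult_left_mono) auto
    moreover have "real d powr lam * real d powr (- lam) = 1" using d by (simp add: powr_add[symmetric])
    ultimately show "\<bar>g d (zero_vec d)\<bar> + \<bar>f d 0 (zero_vec d)\<bar> \<le> real d powr lam * lam"
      by (simp only: mult.assoc[symmetric]) simp
  qed (use d pos in \<open>blast intro: u_C12 u_growth f_cont g_cont lipschitz pde initial\<close>)+
  have err_le: "integrable P (err d M n k)"
    "integral\<^sup>L P (err d M n k)
      \<le> (real d powr lam)\<^sup>2 * c1 * (1 + 5 * \<kappa>) ^ n / real M ^ n * exp ((real M)\<^sup>2 * T)"
    if d: "d \<ge> 1" and M: "M \<ge> 1" and k: "k \<in> {0..d}" for d n M k
  proof -
    interpret S: pde_solution d T "u d" "f d" "g d" "L d" "real d powr lam" lam by (rule sol[OF d])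
    have T0: "[0] \<in> Theta" by (simp add: Theta_def)
    let ?\<Phi> = "\<lambda>\<omega>. \<lambda>\<eta>\<in>Theta. (Z d ([0] @ \<eta>) \<omega>, r ([0] @ \<eta>) \<omega>)"
    let ?F = "\<lambda>\<xi>. (mlp d (f d) (g d) M n T (zero_vec d) \<xi> k - S.uvec T (zero_vec d) k)\<^sup>2"
    have law1: "?\<Phi> \<in> P \<rightarrow>\<^sub>M noise_space d"
      by (rule noise_field_law(1)[OF P d Z_indep Z_normal[OF d] r_range r_indep r_ident r_dist Z_r_indep T0])
    have law2: "distr P (noise_space d) ?\<Phi> = noise_space d"
      by (rule noise_field_law(2)[OF P d Z_indep Z_normal[OF d] r_range r_indep r_ident r_dist Z_r_indep T0])
    note F = S.mlp_mean_square_error[OF M k, of n]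
    have e: "err d M n k \<omega> = ?F (?\<Phi> \<omega>)" if \<omega>: "\<omega> \<in> space P" for \<omega>
      using mlp_scheme_eq_mlp[OF U d M \<omega> r_range[OF _ \<omega>] T0 _ _ k, of T "zero_vec d" n] pos by (simp add: S.uvec_def err_def)
    have m: "?F \<in> borel_measurable (noise_space d)" using F(1) by (rule borel_measurable_integrable)
    have "integrable (distr P (noise_space d) ?\<Phi>) ?F" unfolding law2 by (rule F(1))
    then have "integrable P (\<lambda>\<omega>. ?F (?\<Phi> \<omega>))" by (rule integrable_distr[OF law1])
    then show "integrable P (err d M n k)"
      by (subst Bochner_Integration.integrable_cong[OF refl e])
    have "integral\<^sup>L P (err d M n k) = (LINT \<omega>|P. ?F (?\<Phi> \<omega>))"
      by (rule Bochner_Integration.integral_cong[OF refl e])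
    also have "\<dots> = (LINT \<xi>|distr P (noise_space d) ?\<Phi>. ?F \<xi>)" by (rule integral_distr[OF law1 m, symmetric])
    also have "\<dots> = (LINT \<xi>|noise_space d. ?F \<xi>)" unfolding law2 ..
    also have "\<dots> \<le> (real d powr lam)\<^sup>2 * c1 * (1 + 5 * \<kappa>) ^ n / real M ^ n * exp ((real M)\<^sup>2 * T)"
      using F(2) by (simp only: c1_def \<kappa>_def)
    finally show "integral\<^sup>L P (err d M n k)
      \<le> (real d powr lam)\<^sup>2 * c1 * (1 + 5 * \<kappa>) ^ n / real M ^ n * exp ((real M)\<^sup>2 * T)" .
  qed
  have half: "integral\<^sup>L P (err d (level_size n) n k) \<le> \<epsilon>\<^sup>2 / 2"
    if d: "d \<ge> 1" and \<epsilon>: "\<epsilon> \<in> {0<..1}" and n: "n \<ge> N d \<epsilon>" and k: "k \<in> {0..d}" for d \<epsilon> n k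
  proof -
    have n1: "n \<ge> 1" using N1[OF d \<epsilon>] n by simp
    note ls = level_size_bounds[OF n1]
    let ?M = "real (level_size n)"
    have "(real d powr lam)\<^sup>2 = real d powr (2 * lam)" by (simp add: power2_eq_square flip: powr_add)
    then have "integral\<^sup>L P (err d (level_size n) n k)
      \<le> real d powr (2 * lam) * c1 * (1 + 5 * \<kappa>) ^ n / ?M ^ n * exp (?M\<^sup>2 * T)"
      using err_le(2)[OF d ls(1) k, of n] by simp
    \<comment> \<open>This is where the slow growth of \<open>level_size\<close> enters: its square
      is at most \<open>n\<close>.\<close>
    also have "\<dots> \<le> real d powr (2 * lam) * c1 * (1 + 5 * \<kappa>) ^ n / ?M ^ n * exp (real n * T)"
      using ls(5) pos c1 \<kappa> by (intro mult_left_mono divide_nonneg_nonneg mult_nonneg_nonneg) auto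
    also have "\<dots> = c1 * (real d powr (2 * lam) * (C ^ n / ?M ^ n))"
      by (simp add: C_def power_mult_distrib exp_of_nat_mult)
    also have "\<dots> \<le> (c1 + 1) * (real d powr (2 * lam) * (C ^ n / ?M ^ n))"
      using C by (intro mult_right_mono mult_nonneg_nonneg) auto
    also have "\<dots> = K * real d powr (2 * lam) * (C ^ n / ?M ^ n) / 2"
    proof -
      have "(c1 + 1) * (A * q) = K * A * q / 2" for A q by (simp add: K_def algebra_simps)
      then show ?thesis .
    qed
    also have "\<dots> \<le> \<epsilon>\<^sup>2 / 2" by (intro divide_right_mono N_err[OF d \<epsilon> n]) simp
    finally show ?thesis .
  qed
  have cost: "real_of_int (\<Sum>n=1..N d \<epsilon>. RV (int d) (int n) \<lfloor>real n powr (1/4)\<rfloor>) \<le> c * real d powr c * \<epsilon> powr (- (2 + \<delta>))"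
    if d: "d \<ge> 1" and \<epsilon>: "\<epsilon> \<in> {0<..1}" for d \<epsilon>
  proof -
    have "real_of_int (\<Sum>n=1..N d \<epsilon>. RV (int d) (int n) \<lfloor>real n powr (1/4)\<rfloor>) = (\<Sum>n=1..N d \<epsilon>. real_of_int (RV (int d) (int n) \<lfloor>real n powr (1/4)\<rfloor>))"
      by simp
    also have "\<dots> \<le> (\<Sum>n=1..N d \<epsilon>. real d * (8 * real (level_size n)) ^ n)"
    proof (rule sum_mono)
      fix n assume "n \<in> {1..N d \<epsilon>}"
      then have M: "level_size n \<ge> 1" by (intro level_size_bounds(1)) simp
      have e: "\<lfloor>real n powr (1/4)\<rfloor> = int (level_size n)" by (simp add: level_size_def)
      have "RV (int d) (int n) (int (level_size n)) \<le> int d * (8 * int (level_size n)) ^ n"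
        by (rule cost_recursion_bound[where RV=RV, OF d M RV_0 RV_rec[OF d _ M]]) (use d M in auto)
      then have "real_of_int (RV (int d) (int n) (int (level_size n))) \<le> real_of_int (int d * (8 * int (level_size n)) ^ n)"
        by (simp only: of_int_le_iff)
      then show "real_of_int (RV (int d) (int n) \<lfloor>real n powr (1/4)\<rfloor>) \<le> real d * (8 * real (level_size n)) ^ n"
        unfolding e by simp
    qed
    also have "\<dots> \<le> c * real d powr c * \<epsilon> powr (- (2 + \<delta>))" by (rule N_cost[OF d \<epsilon>])
    finally show ?thesis .
  qed
  show ?thesis
  proof (intro exI[of _ c] exI[of _ N] allI ballI impI conjI)
    fix d :: nat and \<epsilon> :: real assume d: "1 \<le> d" and \<epsilon>: "\<epsilon> \<in> {0<..1}"
    show "1 \<le> N d \<epsilon>" by (rule N1[OF d \<epsilon>])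
    show "real_of_int (\<Sum>n=1..N d \<epsilon>. RV (int d) (int n) \<lfloor>real n powr (1/4)\<rfloor>) \<le> c * real d powr c * \<epsilon> powr (- (2 + \<delta>))"
      by (rule cost[OF d \<epsilon>])
    show "integrable P (\<lambda>\<omega>. \<bar>U d [0] (int n) (nat \<lfloor>real n powr (1/4)\<rfloor>) T (zero_vec d) \<omega> k
            - join_vec (u d T (zero_vec d)) (space_grad d (u d T) (zero_vec d)) k\<bar>\<^sup>2)" if n: "N d \<epsilon> \<le> n" and k: "k \<in> {0..d}" for n k
    proof -
      have "n \<ge> 1" using N1[OF d \<epsilon>] n by simp
      from err_le(1)[OF d level_size_bounds(1)[OF this] k] show ?thesis unfolding level_size_def err_def .
    qed
    show "(SUP n\<in>{N d \<epsilon>..}. ereal (sqrt (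
          (LINT \<omega>|P. \<bar>U d [0] (int n) (nat \<lfloor>real n powr (1/4)\<rfloor>) T (zero_vec d) \<omega> 0
                       - u d T (zero_vec d)\<bar>\<^sup>2)
          + (MAX i\<in>{1..d}.
              LINT \<omega>|P. \<bar>U d [0] (int n) (nat \<lfloor>real n powr (1/4)\<rfloor>) T (zero_vec d) \<omega> i
                          - space_deriv i (u d T) (zero_vec d)\<bar>\<^sup>2)))) \<le> ereal \<epsilon>"
    proof (rule SUP_least)
      fix n assume "n \<in> {N d \<epsilon>..}"
      then have n: "n \<ge> N d \<epsilon>" by simp
      let ?E = "\<lambda>i. integral\<^sup>L P (err d (level_size n) n i)"
      \<comment> \<open>A maximum, unlike a sum, over the gradient components costs no factor
        \<open>d\<close>; the index set is nonempty since \<open>d \<ge> 1\<close>.\<close>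
      have "(MAX i\<in>{1..d}. ?E i) \<le> \<epsilon>\<^sup>2 / 2" using d half[OF d \<epsilon> n] by (intro Max.boundedI) auto
      with half[OF d \<epsilon> n, of 0] have "ereal (sqrt (?E 0 + (MAX i\<in>{1..d}. ?E i))) \<le> ereal \<epsilon>"
        unfolding ereal_less_eq using \<epsilon> by (intro real_le_lsqrt) auto
      moreover have "(MAX i\<in>{1..d}. ?E i) = (MAX i\<in>{1..d}. LINT \<omega>|P.
          \<bar>U d [0] (int n) (nat \<lfloor>real n powr (1/4)\<rfloor>) T (zero_vec d) \<omega> i - space_deriv i (u d T) (zero_vec d)\<bar>\<^sup>2)"
        by (intro arg_cong[where f=Max] image_cong refl) (simp add: err_def[abs_def] level_size_def join_vec_def space_grad_def)
      ultimately show "ereal (sqrt ((LINT \<omega>|P. \<bar>U d [0] (int n) (nat \<lfloor>real n powr (1/4)\<rfloor>) T (zero_vec d) \<omega> 0 - u d T (zero_vec d)\<bar>\<^sup>2)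
          + (MAX i\<in>{1..d}. LINT \<omega>|P.
              \<bar>U d [0] (int n) (nat \<lfloor>real n powr (1/4)\<rfloor>) T (zero_vec d) \<omega> i - space_deriv i (u d T) (zero_vec d)\<bar>\<^sup>2))) \<le> ereal \<epsilon>"
        by (simp add: err_def[abs_def] level_size_def join_vec_def)
    qed
  qed
qed

end
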